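(* Let $\Gamma$ be an undirected graph on four vertices having no loops and no multiple edges. Up to isomorphism of graphs, $\Gamma$ or its complement is one of the six graphs $\Gamma_1,\dots,\Gamma_6$ on $\{1,2,3,4\}$ listed below, and their automorphism groups and quantum automorphism groups are as follows ($\Gamma_i^c$ denotes the complement of $\Gamma_i$ within graphs without loops). (1) $\Gamma_1$ has no edges ($\Gamma_1^c$ is the complete loopless graph $K_4$): $\mathrm{Aut}(\Gamma_1)=S_4$, $G_{aut}^*(\Gamma_1^c)=S_4$, $G_{aut}^*(\Gamma_1)=S_4^+$, $G_{aut}^+(\Gamma_1)=S_4^+$. (2) $\Gamma_2$ has the single edge $\{1,2\}$ ($\Gamma_2^c$ is $K_4$ minus one edge): $\mathrm{Aut}(\Gamma_2)=\mathbb Z_2\times\mathbb Z_2$, $G_{aut}^*(\Gamma_2^c)=\mathbb Z_2\times\mathbb Z_2$, $G_{aut}^*(\Gamma_2)=\widehat{\mathbb Z_2*\mathbb Z_2}$, $G_{aut}^+(\Gamma_2)=\widehat{\mathbb Z_2*\mathbb Z_2}$. (3) $\Gamma_3$ has edges $\{1,2\},\{1,3\}$ ($\Gamma_3^c$ is a triangle with one pendant edge attached): $\mathrm{Aut}(\Gamma_3)=G_{aut}^*(\Gamma_3^c)=G_{aut}^*(\Gamma_3)=G_{aut}^+(\Gamma_3)=\mathbb Z_2$. (4) $\Gamma_4$ has edges $\{1,2\},\{3,4\}$ ($\Gamma_4^c$ is the 4-cycle): $\mathrm{Aut}(\Gamma_4)=D_4$, $G_{aut}^*(\Gamma_4^c)=D_4$,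 $G_{aut}^*(\Gamma_4)=H_2^+$, $G_{aut}^+(\Gamma_4)=H_2^+$. (5) $\Gamma_5$ has edges $\{1,2\},\{1,3\},\{2,3\}$ (a triangle and an isolated vertex; $\Gamma_5^c$ is the star $K_{1,3}$): $\mathrm{Aut}(\Gamma_5)=G_{aut}^*(\Gamma_5^c)=G_{aut}^*(\Gamma_5)=G_{aut}^+(\Gamma_5)=S_3$. (6) $\Gamma_6$ has edges $\{1,2\},\{1,3\},\{2,4\}$ (the path on four vertices; $\Gamma_6^c$ is isomorphic to $\Gamma_6$): $\mathrm{Aut}(\Gamma_6)=G_{aut}^*(\Gamma_6^c)=G_{aut}^*(\Gamma_6)=G_{aut}^+(\Gamma_6)=\mathbb Z_2$. (The remaining groups are determined by $\mathrm{Aut}(\Gamma_i^c)=\mathrm{Aut}(\Gamma_i)$ and $G_{aut}^+(\Gamma_i^c)=G_{aut}^+(\Gamma_i)$.)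
   Context: Graphs. For a graph $\Gamma=(V,E)$ with $V=\{1,\dots,n\}$ and no multiple edges, $E$ is identified with a subset of $V\times V$, with source and range maps $s,r:E\to V$. $\Gamma$ is undirected if $(i,j)\in E$ implies $(j,i)\in E$; "edge $\{i,j\}$" means that both $(i,j)$ and $(j,i)$ are in $E$. The adjacency matrix $\varepsilon\in M_n(\{0,1\})$ has $\varepsilon_{ij}=1$ iff $(i,j)\in E$. The complement (within loopless graphs) is $\Gamma^c=(V,E')$ with $E'=(V\times V)\setminus(E\cup\{(i,i):i\in V\})$. $\mathrm{Aut}(\Gamma)=\{\sigma\in S_n:\sigma\varepsilon=\varepsilon\sigma\}$. Compact matrix quantum groups. A compact matrix quantum group $G=(C(G),u)$ is a unital $C^*$-algebra $C(G)$ generated by the entries of $u\in M_n(C(G))$, with $u$ and $u^t$ invertible, and a $*$-homomorphism $\Delta:C(G)\to C(G)\otimes C(G)$ (minimal tensor product), $\Delta(u_{ij})=\sum_k u_{ik}\otimes u_{kj}$. For $G=(C(G),u)$, $H=(C(H),v)$ with matrices of equal size, $G\subseteq H$ means there is a surjective $*$-homomorphism $C(H)\to C(G)$, $v_{ij}\mapsto u_{ij}$; $G=H$ means $G\subseteq H$ and $H\subseteq G$. A group $K\subseteq S_n$ is viewed as the compact matrix quantum group $(C(K),(\sigma\mapsto\sigma_{ij})_{ij})$ given by the entries of permutation matrices. Quantum automorphism groups. Consider generators $u_{ij}$, $1\le i,j\le n$, and relations (a) $u_{ij}=u_{ij}^*$, $u_{ij}u_{ik}=\delta_{jk}u_{ij}$,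 $u_{ji}u_{ki}=\delta_{jk}u_{ji}$; (b) $\sum_l u_{il}=1=\sum_l u_{li}$; (c) $u\varepsilon=\varepsilon u$ (given (a),(b), equivalent to: $u_{s(e)i}u_{r(e)k}=u_{r(e)k}u_{s(e)i}=0$ and $u_{is(e)}u_{kr(e)}=u_{kr(e)}u_{is(e)}=0$ for all $e\in E$, $(i,k)\notin E$); (d) $u_{s(e)s(f)}u_{r(e)r(f)}=u_{r(e)r(f)}u_{s(e)s(f)}$ for all $e,f\in E$. $S_n^+$ is given by the universal unital $C^*$-algebra with relations (a),(b); Banica's $G_{aut}^+(\Gamma)$ by relations (a),(b),(c); Bichon's $G_{aut}^*(\Gamma)$ by relations (a),(b),(c),(d); in each case with the matrix $u=(u_{ij})$. Notation in the list. $\mathbb Z_2=\mathbb Z/2\mathbb Z$; $D_4=\langle x,y\mid x^2=y^2=(xy)^4=e\rangle$ (order 8). $\widehat{\mathbb Z_2*\mathbb Z_2}=(C^*(\mathbb Z_2*\mathbb Z_2),u)$, where $C^*(\mathbb Z_2*\mathbb Z_2)$ is the universal unital $C^*$-algebra generated by two projections $p,q$ and $$u=\begin{pmatrix}p&1-p&0&0\\1-p&p&0&0\\0&0&q&1-q\\0&0&1-q&q\end{pmatrix}.$$ $H_2^+$ is Bichon's hyperoctahedral quantum group: $C(H_2^+)$ is the universal unital $C^*$-algebra generated by $v_{ij}$, $i,j\in\{1,2\}$, with $v_{ij}=v_{ij}^*$, $v_{ij}v_{ik}=0=v_{ji}v_{ki}$ for $j\neq k$, and $\sum_k v_{ik}^2=1=\sum_k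 v_{ki}^2$, with comultiplication $v_{ij}\mapsto\sum_k v_{ik}\otimes v_{kj}$. Meaning of the equalities. $\mathrm{Aut}(\Gamma_i)=K$ means isomorphism of groups. An entry for $G_{aut}^*$ or $G_{aut}^+$ that is a finite group means that the quantum group equals $\mathrm{Aut}(\Gamma_i)$ (respectively $\mathrm{Aut}(\Gamma_i^c)$) as a compact matrix quantum group, this group being isomorphic to the listed one. Equalities with $S_4^+$ and $\widehat{\mathbb Z_2*\mathbb Z_2}$ are equalities of compact matrix quantum groups with respect to the following matrices: for $G_{aut}^*(\Gamma_i)$, $G_{aut}^+(\Gamma_i)$ and $S_4^+$ the $4\times 4$ matrix $u=(u_{ij})_{1\le i,j\le 4}$ of generators, and for $\widehat{\mathbb Z_2*\mathbb Z_2}$ the $4\times 4$ block diagonal matrix with diagonal blocks $\begin{pmatrix}p&1-p\\1-p&p\end{pmatrix}$ and $\begin{pmatrix}q&1-q\\1-q&q\end{pmatrix}$. Equality with $H_2^+$ means existence of a $*$-isomorphism of the $C^*$-algebras intertwining the comultiplications. *)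

theory Defs
  imports
    Complex_Main
    "HOL-Algebra.Sym_Groups"
    "HOL-Algebra.Elementary_Groups"
    "HOL-Algebra.Subrings"
    "HOL-Algebra.Algebraic_Closure_Type"
begin

section \<open>Unital complex *-algebras and C*-algebras\<close>

text \<open>The field of complex numbers as an HOL-Algebra ring is \<open>ring_of_type_algebra :: complex ring\<close>.
  (The locale \<open>algebra\<close> of HOL-Algebra is restricted to commutative algebras.)\<close>

record 'a star_algebra = "(complex, 'a) module" +
  star :: "'a \<Rightarrow> 'a"

record 'a cstar_algebra = "'a star_algebra" +
  cnorm :: "'a \<Rightarrow> real"

locale star_algebra = ring A for A :: "('a, 'm) star_algebra_scheme" (structure) +
  assumes module: "module (ring_of_type_algebra :: complex ring) A"
    and smult_mult_left:
      "\<lbrakk>x \<in> carrier A; y \<in> carrier A\<rbrakk> \<Longrightarrow> (c \<odot> x) \<otimes> y = c \<odot> (x \<otimes> y)"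
    and smult_mult_right:
      "\<lbrakk>x \<in> carrier A; y \<in> carrier A\<rbrakk> \<Longrightarrow> x \<otimes> (c \<odot> y) = c \<odot> (x \<otimes> y)"
    and star_closed: "x \<in> carrier A \<Longrightarrow> star A x \<in> carrier A"
    and star_star: "x \<in> carrier A \<Longrightarrow> star A (star A x) = x"
    and star_add:
      "\<lbrakk>x \<in> carrier A; y \<in> carrier A\<rbrakk> \<Longrightarrow> star A (x \<oplus> y) = star A x \<oplus> star A y"
    and star_smult: "x \<in> carrier A \<Longrightarrow> star A (c \<odot> x) = cnj c \<odot> star A x"
    and star_mult:
      "\<lbrakk>x \<in> carrier A; y \<in> carrier A\<rbrakk> \<Longrightarrow> star A (x \<otimes> y) = star A y \<otimes> star A x"

definition cstar_seminorm :: "('a, 'm) star_algebra_scheme \<Rightarrow> ('a \<Rightarrow> real) \<Rightarrow> bool" where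
  "cstar_seminorm A p \<longleftrightarrow>
     (\<forall>x\<in>carrier A. 0 \<le> p x \<and> p (star A x \<otimes>\<^bsub>A\<^esub> x) = (p x)\<^sup>2 \<and>
        (\<forall>c. p (c \<odot>\<^bsub>A\<^esub> x) = cmod c * p x)) \<and>
     (\<forall>x\<in>carrier A. \<forall>y\<in>carrier A.
        p (x \<oplus>\<^bsub>A\<^esub> y) \<le> p x + p y \<and> p (x \<otimes>\<^bsub>A\<^esub> y) \<le> p x * p y)"

definition cauchy_seqs :: "('a, 'm) star_algebra_scheme \<Rightarrow> ('a \<Rightarrow> real) \<Rightarrow> (nat \<Rightarrow> 'a) set" where
  "cauchy_seqs A p = {x. range x \<subseteq> carrier A \<and>
     (\<forall>e>0. \<exists>N. \<forall>m\<ge>N. \<forall>n\<ge>N. p (x m \<ominus>\<^bsub>A\<^esub> x n) < e)}"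

locale cstar_algebra = star_algebra A for A :: "('a, 'm) cstar_algebra_scheme" (structure) +
  assumes cstar_seminorm: "cstar_seminorm A (cnorm A)"
    and cnorm_eq_0: "\<lbrakk>x \<in> carrier A; cnorm A x = 0\<rbrakk> \<Longrightarrow> x = \<zero>"
    and complete: "s \<in> cauchy_seqs A (cnorm A) \<Longrightarrow>
      \<exists>a\<in>carrier A. (\<lambda>n. cnorm A (s n \<ominus> a)) \<longlonglongrightarrow> 0"

definition star_hom ::
    "('a, 'm) star_algebra_scheme \<Rightarrow> ('b, 'n) star_algebra_scheme \<Rightarrow> ('a \<Rightarrow> 'b) set" where
  "star_hom A B = {h \<in> ring_hom A B. \<forall>x\<in>carrier A.
     (\<forall>c. h (c \<odot>\<^bsub>A\<^esub> x) = c \<odot>\<^bsub>B\<^esub> h x) \<and> h (star A x) = star B (h x)}"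

definition cstar_generated :: "('a, 'm) cstar_algebra_scheme \<Rightarrow> 'a set \<Rightarrow> bool" where
  "cstar_generated A S \<longleftrightarrow> S \<subseteq> carrier A \<and>
     (\<forall>B. subring B A \<and> S \<subseteq> B \<and>
        (\<forall>x\<in>B. star A x \<in> B \<and> (\<forall>c. c \<odot>\<^bsub>A\<^esub> x \<in> B)) \<and>
        (\<forall>x. \<forall>a\<in>carrier A. range x \<subseteq> B \<and> (\<lambda>n. cnorm A (x n \<ominus>\<^bsub>A\<^esub> a)) \<longlonglongrightarrow> 0 \<longrightarrow> a \<in> B)
        \<longrightarrow> B = carrier A)"


section \<open>Hausdorff completion of a *-algebra with a C*-seminorm\<close>

text \<open>Cauchy sequences modulo null sequences. The operations are well defined on classes,
  so each union below is a union of copies of one and the same class.\<close>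

definition completion_class ::
    "('a, 'm) star_algebra_scheme \<Rightarrow> ('a \<Rightarrow> real) \<Rightarrow> (nat \<Rightarrow> 'a) \<Rightarrow> (nat \<Rightarrow> 'a) set" where
  "completion_class A p x = {y \<in> cauchy_seqs A p. (\<lambda>n. p (x n \<ominus>\<^bsub>A\<^esub> y n)) \<longlonglongrightarrow> 0}"

definition completion ::
    "('a, 'm) star_algebra_scheme \<Rightarrow> ('a \<Rightarrow> real) \<Rightarrow> (nat \<Rightarrow> 'a) set cstar_algebra" where
  "completion A p =
    \<lparr>carrier = completion_class A p ` cauchy_seqs A p,
     mult = (\<lambda>\<xi> \<eta>. \<Union>x\<in>\<xi>. \<Union>y\<in>\<eta>. completion_class A p (\<lambda>n. x n \<otimes>\<^bsub>A\<^esub> y n)),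
     one = completion_class A p (\<lambda>_. \<one>\<^bsub>A\<^esub>),
     zero = completion_class A p (\<lambda>_. \<zero>\<^bsub>A\<^esub>),
     add = (\<lambda>\<xi> \<eta>. \<Union>x\<in>\<xi>. \<Union>y\<in>\<eta>. completion_class A p (\<lambda>n. x n \<oplus>\<^bsub>A\<^esub> y n)),
     module.smult = (\<lambda>c \<xi>. \<Union>x\<in>\<xi>. completion_class A p (\<lambda>n. c \<odot>\<^bsub>A\<^esub> x n)),
     star = (\<lambda>\<xi>. \<Union>x\<in>\<xi>. completion_class A p (\<lambda>n. star A (x n))),
     cnorm = (\<lambda>\<xi>. THE r. \<forall>x\<in>\<xi>. (\<lambda>n. p (x n)) \<longlonglongrightarrow> r)\<rparr>"


section \<open>Universal C*-algebras\<close>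

text \<open>The *-algebra of finitely supported complex functions on a monoid \<open>M\<close> with
  involution \<open>s\<close>, under convolution; \<open>mon m\<close> is the basis element \<open>m\<close>.\<close>

definition mon :: "'m \<Rightarrow> 'm \<Rightarrow> complex" where
  "mon m = (\<lambda>k. of_bool (k = m))"

definition monoid_star_algebra ::
    "('m, 'x) monoid_scheme \<Rightarrow> ('m \<Rightarrow> 'm) \<Rightarrow> ('m \<Rightarrow> complex) star_algebra" where
  "monoid_star_algebra M s =
    \<lparr>carrier = {f. finite {m. f m \<noteq> 0} \<and> {m. f m \<noteq> 0} \<subseteq> carrier M},
     mult = (\<lambda>f g m. \<Sum>(a, b) \<in> {(a, b). f a \<noteq> 0 \<and> g b \<noteq> 0 \<and> a \<otimes>\<^bsub>M\<^esub> b = m}. f a * g b),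
     one = mon \<one>\<^bsub>M\<^esub>,
     zero = (\<lambda>_. 0),
     add = (\<lambda>f g m. f m + g m),
     module.smult = (\<lambda>c f m. c * f m),
     star = (\<lambda>f m. if m \<in> carrier M then cnj (f (s m)) else 0)\<rparr>"

text \<open>Words in letters \<open>(x, False)\<close> and \<open>(x, True)\<close>, which stand for \<open>x\<close> and \<open>x\<^sup>*\<close> in a free
  *-algebra, and for \<open>x\<close> and its inverse in a group presentation.\<close>

type_synonym 'g word = "('g \<times> bool) list"

definition free_star_algebra :: "'g set \<Rightarrow> ('g word \<Rightarrow> complex) star_algebra" where
  "free_star_algebra S = monoid_star_algebra
     \<lparr>carrier = lists (S \<times> UNIV), mult = (@), one = []\<rparr>
     (\<lambda>w. rev (map (\<lambda>(x, b). (x, \<not> b)) w))"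

definition free_gen :: "'g \<Rightarrow> 'g word \<Rightarrow> complex" where
  "free_gen x = mon [(x, False)]"

text \<open>A set of relations is a set \<open>R\<close> of pairs \<open>(a, b)\<close> of elements of the free *-algebra,
  read as equations \<open>a = b\<close>. The universal C*-algebra is the Hausdorff completion of the free
  *-algebra for the largest C*-seminorm compatible with the relations. It only makes sense if
  the supremum is finite, as is the case for all presentations below (their generators
  are forced to have norm at most 1).\<close>

definition universal_seminorm ::
    "'g set \<Rightarrow> (('g word \<Rightarrow> complex) \<times> ('g word \<Rightarrow> complex)) set \<Rightarrow> ('g word \<Rightarrow> complex) \<Rightarrow> real" where
  "universal_seminorm S R f = Sup {p f | p. cstar_seminorm (free_star_algebra S) p \<and>
     (\<forall>(a, b)\<in>R. p (a \<ominus>\<^bsub>free_star_algebra S\<^esub> b) = 0)}"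

definition universal_cstar ::
    "'g set \<Rightarrow> (('g word \<Rightarrow> complex) \<times> ('g word \<Rightarrow> complex)) set \<Rightarrow>
     (nat \<Rightarrow> 'g word \<Rightarrow> complex) set cstar_algebra" where
  "universal_cstar S R = completion (free_star_algebra S) (universal_seminorm S R)"

definition universal_gen ::
    "'g set \<Rightarrow> (('g word \<Rightarrow> complex) \<times> ('g word \<Rightarrow> complex)) set \<Rightarrow> 'g \<Rightarrow>
     (nat \<Rightarrow> 'g word \<Rightarrow> complex) set" where
  "universal_gen S R x =
     completion_class (free_star_algebra S) (universal_seminorm S R) (\<lambda>_. free_gen x)"


section \<open>The minimal tensor product\<close>

text \<open>A state is a positive linear functional of norm 1.\<close>

definition cstar_state :: "('a, 'm) cstar_algebra_scheme \<Rightarrow> ('a \<Rightarrow> complex) \<Rightarrow> bool" where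
  "cstar_state A \<phi> \<longleftrightarrow> \<phi> \<one>\<^bsub>A\<^esub> = 1 \<and>
     (\<forall>x\<in>carrier A. \<forall>y\<in>carrier A. \<phi> (x \<oplus>\<^bsub>A\<^esub> y) = \<phi> x + \<phi> y) \<and>
     (\<forall>x\<in>carrier A. (\<forall>c. \<phi> (c \<odot>\<^bsub>A\<^esub> x) = c * \<phi> x) \<and> cmod (\<phi> x) \<le> cnorm A x \<and>
        Im (\<phi> (star A x \<otimes>\<^bsub>A\<^esub> x)) = 0 \<and> 0 \<le> Re (\<phi> (star A x \<otimes>\<^bsub>A\<^esub> x)))"

text \<open>Formal linear combinations of pairs \<open>(a, b)\<close>, standing for elementary tensors. Bilinearity
  is not imposed at this level: differences such as \<open>(a + a', b) - (a, b) - (a', b)\<close> are in the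
  kernel of every functional \<open>t \<mapsto> (\<phi> \<otimes> \<psi>) (s t r)\<close>, so they have seminorm 0 below and vanish in
  the Hausdorff completion.\<close>

definition formal_tensors ::
    "('a, 'm) cstar_algebra_scheme \<Rightarrow> ('b, 'n) cstar_algebra_scheme \<Rightarrow>
     ('a \<times> 'b \<Rightarrow> complex) star_algebra" where
  "formal_tensors A B = monoid_star_algebra (A \<times>\<times> B) (\<lambda>(a, b). (star A a, star B b))"

definition tensor_functional ::
    "('a \<Rightarrow> complex) \<Rightarrow> ('b \<Rightarrow> complex) \<Rightarrow> ('a \<times> 'b \<Rightarrow> complex) \<Rightarrow> complex" where
  "tensor_functional \<phi> \<psi> t = (\<Sum>(a, b) \<in> {z. t z \<noteq> 0}. t (a, b) * \<phi> a * \<psi> b)"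

text \<open>The spatial norm: the supremum of the operator norms of \<open>\<pi>\<^sub>\<phi> \<otimes> \<pi>\<^sub>\<psi>\<close> over the GNS
  representations of all pairs of states, i.e. the norm of \<open>\<pi>\<^sub>A \<otimes> \<pi>\<^sub>B\<close> for the universal
  representations. On the dense image of the formal tensors in the Hilbert space of
  \<open>\<pi>\<^sub>\<phi> \<otimes> \<pi>\<^sub>\<psi>\<close>, the vector of \<open>s\<close> has squared length \<open>(\<phi> \<otimes> \<psi>) (s\<^sup>* s)\<close> and \<open>t\<close> sends it to the
  vector of \<open>t s\<close>. The element 0 is only inserted for the sake of the zero algebra.\<close>

definition spatial_seminorm ::
    "('a, 'm) cstar_algebra_scheme \<Rightarrow> ('b, 'n) cstar_algebra_scheme \<Rightarrow>
     ('a \<times> 'b \<Rightarrow> complex) \<Rightarrow> real" where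
  "spatial_seminorm A B t = (let T = formal_tensors A B in Sup (insert 0
     {sqrt (Re (tensor_functional \<phi> \<psi> (star T (t \<otimes>\<^bsub>T\<^esub> s) \<otimes>\<^bsub>T\<^esub> (t \<otimes>\<^bsub>T\<^esub> s)))) | \<phi> \<psi> s.
        cstar_state A \<phi> \<and> cstar_state B \<psi> \<and> s \<in> carrier T \<and>
        tensor_functional \<phi> \<psi> (star T s \<otimes>\<^bsub>T\<^esub> s) = 1}))"

definition min_tensor ::
    "('a, 'm) cstar_algebra_scheme \<Rightarrow> ('b, 'n) cstar_algebra_scheme \<Rightarrow>
     (nat \<Rightarrow> 'a \<times> 'b \<Rightarrow> complex) set cstar_algebra" where
  "min_tensor A B = completion (formal_tensors A B) (spatial_seminorm A B)"

definition tensor ::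
    "('a, 'm) cstar_algebra_scheme \<Rightarrow> ('b, 'n) cstar_algebra_scheme \<Rightarrow> 'a \<Rightarrow> 'b \<Rightarrow>
     (nat \<Rightarrow> 'a \<times> 'b \<Rightarrow> complex) set" where
  "tensor A B a b =
     completion_class (formal_tensors A B) (spatial_seminorm A B) (\<lambda>_. mon (a, b))"


section \<open>Compact matrix quantum groups\<close>

text \<open>The matrix is indexed by \<open>{1..qdim G}\<close>; entries outside this range are irrelevant.\<close>

record 'a qgroup =
  qalg :: "'a cstar_algebra"
  qdim :: nat
  qmat :: "nat \<Rightarrow> nat \<Rightarrow> 'a"

definition matrix_invertible ::
    "('a, 'm) ring_scheme \<Rightarrow> nat \<Rightarrow> (nat \<Rightarrow> nat \<Rightarrow> 'a) \<Rightarrow> bool" where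
  "matrix_invertible A n u \<longleftrightarrow> (\<exists>v. (\<forall>i\<in>{1..n}. \<forall>j\<in>{1..n}. v i j \<in> carrier A) \<and>
     (\<forall>i\<in>{1..n}. \<forall>j\<in>{1..n}.
        (\<Oplus>\<^bsub>A\<^esub>k\<in>{1..n}. u i k \<otimes>\<^bsub>A\<^esub> v k j) = (if i = j then \<one>\<^bsub>A\<^esub> else \<zero>\<^bsub>A\<^esub>) \<and>
        (\<Oplus>\<^bsub>A\<^esub>k\<in>{1..n}. v i k \<otimes>\<^bsub>A\<^esub> u k j) = (if i = j then \<one>\<^bsub>A\<^esub> else \<zero>\<^bsub>A\<^esub>)))"

text \<open>If the matrix entries generate the C*-algebra, then there is at most one comultiplication.\<close>

definition comultiplication ::
    "'a qgroup \<Rightarrow> ('a \<Rightarrow> (nat \<Rightarrow> 'a \<times> 'a \<Rightarrow> complex) set) \<Rightarrow> bool" where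
  "comultiplication G \<Delta> \<longleftrightarrow>
     \<Delta> \<in> star_hom (qalg G) (min_tensor (qalg G) (qalg G)) \<and>
     (\<forall>i\<in>{1..qdim G}. \<forall>j\<in>{1..qdim G}. \<Delta> (qmat G i j) =
        (\<Oplus>\<^bsub>min_tensor (qalg G) (qalg G)\<^esub>k\<in>{1..qdim G}.
           tensor (qalg G) (qalg G) (qmat G i k) (qmat G k j)))"

definition compact_matrix_quantum_group :: "'a qgroup \<Rightarrow> bool" where
  "compact_matrix_quantum_group G \<longleftrightarrow>
     cstar_algebra (qalg G) \<and>
     cstar_generated (qalg G) {qmat G i j | i j. i \<in> {1..qdim G} \<and> j \<in> {1..qdim G}} \<and>
     matrix_invertible (qalg G) (qdim G) (qmat G) \<and>
     matrix_invertible (qalg G) (qdim G) (\<lambda>i j. qmat G j i) \<and>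
     (\<exists>\<Delta>. comultiplication G \<Delta>)"

definition qsubgroup :: "'a qgroup \<Rightarrow> 'b qgroup \<Rightarrow> bool" where
  "qsubgroup G H \<longleftrightarrow>
     compact_matrix_quantum_group G \<and> compact_matrix_quantum_group H \<and> qdim G = qdim H \<and>
     (\<exists>h\<in>star_hom (qalg H) (qalg G). h ` carrier (qalg H) = carrier (qalg G) \<and>
        (\<forall>i\<in>{1..qdim H}. \<forall>j\<in>{1..qdim H}. h (qmat H i j) = qmat G i j))"

definition qgroup_eq :: "'a qgroup \<Rightarrow> 'b qgroup \<Rightarrow> bool" where
  "qgroup_eq G H \<longleftrightarrow> qsubgroup G H \<and> qsubgroup H G"

text \<open>Isomorphism of compact quantum groups: a *-isomorphism \<open>h\<close> of the C*-algebras with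
  \<open>(h \<otimes> h) \<circ> \<Delta>\<^sub>G = \<Delta>\<^sub>H \<circ> h\<close>. The sizes of the matrices may differ.\<close>

definition qgroup_iso :: "'a qgroup \<Rightarrow> 'b qgroup \<Rightarrow> bool" where
  "qgroup_iso G H \<longleftrightarrow>
     compact_matrix_quantum_group G \<and> compact_matrix_quantum_group H \<and>
     (\<exists>h hh \<Delta>G \<Delta>H.
        h \<in> star_hom (qalg G) (qalg H) \<and> bij_betw h (carrier (qalg G)) (carrier (qalg H)) \<and>
        hh \<in> star_hom (min_tensor (qalg G) (qalg G)) (min_tensor (qalg H) (qalg H)) \<and>
        (\<forall>a\<in>carrier (qalg G). \<forall>b\<in>carrier (qalg G).
           hh (tensor (qalg G) (qalg G) a b) = tensor (qalg H) (qalg H) (h a) (h b)) \<and>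
        comultiplication G \<Delta>G \<and> comultiplication H \<Delta>H \<and>
        (\<forall>a\<in>carrier (qalg G). hh (\<Delta>G a) = \<Delta>H (h a)))"


subsection \<open>Groups of permutations\<close>

text \<open>The convention for permutation matrices: \<open>\<sigma>\<close> sends the basis vector \<open>e\<^sub>j\<close> to \<open>e\<^bsub>\<sigma> j\<^esub>\<close>, so that
  \<open>(\<sigma> \<circ> \<tau>)\<^sub>i\<^sub>j = (\<Sum>k. \<sigma>\<^sub>i\<^sub>k * \<tau>\<^sub>k\<^sub>j)\<close>.\<close>

definition perm_matrix :: "(nat \<Rightarrow> nat) \<Rightarrow> nat \<Rightarrow> nat \<Rightarrow> complex" where
  "perm_matrix \<sigma> i j = of_bool (\<sigma> j = i)"

definition function_cstar :: "'k set \<Rightarrow> ('k \<Rightarrow> complex) cstar_algebra" where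
  "function_cstar K =
    \<lparr>carrier = extensional K,
     mult = (\<lambda>f g. \<lambda>x\<in>K. f x * g x),
     one = (\<lambda>x\<in>K. 1),
     zero = (\<lambda>x\<in>K. 0),
     add = (\<lambda>f g. \<lambda>x\<in>K. f x + g x),
     module.smult = (\<lambda>c f. \<lambda>x\<in>K. c * f x),
     star = (\<lambda>f. \<lambda>x\<in>K. cnj (f x)),
     cnorm = (\<lambda>f. SUP x\<in>K. cmod (f x))\<rparr>"

definition perm_qgroup :: "nat \<Rightarrow> (nat \<Rightarrow> nat) set \<Rightarrow> ((nat \<Rightarrow> nat) \<Rightarrow> complex) qgroup" where
  "perm_qgroup n K =
    \<lparr>qalg = function_cstar K, qdim = n, qmat = (\<lambda>i j. \<lambda>\<sigma>\<in>K. perm_matrix \<sigma> i j)\<rparr>"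


section \<open>Graphs\<close>

text \<open>A graph on \<open>{1..n}\<close> without multiple edges is its edge set, a subset of
  \<open>{1..n} \<times> {1..n}\<close>; an edge \<open>e\<close> has source \<open>fst e\<close> and range \<open>snd e\<close>.\<close>

definition simple_graph :: "nat \<Rightarrow> (nat \<times> nat) set \<Rightarrow> bool" where
  "simple_graph n E \<longleftrightarrow> E \<subseteq> {1..n} \<times> {1..n} \<and> sym E \<and> irrefl E"

definition graph_compl :: "nat \<Rightarrow> (nat \<times> nat) set \<Rightarrow> (nat \<times> nat) set" where
  "graph_compl n E = ({1..n} \<times> {1..n}) - (E \<union> {(i, i) | i. i \<in> {1..n}})"

definition graph_iso :: "nat \<Rightarrow> (nat \<times> nat) set \<Rightarrow> (nat \<times> nat) set \<Rightarrow> bool" where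
  "graph_iso n E E' \<longleftrightarrow> (\<exists>\<sigma>. \<sigma> permutes {1..n} \<and>
     (\<forall>i\<in>{1..n}. \<forall>j\<in>{1..n}. (i, j) \<in> E \<longleftrightarrow> (\<sigma> i, \<sigma> j) \<in> E'))"

definition undirected :: "(nat \<times> nat) set \<Rightarrow> (nat \<times> nat) set" where
  "undirected S = S \<union> S\<inverse>"

definition adjacency :: "(nat \<times> nat) set \<Rightarrow> nat \<Rightarrow> nat \<Rightarrow> complex" where
  "adjacency E i j = of_bool ((i, j) \<in> E)"

definition aut_group :: "nat \<Rightarrow> (nat \<times> nat) set \<Rightarrow> (nat \<Rightarrow> nat) monoid" where
  "aut_group n E = (sym_group n)\<lparr>carrier := {\<sigma> \<in> carrier (sym_group n).
     \<forall>i\<in>{1..n}. \<forall>j\<in>{1..n}.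
       (\<Sum>k\<in>{1..n}. perm_matrix \<sigma> i k * adjacency E k j) =
       (\<Sum>k\<in>{1..n}. adjacency E i k * perm_matrix \<sigma> k j)}\<rparr>"


section \<open>Quantum automorphism groups\<close>

type_synonym mat_poly = "(nat \<times> nat) word \<Rightarrow> complex"

abbreviation mat_free :: "nat \<Rightarrow> mat_poly star_algebra" where
  "mat_free n \<equiv> free_star_algebra ({1..n} \<times> {1..n})"

definition rel_a :: "nat \<Rightarrow> (mat_poly \<times> mat_poly) set" where
  "rel_a n = (let F = mat_free n; u = (\<lambda>i j. free_gen (i, j)); V = {1..n} in
     {(u i j, star F (u i j)) | i j. i \<in> V \<and> j \<in> V} \<union>
     {(u i j \<otimes>\<^bsub>F\<^esub> u i k, if j = k then u i j else \<zero>\<^bsub>F\<^esub>) | i j k. i \<in> V \<and> j \<in> V \<and> k \<in> V} \<union>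
     {(u j i \<otimes>\<^bsub>F\<^esub> u k i, if j = k then u j i else \<zero>\<^bsub>F\<^esub>) | i j k. i \<in> V \<and> j \<in> V \<and> k \<in> V})"

definition rel_b :: "nat \<Rightarrow> (mat_poly \<times> mat_poly) set" where
  "rel_b n = (let F = mat_free n; u = (\<lambda>i j. free_gen (i, j)); V = {1..n} in
     {(\<Oplus>\<^bsub>F\<^esub>l\<in>V. u i l, \<one>\<^bsub>F\<^esub>) | i. i \<in> V} \<union>
     {(\<Oplus>\<^bsub>F\<^esub>l\<in>V. u l i, \<one>\<^bsub>F\<^esub>) | i. i \<in> V})"

definition rel_c :: "nat \<Rightarrow> (nat \<times> nat) set \<Rightarrow> (mat_poly \<times> mat_poly) set" where
  "rel_c n E = (let F = mat_free n; u = (\<lambda>i j. free_gen (i, j)); V = {1..n} in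
     {(\<Oplus>\<^bsub>F\<^esub>k\<in>V. adjacency E k j \<odot>\<^bsub>F\<^esub> u i k, \<Oplus>\<^bsub>F\<^esub>k\<in>V. adjacency E i k \<odot>\<^bsub>F\<^esub> u k j) | i j.
        i \<in> V \<and> j \<in> V})"

definition rel_d :: "nat \<Rightarrow> (nat \<times> nat) set \<Rightarrow> (mat_poly \<times> mat_poly) set" where
  "rel_d n E = (let F = mat_free n; u = (\<lambda>i j. free_gen (i, j)) in
     {(u (fst e) (fst f) \<otimes>\<^bsub>F\<^esub> u (snd e) (snd f), u (snd e) (snd f) \<otimes>\<^bsub>F\<^esub> u (fst e) (fst f)) | e f.
        e \<in> E \<and> f \<in> E})"

definition matrix_qgroup ::
    "nat \<Rightarrow> (mat_poly \<times> mat_poly) set \<Rightarrow> (nat \<Rightarrow> mat_poly) set qgroup" where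
  "matrix_qgroup n R =
    \<lparr>qalg = universal_cstar ({1..n} \<times> {1..n}) R, qdim = n,
     qmat = (\<lambda>i j. universal_gen ({1..n} \<times> {1..n}) R (i, j))\<rparr>"

definition S_plus :: "nat \<Rightarrow> (nat \<Rightarrow> mat_poly) set qgroup" where
  "S_plus n = matrix_qgroup n (rel_a n \<union> rel_b n)"

text \<open>Banica's quantum automorphism group.\<close>

definition G_aut_plus :: "nat \<Rightarrow> (nat \<times> nat) set \<Rightarrow> (nat \<Rightarrow> mat_poly) set qgroup" where
  "G_aut_plus n E = matrix_qgroup n (rel_a n \<union> rel_b n \<union> rel_c n E)"

text \<open>Bichon's quantum automorphism group.\<close>

definition G_aut_star :: "nat \<Rightarrow> (nat \<times> nat) set \<Rightarrow> (nat \<Rightarrow> mat_poly) set qgroup" where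
  "G_aut_star n E = matrix_qgroup n (rel_a n \<union> rel_b n \<union> rel_c n E \<union> rel_d n E)"

text \<open>The dual of \<open>\<int>\<^sub>2 * \<int>\<^sub>2\<close>.\<close>

datatype proj_gen = Proj_p | Proj_q

definition rel_proj :: "((proj_gen word \<Rightarrow> complex) \<times> (proj_gen word \<Rightarrow> complex)) set" where
  "rel_proj = (let F = free_star_algebra UNIV in
     {(free_gen x, star F (free_gen x)) | x. True} \<union>
     {(free_gen x \<otimes>\<^bsub>F\<^esub> free_gen x, free_gen x) | x. True})"

definition Z2_free_Z2_dual :: "(nat \<Rightarrow> proj_gen word \<Rightarrow> complex) set qgroup" where
  "Z2_free_Z2_dual = (let A = universal_cstar UNIV rel_proj;
       p = universal_gen UNIV rel_proj Proj_p; q = universal_gen UNIV rel_proj Proj_q in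
    \<lparr>qalg = A, qdim = 4, qmat = (\<lambda>i j.
       [[p, \<one>\<^bsub>A\<^esub> \<ominus>\<^bsub>A\<^esub> p, \<zero>\<^bsub>A\<^esub>, \<zero>\<^bsub>A\<^esub>],
        [\<one>\<^bsub>A\<^esub> \<ominus>\<^bsub>A\<^esub> p, p, \<zero>\<^bsub>A\<^esub>, \<zero>\<^bsub>A\<^esub>],
        [\<zero>\<^bsub>A\<^esub>, \<zero>\<^bsub>A\<^esub>, q, \<one>\<^bsub>A\<^esub> \<ominus>\<^bsub>A\<^esub> q],
        [\<zero>\<^bsub>A\<^esub>, \<zero>\<^bsub>A\<^esub>, \<one>\<^bsub>A\<^esub> \<ominus>\<^bsub>A\<^esub> q, q]] ! (i - 1) ! (j - 1))\<rparr>)"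

text \<open>Bichon's hyperoctahedral quantum group \<open>H\<^sub>2\<^sup>+\<close>.\<close>

definition rel_H2 :: "(mat_poly \<times> mat_poly) set" where
  "rel_H2 = (let F = mat_free 2; v = (\<lambda>i j. free_gen (i, j)); V = {1..2} in
     {(v i j, star F (v i j)) | i j. i \<in> V \<and> j \<in> V} \<union>
     {(v i j \<otimes>\<^bsub>F\<^esub> v i k, \<zero>\<^bsub>F\<^esub>) | i j k. i \<in> V \<and> j \<in> V \<and> k \<in> V \<and> j \<noteq> k} \<union>
     {(v j i \<otimes>\<^bsub>F\<^esub> v k i, \<zero>\<^bsub>F\<^esub>) | i j k. i \<in> V \<and> j \<in> V \<and> k \<in> V \<and> j \<noteq> k} \<union>
     {(\<Oplus>\<^bsub>F\<^esub>k\<in>V. v i k \<otimes>\<^bsub>F\<^esub> v i k, \<one>\<^bsub>F\<^esub>) | i. i \<in> V} \<union>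
     {(\<Oplus>\<^bsub>F\<^esub>k\<in>V. v k i \<otimes>\<^bsub>F\<^esub> v k i, \<one>\<^bsub>F\<^esub>) | i. i \<in> V})"

definition H2_plus :: "(nat \<Rightarrow> mat_poly) set qgroup" where
  "H2_plus = matrix_qgroup 2 rel_H2"


section \<open>The groups and graphs of the classification\<close>

abbreviation Z2 :: "int monoid" where
  "Z2 \<equiv> integer_mod_group 2"

text \<open>The group presented by the relators \<open>R\<close>, with all elements of the type \<open>'g\<close> as
  generators.\<close>

inductive presentation_eq :: "'g word set \<Rightarrow> 'g word \<Rightarrow> 'g word \<Rightarrow> bool" for R where
  refl: "presentation_eq R v v"
| sym: "presentation_eq R v w \<Longrightarrow> presentation_eq R w v"
| trans: "presentation_eq R u v \<Longrightarrow> presentation_eq R v w \<Longrightarrow> presentation_eq R u w"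
| cancel: "presentation_eq R (v @ [(x, b), (x, \<not> b)] @ w) (v @ w)"
| relator: "r \<in> R \<Longrightarrow> presentation_eq R (v @ r @ w) (v @ w)"

definition presented_group :: "'g word set \<Rightarrow> 'g word set monoid" where
  "presented_group R =
    \<lparr>carrier = UNIV // {(v, w). presentation_eq R v w},
     mult = (\<lambda>U V. {w. \<exists>u\<in>U. \<exists>v\<in>V. presentation_eq R (u @ v) w}),
     one = {w. presentation_eq R [] w}\<rparr>"

datatype dihedral_gen = Dih_x | Dih_y

definition D4 :: "dihedral_gen word set monoid" where
  "D4 = (let x = (Dih_x, False); y = (Dih_y, False) in
     presented_group {[x, x], [y, y], [x, y, x, y, x, y, x, y]})"

definition \<Gamma> :: "nat \<Rightarrow> (nat \<times> nat) set" where
  "\<Gamma> i =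
    (if i = 1 then undirected {}
     else if i = 2 then undirected {(1, 2)}
     else if i = 3 then undirected {(1, 2), (1, 3)}
     else if i = 4 then undirected {(1, 2), (3, 4)}
     else if i = 5 then undirected {(1, 2), (1, 3), (2, 3)}
     else if i = 6 then undirected {(1, 2), (1, 3), (2, 4)}
     else undefined)"

abbreviation \<Gamma>c :: "nat \<Rightarrow> (nat \<times> nat) set" where
  "\<Gamma>c i \<equiv> graph_compl 4 (\<Gamma> i)"

text \<open>The quantum group \<open>G\<close> (a quantum automorphism group of \<open>E\<close>) is the classical
  automorphism group of \<open>E\<close>, and the latter is isomorphic to \<open>K\<close>.\<close>

definition equals_aut_group ::
    "'a qgroup \<Rightarrow> nat \<Rightarrow> (nat \<times> nat) set \<Rightarrow> ('k, 'x) monoid_scheme \<Rightarrow> bool" where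
  "equals_aut_group G n E K \<longleftrightarrow>
     qgroup_eq G (perm_qgroup n (carrier (aut_group n E))) \<and> aut_group n E \<cong> K"

end

theory Submission
  imports Defs
begin

text \<open>Every claim about a universal C*-algebra is reduced to its universal property: a matrix over a
  C*-algebra satisfying the relations extends to a homomorphism. This makes \<open>S_n^+\<close>,
  \<open>G_aut^+\<close> and \<open>G_aut^*\<close> quantum groups, as \<open>\<Sum>k. u_ik \<otimes> u_kj\<close> inherits the relations from \<open>u\<close>;
  the minimal tensor product is handled through the GNS-type seminorms of its product states, whose
  positivity is the Schur product theorem.

  The relation \<open>u\<epsilon> = \<epsilon>u\<close>, written out for the six graphs, makes all entries of \<open>u\<close> commute for
  \<open>\<Gamma> 3\<close>, \<open>\<Gamma> 5\<close> and \<open>\<Gamma> 6\<close>. If the entries commute, products of entries of \<open>u\<close> along permutations are a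
  partition of unity indexed by the automorphism group, so the quantum group is classical. For
  \<open>\<Gamma> 2\<close> the matrix \<open>u\<close> is block diagonal with blocks determined by one projection each, which gives
  \<open>C*(Z2 * Z2)\<close>. For \<open>\<Gamma> 4\<close> the generators of \<open>H_2^+\<close> are the differences
  \<open>v_ij = u_(2i-1, 2j-1) - u_(2i-1, 2j)\<close>, and \<open>u\<close> is recovered from the projections
  \<open>(v_ij^2 + v_ij) / 2\<close> and \<open>(v_ij^2 - v_ij) / 2\<close>. For each of the six graphs \<open>\<Gamma> i\<close>, the
  commutation along pairs of edges is automatic, so \<open>G_aut^*(\<Gamma> i) = G_aut^+(\<Gamma> i)\<close>; together
  with the commutation along pairs of edges of the complement, which Bichon's relation (d) provides
  for \<open>G_aut^*(\<Gamma>c i)\<close>, it makes all entries of \<open>u\<close> commute.\<close>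

section \<open>Star algebras and C*-seminorms\<close>

text \<open>Continuity is explicit data: a homomorphism comes with a norm bound, which the universal
  property supplies because the norm of \<open>B\<close>, pulled back along the evaluation, is one
  of the seminorms whose supremum defines the universal algebra. A hypothesis about all C*-algebras
  with given relations would range over all types; it is stated for one type, that of the
  completions of the free algebra, which suffices because a compatible seminorm is recovered as the
  norm of its own completion. The spatial seminorm must first be shown to be finite: iterated
  Cauchy-Schwarz on the powers \<open>(t* t)^(2^n)\<close> bounds left multiplication through any
  submultiplicative norm that dominates the functionals. The graph computations rest on two
  consequences of \<open>u\<epsilon> = \<epsilon>u\<close>: \<open>u_ij\<close> vanishes when
  \<open>i\<close> and \<open>j\<close> have different degrees, and \<open>u_ia u_jb\<close>
  vanishes when exactly one of \<open>(i, j)\<close> and \<open>(a, b)\<close> is an edge. The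
  second one explains why commutation along pairs of edges of the graph and of its complement
  exhausts all cases.\<close>

context star_algebra
begin

lemma smult_closed [simp]: "x \<in> carrier A \<Longrightarrow> c \<odot> x \<in> carrier A"
  using module.smult_closed[OF module] by (simp add: ring_of_type_algebra_def)

lemma smult_add_left: "x \<in> carrier A \<Longrightarrow> (c + d) \<odot> x = c \<odot> x \<oplus> d \<odot> x"
  using module.smult_l_distr[OF module] by (simp add: ring_of_type_algebra_def)

lemma smult_add_right:
  "\<lbrakk>x \<in> carrier A; y \<in> carrier A\<rbrakk> \<Longrightarrow> c \<odot> (x \<oplus> y) = c \<odot> x \<oplus> c \<odot> y"
  using module.smult_r_distr[OF module] by (simp add: ring_of_type_algebra_def)

lemma smult_smult [simp]: "x \<in> carrier A \<Longrightarrow> c \<odot> (d \<odot> x) = (c * d) \<odot> x"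
  using module.smult_assoc1[OF module] by (simp add: ring_of_type_algebra_def)

lemma smult_one [simp]: "x \<in> carrier A \<Longrightarrow> 1 \<odot> x = x"
  using module.smult_one[OF module] by (simp add: ring_of_type_algebra_def)

lemma smult_0_left [simp]: "x \<in> carrier A \<Longrightarrow> 0 \<odot> x = \<zero>"
  using module.smult_l_null[OF module] by (simp add: ring_of_type_algebra_def)

lemma smult_0_right [simp]: "c \<odot> \<zero> = \<zero>"
  using module.smult_r_null[OF module, of c] by (simp add: ring_of_type_algebra_def)

lemma uminus_eq_smult: "x \<in> carrier A \<Longrightarrow> \<ominus> x = (- 1) \<odot> x"
  by (rule minus_equality) (simp_all add: smult_add_left[symmetric] flip: smult_add_left smult_one,
      metis add.left_inverse smult_0_left smult_add_left smult_one)

lemma minus_eq_smult: "\<lbrakk>x \<in> carrier A; y \<in> carrier A\<rbrakk> \<Longrightarrow> x \<ominus> y = x \<oplus> (- 1) \<odot> y"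
  by (simp add: minus_eq uminus_eq_smult)

declare star_closed [simp] star_star [simp]

lemma star_zero [simp]: "star A \<zero> = \<zero>"
  using star_smult[of \<zero> 0] by simp

lemma star_one [simp]: "star A \<one> = \<one>"
  by (metis one_closed l_one r_one star_closed star_mult star_star)

lemma star_uminus: "x \<in> carrier A \<Longrightarrow> star A (\<ominus> x) = \<ominus> star A x"
  by (simp add: uminus_eq_smult star_smult)

lemma star_minus:
  "\<lbrakk>x \<in> carrier A; y \<in> carrier A\<rbrakk> \<Longrightarrow> star A (x \<ominus> y) = star A x \<ominus> star A y"
  by (simp add: minus_eq star_add star_uminus)

lemma smult_minus_right:
  "\<lbrakk>x \<in> carrier A; y \<in> carrier A\<rbrakk> \<Longrightarrow> c \<odot> (x \<ominus> y) = c \<odot> x \<ominus> c \<odot> y"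
  by (simp add: minus_eq_smult smult_add_right mult.commute)

lemma minus_distr_left:
  "\<lbrakk>x \<in> carrier A; y \<in> carrier A; z \<in> carrier A\<rbrakk> \<Longrightarrow> (x \<ominus> y) \<otimes> z = x \<otimes> z \<ominus> y \<otimes> z"
  by (simp add: minus_eq l_distr l_minus)

lemma minus_distr_right:
  "\<lbrakk>x \<in> carrier A; y \<in> carrier A; z \<in> carrier A\<rbrakk> \<Longrightarrow> z \<otimes> (x \<ominus> y) = z \<otimes> x \<ominus> z \<otimes> y"
  by (simp add: minus_eq r_distr r_minus)

lemma minus_self [simp]: "x \<in> carrier A \<Longrightarrow> x \<ominus> x = \<zero>"
  by (simp add: minus_eq r_neg)

lemma minus_eq_0_iff: "\<lbrakk>x \<in> carrier A; y \<in> carrier A\<rbrakk> \<Longrightarrow> x \<ominus> y = \<zero> \<longleftrightarrow> x = y"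
  by (metis minus_self r_right_minus_eq)

lemma finsum_smult:
  "finite I \<Longrightarrow> f \<in> I \<rightarrow> carrier A \<Longrightarrow> c \<odot> finsum A f I = (\<Oplus>i\<in>I. c \<odot> f i)"
  by (induction I rule: finite_induct) (auto simp: smult_add_right Pi_iff)

lemma finsum_star:
  "finite I \<Longrightarrow> f \<in> I \<rightarrow> carrier A \<Longrightarrow> star A (finsum A f I) = (\<Oplus>i\<in>I. star A (f i))"
  by (induction I rule: finite_induct) (auto simp: star_add Pi_iff)

lemma finsum_smult_left:
  "finite I \<Longrightarrow> x \<in> carrier A \<Longrightarrow> (\<Oplus>i\<in>I. f i \<odot> x) = (\<Sum>i\<in>I. f i) \<odot> x"
  by (induction I rule: finite_induct) (auto simp: smult_add_left Pi_iff)

lemma finsum_swap: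
  "finite I \<Longrightarrow> finite J \<Longrightarrow> (\<And>i j. i \<in> I \<Longrightarrow> j \<in> J \<Longrightarrow> f i j \<in> carrier A) \<Longrightarrow>
   (\<Oplus>i\<in>I. \<Oplus>j\<in>J. f i j) = (\<Oplus>j\<in>J. \<Oplus>i\<in>I. f i j)"
proof (induction I rule: finite_induct)
  case empty
  then show ?case by (simp add: finsum_zero)
next
  case (insert a I)
  then have "(\<Oplus>j\<in>J. \<Oplus>i\<in>insert a I. f i j) = (\<Oplus>j\<in>J. f a j \<oplus> (\<Oplus>i\<in>I. f i j))"
    by (intro finsum_cong') (auto simp: Pi_iff)
  also have "\<dots> = (\<Oplus>j\<in>J. f a j) \<oplus> (\<Oplus>j\<in>J. \<Oplus>i\<in>I. f i j)"
    using insert by (intro finsum_addf) (auto simp: Pi_iff)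
  finally show ?case using insert by (simp add: Pi_iff)
qed

lemma finsum_delta:
  assumes "finite I" "k \<in> I" "\<And>i. i \<in> I \<Longrightarrow> f i \<in> carrier A" "\<And>i. i \<in> I \<Longrightarrow> i \<noteq> k \<Longrightarrow> f i = \<zero>"
  shows "(\<Oplus>i\<in>I. f i) = f k"
proof -
  have "(\<Oplus>i\<in>I. f i) = (\<Oplus>i\<in>I. if k = i then f i else \<zero>)"
    using assms by (intro finsum_cong') auto
  also have "\<dots> = f k"
    using assms by (intro finsum_singleton) auto
  finally show ?thesis .
qed

lemma finsum_all_zero: "(\<And>i. i \<in> I \<Longrightarrow> f i = \<zero>) \<Longrightarrow> (\<Oplus>i\<in>I. f i) = \<zero>"
  by (rule add.finprod_one_eqI)

lemma finsum_superset:
  assumes "finite J" "I \<subseteq> J" "\<And>i. i \<in> J - I \<Longrightarrow> f i = \<zero>" "\<And>i. i \<in> I \<Longrightarrow> f i \<in> carrier A"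
  shows "(\<Oplus>i\<in>I. f i) = (\<Oplus>i\<in>J. f i)"
proof (intro add.finprod_mono_neutral_cong_left)
  show "f \<in> J \<rightarrow> carrier A" using assms by fastforce
qed (use assms in auto)

end

text \<open>Free *-algebras and formal tensors carry C*-seminorms with a large kernel. Estimates
  proved at this level serve them, their completions and, through the sublocale below, every
  C*-algebra.\<close>

locale cstar_seminormed = star_algebra A for A :: "('a, 'm) star_algebra_scheme" (structure) +
  fixes p :: "'a \<Rightarrow> real"
  assumes seminorm: "cstar_seminorm A p"
begin

lemma p_nonneg [simp]: "x \<in> carrier A \<Longrightarrow> 0 \<le> p x"
  using seminorm by (simp add: cstar_seminorm_def)

lemma p_cstar: "x \<in> carrier A \<Longrightarrow> p (star A x \<otimes> x) = (p x)\<^sup>2"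
  using seminorm by (simp add: cstar_seminorm_def)

lemma p_smult: "x \<in> carrier A \<Longrightarrow> p (c \<odot> x) = cmod c * p x"
  using seminorm by (simp add: cstar_seminorm_def)

lemma p_add: "x \<in> carrier A \<Longrightarrow> y \<in> carrier A \<Longrightarrow> p (x \<oplus> y) \<le> p x + p y"
  using seminorm by (simp add: cstar_seminorm_def)

lemma p_mult: "x \<in> carrier A \<Longrightarrow> y \<in> carrier A \<Longrightarrow> p (x \<otimes> y) \<le> p x * p y"
  using seminorm by (simp add: cstar_seminorm_def)

lemma p_zero [simp]: "p \<zero> = 0"
  using p_smult[of \<zero> 0] by simp

lemma p_uminus: "x \<in> carrier A \<Longrightarrow> p (\<ominus> x) = p x"
  by (simp add: uminus_eq_smult p_smult)

text \<open>The C*-identity and submultiplicativity give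
  \<open>(p y)^2 \<le> p (star A y) * p y\<close>; cancelling \<open>p y\<close> and exchanging the
  roles of \<open>y\<close> and its adjoint yields both inequalities.\<close>

lemma p_star: assumes "x \<in> carrier A" shows "p (star A x) = p x"
proof -
  have *: "p y \<le> p (star A y)" if "y \<in> carrier A" for y
  proof (cases "p y = 0")
    case False
    have "p y * p y \<le> p (star A y) * p y"
      using p_mult[of "star A y" y] that by (simp add: p_cstar power2_eq_square)
    with False that show ?thesis by (metis mult_right_le_imp_le p_nonneg order_le_less)
  qed (use that in simp)
  show ?thesis using *[OF assms] *[of "star A x"] assms by simp
qed

lemma p_minus_commute: "x \<in> carrier A \<Longrightarrow> y \<in> carrier A \<Longrightarrow> p (x \<ominus> y) = p (y \<ominus> x)"
  using p_uminus[of "x \<ominus> y"] by (simp add: minus_eq minus_add a_comm)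

lemma minus_split:
  "x \<in> carrier A \<Longrightarrow> y \<in> carrier A \<Longrightarrow> z \<in> carrier A \<Longrightarrow> x \<ominus> z = (x \<ominus> y) \<oplus> (y \<ominus> z)"
  by (simp add: minus_eq a_assoc r_neg1 r_neg2)

lemma p_triangle:
  "x \<in> carrier A \<Longrightarrow> y \<in> carrier A \<Longrightarrow> z \<in> carrier A \<Longrightarrow> p (x \<ominus> z) \<le> p (x \<ominus> y) + p (y \<ominus> z)"
  using p_add[of "x \<ominus> y" "y \<ominus> z"] minus_split[of x y z] by simp

lemma p_le_minus: assumes "x \<in> carrier A" "y \<in> carrier A" shows "p x \<le> p (x \<ominus> y) + p y"
proof -
  have "x = (x \<ominus> y) \<oplus> y" using assms by (simp add: minus_eq a_assoc l_neg)
  then show ?thesis using p_add[of "x \<ominus> y" y] assms by simp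
qed

lemma p_abs_diff:
  "x \<in> carrier A \<Longrightarrow> y \<in> carrier A \<Longrightarrow> \<bar>p x - p y\<bar> \<le> p (x \<ominus> y)"
  using p_le_minus[of x y] p_le_minus[of y x] p_minus_commute[of x y] by linarith

lemma add_minus_add:
  "x \<in> carrier A \<Longrightarrow> y \<in> carrier A \<Longrightarrow> x' \<in> carrier A \<Longrightarrow> y' \<in> carrier A \<Longrightarrow>
   (x \<oplus> y) \<ominus> (x' \<oplus> y') = (x \<ominus> x') \<oplus> (y \<ominus> y')"
  by (simp add: minus_eq minus_add a_assoc a_lcomm)

lemma p_add_diff:
  "x \<in> carrier A \<Longrightarrow> y \<in> carrier A \<Longrightarrow> x' \<in> carrier A \<Longrightarrow> y' \<in> carrier A \<Longrightarrow>
   p ((x \<oplus> y) \<ominus> (x' \<oplus> y')) \<le> p (x \<ominus> x') + p (y \<ominus> y')"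
  by (simp add: add_minus_add p_add)

lemma p_mult_diff:
  assumes "x \<in> carrier A" "y \<in> carrier A" "x' \<in> carrier A" "y' \<in> carrier A"
  shows "p ((x \<otimes> y) \<ominus> (x' \<otimes> y')) \<le> p (x \<ominus> x') * p y + p x' * p (y \<ominus> y')"
proof -
  have "p ((x \<otimes> y) \<ominus> (x' \<otimes> y')) \<le> p ((x \<otimes> y) \<ominus> (x' \<otimes> y)) + p ((x' \<otimes> y) \<ominus> (x' \<otimes> y'))"
    using assms by (intro p_triangle) auto
  also have "\<dots> = p ((x \<ominus> x') \<otimes> y) + p (x' \<otimes> (y \<ominus> y'))"
    using assms by (simp add: minus_distr_left minus_distr_right)
  also have "\<dots> \<le> p (x \<ominus> x') * p y + p x' * p (y \<ominus> y')"
    using assms by (intro add_mono p_mult) auto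
  finally show ?thesis .
qed

lemma p_finsum: "finite I \<Longrightarrow> f \<in> I \<rightarrow> carrier A \<Longrightarrow> p (finsum A f I) \<le> (\<Sum>i\<in>I. p (f i))"
proof (induction I rule: finite_induct)
  case (insert a I)
  then have "f a \<in> carrier A" "f \<in> I \<rightarrow> carrier A" by auto
  then have "p (f a \<oplus> finsum A f I) \<le> p (f a) + p (finsum A f I)" by (intro p_add) auto
  with insert show ?case by (fastforce simp: Pi_iff)
qed simp

text \<open>By the C*-identity \<open>p \<one>\<close> equals its own square, hence is 0 or 1. The
  value 0 occurs for the zero seminorm, which is among the compatible ones later on.\<close>

lemma p_one_le: "p \<one> \<le> 1"
proof -
  have "(p \<one>)\<^sup>2 = p \<one>" using p_cstar[of \<one>] by simp
  then have "p \<one> = 0 \<or> p \<one> = 1" by (simp add: power2_eq_square)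
  then show ?thesis by auto
qed

end

lemma (in cstar_algebra) cstar_seminormed_cnorm: "cstar_seminormed A (cnorm A)"
  by (rule cstar_seminormed.intro) (use cstar_seminorm in \<open>unfold_locales, auto\<close>)

sublocale cstar_algebra \<subseteq> cstar_seminormed A "cnorm A"
  by (rule cstar_seminormed_cnorm)

section \<open>Homomorphisms\<close>

locale star_homomorphism = A: star_algebra A + B: star_algebra B
  for A :: "('a, 'm) star_algebra_scheme" and B :: "('b, 'n) star_algebra_scheme" +
  fixes h :: "'a \<Rightarrow> 'b"
  assumes star_hom: "h \<in> star_hom A B"
begin

lemma hom_closed [simp]: "x \<in> carrier A \<Longrightarrow> h x \<in> carrier B"
  using star_hom by (auto simp: star_hom_def ring_hom_def)

lemma hom_mult: "x \<in> carrier A \<Longrightarrow> y \<in> carrier A \<Longrightarrow> h (x \<otimes>\<^bsub>A\<^esub> y) = h x \<otimes>\<^bsub>B\<^esub> h y"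
  using star_hom by (auto simp: star_hom_def ring_hom_def)

lemma hom_add: "x \<in> carrier A \<Longrightarrow> y \<in> carrier A \<Longrightarrow> h (x \<oplus>\<^bsub>A\<^esub> y) = h x \<oplus>\<^bsub>B\<^esub> h y"
  using star_hom by (auto simp: star_hom_def ring_hom_def)

lemma hom_one: "h \<one>\<^bsub>A\<^esub> = \<one>\<^bsub>B\<^esub>"
  using star_hom by (auto simp: star_hom_def ring_hom_def)

lemma hom_smult: "x \<in> carrier A \<Longrightarrow> h (c \<odot>\<^bsub>A\<^esub> x) = c \<odot>\<^bsub>B\<^esub> h x"
  using star_hom by (auto simp: star_hom_def)

lemma hom_star: "x \<in> carrier A \<Longrightarrow> h (star A x) = star B (h x)"
  using star_hom by (auto simp: star_hom_def)

lemma hom_zero: "h \<zero>\<^bsub>A\<^esub> = \<zero>\<^bsub>B\<^esub>"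
  using hom_smult[of "\<zero>\<^bsub>A\<^esub>" 0] by simp

lemma hom_minus: "x \<in> carrier A \<Longrightarrow> y \<in> carrier A \<Longrightarrow> h (x \<ominus>\<^bsub>A\<^esub> y) = h x \<ominus>\<^bsub>B\<^esub> h y"
  by (simp add: A.minus_eq_smult B.minus_eq_smult hom_add hom_smult)

lemma hom_finsum:
  "finite I \<Longrightarrow> f \<in> I \<rightarrow> carrier A \<Longrightarrow> h (finsum A f I) = (\<Oplus>\<^bsub>B\<^esub>i\<in>I. h (f i))"
  by (induction I rule: finite_induct) (auto simp: hom_zero hom_add Pi_iff)

end

lemma star_homI:
  assumes "\<And>x. x \<in> carrier A \<Longrightarrow> h x \<in> carrier B"
    and "\<And>x y. x \<in> carrier A \<Longrightarrow> y \<in> carrier A \<Longrightarrow> h (x \<otimes>\<^bsub>A\<^esub> y) = h x \<otimes>\<^bsub>B\<^esub> h y"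
    and "\<And>x y. x \<in> carrier A \<Longrightarrow> y \<in> carrier A \<Longrightarrow> h (x \<oplus>\<^bsub>A\<^esub> y) = h x \<oplus>\<^bsub>B\<^esub> h y"
    and "h \<one>\<^bsub>A\<^esub> = \<one>\<^bsub>B\<^esub>"
    and "\<And>c x. x \<in> carrier A \<Longrightarrow> h (c \<odot>\<^bsub>A\<^esub> x) = c \<odot>\<^bsub>B\<^esub> h x"
    and "\<And>x. x \<in> carrier A \<Longrightarrow> h (star A x) = star B (h x)"
  shows "h \<in> star_hom A B"
  using assms by (auto simp: star_hom_def ring_hom_def)

lemma star_hom_comp:
  "g \<in> star_hom A B \<Longrightarrow> h \<in> star_hom B C \<Longrightarrow> (\<lambda>x. h (g x)) \<in> star_hom A C"
  by (auto simp: star_hom_def ring_hom_def Pi_iff)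

lemma star_hom_seminorm:
  assumes "star_algebra A" "cstar_seminormed B q" "h \<in> star_hom A B"
  shows "cstar_seminorm A (\<lambda>x. q (h x))"
proof -
  interpret B: cstar_seminormed B q by fact
  interpret A: star_algebra A by fact
  interpret h: star_homomorphism A B h by unfold_locales fact
  show ?thesis
    unfolding cstar_seminorm_def
    by (auto simp: h.hom_mult h.hom_star h.hom_smult h.hom_add B.p_cstar B.p_smult B.p_add B.p_mult)
qed

section \<open>Hausdorff completions\<close>

lemma tendsto_0_le:
  fixes f g :: "nat \<Rightarrow> real"
  assumes "g \<longlonglongrightarrow> 0" "\<And>n. 0 \<le> f n" "\<And>n. f n \<le> g n"
  shows "f \<longlonglongrightarrow> 0"
  by (rule tendsto_sandwich[of "\<lambda>_. 0" f sequentially g]) (use assms in auto)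

context cstar_seminormed
begin

abbreviation CS :: "(nat \<Rightarrow> 'a) set" where "CS \<equiv> cauchy_seqs A p"

abbreviation (input) asymp :: "(nat \<Rightarrow> 'a) \<Rightarrow> (nat \<Rightarrow> 'a) \<Rightarrow> bool" where
  "asymp x y \<equiv> (\<lambda>n. p (x n \<ominus> y n)) \<longlonglongrightarrow> 0"

lemma CS_carrier [simp]: "x \<in> CS \<Longrightarrow> x n \<in> carrier A"
  by (auto simp: cauchy_seqs_def)

lemma CS_iff: "x \<in> CS \<longleftrightarrow> (\<forall>n. x n \<in> carrier A) \<and>
    (\<forall>e>0. \<exists>N. \<forall>m\<ge>N. \<forall>n\<ge>N. p (x m \<ominus> x n) < e)"
  by (auto simp: cauchy_seqs_def)

lemma CS_const [simp]: "a \<in> carrier A \<Longrightarrow> (\<lambda>_. a) \<in> CS"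
  by (auto simp: CS_iff)

lemma CS_bounded: assumes "x \<in> CS" obtains K where "0 < K" "\<And>n. p (x n) \<le> K"
proof -
  obtain N where N: "\<And>m n. m \<ge> N \<Longrightarrow> n \<ge> N \<Longrightarrow> p (x m \<ominus> x n) < 1"
    using assms zero_less_one unfolding CS_iff by meson
  define K where "K = 1 + (\<Sum>i\<le>N. p (x i))"
  have le: "p (x i) \<le> (\<Sum>i\<le>N. p (x i))" if "i \<le> N" for i
    by (rule member_le_sum) (use that assms in auto)
  have "p (x n) \<le> K" for n
  proof (cases "n \<le> N")
    case True
    then show ?thesis using le[of n] by (simp add: K_def)
  next
    case False
    then show ?thesis
      using N[of n N] p_le_minus[of "x n" "x N"] le[of N] assms by (simp add: K_def)
  qed
  moreover have "0 < K" unfolding K_def using assms by (intro add_pos_nonneg sum_nonneg) auto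
  ultimately show ?thesis using that by blast
qed

text \<open>One estimate for all algebra operations. For products the constants are bounds of the
  two factor sequences; for unary operations the second sequence is a copy of the first.\<close>

lemma CS_lipschitz:
  assumes "x \<in> CS" "y \<in> CS" "\<And>n. z n \<in> carrier A" "0 < K" "0 < L"
    and "\<And>m n. p (z m \<ominus> z n) \<le> K * p (x m \<ominus> x n) + L * p (y m \<ominus> y n)"
  shows "z \<in> CS"
  unfolding CS_iff
proof (intro conjI allI impI)
  fix e :: real assume e: "0 < e"
  obtain M where M: "\<And>m n. m \<ge> M \<Longrightarrow> n \<ge> M \<Longrightarrow> p (x m \<ominus> x n) < e / 2 / K"
    using assms(1,4) e unfolding CS_iff by (metis divide_pos_pos zero_less_numeral)
  obtain N where N: "\<And>m n. m \<ge> N \<Longrightarrow> n \<ge> N \<Longrightarrow> p (y m \<ominus> y n) < e / 2 / L"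
    using assms(2,5) e unfolding CS_iff by (metis divide_pos_pos zero_less_numeral)
  have "p (z m \<ominus> z n) < e" if "m \<ge> max M N" "n \<ge> max M N" for m n
  proof -
    have "K * p (x m \<ominus> x n) < e / 2" "L * p (y m \<ominus> y n) < e / 2"
      using M[of m n] N[of m n] that assms(4,5) by (auto simp: field_simps)
    with assms(6)[of m n] show ?thesis by linarith
  qed
  then show "\<exists>N. \<forall>m\<ge>N. \<forall>n\<ge>N. p (z m \<ominus> z n) < e" by blast
qed (use assms in auto)

lemma CS_add: assumes "x \<in> CS" "y \<in> CS" shows "(\<lambda>n. x n \<oplus> y n) \<in> CS"
  by (rule CS_lipschitz[of x y _ 1 1]) (use assms p_add_diff in auto)

lemma CS_smult: assumes "x \<in> CS" shows "(\<lambda>n. c \<odot> x n) \<in> CS"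
\<comment> \<open>The summand 1 keeps the factor positive when \<open>c = 0\<close>.\<close>
proof (rule CS_lipschitz[of x x _ "cmod c + 1" 1])
  show "p (c \<odot> x m \<ominus> c \<odot> x n) \<le> (cmod c + 1) * p (x m \<ominus> x n) + 1 * p (x m \<ominus> x n)" for m n
    using assms by (simp add: smult_minus_right[symmetric] p_smult algebra_simps)
qed (use assms in \<open>auto intro: add_nonneg_pos\<close>)

lemma CS_star: assumes "x \<in> CS" shows "(\<lambda>n. star A (x n)) \<in> CS"
  by (rule CS_lipschitz[of x x _ 1 1]) (use assms in \<open>auto simp: star_minus[symmetric] p_star\<close>)

lemma CS_mult: assumes "x \<in> CS" "y \<in> CS" shows "(\<lambda>n. x n \<otimes> y n) \<in> CS"
proof -
  obtain K where K: "0 < K" "\<And>n. p (x n) \<le> K" using CS_bounded assms(1) by blast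
  obtain L where L: "0 < L" "\<And>n. p (y n) \<le> L" using CS_bounded assms(2) by blast
  show ?thesis
  proof (rule CS_lipschitz[OF assms _ L(1) K(1)])
    fix m n
    have "p (x m \<otimes> y m \<ominus> x n \<otimes> y n) \<le> p (x m \<ominus> x n) * p (y m) + p (x n) * p (y m \<ominus> y n)"
      using assms by (intro p_mult_diff) auto
    also have "\<dots> \<le> p (x m \<ominus> x n) * L + K * p (y m \<ominus> y n)"
      using assms K L by (intro add_mono mult_mono) auto
    finally show "p (x m \<otimes> y m \<ominus> x n \<otimes> y n) \<le> L * p (x m \<ominus> x n) + K * p (y m \<ominus> y n)"
      by (simp add: mult.commute)
  qed (use assms in auto)
qed

lemma asymp_sym: "x \<in> CS \<Longrightarrow> y \<in> CS \<Longrightarrow> asymp x y \<Longrightarrow> asymp y x"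
  by (simp add: p_minus_commute)

lemma asymp_trans:
  assumes "x \<in> CS" "y \<in> CS" "z \<in> CS" "asymp x y" "asymp y z" shows "asymp x z"
  by (rule tendsto_0_le[OF tendsto_add_zero[OF assms(4,5)]])
     (use assms in \<open>auto intro: p_triangle\<close>)

lemma asymp_add:
  assumes "x \<in> CS" "y \<in> CS" "x' \<in> CS" "y' \<in> CS" "asymp x x'" "asymp y y'"
  shows "asymp (\<lambda>n. x n \<oplus> y n) (\<lambda>n. x' n \<oplus> y' n)"
  by (rule tendsto_0_le[OF tendsto_add_zero[OF assms(5,6)]])
     (use assms in \<open>auto intro: p_add_diff\<close>)

lemma asymp_smult:
  assumes "x \<in> CS" "x' \<in> CS" "asymp x x'" shows "asymp (\<lambda>n. c \<odot> x n) (\<lambda>n. c \<odot> x' n)"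
  using tendsto_mult_right_zero[OF assms(3), of "cmod c"] assms
  by (simp add: smult_minus_right[symmetric] p_smult)

lemma asymp_star:
  assumes "x \<in> CS" "x' \<in> CS" "asymp x x'" shows "asymp (\<lambda>n. star A (x n)) (\<lambda>n. star A (x' n))"
  using assms by (simp add: star_minus[symmetric] p_star)

lemma asymp_mult:
  assumes "x \<in> CS" "y \<in> CS" "x' \<in> CS" "y' \<in> CS" "asymp x x'" "asymp y y'"
  shows "asymp (\<lambda>n. x n \<otimes> y n) (\<lambda>n. x' n \<otimes> y' n)"
proof -
  obtain K where K: "0 < K" "\<And>n. p (x' n) \<le> K" using CS_bounded assms(3) by blast
  obtain L where L: "0 < L" "\<And>n. p (y n) \<le> L" using CS_bounded assms(2) by blast
  have "(\<lambda>n. p (x n \<ominus> x' n) * L + K * p (y n \<ominus> y' n)) \<longlonglongrightarrow> 0"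
    by (intro tendsto_add_zero tendsto_mult_left_zero tendsto_mult_right_zero assms)
  then show ?thesis
  proof (rule tendsto_0_le)
    fix n
    have "p (x n \<otimes> y n \<ominus> x' n \<otimes> y' n) \<le> p (x n \<ominus> x' n) * p (y n) + p (x' n) * p (y n \<ominus> y' n)"
      using assms by (intro p_mult_diff) auto
    also have "\<dots> \<le> p (x n \<ominus> x' n) * L + K * p (y n \<ominus> y' n)"
      using assms K L by (intro add_mono mult_mono) auto
    finally show "p (x n \<otimes> y n \<ominus> x' n \<otimes> y' n) \<le> p (x n \<ominus> x' n) * L + K * p (y n \<ominus> y' n)" .
  qed (use assms in auto)
qed

lemma convergent_p: assumes "x \<in> CS" shows "convergent (\<lambda>n. p (x n))"
  unfolding Cauchy_convergent_iff[symmetric]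
proof (rule CauchyI)
  fix e :: real assume "0 < e"
  then obtain N where N: "\<And>m n. m \<ge> N \<Longrightarrow> n \<ge> N \<Longrightarrow> p (x m \<ominus> x n) < e"
    using assms unfolding CS_iff by meson
  show "\<exists>M. \<forall>m\<ge>M. \<forall>n\<ge>M. norm (p (x m) - p (x n)) < e"
  proof (intro exI allI impI)
    fix m n assume "N \<le> m" "N \<le> n"
    then show "norm (p (x m) - p (x n)) < e"
      using N[of m n] p_abs_diff[of "x m" "x n"] assms by simp
  qed
qed

abbreviation C :: "(nat \<Rightarrow> 'a) set cstar_algebra" where "C \<equiv> completion A p"
abbreviation cl :: "(nat \<Rightarrow> 'a) \<Rightarrow> (nat \<Rightarrow> 'a) set" where "cl \<equiv> completion_class A p"

lemma mem_cl: "y \<in> cl x \<longleftrightarrow> y \<in> CS \<and> asymp x y"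
  by (simp add: completion_class_def)

lemma cl_self [simp]: "x \<in> CS \<Longrightarrow> x \<in> cl x"
  by (simp add: mem_cl)

lemma cl_eqI: assumes "x \<in> CS" "y \<in> CS" "asymp x y" shows "cl x = cl y"
  using asymp_trans[OF assms(1,2) _ assms(3)] asymp_trans[OF assms(2,1) _ asymp_sym[OF assms]]
  by (auto simp: mem_cl)

lemma cl_eq_iff: "x \<in> CS \<Longrightarrow> y \<in> CS \<Longrightarrow> cl x = cl y \<longleftrightarrow> asymp x y"
  by (metis cl_eqI cl_self mem_cl)

lemma carrier_C: "carrier C = cl ` CS"
  by (simp add: completion_def)

lemma cl_closed [simp]: "x \<in> CS \<Longrightarrow> cl x \<in> carrier C"
  by (simp add: carrier_C)

lemma C_cases: assumes "\<xi> \<in> carrier C" obtains x where "x \<in> CS" "\<xi> = cl x"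
  using assms by (auto simp: carrier_C)

lemma C_one: "\<one>\<^bsub>C\<^esub> = cl (\<lambda>_. \<one>)" and C_zero: "\<zero>\<^bsub>C\<^esub> = cl (\<lambda>_. \<zero>)"
  by (simp_all add: completion_def)

lemma mem_clD: assumes "a \<in> CS" "x \<in> cl a" shows "x \<in> CS" "asymp x a"
  using assms asymp_sym[of a x] by (auto simp: mem_cl)

text \<open>Removes the unions from the operations of \<open>completion\<close>: a class contains
  its representative, so a union of copies of one class over it is that class and not the empty
  set.\<close>

lemma UN_cl:
  assumes "a \<in> CS" "\<And>x. x \<in> cl a \<Longrightarrow> F x = c" shows "(\<Union>x\<in>cl a. F x) = c"
  using assms cl_self by blast

lemma C_mult: assumes "a \<in> CS" "b \<in> CS" shows "cl a \<otimes>\<^bsub>C\<^esub> cl b = cl (\<lambda>n. a n \<otimes> b n)"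
proof -
  have "cl a \<otimes>\<^bsub>C\<^esub> cl b = (\<Union>x\<in>cl a. \<Union>y\<in>cl b. cl (\<lambda>n. x n \<otimes> y n))"
    by (simp add: completion_def)
  also have "\<dots> = cl (\<lambda>n. a n \<otimes> b n)"
    by (intro UN_cl assms cl_eqI CS_mult asymp_mult; blast intro: assms mem_clD)
  finally show ?thesis .
qed

lemma C_add: assumes "a \<in> CS" "b \<in> CS" shows "cl a \<oplus>\<^bsub>C\<^esub> cl b = cl (\<lambda>n. a n \<oplus> b n)"
proof -
  have "cl a \<oplus>\<^bsub>C\<^esub> cl b = (\<Union>x\<in>cl a. \<Union>y\<in>cl b. cl (\<lambda>n. x n \<oplus> y n))"
    by (simp add: completion_def)
  also have "\<dots> = cl (\<lambda>n. a n \<oplus> b n)"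
    by (intro UN_cl assms cl_eqI CS_add asymp_add; blast intro: assms mem_clD)
  finally show ?thesis .
qed

lemma C_smult: assumes "a \<in> CS" shows "c \<odot>\<^bsub>C\<^esub> cl a = cl (\<lambda>n. c \<odot> a n)"
proof -
  have "c \<odot>\<^bsub>C\<^esub> cl a = (\<Union>x\<in>cl a. cl (\<lambda>n. c \<odot> x n))"
    by (simp add: completion_def)
  also have "\<dots> = cl (\<lambda>n. c \<odot> a n)"
    by (intro UN_cl assms cl_eqI CS_smult asymp_smult; blast intro: assms mem_clD)
  finally show ?thesis .
qed

lemma C_star: assumes "a \<in> CS" shows "star C (cl a) = cl (\<lambda>n. star A (a n))"
proof -
  have "star C (cl a) = (\<Union>x\<in>cl a. cl (\<lambda>n. star A (x n)))"
    by (simp add: completion_def)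
  also have "\<dots> = cl (\<lambda>n. star A (a n))"
    by (intro UN_cl assms cl_eqI CS_star asymp_star; blast intro: assms mem_clD)
  finally show ?thesis .
qed

text \<open>The seminorms of two representatives differ by at most the seminorm of their difference,
  so the limit is common to the whole class and the \<open>THE\<close> in the definition is
  determined.\<close>

lemma C_norm_eqI: assumes "a \<in> CS" "(\<lambda>n. p (a n)) \<longlonglongrightarrow> r" shows "cnorm C (cl a) = r"
proof -
  have "(\<lambda>n. p (x n)) \<longlonglongrightarrow> r" if "x \<in> cl a" for x
  proof -
    have "(\<lambda>n. p (x n) - p (a n)) \<longlonglongrightarrow> 0"
    proof (rule tendsto_rabs_zero_cancel, rule tendsto_0_le)
      show "asymp a x" using that by (simp add: mem_cl)
      show "\<bar>p (x n) - p (a n)\<bar> \<le> p (a n \<ominus> x n)" for n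
        using p_abs_diff[of "a n" "x n"] assms(1) that by (simp add: mem_cl abs_minus_commute)
    qed auto
    from tendsto_add[OF this assms(2)] show ?thesis by simp
  qed
  then have lim: "\<forall>x\<in>cl a. (\<lambda>n. p (x n)) \<longlonglongrightarrow> r" by blast
  have uniq: "r' = r" if "\<forall>x\<in>cl a. (\<lambda>n. p (x n)) \<longlonglongrightarrow> r'" for r'
    by (rule LIMSEQ_unique[OF bspec[OF that cl_self[OF assms(1)]] assms(2)])
  have "(THE r. \<forall>x\<in>cl a. (\<lambda>n. p (x n)) \<longlonglongrightarrow> r) = r"
    by (rule the_equality) (fact lim, rule uniq)
  then show ?thesis by (simp add: completion_def)
qed

lemma C_norm_lim: "a \<in> CS \<Longrightarrow> (\<lambda>n. p (a n)) \<longlonglongrightarrow> cnorm C (cl a)"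
  using C_norm_eqI convergent_p by (metis convergent_def)

lemma C_norm_const [simp]: "a \<in> carrier A \<Longrightarrow> cnorm C (cl (\<lambda>_. a)) = p a"
  by (simp add: C_norm_eqI)

lemmas CS_intros = CS_const CS_add CS_smult CS_star CS_mult
lemmas C_ops = C_one C_zero C_mult C_add C_smult C_star

lemma star_algebra_C: "star_algebra C"
proof -
  have grp: "abelian_group C"
  proof (rule abelian_groupI)
    fix \<xi> assume "\<xi> \<in> carrier C"
    then obtain x where x: "x \<in> CS" "\<xi> = cl x" by (rule C_cases)
    have "cl (\<lambda>n. (-1) \<odot> x n) \<oplus>\<^bsub>C\<^esub> \<xi> = \<zero>\<^bsub>C\<^esub>"
    proof -
      have "cl (\<lambda>n. (-1) \<odot> x n) \<oplus>\<^bsub>C\<^esub> \<xi> = cl (\<lambda>n. (-1) \<odot> x n \<oplus> x n)"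
        using x by (simp add: C_add CS_smult)
      also have "\<dots> = \<zero>\<^bsub>C\<^esub>" using x by (simp add: C_zero uminus_eq_smult[symmetric] l_neg)
      finally show ?thesis .
    qed
    then show "\<exists>\<eta>\<in>carrier C. \<eta> \<oplus>\<^bsub>C\<^esub> \<xi> = \<zero>\<^bsub>C\<^esub>"
      by (rule bexI) (use x in \<open>simp add: CS_smult\<close>)
  qed (auto elim!: C_cases simp: C_ops CS_intros a_assoc, auto simp: a_comm)
  interpret C: abelian_group C by fact
  have rng: "ring C"
  proof (rule ringI[OF grp])
    show "monoid C"
      by (rule monoidI) (auto elim!: C_cases simp: C_ops CS_intros m_assoc)
  qed (auto elim!: C_cases simp: C_ops CS_intros l_distr r_distr)
  have mod: "module (ring_of_type_algebra :: complex ring) C"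
    by (rule moduleI[OF cring_from_type_algebra grp])
       (auto elim!: C_cases simp: ring_of_type_algebra_def C_ops CS_intros smult_add_left smult_add_right)
  show ?thesis
  proof (rule star_algebra.intro[OF rng], rule star_algebra_axioms.intro[OF mod])
  qed (auto elim!: C_cases simp: C_ops CS_intros smult_mult_left smult_mult_right star_add star_smult
        star_mult)
qed

lemma C_minus: assumes "a \<in> CS" "b \<in> CS" shows "cl a \<ominus>\<^bsub>C\<^esub> cl b = cl (\<lambda>n. a n \<ominus> b n)"
proof -
  interpret C: star_algebra C by (rule star_algebra_C)
  show ?thesis
    using assms by (simp add: C.minus_eq_smult minus_eq_smult C_ops CS_intros)
qed

lemma CS_minus: "x \<in> CS \<Longrightarrow> y \<in> CS \<Longrightarrow> (\<lambda>n. x n \<ominus> y n) \<in> CS"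
  by (simp add: minus_eq_smult CS_intros)

lemma cstar_seminorm_C: "cstar_seminorm C (cnorm C)"
  unfolding cstar_seminorm_def
proof (intro conjI ballI allI)
  fix \<xi> c assume "\<xi> \<in> carrier C"
  then obtain x where x: "x \<in> CS" "\<xi> = cl x" by (rule C_cases)
  note lim = C_norm_lim[OF x(1)]
  show "0 \<le> cnorm C \<xi>"
    unfolding x by (rule LIMSEQ_le_const[OF lim]) (use x in auto)
  show "cnorm C (star C \<xi> \<otimes>\<^bsub>C\<^esub> \<xi>) = (cnorm C \<xi>)\<^sup>2"
    using x tendsto_power[OF lim, of 2] by (simp add: C_ops CS_intros C_norm_eqI p_cstar)
  show "cnorm C (c \<odot>\<^bsub>C\<^esub> \<xi>) = cmod c * cnorm C \<xi>"
    using x tendsto_mult_left[OF lim, of "cmod c"] by (simp add: C_ops CS_intros C_norm_eqI p_smult)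
next
  fix \<xi> \<eta> assume "\<xi> \<in> carrier C" "\<eta> \<in> carrier C"
  then obtain x y where x: "x \<in> CS" "\<xi> = cl x" and y: "y \<in> CS" "\<eta> = cl y" by (metis C_cases)
  note lim = C_norm_lim[OF x(1)] C_norm_lim[OF y(1)]
  show "cnorm C (\<xi> \<oplus>\<^bsub>C\<^esub> \<eta>) \<le> cnorm C \<xi> + cnorm C \<eta>"
    unfolding x y C_add[OF x(1) y(1)]
    by (rule LIMSEQ_le[OF C_norm_lim[OF CS_add] tendsto_add[OF lim]]) (use x y p_add in auto)
  show "cnorm C (\<xi> \<otimes>\<^bsub>C\<^esub> \<eta>) \<le> cnorm C \<xi> * cnorm C \<eta>"
    unfolding x y C_mult[OF x(1) y(1)]
    by (rule LIMSEQ_le[OF C_norm_lim[OF CS_mult] tendsto_mult[OF lim]]) (use x y p_mult in auto)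
qed

lemma C_norm_minus_le:
  assumes "x \<in> CS" "y \<in> CS" "\<And>n. n \<ge> N \<Longrightarrow> p (x n \<ominus> y n) \<le> e"
  shows "cnorm C (cl x \<ominus>\<^bsub>C\<^esub> cl y) \<le> e"
  unfolding C_minus[OF assms(1,2)]
  by (rule LIMSEQ_le_const2[OF C_norm_lim]) (use assms CS_minus in auto)

text \<open>Density of the base algebra: a late term of a Cauchy sequence is close to all subsequent
  ones.\<close>

lemma approx_const:
  assumes "x \<in> CS" "0 < e"
  obtains a where "a \<in> carrier A" "cnorm C (cl x \<ominus>\<^bsub>C\<^esub> cl (\<lambda>_. a)) \<le> e"
proof -
  obtain N where N: "\<And>m n. m \<ge> N \<Longrightarrow> n \<ge> N \<Longrightarrow> p (x m \<ominus> x n) < e"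
    using assms unfolding CS_iff by meson
  show ?thesis
  proof (rule that[of "x N"])
    show "cnorm C (cl x \<ominus>\<^bsub>C\<^esub> cl (\<lambda>_. x N)) \<le> e"
      by (rule C_norm_minus_le[of _ _ N]) (use assms N in \<open>auto intro: less_imp_le\<close>)
  qed (use assms in simp)
qed

lemma cl_const_tendsto:
  assumes "x \<in> CS" shows "(\<lambda>n. cnorm C (cl (\<lambda>_. x n) \<ominus>\<^bsub>C\<^esub> cl x)) \<longlonglongrightarrow> 0"
proof (rule LIMSEQ_I)
  fix e :: real assume e: "0 < e"
  then obtain N where N: "\<And>m n. m \<ge> N \<Longrightarrow> n \<ge> N \<Longrightarrow> p (x m \<ominus> x n) < e / 2"
    using assms unfolding CS_iff by (meson half_gt_zero)
  interpret C: cstar_seminormed C "cnorm C"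
    by (intro cstar_seminormed.intro star_algebra_C cstar_seminormed_axioms.intro cstar_seminorm_C)
  have "cnorm C (cl (\<lambda>_. x n) \<ominus>\<^bsub>C\<^esub> cl x) < e" if "n \<ge> N" for n
  proof -
    have "cnorm C (cl (\<lambda>_. x n) \<ominus>\<^bsub>C\<^esub> cl x) \<le> e / 2"
      by (rule C_norm_minus_le[of _ _ N]) (use assms N that in \<open>auto intro: less_imp_le\<close>)
    with e show ?thesis by simp
  qed
  then show "\<exists>no. \<forall>n\<ge>no. norm (cnorm C (cl (\<lambda>_. x n) \<ominus>\<^bsub>C\<^esub> cl x) - 0) < e"
    using assms by auto
qed

lemma cstar_algebra_C: "cstar_algebra C"
proof (rule cstar_algebra.intro[OF star_algebra_C], rule cstar_algebra_axioms.intro)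
  interpret C: cstar_seminormed C "cnorm C"
    by (intro cstar_seminormed.intro star_algebra_C cstar_seminormed_axioms.intro cstar_seminorm_C)
  show "cstar_seminorm C (cnorm C)" by (rule cstar_seminorm_C)
  show "\<xi> = \<zero>\<^bsub>C\<^esub>" if \<xi>: "\<xi> \<in> carrier C" "cnorm C \<xi> = 0" for \<xi>
  proof -
    obtain x where x: "x \<in> CS" "\<xi> = cl x" using \<xi>(1) by (rule C_cases)
    have "(\<lambda>n. p (x n)) \<longlonglongrightarrow> 0" using C_norm_lim[OF x(1)] \<xi> x by simp
    then show ?thesis unfolding x C_zero using x by (intro cl_eqI) (auto simp: minus_eq)
  qed
  show "\<exists>a\<in>carrier C. (\<lambda>n. cnorm C (s n \<ominus>\<^bsub>C\<^esub> a)) \<longlonglongrightarrow> 0"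
    if s: "s \<in> cauchy_seqs C (cnorm C)" for s
  proof -
    have s_carrier [simp]: "s n \<in> carrier C" for n using s by (auto simp: cauchy_seqs_def)
    \<comment> \<open>Diagonal argument: each \<open>s n\<close> is approximated within
      \<open>1 / (n + 1)\<close> by an element \<open>y n\<close> of the base algebra. The sequence
      \<open>y\<close> is again Cauchy, and its class is the limit of \<open>s\<close>.\<close>
    have "\<exists>a. a \<in> carrier A \<and> cnorm C (s n \<ominus>\<^bsub>C\<^esub> cl (\<lambda>_. a)) \<le> 1 / real (Suc n)" for n
      using C_cases[OF s_carrier] approx_const
      by (metis of_nat_0_less_iff zero_less_Suc zero_less_divide_1_iff)
    then obtain y where y [simp]: "\<And>n. y n \<in> carrier A"
      and sy: "\<And>n. cnorm C (s n \<ominus>\<^bsub>C\<^esub> cl (\<lambda>_. y n)) \<le> 1 / real (Suc n)"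
      by metis
    have sy0: "(\<lambda>n. cnorm C (s n \<ominus>\<^bsub>C\<^esub> cl (\<lambda>_. y n))) \<longlonglongrightarrow> 0"
      by (rule tendsto_0_le[OF LIMSEQ_inverse_real_of_nat])
         (use sy in \<open>auto simp: inverse_eq_divide\<close>)
    have yC: "y \<in> CS"
      unfolding CS_iff
    proof (intro conjI allI impI)
      fix e :: real assume e: "0 < e"
      obtain M where M: "\<And>m n. m \<ge> M \<Longrightarrow> n \<ge> M \<Longrightarrow> cnorm C (s m \<ominus>\<^bsub>C\<^esub> s n) < e / 3"
        using s e unfolding cauchy_seqs_def mem_Collect_eq by (metis divide_pos_pos zero_less_numeral)
      obtain N where N: "\<And>n. n \<ge> N \<Longrightarrow> cnorm C (s n \<ominus>\<^bsub>C\<^esub> cl (\<lambda>_. y n)) < e / 3"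
        using LIMSEQ_D[OF sy0, of "e / 3"] e by auto
      have "p (y m \<ominus> y n) < e" if "m \<ge> max M N" "n \<ge> max M N" for m n
      proof -
        have "p (y m \<ominus> y n) = cnorm C (cl (\<lambda>_. y m) \<ominus>\<^bsub>C\<^esub> cl (\<lambda>_. y n))"
          by (simp add: C_minus)
        also have "\<dots> \<le> cnorm C (cl (\<lambda>_. y m) \<ominus>\<^bsub>C\<^esub> s m) + cnorm C (s m \<ominus>\<^bsub>C\<^esub> cl (\<lambda>_. y n))"
          by (rule C.p_triangle) auto
        also have "cnorm C (s m \<ominus>\<^bsub>C\<^esub> cl (\<lambda>_. y n)) \<le>
            cnorm C (s m \<ominus>\<^bsub>C\<^esub> s n) + cnorm C (s n \<ominus>\<^bsub>C\<^esub> cl (\<lambda>_. y n))"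
          by (rule C.p_triangle) auto
        also have "cnorm C (cl (\<lambda>_. y m) \<ominus>\<^bsub>C\<^esub> s m) = cnorm C (s m \<ominus>\<^bsub>C\<^esub> cl (\<lambda>_. y m))"
          by (rule C.p_minus_commute) auto
        finally show ?thesis using M[of m n] N[of m] N[of n] that by simp
      qed
      then show "\<exists>N. \<forall>m\<ge>N. \<forall>n\<ge>N. p (y m \<ominus> y n) < e" by blast
    qed simp
    have "(\<lambda>n. cnorm C (s n \<ominus>\<^bsub>C\<^esub> cl y)) \<longlonglongrightarrow> 0"
      by (rule tendsto_0_le[OF tendsto_add_zero[OF sy0 cl_const_tendsto[OF yC]]])
         (use yC in \<open>auto intro: C.p_triangle\<close>)
    with yC show ?thesis by auto
  qed
qed

end

section \<open>Limits in C*-algebras\<close>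

context cstar_algebra
begin

abbreviation converges :: "(nat \<Rightarrow> 'a) \<Rightarrow> 'a \<Rightarrow> bool" where
  "converges s a \<equiv> (\<lambda>n. cnorm A (s n \<ominus> a)) \<longlonglongrightarrow> 0"

lemma converges_unique:
  assumes "\<And>n. s n \<in> carrier A" "a \<in> carrier A" "b \<in> carrier A" "converges s a" "converges s b"
  shows "a = b"
proof -
  have "(\<lambda>n. cnorm A (a \<ominus> b)) \<longlonglongrightarrow> 0"
    by (rule tendsto_0_le[OF tendsto_add_zero[OF assms(4,5)]])
       (use assms p_triangle[OF assms(2,1,3)] p_minus_commute[OF assms(2,1)] in auto)
  then have "cnorm A (a \<ominus> b) = 0" by (simp add: LIMSEQ_const_iff)
  then show ?thesis using assms cnorm_eq_0[of "a \<ominus> b"] minus_eq_0_iff by simp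
qed

lemma converges_add:
  assumes "\<And>n. s n \<in> carrier A" "\<And>n. t n \<in> carrier A" "a \<in> carrier A" "b \<in> carrier A"
    "converges s a" "converges t b"
  shows "converges (\<lambda>n. s n \<oplus> t n) (a \<oplus> b)"
  by (rule tendsto_0_le[OF tendsto_add_zero[OF assms(5,6)]]) (use assms p_add_diff in auto)

lemma converges_smult:
  assumes "\<And>n. s n \<in> carrier A" "a \<in> carrier A" "converges s a"
  shows "converges (\<lambda>n. c \<odot> s n) (c \<odot> a)"
  using tendsto_mult_right_zero[OF assms(3), of "cmod c"] assms
  by (simp add: smult_minus_right[symmetric] p_smult)

lemma converges_star:
  assumes "\<And>n. s n \<in> carrier A" "a \<in> carrier A" "converges s a"
  shows "converges (\<lambda>n. star A (s n)) (star A a)"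
  using assms by (simp add: star_minus[symmetric] p_star)

lemma converges_mult:
  assumes "\<And>n. s n \<in> carrier A" "\<And>n. t n \<in> carrier A" "a \<in> carrier A" "b \<in> carrier A"
    "converges s a" "converges t b"
  shows "converges (\<lambda>n. s n \<otimes> t n) (a \<otimes> b)"
proof -
  have "\<bar>cnorm A (t n) - cnorm A b\<bar> \<le> cnorm A (t n \<ominus> b)" for n
    using p_abs_diff assms by blast
  then have "(\<lambda>n. cnorm A (t n) - cnorm A b) \<longlonglongrightarrow> 0"
    by (intro tendsto_rabs_zero_cancel[OF tendsto_0_le[OF assms(6)]]) auto
  then have "(\<lambda>n. cnorm A (t n)) \<longlonglongrightarrow> cnorm A b" by (simp add: LIM_zero_iff)
  then have "(\<lambda>n. cnorm A (s n \<ominus> a) * cnorm A (t n) + cnorm A a * cnorm A (t n \<ominus> b))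
      \<longlonglongrightarrow> 0 * cnorm A b + cnorm A a * 0"
    by (intro tendsto_intros assms)
  then have "(\<lambda>n. cnorm A (s n \<ominus> a) * cnorm A (t n) + cnorm A a * cnorm A (t n \<ominus> b)) \<longlonglongrightarrow> 0"
    by simp
  then show ?thesis by (rule tendsto_0_le) (use assms p_mult_diff in auto)
qed

end

section \<open>Extension of homomorphisms to the completion\<close>

context cstar_seminormed
begin

text \<open>The bound by \<open>p\<close> carries Cauchy sequences to Cauchy sequences and null
  sequences to null sequences, so the limit belongs to the class and not to the
  representative.\<close>

lemma contractive_converges:
  fixes B :: "('b, 'n) cstar_algebra_scheme"
  assumes B: "cstar_algebra B" and h: "h \<in> star_hom A B"
    and le: "\<And>x. x \<in> carrier A \<Longrightarrow> cnorm B (h x) \<le> p x" and x: "x \<in> CS"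
  shows "\<exists>b\<in>carrier B. \<forall>y\<in>cl x. (\<lambda>n. cnorm B (h (y n) \<ominus>\<^bsub>B\<^esub> b)) \<longlonglongrightarrow> 0"
proof -
  interpret B: cstar_algebra B by fact
  interpret h: star_homomorphism A B h by unfold_locales fact
  have le': "cnorm B (h a \<ominus>\<^bsub>B\<^esub> h b) \<le> p (a \<ominus> b)" if "a \<in> carrier A" "b \<in> carrier A" for a b
    using le[of "a \<ominus> b"] that by (simp add: h.hom_minus)
  have "(\<lambda>n. h (x n)) \<in> cauchy_seqs B (cnorm B)"
    unfolding B.CS_iff
  proof (intro conjI allI impI)
    fix e :: real assume "0 < e"
    then obtain N where N: "\<And>m n. m \<ge> N \<Longrightarrow> n \<ge> N \<Longrightarrow> p (x m \<ominus> x n) < e"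
      using x unfolding CS_iff by meson
    show "\<exists>N. \<forall>m\<ge>N. \<forall>n\<ge>N. cnorm B (h (x m) \<ominus>\<^bsub>B\<^esub> h (x n)) < e"
      using N x by (intro exI[of _ N] allI impI le_less_trans[OF le']) auto
  qed (use x in simp)
  then obtain b where b: "b \<in> carrier B" "(\<lambda>n. cnorm B (h (x n) \<ominus>\<^bsub>B\<^esub> b)) \<longlonglongrightarrow> 0"
    using B.complete by blast
  have "(\<lambda>n. cnorm B (h (y n) \<ominus>\<^bsub>B\<^esub> b)) \<longlonglongrightarrow> 0" if "y \<in> cl x" for y
  proof -
    have yC: "y \<in> CS" and "asymp y x" using mem_clD[OF x that] by auto
    then have "(\<lambda>n. p (y n \<ominus> x n) + cnorm B (h (x n) \<ominus>\<^bsub>B\<^esub> b)) \<longlonglongrightarrow> 0"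
      using b by (intro tendsto_add_zero)
    then show ?thesis
    proof (rule tendsto_0_le)
      fix n
      show "cnorm B (h (y n) \<ominus>\<^bsub>B\<^esub> b) \<le> p (y n \<ominus> x n) + cnorm B (h (x n) \<ominus>\<^bsub>B\<^esub> b)"
        using B.p_triangle[of "h (y n)" "h (x n)" b] le'[of "y n" "x n"] x yC b(1) by simp
    qed (use x yC b in auto)
  qed
  with b show ?thesis by blast
qed

theorem extend_to_completion:
  fixes B :: "('b, 'n) cstar_algebra_scheme"
  assumes B: "cstar_algebra B" and h: "h \<in> star_hom A B"
    and le: "\<And>x. x \<in> carrier A \<Longrightarrow> cnorm B (h x) \<le> p x"
  shows "\<exists>H\<in>star_hom C B. (\<forall>a\<in>carrier A. H (cl (\<lambda>_. a)) = h a) \<and>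
           (\<forall>\<xi>\<in>carrier C. cnorm B (H \<xi>) \<le> cnorm C \<xi>)"
proof -
  interpret B: cstar_algebra B by fact
  interpret h: star_homomorphism A B h by unfold_locales fact
  \<comment> \<open>The common limit along all representatives; choosing it from the class itself
    makes \<open>H\<close> a function on the completion.\<close>
  define H where "H \<xi> = (SOME b. b \<in> carrier B \<and> (\<forall>y\<in>\<xi>. B.converges (\<lambda>n. h (y n)) b))" for \<xi>
  have H: "H (cl x) \<in> carrier B \<and> (\<forall>y\<in>cl x. B.converges (\<lambda>n. h (y n)) (H (cl x)))"
    if "x \<in> CS" for x
    using contractive_converges[OF B h le that] unfolding H_def Bex_def by (rule someI_ex)
  have Hc [simp]: "H (cl x) \<in> carrier B" if "x \<in> CS" for x using H that by blast
  have Hl: "B.converges (\<lambda>n. h (x n)) (H (cl x))" if "x \<in> CS" for x using H that by auto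
  \<comment> \<open>Uniqueness of limits: each homomorphism law for \<open>H\<close> reduces to the
    corresponding law for convergent sequences.\<close>
  have Hx: "H (cl x) = b" if "x \<in> CS" "b \<in> carrier B" "B.converges (\<lambda>n. h (x n)) b" for x b
    by (rule B.converges_unique[OF _ _ _ Hl]) (use that in auto)
  have Hconst: "H (cl (\<lambda>_. a)) = h a" if "a \<in> carrier A" for a
    by (rule Hx) (use that in auto)
  have "H \<in> star_hom C B"
  proof (rule star_homI)
    show "H \<one>\<^bsub>C\<^esub> = \<one>\<^bsub>B\<^esub>" by (simp add: C_one Hconst h.hom_one)
  next
    fix \<xi> \<eta> assume "\<xi> \<in> carrier C" "\<eta> \<in> carrier C"
    then obtain x y where x: "x \<in> CS" "\<xi> = cl x" and y: "y \<in> CS" "\<eta> = cl y" by (metis C_cases)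
    show "H (\<xi> \<otimes>\<^bsub>C\<^esub> \<eta>) = H \<xi> \<otimes>\<^bsub>B\<^esub> H \<eta>"
      unfolding x y C_mult[OF x(1) y(1)]
      by (rule Hx) (use x y B.converges_mult[OF _ _ _ _ Hl[OF x(1)] Hl[OF y(1)]] in
          \<open>auto simp: CS_mult h.hom_mult\<close>)
    show "H (\<xi> \<oplus>\<^bsub>C\<^esub> \<eta>) = H \<xi> \<oplus>\<^bsub>B\<^esub> H \<eta>"
      unfolding x y C_add[OF x(1) y(1)]
      by (rule Hx) (use x y B.converges_add[OF _ _ _ _ Hl[OF x(1)] Hl[OF y(1)]] in
          \<open>auto simp: CS_add h.hom_add\<close>)
  next
    fix \<xi> c assume "\<xi> \<in> carrier C"
    then obtain x where x: "x \<in> CS" "\<xi> = cl x" by (metis C_cases)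
    show "H (c \<odot>\<^bsub>C\<^esub> \<xi>) = c \<odot>\<^bsub>B\<^esub> H \<xi>"
      unfolding x C_smult[OF x(1)]
      by (rule Hx) (use x B.converges_smult[OF _ _ Hl[OF x(1)]] in
          \<open>auto simp: CS_smult h.hom_smult\<close>)
    show "H (star C \<xi>) = star B (H \<xi>)"
      unfolding x C_star[OF x(1)]
      by (rule Hx) (use x B.converges_star[OF _ _ Hl[OF x(1)]] in
          \<open>auto simp: CS_star h.hom_star\<close>)
  qed (auto elim: C_cases)
  moreover have "cnorm B (H \<xi>) \<le> cnorm C \<xi>" if "\<xi> \<in> carrier C" for \<xi>
  proof -
    obtain x where x: "x \<in> CS" "\<xi> = cl x" using \<open>\<xi> \<in> carrier C\<close> by (metis C_cases)
    \<comment> \<open>The norm of \<open>H \<xi>\<close> is at most the norm of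
      \<open>h (x n)\<close> plus the distance to it; the first part is bounded by
      \<open>p (x n)\<close>, the second tends to 0.\<close>
    have "(\<lambda>n. p (x n) + cnorm B (h (x n) \<ominus>\<^bsub>B\<^esub> H \<xi>)) \<longlonglongrightarrow> cnorm C \<xi> + 0"
      unfolding x by (intro tendsto_add C_norm_lim Hl x)
    moreover have "cnorm B (H \<xi>) \<le> p (x n) + cnorm B (h (x n) \<ominus>\<^bsub>B\<^esub> H \<xi>)" for n
      using B.p_le_minus[of "H \<xi>" "h (x n)"] B.p_minus_commute[of "H \<xi>" "h (x n)"] le[of "x n"] x
      by simp
    ultimately show ?thesis by (intro LIMSEQ_le_const) auto
  qed
  ultimately show ?thesis using Hconst by blast
qed

end

section \<open>Monoid star algebras\<close>

text \<open>Used twice: for words with reversal, which gives the free *-algebra, and for pairs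
  \<open>(a, b)\<close> with the componentwise product and star, which gives the formal
  tensors.\<close>

locale star_monoid = monoid M for M :: "('m, 'x) monoid_scheme" (structure) +
  fixes s :: "'m \<Rightarrow> 'm"
  assumes s_closed [simp]: "m \<in> carrier M \<Longrightarrow> s m \<in> carrier M"
    and s_s [simp]: "m \<in> carrier M \<Longrightarrow> s (s m) = m"
    and s_mult: "m \<in> carrier M \<Longrightarrow> k \<in> carrier M \<Longrightarrow> s (m \<otimes> k) = s k \<otimes> s m"
begin

abbreviation T :: "('m \<Rightarrow> complex) star_algebra" where "T \<equiv> monoid_star_algebra M s"
abbreviation supp :: "('m \<Rightarrow> complex) \<Rightarrow> 'm set" where "supp f \<equiv> {m. f m \<noteq> 0}"

lemma T_iff: "f \<in> carrier T \<longleftrightarrow> finite (supp f) \<and> supp f \<subseteq> carrier M"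
  by (simp add: monoid_star_algebra_def)

lemma T_add: "f \<oplus>\<^bsub>T\<^esub> g = (\<lambda>m. f m + g m)"
  and T_zero: "\<zero>\<^bsub>T\<^esub> = (\<lambda>_. 0)"
  and T_one: "\<one>\<^bsub>T\<^esub> = mon \<one>"
  and T_smult: "c \<odot>\<^bsub>T\<^esub> f = (\<lambda>m. c * f m)"
  and T_star: "star T f = (\<lambda>m. if m \<in> carrier M then cnj (f (s m)) else 0)"
  by (simp_all add: monoid_star_algebra_def)

lemma supp_mon [simp]: "supp (mon a) = {a}"
  by (auto simp: mon_def)

lemma mon_closed [simp]: "a \<in> carrier M \<Longrightarrow> mon a \<in> carrier T"
  by (simp add: T_iff)

text \<open>The definition sums over exact supports, which shrink under addition and scaling. Over
  fixed finite supersets the product is visibly bilinear.\<close>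

lemma T_mult:
  assumes "finite U" "finite W" "supp f \<subseteq> U" "supp g \<subseteq> W"
  shows "f \<otimes>\<^bsub>T\<^esub> g = (\<lambda>m. \<Sum>a\<in>U. \<Sum>b\<in>W. if a \<otimes> b = m then f a * g b else 0)"
proof
  fix m
  have "(f \<otimes>\<^bsub>T\<^esub> g) m = (\<Sum>(a, b) \<in> {(a, b). f a \<noteq> 0 \<and> g b \<noteq> 0 \<and> a \<otimes> b = m}. f a * g b)"
    by (simp add: monoid_star_algebra_def)
  also have "\<dots> = (\<Sum>(a, b)\<in>U \<times> W. if a \<otimes> b = m then f a * g b else 0)"
    by (rule sum.mono_neutral_cong_left) (use assms in \<open>auto split: if_splits\<close>)
  finally show "(f \<otimes>\<^bsub>T\<^esub> g) m = (\<Sum>a\<in>U. \<Sum>b\<in>W. if a \<otimes> b = m then f a * g b else 0)"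
    by (simp add: sum.cartesian_product)
qed

lemma T_mult_closed: assumes "f \<in> carrier T" "g \<in> carrier T" shows "f \<otimes>\<^bsub>T\<^esub> g \<in> carrier T"
proof -
  have "supp (f \<otimes>\<^bsub>T\<^esub> g) \<subseteq> (\<lambda>(a, b). a \<otimes> b) ` (supp f \<times> supp g)"
  proof
    fix m assume "m \<in> supp (f \<otimes>\<^bsub>T\<^esub> g)"
    then have "(\<Sum>a\<in>supp f. \<Sum>b\<in>supp g. if a \<otimes> b = m then f a * g b else 0) \<noteq> 0"
      using T_mult[of "supp f" "supp g" f g] assms by (simp add: T_iff)
    then obtain a where a: "a \<in> supp f" "(\<Sum>b\<in>supp g. if a \<otimes> b = m then f a * g b else 0) \<noteq> 0"
      by (rule sum.not_neutral_contains_not_neutral)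
    from a(2) obtain b where "b \<in> supp g" "(if a \<otimes> b = m then f a * g b else 0) \<noteq> 0"
      by (rule sum.not_neutral_contains_not_neutral)
    with a show "m \<in> (\<lambda>(a, b). a \<otimes> b) ` (supp f \<times> supp g)"
      by (intro image_eqI[of _ _ "(a, b)"]) (auto split: if_splits)
  qed
  moreover have "finite ((\<lambda>(a, b). a \<otimes> b) ` (supp f \<times> supp g))" using assms by (simp add: T_iff)
  moreover have "(\<lambda>(a, b). a \<otimes> b) ` (supp f \<times> supp g) \<subseteq> carrier M" using assms by (auto simp: T_iff subset_iff)
  ultimately show ?thesis unfolding T_iff by (meson finite_subset subset_trans)
qed

lemma T_add_closed: assumes "f \<in> carrier T" "g \<in> carrier T" shows "f \<oplus>\<^bsub>T\<^esub> g \<in> carrier T"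
proof -
  have "supp (f \<oplus>\<^bsub>T\<^esub> g) \<subseteq> supp f \<union> supp g" by (auto simp: T_add)
  then show ?thesis using assms finite_subset[of _ "supp f \<union> supp g"] unfolding T_iff by auto
qed

lemma T_smult_closed: "f \<in> carrier T \<Longrightarrow> c \<odot>\<^bsub>T\<^esub> f \<in> carrier T"
  by (auto simp: T_iff T_smult elim: finite_subset[rotated])

lemma T_zero_closed: "\<zero>\<^bsub>T\<^esub> \<in> carrier T"
  by (simp add: T_iff T_zero)

lemma T_star_closed: assumes "f \<in> carrier T" shows "star T f \<in> carrier T"
proof -
  have "supp (star T f) \<subseteq> s ` supp f" by (auto simp: T_star) (metis (mono_tags, lifting) image_eqI mem_Collect_eq s_s)
  then show ?thesis
    using assms unfolding T_iff by (auto intro: finite_subset simp: T_star split: if_splits)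
qed

lemmas T_closed = T_mult_closed T_add_closed T_smult_closed T_zero_closed T_star_closed

lemma T_mult_add_left:
  assumes "f \<in> carrier T" "f' \<in> carrier T" "g \<in> carrier T"
  shows "(f \<oplus>\<^bsub>T\<^esub> f') \<otimes>\<^bsub>T\<^esub> g = f \<otimes>\<^bsub>T\<^esub> g \<oplus>\<^bsub>T\<^esub> f' \<otimes>\<^bsub>T\<^esub> g"
proof -
  let ?U = "supp f \<union> supp f'"
  have "supp (f \<oplus>\<^bsub>T\<^esub> f') \<subseteq> ?U" by (auto simp: T_add)
  then show ?thesis
    using assms
    by (simp add: T_iff T_mult[of ?U "supp g"] sup.coboundedI1)
       (auto simp: T_add fun_eq_iff simp flip: sum.distrib intro!: sum.cong simp: distrib_right)
qed

lemma T_mult_add_right: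
  assumes "f \<in> carrier T" "f' \<in> carrier T" "g \<in> carrier T"
  shows "g \<otimes>\<^bsub>T\<^esub> (f \<oplus>\<^bsub>T\<^esub> f') = g \<otimes>\<^bsub>T\<^esub> f \<oplus>\<^bsub>T\<^esub> g \<otimes>\<^bsub>T\<^esub> f'"
proof -
  let ?U = "supp f \<union> supp f'"
  have "supp (f \<oplus>\<^bsub>T\<^esub> f') \<subseteq> ?U" by (auto simp: T_add)
  then show ?thesis
    using assms
    by (simp add: T_iff T_mult[of "supp g" ?U] sup.coboundedI1)
       (auto simp: T_add fun_eq_iff simp flip: sum.distrib intro!: sum.cong simp: distrib_left)
qed

lemma T_mult_smult_left:
  assumes "f \<in> carrier T" "g \<in> carrier T"
  shows "(c \<odot>\<^bsub>T\<^esub> f) \<otimes>\<^bsub>T\<^esub> g = c \<odot>\<^bsub>T\<^esub> (f \<otimes>\<^bsub>T\<^esub> g)"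
proof -
  have "supp (c \<odot>\<^bsub>T\<^esub> f) \<subseteq> supp f" by (auto simp: T_smult)
  then show ?thesis
    using assms
    by (simp add: T_iff T_mult[of "supp f" "supp g"])
       (auto simp: T_smult fun_eq_iff sum_distrib_left intro!: sum.cong)
qed

lemma T_mult_smult_right:
  assumes "f \<in> carrier T" "g \<in> carrier T"
  shows "f \<otimes>\<^bsub>T\<^esub> (c \<odot>\<^bsub>T\<^esub> g) = c \<odot>\<^bsub>T\<^esub> (f \<otimes>\<^bsub>T\<^esub> g)"
proof -
  have "supp (c \<odot>\<^bsub>T\<^esub> g) \<subseteq> supp g" by (auto simp: T_smult)
  then show ?thesis
    using assms
    by (simp add: T_iff T_mult[of "supp f" "supp g"])
       (auto simp: T_smult fun_eq_iff sum_distrib_left intro!: sum.cong)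
qed

lemma T_mult_zero: "f \<in> carrier T \<Longrightarrow> \<zero>\<^bsub>T\<^esub> \<otimes>\<^bsub>T\<^esub> f = \<zero>\<^bsub>T\<^esub>" "f \<in> carrier T \<Longrightarrow> f \<otimes>\<^bsub>T\<^esub> \<zero>\<^bsub>T\<^esub> = \<zero>\<^bsub>T\<^esub>"
  by (simp_all add: T_iff T_zero T_mult[of "supp f" "{}"] T_mult[of "{}" "supp f"])

lemma mon_mult: "mon a \<otimes>\<^bsub>T\<^esub> mon b = mon (a \<otimes> b)"
proof -
  have "supp (mon a) \<subseteq> {a}" "supp (mon b) \<subseteq> {b}" by simp_all
  then have "mon a \<otimes>\<^bsub>T\<^esub> mon b =
      (\<lambda>m. \<Sum>a'\<in>{a}. \<Sum>b'\<in>{b}. if a' \<otimes> b' = m then mon a a' * mon b b' else 0)"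
    by (intro T_mult) auto
  then show ?thesis by (auto simp: mon_def fun_eq_iff)
qed

text \<open>Adding one basis element at a time reduces identities that are linear in
  \<open>f\<close> to elements of the monoid; associativity, the rule for the star of a product and
  the multiplicativity of \<open>ext\<close> are all obtained in this way.\<close>

lemma T_induct [consumes 1, case_names zero add]:
  assumes "f \<in> carrier T" "P \<zero>\<^bsub>T\<^esub>"
    and "\<And>f c a. f \<in> carrier T \<Longrightarrow> a \<in> carrier M \<Longrightarrow> f a = 0 \<Longrightarrow> P f \<Longrightarrow> P (f \<oplus>\<^bsub>T\<^esub> c \<odot>\<^bsub>T\<^esub> mon a)"
  shows "P f"
proof -
  have "P g" if "finite U" "supp g = U" "U \<subseteq> carrier M" for g U
    using that
  proof (induction U arbitrary: g rule: finite_induct)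
    case empty
    then have "g = \<zero>\<^bsub>T\<^esub>" by (auto simp: T_zero)
    then show ?case using assms(2) by simp
  next
    case (insert a U)
    define f where "f = g(a := 0)"
    have f: "supp f = U" using insert by (auto simp: f_def)
    have "g = f \<oplus>\<^bsub>T\<^esub> g a \<odot>\<^bsub>T\<^esub> mon a" by (auto simp: f_def T_add T_smult mon_def fun_eq_iff)
    moreover have "P (f \<oplus>\<^bsub>T\<^esub> g a \<odot>\<^bsub>T\<^esub> mon a)"
    proof (rule assms(3))
      show "f \<in> carrier T" using insert f by (simp add: T_iff)
      show "f a = 0" by (simp add: f_def)
      show "P f" using insert f by blast
    qed (use insert in auto)
    ultimately show ?case by simp
  qed
  then show ?thesis using assms(1) by (auto simp: T_iff)
qed

lemma T_star_add: "star T (f \<oplus>\<^bsub>T\<^esub> g) = star T f \<oplus>\<^bsub>T\<^esub> star T g"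
  by (auto simp: T_star T_add)

lemma T_star_smult: "star T (c \<odot>\<^bsub>T\<^esub> f) = cnj c \<odot>\<^bsub>T\<^esub> star T f"
  by (auto simp: T_star T_smult)

lemma T_star_mon: "a \<in> carrier M \<Longrightarrow> star T (mon a) = mon (s a)"
  by (auto simp: T_star mon_def fun_eq_iff)

lemmas T_lin = T_mult_add_left T_mult_add_right T_mult_smult_left T_mult_smult_right T_mult_zero
  T_star_add T_star_smult T_closed

text \<open>Both sides are trilinear, so associativity of the monoid is enough; there is one
  induction per argument, starting with the last one.\<close>

lemma T_assoc:
  assumes "f \<in> carrier T" "g \<in> carrier T" "h \<in> carrier T"
  shows "(f \<otimes>\<^bsub>T\<^esub> g) \<otimes>\<^bsub>T\<^esub> h = f \<otimes>\<^bsub>T\<^esub> (g \<otimes>\<^bsub>T\<^esub> h)"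
proof -
  have 1: "(mon a \<otimes>\<^bsub>T\<^esub> mon b) \<otimes>\<^bsub>T\<^esub> h = mon a \<otimes>\<^bsub>T\<^esub> (mon b \<otimes>\<^bsub>T\<^esub> h)"
    if "a \<in> carrier M" "b \<in> carrier M" for a b
    using assms(3) that
    by (induction h rule: T_induct) (simp_all add: T_lin, simp add: mon_mult m_assoc)
  have 2: "(mon a \<otimes>\<^bsub>T\<^esub> g) \<otimes>\<^bsub>T\<^esub> h = mon a \<otimes>\<^bsub>T\<^esub> (g \<otimes>\<^bsub>T\<^esub> h)"
    if "a \<in> carrier M" for a
    using assms(2) that assms(3)
    by (induction g rule: T_induct) (simp_all add: T_lin 1)
  show ?thesis
    using assms by (induction f rule: T_induct) (simp_all add: T_lin 2)
qed

lemma T_star_mult: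
  assumes "f \<in> carrier T" "g \<in> carrier T"
  shows "star T (f \<otimes>\<^bsub>T\<^esub> g) = star T g \<otimes>\<^bsub>T\<^esub> star T f"
proof -
  have z: "star T \<zero>\<^bsub>T\<^esub> = \<zero>\<^bsub>T\<^esub>" by (simp add: T_star T_zero fun_eq_iff)
  have 1: "star T (mon a \<otimes>\<^bsub>T\<^esub> g) = star T g \<otimes>\<^bsub>T\<^esub> star T (mon a)" if "a \<in> carrier M" for a
    using assms(2) that
    by (induction g rule: T_induct) (simp_all add: T_lin z, simp add: mon_mult T_star_mon s_mult)
  show ?thesis
    using assms by (induction f rule: T_induct) (simp_all add: T_lin z 1)
qed

lemma T_one_mult: assumes "f \<in> carrier T" shows "\<one>\<^bsub>T\<^esub> \<otimes>\<^bsub>T\<^esub> f = f" "f \<otimes>\<^bsub>T\<^esub> \<one>\<^bsub>T\<^esub> = f"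
  unfolding T_one using assms
  by (induction f rule: T_induct) (simp_all add: T_lin, simp_all add: mon_mult)

lemma star_algebra_T: "star_algebra T"
proof -
  have grp: "abelian_group T"
  proof (rule abelian_groupI)
    show "\<exists>g\<in>carrier T. g \<oplus>\<^bsub>T\<^esub> f = \<zero>\<^bsub>T\<^esub>" if "f \<in> carrier T" for f
      by (rule bexI[of _ "(- 1) \<odot>\<^bsub>T\<^esub> f"]) (use that in \<open>auto simp: T_closed, simp add: T_smult T_add T_zero\<close>)
  qed (simp_all add: T_closed, simp_all add: T_add T_zero add_ac)
  have rng: "ring T"
  proof (rule ringI[OF grp])
    show "monoid T"
      by (rule monoidI) (simp_all add: T_closed T_assoc T_one_mult, simp add: T_one)
  qed (simp_all add: T_lin)
  have mod: "module (ring_of_type_algebra :: complex ring) T"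
    by (rule moduleI[OF cring_from_type_algebra grp])
       (simp_all add: ring_of_type_algebra_def T_closed, simp_all add: T_add T_smult algebra_simps)
  have "star T (star T f) = f" if "f \<in> carrier T" for f
    using that by (auto simp: T_star fun_eq_iff T_iff)
  then show ?thesis
    by (intro star_algebra.intro[OF rng] star_algebra_axioms.intro[OF mod])
       (simp_all add: T_lin T_star_mult)
qed

sublocale T: star_algebra T by (rule star_algebra_T)

section \<open>Linear functionals and weighted l1-norms on a monoid algebra\<close>

definition lin :: "('m \<Rightarrow> complex) \<Rightarrow> ('m \<Rightarrow> complex) \<Rightarrow> complex" where
  "lin F f = (\<Sum>z\<in>supp f. f z * F z)"

lemma lin_superset: "finite U \<Longrightarrow> supp f \<subseteq> U \<Longrightarrow> lin F f = (\<Sum>z\<in>U. f z * F z)"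
  unfolding lin_def by (rule sum.mono_neutral_left) auto

lemma lin_zero [simp]: "lin F \<zero>\<^bsub>T\<^esub> = 0"
  by (simp add: lin_def T_zero)

lemma lin_add: assumes "f \<in> carrier T" "g \<in> carrier T" shows "lin F (f \<oplus>\<^bsub>T\<^esub> g) = lin F f + lin F g"
proof -
  let ?U = "supp f \<union> supp g"
  have "lin F (f \<oplus>\<^bsub>T\<^esub> g) = (\<Sum>z\<in>?U. (f \<oplus>\<^bsub>T\<^esub> g) z * F z)"
    "lin F f = (\<Sum>z\<in>?U. f z * F z)" "lin F g = (\<Sum>z\<in>?U. g z * F z)"
    by (rule lin_superset; use assms in \<open>auto simp: T_iff T_add\<close>)+
  then show ?thesis by (simp add: T_add algebra_simps sum.distrib)
qed

lemma lin_smult: assumes "f \<in> carrier T" shows "lin F (c \<odot>\<^bsub>T\<^esub> f) = c * lin F f"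
proof -
  have "lin F (c \<odot>\<^bsub>T\<^esub> f) = (\<Sum>z\<in>supp f. (c \<odot>\<^bsub>T\<^esub> f) z * F z)"
    by (rule lin_superset; use assms in \<open>auto simp: T_iff T_smult\<close>)
  then show ?thesis by (simp add: T_smult lin_def sum_distrib_left mult.assoc)
qed

lemma lin_mon [simp]: "lin F (mon a) = F a"
  unfolding lin_def supp_mon by (simp add: mon_def)

lemma lin_star_mult:
  assumes "f \<in> carrier T" "g \<in> carrier T"
  shows "lin F (star T f \<otimes>\<^bsub>T\<^esub> g) = (\<Sum>a\<in>supp f. \<Sum>b\<in>supp g. cnj (f a) * g b * F (s a \<otimes> b))"
proof -
  have 1: "lin F (mon a \<otimes>\<^bsub>T\<^esub> g) = lin (\<lambda>b. F (a \<otimes> b)) g" if "a \<in> carrier M" for a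
    using assms(2) that
    by (induction g rule: T_induct)
       (simp_all add: T_lin lin_add lin_smult, simp add: mon_mult)
  \<comment> \<open>The left side is conjugate-linear in \<open>f\<close>. Two conjugations express
    it through the linear \<open>lin\<close>, so that the induction on \<open>f\<close>
    applies.\<close>
  have sh: "lin F (star T f \<otimes>\<^bsub>T\<^esub> g) = cnj (lin (\<lambda>a. cnj (lin (\<lambda>b. F (s a \<otimes> b)) g)) f)"
    using assms(1) assms(2)
    by (induction f rule: T_induct)
       (simp_all add: T_lin lin_add lin_smult T_star_mon 1)
  show ?thesis
    unfolding sh by (simp add: lin_def sum_distrib_left mult_ac)
qed

text \<open>The l1-norm with weight \<open>N\<close>. For pairs weighted by the product of the two
  norms it dominates every product of two states.\<close>

definition norm1 :: "('m \<Rightarrow> real) \<Rightarrow> ('m \<Rightarrow> complex) \<Rightarrow> real" where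
  "norm1 N f = (\<Sum>z\<in>supp f. cmod (f z) * N z)"

lemma norm1_superset: "finite U \<Longrightarrow> supp f \<subseteq> U \<Longrightarrow> norm1 N f = (\<Sum>z\<in>U. cmod (f z) * N z)"
  unfolding norm1_def by (rule sum.mono_neutral_left) auto

text \<open>The triangle inequality is applied to each coefficient of the convolution; after
  exchanging sums every pair \<open>(a, b)\<close> contributes at its product only, where the weight
  is submultiplicative.\<close>

lemma norm1_mult_le:
  assumes "f \<in> carrier T" "g \<in> carrier T"
    and N: "\<And>a. a \<in> carrier M \<Longrightarrow> 0 \<le> N a"
      "\<And>a b. a \<in> carrier M \<Longrightarrow> b \<in> carrier M \<Longrightarrow> N (a \<otimes> b) \<le> N a * N b"
  shows "norm1 N (f \<otimes>\<^bsub>T\<^esub> g) \<le> norm1 N f * norm1 N g"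
proof -
  let ?U = "supp f" and ?W = "supp g"
  let ?Z = "(\<lambda>(a, b). a \<otimes> b) ` (?U \<times> ?W)"
  have fin: "finite ?U" "finite ?W" "?U \<subseteq> carrier M" "?W \<subseteq> carrier M" using assms by (auto simp: T_iff)
  have val: "(f \<otimes>\<^bsub>T\<^esub> g) m = (\<Sum>(a, b)\<in>?U \<times> ?W. if a \<otimes> b = m then f a * g b else 0)" for m
    using fin by (simp add: T_mult[of ?U ?W] sum.cartesian_product)
  have sub: "supp (f \<otimes>\<^bsub>T\<^esub> g) \<subseteq> ?Z"
  proof
    fix m assume "m \<in> supp (f \<otimes>\<^bsub>T\<^esub> g)"
    then obtain z where "z \<in> ?U \<times> ?W" "(case z of (a, b) \<Rightarrow> if a \<otimes> b = m then f a * g b else 0) \<noteq> 0"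
      unfolding val mem_Collect_eq by (rule sum.not_neutral_contains_not_neutral)
    then show "m \<in> ?Z" by (intro image_eqI[of _ _ z]) (auto split: if_splits)
  qed
  have "norm1 N (f \<otimes>\<^bsub>T\<^esub> g) = (\<Sum>m\<in>?Z. cmod ((f \<otimes>\<^bsub>T\<^esub> g) m) * N m)"
    by (rule norm1_superset) (use fin sub in auto)
  also have "\<dots> \<le> (\<Sum>m\<in>?Z. \<Sum>(a, b)\<in>?U \<times> ?W. if a \<otimes> b = m then cmod (f a) * cmod (g b) * N m else 0)"
  proof (rule sum_mono)
    fix m assume m: "m \<in> ?Z"
    have "cmod ((f \<otimes>\<^bsub>T\<^esub> g) m) \<le>
        (\<Sum>z\<in>?U \<times> ?W. cmod (case z of (a, b) \<Rightarrow> if a \<otimes> b = m then f a * g b else 0))"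
      unfolding val by (rule norm_sum)
    also have "\<dots> = (\<Sum>(a, b)\<in>?U \<times> ?W. if a \<otimes> b = m then cmod (f a) * cmod (g b) else 0)"
      by (intro sum.cong) (auto simp: norm_mult)
    finally have "cmod ((f \<otimes>\<^bsub>T\<^esub> g) m) * N m \<le>
        (\<Sum>(a, b)\<in>?U \<times> ?W. if a \<otimes> b = m then cmod (f a) * cmod (g b) else 0) * N m"
      using m fin by (intro mult_right_mono) (auto simp: subset_iff intro!: N(1))
    also have "\<dots> = (\<Sum>(a, b)\<in>?U \<times> ?W. if a \<otimes> b = m then cmod (f a) * cmod (g b) * N m else 0)"
      by (auto simp: sum_distrib_right intro!: sum.cong)
    finally show "cmod ((f \<otimes>\<^bsub>T\<^esub> g) m) * N m \<le> \<dots>" .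
  qed
  also have "\<dots> = (\<Sum>z\<in>?U \<times> ?W. \<Sum>m\<in>?Z. case z of (a, b) \<Rightarrow> if a \<otimes> b = m then cmod (f a) * cmod (g b) * N m else 0)"
    by (rule sum.swap)
  also have "\<dots> = (\<Sum>(a, b)\<in>?U \<times> ?W. cmod (f a) * cmod (g b) * N (a \<otimes> b))"
  proof (rule sum.cong[OF HOL.refl], clarify)
    fix a b assume "f a \<noteq> 0" "g b \<noteq> 0"
    then have "a \<otimes> b \<in> ?Z" by force
    then show "(\<Sum>m\<in>?Z. if a \<otimes> b = m then cmod (f a) * cmod (g b) * N m else 0) =
        cmod (f a) * cmod (g b) * N (a \<otimes> b)"
      using fin by (subst sum.delta') auto
  qed
  also have "\<dots> \<le> (\<Sum>(a, b)\<in>?U \<times> ?W. (cmod (f a) * N a) * (cmod (g b) * N b))"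
  proof (rule sum_mono, clarify)
    fix a b assume "f a \<noteq> 0" "g b \<noteq> 0"
    then have "cmod (f a) * cmod (g b) * N (a \<otimes> b) \<le> cmod (f a) * cmod (g b) * (N a * N b)"
      using fin by (intro mult_left_mono N(2)) (auto simp: subset_iff)
    then show "cmod (f a) * cmod (g b) * N (a \<otimes> b) \<le> (cmod (f a) * N a) * (cmod (g b) * N b)"
      by (simp add: mult_ac)
  qed
  also have "\<dots> = norm1 N f * norm1 N g"
    by (simp add: norm1_def sum_product sum.cartesian_product)
  finally show ?thesis .
qed

lemma norm1_nonneg:
  "f \<in> carrier T \<Longrightarrow> (\<And>a. a \<in> carrier M \<Longrightarrow> 0 \<le> N a) \<Longrightarrow> 0 \<le> norm1 N f"
  unfolding norm1_def by (intro sum_nonneg mult_nonneg_nonneg) (auto simp: T_iff)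

lemma lin_le_norm1:
  assumes "f \<in> carrier T" "\<And>a. a \<in> carrier M \<Longrightarrow> cmod (F a) \<le> N a"
  shows "cmod (lin F f) \<le> norm1 N f"
  unfolding lin_def norm1_def
  by (rule order_trans[OF norm_sum], intro sum_mono)
     (use assms in \<open>auto simp: norm_mult T_iff intro!: mult_left_mono\<close>)

section \<open>Linear extension of a map on the monoid to a *-homomorphism\<close>

definition ext :: "('b, 'n) star_algebra_scheme \<Rightarrow> ('m \<Rightarrow> 'b) \<Rightarrow> ('m \<Rightarrow> complex) \<Rightarrow> 'b" where
  "ext B F f = (\<Oplus>\<^bsub>B\<^esub>z\<in>supp f. f z \<odot>\<^bsub>B\<^esub> F z)"

context
  fixes B :: "('b, 'n) star_algebra_scheme" and F :: "'m \<Rightarrow> 'b"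
  assumes B: "star_algebra B" and F [simp]: "\<And>m. m \<in> carrier M \<Longrightarrow> F m \<in> carrier B"
begin

interpretation B: star_algebra B by (rule B)

lemma ext_superset:
  "finite U \<Longrightarrow> supp f \<subseteq> U \<Longrightarrow> U \<subseteq> carrier M \<Longrightarrow> ext B F f = (\<Oplus>\<^bsub>B\<^esub>z\<in>U. f z \<odot>\<^bsub>B\<^esub> F z)"
  unfolding ext_def by (rule B.finsum_superset) (auto simp: subset_iff)

lemma ext_closed: "f \<in> carrier T \<Longrightarrow> ext B F f \<in> carrier B"
  unfolding ext_def by (intro B.finsum_closed) (auto simp: T_iff)

lemma ext_zero: "ext B F \<zero>\<^bsub>T\<^esub> = \<zero>\<^bsub>B\<^esub>"
  by (simp add: ext_def T_zero)

lemma ext_add: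
  assumes "f \<in> carrier T" "g \<in> carrier T" shows "ext B F (f \<oplus>\<^bsub>T\<^esub> g) = ext B F f \<oplus>\<^bsub>B\<^esub> ext B F g"
proof -
  let ?U = "supp f \<union> supp g"
  have U: "?U \<subseteq> carrier M" using assms by (auto simp: T_iff)
  have eq: "ext B F (f \<oplus>\<^bsub>T\<^esub> g) = (\<Oplus>\<^bsub>B\<^esub>z\<in>?U. (f \<oplus>\<^bsub>T\<^esub> g) z \<odot>\<^bsub>B\<^esub> F z)"
    "ext B F f = (\<Oplus>\<^bsub>B\<^esub>z\<in>?U. f z \<odot>\<^bsub>B\<^esub> F z)" "ext B F g = (\<Oplus>\<^bsub>B\<^esub>z\<in>?U. g z \<odot>\<^bsub>B\<^esub> F z)"
    by (rule ext_superset; use assms in \<open>auto simp: T_iff T_add\<close>)+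
  have "(\<Oplus>\<^bsub>B\<^esub>z\<in>?U. (f \<oplus>\<^bsub>T\<^esub> g) z \<odot>\<^bsub>B\<^esub> F z) = (\<Oplus>\<^bsub>B\<^esub>z\<in>?U. f z \<odot>\<^bsub>B\<^esub> F z \<oplus>\<^bsub>B\<^esub> g z \<odot>\<^bsub>B\<^esub> F z)"
    by (intro B.finsum_cong') (use U in \<open>auto simp: T_add B.smult_add_left\<close>)
  also have "\<dots> = (\<Oplus>\<^bsub>B\<^esub>z\<in>?U. f z \<odot>\<^bsub>B\<^esub> F z) \<oplus>\<^bsub>B\<^esub> (\<Oplus>\<^bsub>B\<^esub>z\<in>?U. g z \<odot>\<^bsub>B\<^esub> F z)"
    by (intro B.finsum_addf) (use U in auto)
  finally show ?thesis by (simp add: eq)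
qed

lemma ext_smult: assumes "f \<in> carrier T" shows "ext B F (c \<odot>\<^bsub>T\<^esub> f) = c \<odot>\<^bsub>B\<^esub> ext B F f"
proof -
  have "ext B F (c \<odot>\<^bsub>T\<^esub> f) = (\<Oplus>\<^bsub>B\<^esub>z\<in>supp f. (c \<odot>\<^bsub>T\<^esub> f) z \<odot>\<^bsub>B\<^esub> F z)"
    by (rule ext_superset; use assms in \<open>auto simp: T_iff T_smult\<close>)
  also have "\<dots> = (\<Oplus>\<^bsub>B\<^esub>z\<in>supp f. c \<odot>\<^bsub>B\<^esub> (f z \<odot>\<^bsub>B\<^esub> F z))"
    by (intro B.finsum_cong') (use assms in \<open>auto simp: T_smult T_iff subset_iff\<close>)
  also have "\<dots> = c \<odot>\<^bsub>B\<^esub> ext B F f"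
    unfolding ext_def by (rule B.finsum_smult[symmetric]) (use assms in \<open>auto simp: T_iff\<close>)
  finally show ?thesis .
qed

lemma ext_mon: "a \<in> carrier M \<Longrightarrow> ext B F (mon a) = F a"
  unfolding ext_def supp_mon by (simp add: mon_def)

lemma ext_star_hom:
  assumes one: "F \<one> = \<one>\<^bsub>B\<^esub>"
    and mult: "\<And>a b. a \<in> carrier M \<Longrightarrow> b \<in> carrier M \<Longrightarrow> F (a \<otimes> b) = F a \<otimes>\<^bsub>B\<^esub> F b"
    and star: "\<And>a. a \<in> carrier M \<Longrightarrow> F (s a) = star B (F a)"
  shows "ext B F \<in> star_hom T B"
proof (rule star_homI)
  note ext = ext_add ext_smult ext_mon ext_zero ext_closed
  note Bl = B.l_distr B.r_distr B.smult_mult_left B.smult_mult_right B.star_add B.star_smult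
  have 1: "ext B F (mon a \<otimes>\<^bsub>T\<^esub> g) = ext B F (mon a) \<otimes>\<^bsub>B\<^esub> ext B F g"
    if "a \<in> carrier M" "g \<in> carrier T" for a g
    using that(2,1)
    by (induction g rule: T_induct) (simp_all add: T_lin ext Bl, simp add: mon_mult ext mult)
  show "ext B F (f \<otimes>\<^bsub>T\<^esub> g) = ext B F f \<otimes>\<^bsub>B\<^esub> ext B F g" if "f \<in> carrier T" "g \<in> carrier T" for f g
    using that by (induction f rule: T_induct) (simp_all add: T_lin ext Bl 1)
  show "ext B F (star T f) = star B (ext B F f)" if "f \<in> carrier T" for f
    using that by (induction f rule: T_induct) (simp_all add: T_lin ext Bl T_star_mon star)
  show "ext B F \<one>\<^bsub>T\<^esub> = \<one>\<^bsub>B\<^esub>" using one by (simp add: T_one ext)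
qed (simp_all add: ext_closed ext_add ext_smult)

end

end

section \<open>Universal C*-algebras\<close>

text \<open>Each condition survives a pointwise supremum. For the C*-identity this is so because
  squaring is monotone on nonnegative reals and therefore commutes with the supremum.\<close>

lemma (in star_algebra) cstar_seminorm_SUP:
  assumes ne: "P \<noteq> {}" and P: "\<And>p. p \<in> P \<Longrightarrow> cstar_seminorm A p"
    and bdd: "\<And>x. x \<in> carrier A \<Longrightarrow> bdd_above ((\<lambda>p. p x) ` P)"
  shows "cstar_seminorm A (\<lambda>x. SUP p\<in>P. p x)"
proof -
  let ?q = "\<lambda>x. SUP p\<in>P. p x"
  have sn: "cstar_seminormed A p" if "p \<in> P" for p
    by (intro cstar_seminormed.intro cstar_seminormed_axioms.intro P that) unfold_locales
  have up: "p x \<le> ?q x" if "x \<in> carrier A" "p \<in> P" for p x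
    using bdd that by (intro cSUP_upper) auto
  have le: "?q x \<le> b" if "\<And>p. p \<in> P \<Longrightarrow> p x \<le> b" for x b
    using that ne by (intro cSUP_least) auto
  have nn: "0 \<le> ?q x" if "x \<in> carrier A" for x
  proof -
    obtain p where p: "p \<in> P" using ne by blast
    from cstar_seminormed.p_nonneg[OF sn[OF p] that] up[OF that p] show ?thesis by linarith
  qed
  have smult_le: "?q (c \<odot> x) \<le> cmod c * ?q x" if "x \<in> carrier A" for c x
    by (rule le) (use that up in \<open>auto simp: cstar_seminormed.p_smult[OF sn] intro: mult_left_mono\<close>)
  show ?thesis
    unfolding cstar_seminorm_def
  proof (intro conjI ballI allI)
    fix x c assume x: "x \<in> carrier A"
    show "0 \<le> ?q x" using nn x by blast
    show "?q (star A x \<otimes> x) = (?q x)\<^sup>2"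
    proof (rule antisym)
      show "?q (star A x \<otimes> x) \<le> (?q x)\<^sup>2"
        by (rule le) (use x up in \<open>auto simp: cstar_seminormed.p_cstar[OF sn]
            cstar_seminormed.p_nonneg[OF sn] intro: power_mono\<close>)
      have "?q x \<le> sqrt (?q (star A x \<otimes> x))"
      proof (rule le)
        fix p assume p: "p \<in> P"
        then have "(p x)\<^sup>2 \<le> ?q (star A x \<otimes> x)"
          using up[of "star A x \<otimes> x" p] x by (simp add: cstar_seminormed.p_cstar[OF sn])
        then show "p x \<le> sqrt (?q (star A x \<otimes> x))" by (rule real_le_rsqrt)
      qed
      then show "(?q x)\<^sup>2 \<le> ?q (star A x \<otimes> x)"
        using nn x by (simp add: real_le_rsqrt sqrt_ge_absD)
    qed
    show "?q (c \<odot> x) = cmod c * ?q x"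
    proof (rule antisym[OF smult_le[OF x]])
      show "cmod c * ?q x \<le> ?q (c \<odot> x)"
      proof (cases "c = 0")
        case False
        \<comment> \<open>The reverse inequality is the direct one for the inverse scalar.\<close>
        have "?q x = ?q (inverse c \<odot> (c \<odot> x))" using False x by simp
        also have "\<dots> \<le> cmod (inverse c) * ?q (c \<odot> x)" by (rule smult_le) (use x in simp)
        finally show ?thesis using False by (simp add: norm_inverse norm_divide field_simps)
      qed (use x nn in simp)
    qed
  next
    fix x y assume xy: "x \<in> carrier A" "y \<in> carrier A"
    show "?q (x \<oplus> y) \<le> ?q x + ?q y"
      by (rule le, rule order_trans[OF cstar_seminormed.p_add[OF sn]]) (use xy up in \<open>auto intro: add_mono\<close>)
    show "?q (x \<otimes> y) \<le> ?q x * ?q y"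
      by (rule le, rule order_trans[OF cstar_seminormed.p_mult[OF sn]])
         (use xy up nn in \<open>auto simp: cstar_seminormed.p_nonneg[OF sn] intro!: mult_mono\<close>)
  qed
qed

lemma (in star_algebra) cstar_seminorm_0: "cstar_seminorm A (\<lambda>_. 0)"
  by (simp add: cstar_seminorm_def)

lemma (in cstar_seminormed) const_star_hom: "(\<lambda>a. cl (\<lambda>_. a)) \<in> star_hom A C"
  by (rule star_homI) (simp_all add: C_ops)

lemma (in cstar_seminormed) const_eq_iff:
  "a \<in> carrier A \<Longrightarrow> b \<in> carrier A \<Longrightarrow> cl (\<lambda>_. a) = cl (\<lambda>_. b) \<longleftrightarrow> p (a \<ominus> b) = 0"
  by (simp add: cl_eq_iff LIMSEQ_const_iff)

subsection \<open>Free star algebras\<close>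

interpretation free: star_monoid "\<lparr>carrier = lists (S \<times> UNIV), mult = (@), one = []\<rparr>"
  "\<lambda>w. rev (map (\<lambda>(x, b). (x, \<not> b)) w)"
  rewrites "monoid_star_algebra \<lparr>carrier = lists (S \<times> UNIV), mult = (@), one = []\<rparr>
      (\<lambda>w. rev (map (\<lambda>(x, b). (x, \<not> b)) w)) \<equiv> free_star_algebra S"
  for S :: "'g set"
proof -
  show "star_monoid \<lparr>carrier = lists (S \<times> UNIV), mult = (@), one = []\<rparr>
      (\<lambda>w. rev (map (\<lambda>(x, b). (x, \<not> b)) w))"
    by unfold_locales (auto simp: rev_map o_def split_def, fastforce)
qed (simp add: free_star_algebra_def)

lemma free_gen_closed [simp]: "x \<in> S \<Longrightarrow> free_gen x \<in> carrier (free_star_algebra S)"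
  unfolding free_gen_def by (rule free.mon_closed) simp

text \<open>A word is a product of letters, and a letter is a generator or the adjoint of one;
  closure under products and star therefore covers all words, and linearity does the rest.\<close>

lemma free_algebra_induct:
  assumes f: "f \<in> carrier (free_star_algebra S)"
    and "\<zero>\<^bsub>free_star_algebra S\<^esub> \<in> Q" "\<one>\<^bsub>free_star_algebra S\<^esub> \<in> Q"
    and gen: "\<And>x. x \<in> S \<Longrightarrow> free_gen x \<in> Q"
    and "\<And>x y. x \<in> carrier (free_star_algebra S) \<Longrightarrow> y \<in> carrier (free_star_algebra S) \<Longrightarrow> x \<in> Q \<Longrightarrow> y \<in> Q \<Longrightarrow> x \<oplus>\<^bsub>free_star_algebra S\<^esub> y \<in> Q"
    and mult: "\<And>x y. x \<in> carrier (free_star_algebra S) \<Longrightarrow> y \<in> carrier (free_star_algebra S) \<Longrightarrow> x \<in> Q \<Longrightarrow> y \<in> Q \<Longrightarrow> x \<otimes>\<^bsub>free_star_algebra S\<^esub> y \<in> Q"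
    and "\<And>c x. x \<in> carrier (free_star_algebra S) \<Longrightarrow> x \<in> Q \<Longrightarrow> c \<odot>\<^bsub>free_star_algebra S\<^esub> x \<in> Q"
    and star: "\<And>x. x \<in> carrier (free_star_algebra S) \<Longrightarrow> x \<in> Q \<Longrightarrow> star (free_star_algebra S) x \<in> Q"
  shows "f \<in> Q"
proof -
  have mon: "mon w \<in> Q" if "w \<in> lists (S \<times> UNIV)" for w
    using that
  proof (induction w)
    case Nil
    then show ?case using assms(3) by (simp add: free.T_one)
  next
    case (Cons l w)
    obtain x b where l: "l = (x, b)" by (cases l)
    have x: "x \<in> S" using Cons l by auto
    have "star (free_star_algebra S) (free_gen x) = mon [(x, True)]"
      unfolding free_gen_def using x by (subst free.T_star_mon) auto
    then have "mon [l] \<in> Q" "mon [l] \<in> carrier (free_star_algebra S)"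
      using gen[OF x] star[of "free_gen x"] x l by (cases b; auto simp: free_gen_def)+
    moreover have "mon w \<in> carrier (free_star_algebra S)" using Cons by (intro free.mon_closed) simp
    ultimately have "mon [l] \<otimes>\<^bsub>free_star_algebra S\<^esub> mon w \<in> Q" using Cons mult by blast
    then show ?case by (subst (asm) free.mon_mult) simp
  qed
  show ?thesis
    using f by (induction f rule: free.T_induct) (use assms mon in \<open>auto simp: free.T_smult_closed\<close>)
qed

definition word_val :: "('b, 'n) star_algebra_scheme \<Rightarrow> ('g \<Rightarrow> 'b) \<Rightarrow> 'g word \<Rightarrow> 'b" where
  "word_val B u w = foldr (\<lambda>(x, b) y. (if b then star B (u x) else u x) \<otimes>\<^bsub>B\<^esub> y) w \<one>\<^bsub>B\<^esub>"

definition free_ev :: "('b, 'n) star_algebra_scheme \<Rightarrow> ('g \<Rightarrow> 'b) \<Rightarrow> ('g word \<Rightarrow> complex) \<Rightarrow> 'b" where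
  "free_ev B u = star_monoid.ext B (word_val B u)"

context star_algebra
begin

lemma word_val_closed:
  "(\<And>x. x \<in> S \<Longrightarrow> u x \<in> carrier A) \<Longrightarrow> w \<in> lists (S \<times> UNIV) \<Longrightarrow> word_val A u w \<in> carrier A"
  by (induction w) (auto simp: word_val_def)

lemma word_val_append:
  assumes "\<And>x. x \<in> S \<Longrightarrow> u x \<in> carrier A" "v \<in> lists (S \<times> UNIV)" "w \<in> lists (S \<times> UNIV)"
  shows "word_val A u (v @ w) = word_val A u v \<otimes> word_val A u w"
  using assms(2)
proof (induction v)
  case Nil
  then show ?case using word_val_closed[OF assms(1,3)] by (simp add: word_val_def)
next
  case (Cons l v)
  have "word_val A u v \<in> carrier A" "word_val A u w \<in> carrier A"
    using word_val_closed[of S u] assms(1,3) Cons by auto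
  with Cons assms(1) show ?case by (auto simp: word_val_def m_assoc)
qed

lemma word_val_star:
  assumes "\<And>x. x \<in> S \<Longrightarrow> u x \<in> carrier A" "w \<in> lists (S \<times> UNIV)"
  shows "word_val A u (rev (map (\<lambda>(x, b). (x, \<not> b)) w)) = star A (word_val A u w)"
  using assms(2)
proof (induction w)
  case Nil
  then show ?case by (simp add: word_val_def)
next
  case (Cons l w)
  obtain x b where l: "l = (x, b)" by (cases l)
  have x: "u x \<in> carrier A" using assms(1) Cons l by auto
  have w: "word_val A u w \<in> carrier A" using word_val_closed[of S u w] assms(1) Cons by auto
  have "rev (map (\<lambda>(x, b). (x, \<not> b)) (l # w)) = rev (map (\<lambda>(x, b). (x, \<not> b)) w) @ [(x, \<not> b)]"
    by (simp add: l)
  also have "word_val A u \<dots> = word_val A u (rev (map (\<lambda>(x, b). (x, \<not> b)) w)) \<otimes> word_val A u [(x, \<not> b)]"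
    by (rule word_val_append[OF assms(1)]) (use Cons l in auto)
  also have "\<dots> = star A (word_val A u w) \<otimes> word_val A u [(x, \<not> b)]" using Cons by simp
  also have "\<dots> = star A (word_val A u (l # w))"
    using x w by (cases b) (simp_all add: word_val_def l star_mult)
  finally show ?case .
qed

lemma free_ev_hom:
  assumes "\<And>x. x \<in> S \<Longrightarrow> u x \<in> carrier A"
  shows "free_ev A u \<in> star_hom (free_star_algebra S) A"
  unfolding free_ev_def
  by (rule free.ext_star_hom[where B = A and S = S])
     (use word_val_closed[of S u] word_val_append[of S u] word_val_star[of S u] assms in
       \<open>auto simp: word_val_def[of A u "[]"] star_algebra_axioms\<close>)

lemma free_ev_gen:
  assumes "u x \<in> carrier A" shows "free_ev A u (free_gen x) = u x"
proof -
  have "free_ev A u (free_gen x) = word_val A u [(x, False)]"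
    unfolding free_ev_def free_gen_def
    by (rule free.ext_mon[where B = A and S = "{x}"])
       (use assms word_val_closed[of "{x}" u] in \<open>auto simp: star_algebra_axioms\<close>)
  then show ?thesis using assms by (simp add: word_val_def)
qed

end

lemma free_hom_eqI:
  assumes "star_algebra B" "g \<in> star_hom (free_star_algebra S) B" "h \<in> star_hom (free_star_algebra S) B"
    and "\<And>x. x \<in> S \<Longrightarrow> g (free_gen x) = h (free_gen x)"
    and f: "f \<in> carrier (free_star_algebra S)"
  shows "g f = h f"
proof -
  interpret B: star_algebra B by fact
  interpret g: star_homomorphism "free_star_algebra S" B g by unfold_locales fact
  interpret h: star_homomorphism "free_star_algebra S" B h by unfold_locales fact
  have "f \<in> {x. g x = h x}"
    using f by (rule free_algebra_induct)
      (use assms(4) in \<open>auto simp: g.hom_zero h.hom_zero g.hom_one h.hom_one g.hom_add h.hom_add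
        g.hom_mult h.hom_mult g.hom_smult h.hom_smult g.hom_star h.hom_star\<close>)
  then show ?thesis by simp
qed

subsection \<open>Presentations\<close>

definition satisfies ::
    "'g set \<Rightarrow> (('g word \<Rightarrow> complex) \<times> ('g word \<Rightarrow> complex)) set \<Rightarrow> ('b, 'n) star_algebra_scheme \<Rightarrow>
     ('g \<Rightarrow> 'b) \<Rightarrow> bool" where
  "satisfies S R B u \<longleftrightarrow> (\<forall>x\<in>S. u x \<in> carrier B) \<and> (\<forall>(a, b)\<in>R. free_ev B u a = free_ev B u b)"

definition compatible ::
    "'g set \<Rightarrow> (('g word \<Rightarrow> complex) \<times> ('g word \<Rightarrow> complex)) set \<Rightarrow> (('g word \<Rightarrow> complex) \<Rightarrow> real) \<Rightarrow> bool" where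
  "compatible S R p \<longleftrightarrow> cstar_seminorm (free_star_algebra S) p \<and>
     (\<forall>(a, b)\<in>R. p (a \<ominus>\<^bsub>free_star_algebra S\<^esub> b) = 0)"

lemma seminormed_free:
  "cstar_seminorm (free_star_algebra S) p \<Longrightarrow> cstar_seminormed (free_star_algebra S) p"
  by (intro cstar_seminormed.intro cstar_seminormed_axioms.intro free.star_algebra_T)

text \<open>The evaluation at the classes of the generators and the map to constant sequences are
  both *-homomorphisms, and they agree on generators.\<close>

lemma completion_ev:
  assumes p: "cstar_seminorm (free_star_algebra S) p" and f: "f \<in> carrier (free_star_algebra S)"
  shows "free_ev (completion (free_star_algebra S) p)
      (\<lambda>x. completion_class (free_star_algebra S) p (\<lambda>_. free_gen x)) f =
    completion_class (free_star_algebra S) p (\<lambda>_. f)"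
proof -
  interpret F: cstar_seminormed "free_star_algebra S" p by (rule seminormed_free[OF p])
  interpret K: star_algebra F.C by (rule F.star_algebra_C)
  show ?thesis
    by (rule free_hom_eqI[OF _ K.free_ev_hom F.const_star_hom _ f])
       (auto simp: K.free_ev_gen K.star_algebra_axioms)
qed

text \<open>The bridge between seminorms and elements: a condition on \<open>p\<close> becomes a
  system of equations in a C*-algebra, which can then be treated by algebra.\<close>

lemma satisfies_completion_iff:
  assumes p: "cstar_seminorm (free_star_algebra S) p"
    and R: "R \<subseteq> carrier (free_star_algebra S) \<times> carrier (free_star_algebra S)"
  shows "satisfies S R (completion (free_star_algebra S) p)
      (\<lambda>x. completion_class (free_star_algebra S) p (\<lambda>_. free_gen x)) \<longleftrightarrow> compatible S R p"
proof -
  interpret F: cstar_seminormed "free_star_algebra S" p by (rule seminormed_free[OF p])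
  have "free_ev F.C (\<lambda>x. F.cl (\<lambda>_. free_gen x)) a = free_ev F.C (\<lambda>x. F.cl (\<lambda>_. free_gen x)) b
      \<longleftrightarrow> p (a \<ominus>\<^bsub>free_star_algebra S\<^esub> b) = 0" if "(a, b) \<in> R" for a b
  proof -
    have "a \<in> carrier (free_star_algebra S)" "b \<in> carrier (free_star_algebra S)" using that R by auto
    then show ?thesis by (simp only: completion_ev[OF p] F.const_eq_iff)
  qed
  then have "(\<forall>(a, b)\<in>R. free_ev F.C (\<lambda>x. F.cl (\<lambda>_. free_gen x)) a = free_ev F.C (\<lambda>x. F.cl (\<lambda>_. free_gen x)) b)
      \<longleftrightarrow> (\<forall>(a, b)\<in>R. p (a \<ominus>\<^bsub>free_star_algebra S\<^esub> b) = 0)"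
    by (intro ball_cong HOL.refl) (simp add: split_def)
  then show ?thesis
    using p by (simp add: satisfies_def compatible_def)
qed

text \<open>The hypothesis concerns C*-algebras of a single type. The completions of the free
  algebra have that type, and the relations hold in such a completion exactly when its seminorm is
  compatible; so both supremums run over the same seminorms.\<close>

lemma universal_cstar_cong:
  fixes S :: "'g set"
  assumes R: "R \<subseteq> carrier (free_star_algebra S) \<times> carrier (free_star_algebra S)"
    and R': "R' \<subseteq> carrier (free_star_algebra S) \<times> carrier (free_star_algebra S)"
    and iff: "\<And>(B :: (nat \<Rightarrow> 'g word \<Rightarrow> complex) set cstar_algebra) u.
      cstar_algebra B \<Longrightarrow> satisfies S R B u \<longleftrightarrow> satisfies S R' B u"
  shows "universal_seminorm S R = universal_seminorm S R'"
proof -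
  have "compatible S R p \<longleftrightarrow> compatible S R' p" for p
  proof (cases "cstar_seminorm (free_star_algebra S) p")
    case True
    have "cstar_algebra (completion (free_star_algebra S) p)"
      by (rule cstar_seminormed.cstar_algebra_C[OF seminormed_free[OF True]])
    then show ?thesis
      using iff satisfies_completion_iff[OF True R] satisfies_completion_iff[OF True R'] by blast
  qed (simp add: compatible_def)
  then show ?thesis unfolding universal_seminorm_def compatible_def[symmetric] fun_eq_iff by simp
qed

text \<open>\<open>bounded_rel\<close> makes the supremum in \<open>universal_seminorm\<close>
  finite: bounds on the generators propagate to all polynomials in them.\<close>

locale presentation =
  fixes S :: "'g set" and R :: "(('g word \<Rightarrow> complex) \<times> ('g word \<Rightarrow> complex)) set"
  assumes R_carrier: "R \<subseteq> carrier (free_star_algebra S) \<times> carrier (free_star_algebra S)"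
    and bounded_rel: "compatible S R p \<Longrightarrow> x \<in> S \<Longrightarrow> p (free_gen x) \<le> 1"
begin

abbreviation F :: "('g word \<Rightarrow> complex) star_algebra" where "F \<equiv> free_star_algebra S"

lemma bounded_compatible:
  assumes "f \<in> carrier F" shows "\<exists>K\<ge>0. \<forall>p. compatible S R p \<longrightarrow> p f \<le> K"
proof -
  define Q where "Q = {f. \<exists>K\<ge>0. \<forall>p. compatible S R p \<longrightarrow> p f \<le> K}"
  have sn: "cstar_seminormed F p" if "compatible S R p" for p
    using that by (auto simp: compatible_def intro: seminormed_free)
  note props = cstar_seminormed.p_nonneg[OF sn] cstar_seminormed.p_zero[OF sn]
    cstar_seminormed.p_one_le[OF sn] cstar_seminormed.p_smult[OF sn] cstar_seminormed.p_star[OF sn]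
  have "f \<in> Q"
    using assms
  proof (rule free_algebra_induct)
    show "\<zero>\<^bsub>F\<^esub> \<in> Q" "\<one>\<^bsub>F\<^esub> \<in> Q" unfolding Q_def using props(2,3) by (auto intro!: exI[of _ 1] simp: props)
    show "free_gen x \<in> Q" if "x \<in> S" for x unfolding Q_def using bounded_rel that by (auto intro!: exI[of _ 1])
    show "star F x \<in> Q" if "x \<in> carrier F" "x \<in> Q" for x
      using that unfolding Q_def by (auto simp: props)
  next
    fix c x assume x: "x \<in> carrier F" "x \<in> Q"
    then obtain K where "K \<ge> 0" "\<And>p. compatible S R p \<Longrightarrow> p x \<le> K" unfolding Q_def by blast
    with x show "c \<odot>\<^bsub>F\<^esub> x \<in> Q"
      unfolding Q_def by (auto intro!: exI[of _ "cmod c * K"] mult_left_mono simp: props)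
  next
    fix x y assume xy: "x \<in> carrier F" "y \<in> carrier F" "x \<in> Q" "y \<in> Q"
    then obtain K L where K: "K \<ge> 0" "\<And>p. compatible S R p \<Longrightarrow> p x \<le> K"
      and L: "L \<ge> 0" "\<And>p. compatible S R p \<Longrightarrow> p y \<le> L" unfolding Q_def by blast
    have "p (x \<oplus>\<^bsub>F\<^esub> y) \<le> K + L" if "compatible S R p" for p
      using cstar_seminormed.p_add[OF sn[OF that] xy(1,2)] K(2)[OF that] L(2)[OF that] by linarith
    then show "x \<oplus>\<^bsub>F\<^esub> y \<in> Q"
      unfolding Q_def using K(1) L(1) by (intro CollectI exI[of _ "K + L"]) auto
    have "p (x \<otimes>\<^bsub>F\<^esub> y) \<le> K * L" if "compatible S R p" for p
      by (rule order_trans[OF cstar_seminormed.p_mult[OF sn[OF that] xy(1,2)]])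
         (use K L xy that props(1) in \<open>auto intro: mult_mono\<close>)
    then show "x \<otimes>\<^bsub>F\<^esub> y \<in> Q"
      unfolding Q_def using K(1) L(1) by (intro CollectI exI[of _ "K * L"]) auto
  qed
  then show ?thesis by (simp add: Q_def)
qed

abbreviation q :: "('g word \<Rightarrow> complex) \<Rightarrow> real" where "q \<equiv> universal_seminorm S R"

lemma q_SUP: "q = (\<lambda>f. SUP p\<in>{p. compatible S R p}. p f)"
  by (simp add: universal_seminorm_def compatible_def setcompr_eq_image fun_eq_iff)

lemma compatible_le_q: assumes "compatible S R p" "f \<in> carrier F" shows "p f \<le> q f"
proof -
  obtain K where "\<And>p. compatible S R p \<Longrightarrow> p f \<le> K" using bounded_compatible[OF assms(2)] by blast
  then have "bdd_above ((\<lambda>p. p f) ` {p. compatible S R p})" by (intro bdd_aboveI2[of _ _ K]) auto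
  then show ?thesis unfolding q_SUP by (rule cSUP_upper[rotated]) (use assms in simp)
qed

lemma q_compatible: "compatible S R q"
proof -
  \<comment> \<open>The zero seminorm satisfies all relations, so the supremum is taken over a
    non-empty family.\<close>
  have 0: "compatible S R (\<lambda>_. 0)" by (simp add: compatible_def free.T.cstar_seminorm_0)
  have "cstar_seminorm F q"
    unfolding q_SUP
  proof (rule free.T.cstar_seminorm_SUP)
    show "bdd_above ((\<lambda>p. p x) ` {p. compatible S R p})" if x: "x \<in> carrier F" for x
    proof -
      obtain K where "\<And>p. compatible S R p \<Longrightarrow> p x \<le> K" using bounded_compatible[OF x] by blast
      then show ?thesis by (intro bdd_aboveI2[of _ _ K]) auto
    qed
  qed (use 0 in \<open>auto simp: compatible_def\<close>)
  moreover have "q (a \<ominus>\<^bsub>F\<^esub> b) = 0" if "(a, b) \<in> R" for a b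
  proof -
    have "(\<lambda>p. p (a \<ominus>\<^bsub>F\<^esub> b)) ` {p. compatible S R p} = {0}"
      using 0 that by (auto simp: compatible_def image_iff)
    then show ?thesis unfolding q_SUP by simp
  qed
  ultimately show ?thesis by (auto simp: compatible_def)
qed

lemma q_seminorm: "cstar_seminorm F q"
  using q_compatible by (simp add: compatible_def)

sublocale Q: cstar_seminormed F q
  by (rule seminormed_free[OF q_seminorm])

abbreviation U :: "(nat \<Rightarrow> 'g word \<Rightarrow> complex) set cstar_algebra" where "U \<equiv> universal_cstar S R"
abbreviation gen :: "'g \<Rightarrow> (nat \<Rightarrow> 'g word \<Rightarrow> complex) set" where "gen \<equiv> universal_gen S R"

lemma U_completion: "U = Q.C"
  by (simp add: universal_cstar_def)

lemma cstar_U: "cstar_algebra U"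
  unfolding U_completion by (rule Q.cstar_algebra_C)

sublocale U: cstar_algebra U by (rule cstar_U)

lemma gen_cl: "gen x = Q.cl (\<lambda>_. free_gen x)"
  by (simp add: universal_gen_def)

lemma gen_closed [simp]: "x \<in> S \<Longrightarrow> gen x \<in> carrier U"
  by (simp add: gen_cl U_completion)

lemma satisfies_gen: "satisfies S R U gen"
  using satisfies_completion_iff[OF q_seminorm R_carrier] q_compatible
  by (simp add: universal_cstar_def universal_gen_def[abs_def])

text \<open>Pulling the norm of \<open>B\<close> back along the evaluation gives a compatible
  seminorm, hence one below \<open>q\<close>. The evaluation is thus contractive for
  \<open>q\<close> and extends to the completion.\<close>

theorem universal_property:
  fixes B :: "('b, 'n) cstar_algebra_scheme"
  assumes B: "cstar_algebra B" and sat: "satisfies S R B u"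
  shows "\<exists>h\<in>star_hom U B. (\<forall>x\<in>S. h (gen x) = u x) \<and> (\<forall>\<xi>\<in>carrier U. cnorm B (h \<xi>) \<le> cnorm U \<xi>)"
proof -
  interpret B: cstar_algebra B by fact
  have u: "\<And>x. x \<in> S \<Longrightarrow> u x \<in> carrier B" using sat by (simp add: satisfies_def)
  have ev: "free_ev B u \<in> star_hom F B" by (rule B.free_ev_hom) (rule u)
  interpret ev: star_homomorphism F B "free_ev B u" by unfold_locales (rule ev)
  have "compatible S R (\<lambda>f. cnorm B (free_ev B u f))"
    unfolding compatible_def
  proof (intro conjI ballI)
    show "cstar_seminorm F (\<lambda>f. cnorm B (free_ev B u f))"
      by (rule star_hom_seminorm[OF _ B.cstar_seminormed_cnorm ev]) unfold_locales
    fix r assume r: "r \<in> R"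
    then obtain a b where ab: "r = (a, b)" "a \<in> carrier F" "b \<in> carrier F" using R_carrier by blast
    with r sat have "free_ev B u a = free_ev B u b" by (auto simp: satisfies_def)
    with ab show "case r of (a, b) \<Rightarrow> cnorm B (free_ev B u (a \<ominus>\<^bsub>F\<^esub> b)) = 0"
      by (simp add: ev.hom_minus)
  qed
  then have "\<And>f. f \<in> carrier F \<Longrightarrow> cnorm B (free_ev B u f) \<le> q f" by (rule compatible_le_q)
  from Q.extend_to_completion[OF B ev this]
  obtain h where h: "h \<in> star_hom U B" "\<And>a. a \<in> carrier F \<Longrightarrow> h (Q.cl (\<lambda>_. a)) = free_ev B u a"
    "\<And>\<xi>. \<xi> \<in> carrier U \<Longrightarrow> cnorm B (h \<xi>) \<le> cnorm U \<xi>"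
    unfolding U_completion by auto
  have "h (gen x) = u x" if "x \<in> S" for x
    using h(2)[of "free_gen x"] u that by (simp add: gen_cl B.free_ev_gen)
  with h show ?thesis by blast
qed

lemma const_closed [simp]: "f \<in> carrier F \<Longrightarrow> Q.cl (\<lambda>_. f) \<in> carrier U"
  by (simp add: U_completion)

lemma const_hom: "(\<lambda>f. Q.cl (\<lambda>_. f)) \<in> star_hom F U"
  unfolding U_completion by (rule Q.const_star_hom)

lemma U_cases:
  assumes "\<xi> \<in> carrier U"
  obtains x where "\<And>n. x n \<in> carrier F" "U.converges (\<lambda>n. Q.cl (\<lambda>_. x n)) \<xi>"
proof -
  obtain x where x: "x \<in> Q.CS" "\<xi> = Q.cl x" using assms unfolding U_completion by (rule Q.C_cases)
  show ?thesis
    by (rule that[of x]) (use x Q.cl_const_tendsto in \<open>auto simp: U_completion\<close>)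
qed

text \<open>A *-subalgebra containing the generators contains the image of the free algebra; this
  image is dense, so a closed one is everything.\<close>

lemma generated: "cstar_generated U (gen ` S)"
  unfolding cstar_generated_def
proof (intro conjI allI impI)
  fix B assume B: "subring B U \<and> gen ` S \<subseteq> B \<and> (\<forall>x\<in>B. star U x \<in> B \<and> (\<forall>c. c \<odot>\<^bsub>U\<^esub> x \<in> B)) \<and>
    (\<forall>x. \<forall>a\<in>carrier U. range x \<subseteq> B \<and> (\<lambda>n. cnorm U (x n \<ominus>\<^bsub>U\<^esub> a)) \<longlonglongrightarrow> 0 \<longrightarrow> a \<in> B)"
  then interpret B: subring B U by blast
  interpret c: star_homomorphism F U "\<lambda>f. Q.cl (\<lambda>_. f)"
    by unfold_locales (rule const_hom)
  have B0: "\<zero>\<^bsub>U\<^esub> \<in> B"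
    using B B.one_closed U.smult_0_left[of "\<one>\<^bsub>U\<^esub>"] by (metis U.one_closed)
  have c: "f \<in> {f. Q.cl (\<lambda>_. f) \<in> B}" if "f \<in> carrier F" for f
    using that
    by (rule free_algebra_induct)
       (use B B0 in \<open>auto simp: c.hom_zero c.hom_one c.hom_add c.hom_mult c.hom_smult c.hom_star
         gen_cl[symmetric] intro: B.one_closed B.m_closed subringE(7)\<close>)
  have "\<xi> \<in> B" if "\<xi> \<in> carrier U" for \<xi>
  proof -
    obtain x where x: "\<And>n. x n \<in> carrier F" "U.converges (\<lambda>n. Q.cl (\<lambda>_. x n)) \<xi>"
      using U_cases \<open>\<xi> \<in> carrier U\<close> by blast
    have "range (\<lambda>n. Q.cl (\<lambda>_. x n)) \<subseteq> B" using c x(1) by auto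
    with x(2) that B show ?thesis by blast
  qed
  then show "B = carrier U" using B.subset by blast
qed auto

text \<open>Equality on generators extends to the dense image of the free algebra, and the norm
  bounds provide continuity. The constants are arbitrary because the map out of the function algebra
  of a permutation group comes with a bound that may exceed 1.\<close>

lemma hom_eqI:
  fixes B :: "('b, 'n) cstar_algebra_scheme"
  assumes B: "cstar_algebra B"
    and g: "g \<in> star_hom U B" "\<And>\<xi>. \<xi> \<in> carrier U \<Longrightarrow> cnorm B (g \<xi>) \<le> K * cnorm U \<xi>"
    and h: "h \<in> star_hom U B" "\<And>\<xi>. \<xi> \<in> carrier U \<Longrightarrow> cnorm B (h \<xi>) \<le> L * cnorm U \<xi>"
    and eq: "\<And>x. x \<in> S \<Longrightarrow> g (gen x) = h (gen x)" and \<xi>: "\<xi> \<in> carrier U"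
  shows "g \<xi> = h \<xi>"
proof -
  interpret B: cstar_algebra B by fact
  interpret g: star_homomorphism U B g by unfold_locales fact
  interpret h: star_homomorphism U B h by unfold_locales fact
  have "(\<lambda>f. g (Q.cl (\<lambda>_. f))) \<in> star_hom F B" "(\<lambda>f. h (Q.cl (\<lambda>_. f))) \<in> star_hom F B"
    using star_hom_comp[OF const_hom] g(1) h(1) by auto
  then have c: "g (Q.cl (\<lambda>_. f)) = h (Q.cl (\<lambda>_. f))" if "f \<in> carrier F" for f
    by (rule free_hom_eqI[OF B.star_algebra_axioms _ _ _ that]) (use eq in \<open>simp add: gen_cl\<close>)
  obtain x where x: "\<And>n. x n \<in> carrier F" "U.converges (\<lambda>n. Q.cl (\<lambda>_. x n)) \<xi>"
    using U_cases \<xi> by blast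
  have conv: "B.converges (\<lambda>n. f (Q.cl (\<lambda>_. x n))) (f \<xi>)"
    if f: "f \<in> star_hom U B" "\<And>\<xi>. \<xi> \<in> carrier U \<Longrightarrow> cnorm B (f \<xi>) \<le> M * cnorm U \<xi>" for f M
  proof -
    interpret f: star_homomorphism U B f by unfold_locales fact
    show ?thesis
    proof (rule tendsto_0_le[OF tendsto_mult_right_zero[OF x(2), of M]])
      show "cnorm B (f (Q.cl (\<lambda>_. x n)) \<ominus>\<^bsub>B\<^esub> f \<xi>) \<le> M * cnorm U (Q.cl (\<lambda>_. x n) \<ominus>\<^bsub>U\<^esub> \<xi>)" for n
        using f(2)[of "Q.cl (\<lambda>_. x n) \<ominus>\<^bsub>U\<^esub> \<xi>"] x(1) \<xi> by (simp add: f.hom_minus)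
    qed (use x(1) \<xi> in simp)
  qed
  show ?thesis
    by (rule B.converges_unique[OF _ _ _ conv[OF g]]) (use conv[OF h] x(1) \<xi> c in auto)
qed

end

text \<open>The seminorm of a generator is the norm of its class in a completion, where the
  relations hold as equations; it is enough to bound solutions of the relations in
  C*-algebras.\<close>

lemma presentationI:
  fixes S :: "'g set"
  assumes R: "R \<subseteq> carrier (free_star_algebra S) \<times> carrier (free_star_algebra S)"
    and le: "\<And>(B :: (nat \<Rightarrow> 'g word \<Rightarrow> complex) set cstar_algebra) u x.
      cstar_algebra B \<Longrightarrow> satisfies S R B u \<Longrightarrow> x \<in> S \<Longrightarrow> cnorm B (u x) \<le> 1"
  shows "presentation S R"
proof
  fix p x assume p: "compatible S R p" and x: "x \<in> S"
  have sn: "cstar_seminorm (free_star_algebra S) p" using p by (simp add: compatible_def)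
  interpret F: cstar_seminormed "free_star_algebra S" p by (rule seminormed_free[OF sn])
  have "cnorm F.C (F.cl (\<lambda>_. free_gen x)) \<le> 1"
    using le[OF F.cstar_algebra_C] satisfies_completion_iff[OF sn R] p x by blast
  then show "p (free_gen x) \<le> 1" using x by simp
qed (rule R)

section \<open>Positivity, GNS seminorms and tensor products\<close>

section \<open>Positive functionals\<close>

text \<open>Iteration of the square inequality gives
  \<open>(a 0 / c)^(2^n) \<le> a n / c \<le> (K / c) * r^(2^n)\<close>. If \<open>a 0 / c\<close>
  exceeded \<open>r\<close>, the ratio of the outer terms would be unbounded; the constant
  \<open>K\<close> is lost in the limit.\<close>

lemma dyadic_bound:
  fixes a :: "nat \<Rightarrow> real"
  assumes "0 \<le> c" "0 \<le> r" and sq: "\<And>n. (a n)\<^sup>2 \<le> c * a (Suc n)" and le: "\<And>n. a n \<le> K * r ^ (2 ^ n)"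
  shows "a 0 \<le> c * r"
proof (cases "c = 0")
  case True
  with sq[of 0] show ?thesis by simp
next
  case False
  with assms have c: "0 < c" by simp
  show ?thesis
  proof (rule ccontr)
    assume "\<not> a 0 \<le> c * r"
    then have b0: "a 0 / c > r" using c by (simp add: field_simps)
    have pow: "a n / c \<ge> (a 0 / c) ^ (2 ^ n)" for n
    proof (induction n)
      case (Suc n)
      have "(a 0 / c) ^ (2 ^ Suc n) = ((a 0 / c) ^ (2 ^ n))\<^sup>2"
        by (simp add: power_mult[symmetric] mult.commute)
      also have "\<dots> \<le> (a n / c)\<^sup>2"
        using Suc b0 assms(2) by (intro power_mono) auto
      also have "\<dots> \<le> a (Suc n) / c"
        using sq[of n] c by (simp add: power2_eq_square field_simps)
      finally show ?case .
    qed simp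
    have bound: "(a 0 / c) ^ (2 ^ n) \<le> K / c * r ^ (2 ^ n)" for n
    proof -
      have "a n / c \<le> K * r ^ (2 ^ n) / c" using le[of n] c by (intro divide_right_mono) auto
      with pow[of n] show ?thesis by simp
    qed
    show False
    proof (cases "r = 0")
      case True
      then show False using bound[of 0] b0 c by simp
    next
      case False
      then have r: "0 < r" using assms by simp
      define t where "t = a 0 / c / r"
      have t: "t > 1" using b0 r c by (simp add: t_def field_simps)
      have tr: "a 0 / c = t * r" using r by (simp add: t_def)
      have "t ^ (2 ^ n) \<le> K / c" for n
        by (rule mult_right_le_imp_le[of _ "r ^ (2 ^ n)"])
           (use bound[of n, unfolded tr power_mult_distrib] r in simp_all)
      moreover obtain m where "K / c < t ^ m" using t real_arch_pow by blast
      moreover have "t ^ m \<le> t ^ (2 ^ m)" using t by (intro power_increasing) (auto simp: less_imp_le)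
      ultimately show False by (meson linorder_not_le order_trans)
    qed
  qed
qed

locale positive_functional = star_algebra A for A :: "('a, 'm) star_algebra_scheme" (structure) +
  fixes \<omega> :: "'a \<Rightarrow> complex"
  assumes f_add: "\<lbrakk>x \<in> carrier A; y \<in> carrier A\<rbrakk> \<Longrightarrow> \<omega> (x \<oplus> y) = \<omega> x + \<omega> y"
    and f_smult: "x \<in> carrier A \<Longrightarrow> \<omega> (c \<odot> x) = c * \<omega> x"
    and f_pos: "x \<in> carrier A \<Longrightarrow> Im (\<omega> (star A x \<otimes> x)) = 0 \<and> 0 \<le> Re (\<omega> (star A x \<otimes> x))"
begin

definition ip :: "'a \<Rightarrow> 'a \<Rightarrow> complex" where "ip x y = \<omega> (star A x \<otimes> y)"
definition nrm :: "'a \<Rightarrow> real" where "nrm x = sqrt (Re (ip x x))"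

lemma f_zero [simp]: "\<omega> \<zero> = 0"
  using f_smult[of \<zero> 0] by simp

lemma ip_add_right: "\<lbrakk>x \<in> carrier A; y \<in> carrier A; z \<in> carrier A\<rbrakk> \<Longrightarrow> ip x (y \<oplus> z) = ip x y + ip x z"
  by (simp add: ip_def r_distr f_add)

lemma ip_add_left: "\<lbrakk>x \<in> carrier A; y \<in> carrier A; z \<in> carrier A\<rbrakk> \<Longrightarrow> ip (x \<oplus> y) z = ip x z + ip y z"
  by (simp add: ip_def star_add l_distr f_add)

lemma ip_smult_right: "\<lbrakk>x \<in> carrier A; y \<in> carrier A\<rbrakk> \<Longrightarrow> ip x (c \<odot> y) = c * ip x y"
  by (simp add: ip_def smult_mult_right f_smult)

lemma ip_smult_left: "\<lbrakk>x \<in> carrier A; y \<in> carrier A\<rbrakk> \<Longrightarrow> ip (c \<odot> x) y = cnj c * ip x y"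
  by (simp add: ip_def star_smult smult_mult_left f_smult)

lemmas ip_lin = ip_add_right ip_add_left ip_smult_right ip_smult_left

lemma ip_pos: "x \<in> carrier A \<Longrightarrow> Im (ip x x) = 0" "x \<in> carrier A \<Longrightarrow> 0 \<le> Re (ip x x)"
  using f_pos by (auto simp: ip_def)

text \<open>Polarization: reality of the form at \<open>x \<oplus> y\<close> fixes the imaginary
  part of \<open>ip y x\<close>, reality at \<open>x \<oplus> \<i> \<odot> y\<close> its real
  part.\<close>

lemma ip_herm: assumes "x \<in> carrier A" "y \<in> carrier A" shows "ip y x = cnj (ip x y)"
proof -
  have "Im (ip (x \<oplus> y) (x \<oplus> y)) = 0" "Im (ip (x \<oplus> \<i> \<odot> y) (x \<oplus> \<i> \<odot> y)) = 0"
    by (rule ip_pos; use assms in simp)+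
  then show ?thesis
    using assms ip_pos(1)[of x] ip_pos(1)[of y] by (simp add: ip_lin complex_eq_iff)
qed

lemma cauchy_schwarz_sq:
  assumes "x \<in> carrier A" "y \<in> carrier A"
  shows "(cmod (ip x y))\<^sup>2 \<le> Re (ip x x) * Re (ip y y)"
proof -
  let ?a = "ip x y" and ?p = "Re (ip x x)" and ?b = "Re (ip y y)"
  \<comment> \<open>Positivity of the form at \<open>x\<close> minus \<open>t * cnj (ip x y)\<close>
    times \<open>y\<close>, for real \<open>t\<close>.\<close>
  have key: "0 \<le> ?p - 2 * t * (cmod ?a)\<^sup>2 + t\<^sup>2 * (cmod ?a)\<^sup>2 * ?b" for t :: real
  proof -
    let ?c = "- (of_real t * cnj ?a)"
    have "0 \<le> Re (ip (x \<oplus> ?c \<odot> y) (x \<oplus> ?c \<odot> y))"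
      by (rule ip_pos) (use assms in simp)
    also have "ip (x \<oplus> ?c \<odot> y) (x \<oplus> ?c \<odot> y) =
        ip x x + ?c * ?a + cnj ?c * cnj ?a + cnj ?c * ?c * ip y y"
      using assms ip_herm[OF assms] by (simp add: ip_lin algebra_simps)
    also have "Re \<dots> = ?p - 2 * t * (cmod ?a)\<^sup>2 + t\<^sup>2 * (cmod ?a)\<^sup>2 * ?b"
      using ip_pos(1)[OF assms(2)] unfolding cmod_power2
      by (simp add: power2_eq_square algebra_simps)
    finally show ?thesis .
  qed
  show ?thesis
  proof (cases "?b = 0")
    case True
    have "cmod ?a = 0"
    proof (rule ccontr)
      assume "cmod ?a \<noteq> 0"
      \<comment> \<open>For \<open>?b = 0\<close> the inequality is linear in \<open>t\<close>, and
        this value of \<open>t\<close> turns it into \<open>0 \<le> - ?p - 2\<close>.\<close>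
      with key[of "(?p + 1) / (cmod ?a)\<^sup>2"] True ip_pos(2)[OF assms(1)] show False
        by (simp add: field_simps power2_eq_square)
    qed
    with True show ?thesis by simp
  next
    case False
    then have b: "0 < ?b" using ip_pos(2)[OF assms(2)] by simp
    \<comment> \<open>\<open>1 / ?b\<close> minimizes the quadratic polynomial in
      \<open>t\<close>.\<close>
    have "0 \<le> ?p - 2 * (1 / ?b) * (cmod ?a)\<^sup>2 + (1 / ?b)\<^sup>2 * (cmod ?a)\<^sup>2 * ?b" by (rule key)
    also have "\<dots> = ?p - (cmod ?a)\<^sup>2 / ?b" using b by (simp add: power2_eq_square field_simps)
    finally show ?thesis using b by (simp add: field_simps)
  qed
qed

lemma nrm_nonneg: "x \<in> carrier A \<Longrightarrow> 0 \<le> nrm x"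
  by (simp add: nrm_def ip_pos)

lemma nrm_sq: "x \<in> carrier A \<Longrightarrow> (nrm x)\<^sup>2 = Re (ip x x)"
  by (simp add: nrm_def ip_pos)

lemma cauchy_schwarz:
  assumes "x \<in> carrier A" "y \<in> carrier A" shows "cmod (ip x y) \<le> nrm x * nrm y"
  using cauchy_schwarz_sq[OF assms] by (simp add: nrm_def real_le_rsqrt flip: real_sqrt_mult)

lemma nrm_add:
  assumes "x \<in> carrier A" "y \<in> carrier A" shows "nrm (x \<oplus> y) \<le> nrm x + nrm y"
proof (rule power2_le_imp_le)
  have "(nrm (x \<oplus> y))\<^sup>2 = (nrm x)\<^sup>2 + 2 * Re (ip x y) + (nrm y)\<^sup>2"
    using assms ip_herm[OF assms] by (simp add: nrm_sq ip_lin)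
  also have "\<dots> \<le> (nrm x)\<^sup>2 + 2 * (nrm x * nrm y) + (nrm y)\<^sup>2"
    using cauchy_schwarz[OF assms] complex_Re_le_cmod[of "ip x y"] by simp
  finally show "(nrm (x \<oplus> y))\<^sup>2 \<le> (nrm x + nrm y)\<^sup>2" by (simp add: power2_sum)
qed (use assms nrm_nonneg in simp)

lemma nrm_smult: assumes "x \<in> carrier A" shows "nrm (c \<odot> x) = cmod c * nrm x"
proof -
  have "ip (c \<odot> x) (c \<odot> x) = of_real ((cmod c)\<^sup>2) * ip x x"
    using assms by (simp add: ip_lin complex_norm_square mult_ac del: of_real_power)
  then show ?thesis by (simp add: nrm_def real_sqrt_mult)
qed

text \<open>The double sum is the form evaluated at the linear combination of the \<open>b i\<close>
  with coefficients \<open>d i\<close>.\<close>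

lemma gram_positive:
  assumes "finite I" "b \<in> I \<rightarrow> carrier A"
  shows "Im (\<Sum>i\<in>I. \<Sum>j\<in>I. cnj (d i) * d j * ip (b i) (b j)) = 0 \<and>
    0 \<le> Re (\<Sum>i\<in>I. \<Sum>j\<in>I. cnj (d i) * d j * ip (b i) (b j))"
proof -
  let ?x = "\<Oplus>i\<in>I. d i \<odot> b i"
  have x: "?x \<in> carrier A" using assms by (auto simp: Pi_iff)
  have right: "ip y ?x = (\<Sum>j\<in>I. d j * ip y (b j))" if "y \<in> carrier A" for y
    using assms that
    by (induction I rule: finite_induct) (auto simp: Pi_iff ip_lin, simp add: ip_def)
  have "ip ?x y = (\<Sum>i\<in>I. cnj (d i) * ip (b i) y)" if "y \<in> carrier A" for y
    using assms that
    by (induction I rule: finite_induct) (auto simp: Pi_iff ip_lin, simp add: ip_def)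
  from this[OF x] have "ip ?x ?x = (\<Sum>i\<in>I. \<Sum>j\<in>I. cnj (d i) * d j * ip (b i) (b j))"
    using assms by (auto simp: right sum_distrib_left mult.assoc Pi_iff intro!: sum.cong)
  with ip_pos[OF x] show ?thesis by simp
qed

text \<open>By Gram-Schmidt orthogonalization of the \<open>a i\<close>, which avoids square roots of matrices.\<close>

lemma schur_product:
  fixes N :: "'i \<Rightarrow> 'i \<Rightarrow> complex"
  assumes "finite I" "a \<in> I \<rightarrow> carrier A"
    and N: "\<And>J d. J \<subseteq> I \<Longrightarrow> Im (\<Sum>i\<in>J. \<Sum>j\<in>J. cnj (d i) * d j * N i j) = 0 \<and>
      0 \<le> Re (\<Sum>i\<in>J. \<Sum>j\<in>J. cnj (d i) * d j * N i j)"
  shows "Im (\<Sum>i\<in>I. \<Sum>j\<in>I. cnj (c i) * c j * (ip (a i) (a j) * N i j)) = 0 \<and>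
    0 \<le> Re (\<Sum>i\<in>I. \<Sum>j\<in>I. cnj (c i) * c j * (ip (a i) (a j) * N i j))"
  using assms
proof (induction I arbitrary: a rule: finite_induct)
  case (insert k I)
  have ak [simp]: "a k \<in> carrier A" and ai [simp]: "\<And>i. i \<in> I \<Longrightarrow> a i \<in> carrier A"
    using insert.prems by auto
  define m where "m = ip (a k) (a k)"
  \<comment> \<open>For \<open>m = 0\<close> the quotient is 0; Cauchy-Schwarz then makes
    \<open>ip (a k) (a i)\<close> vanish as well, so \<open>z\<close> below holds in both
    cases.\<close>
  define l where "l i = ip (a k) (a i) / m" for i
  define a' where "a' i = a i \<oplus> (- l i) \<odot> a k" for i
  have mre: "m = of_real (Re m)" "0 \<le> Re m"
    using ip_pos[OF ak] by (auto simp: m_def complex_eq_iff)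
  then have mcnj: "cnj m = m" by (metis complex_cnj_complex_of_real)
  have z: "ip (a k) (a i) = l i * m" if "i \<in> insert k I" for i
  proof (cases "m = 0")
    case True
    then have "Re (ip (a k) (a k)) = 0" by (simp add: m_def)
    then have "(cmod (ip (a k) (a i)))\<^sup>2 \<le> 0"
      using cauchy_schwarz_sq[of "a k" "a i"] that by auto
    with True show ?thesis by simp
  qed (simp add: l_def)
  have split: "ip (a i) (a j) = ip (a' i) (a' j) + cnj (l i) * l j * m"
    if "i \<in> insert k I" "j \<in> insert k I" for i j
  proof -
    have [simp]: "a i \<in> carrier A" "a j \<in> carrier A" using that by auto
    have "ip (a i) (a k) = cnj (l i) * m"
      using ip_herm[of "a k" "a i"] z[OF that(1)] mcnj by simp
    then show ?thesis
      using z[OF that(2)] by (simp add: a'_def ip_lin m_def[symmetric] algebra_simps)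
  qed
  have lk: "ip (a' i) (a' j) = 0" if "i = k \<or> j = k" "i \<in> insert k I" "j \<in> insert k I" for i j
  proof (cases "m = 0")
    case True
    have "ip (a i) (a j) = 0"
      using that z[of i] z[of j] ip_herm[of "a k" "a i"] True by auto
    then show ?thesis using split[OF that(2,3)] True by simp
  next
    case False
    then have 1: "l k = 1" by (simp add: l_def m_def)
    show ?thesis
      using that(1)
    proof
      assume "i = k"
      with split[OF that(2,3)] z[OF that(3)] 1 show ?thesis by simp
    next
      assume "j = k"
      with split[OF that(2,3)] z[OF that(2)] 1 ip_herm[of "a k" "a i"] that(2) mcnj show ?thesis by auto
    qed
  qed
  let ?I = "insert k I"
  \<comment> \<open>The Gram matrix splits into that of \<open>a'\<close>, whose row and column
    \<open>k\<close> vanish, and the rank one part \<open>cnj (l i) * l j * m\<close>. The induction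
    hypothesis covers the first; positivity of \<open>N\<close> with coefficients
    \<open>c i * l i\<close> covers the second.\<close>
  have "(\<Sum>i\<in>?I. \<Sum>j\<in>?I. cnj (c i) * c j * (ip (a i) (a j) * N i j)) =
      (\<Sum>i\<in>?I. \<Sum>j\<in>?I. cnj (c i) * c j * (ip (a' i) (a' j) * N i j)) +
      (\<Sum>i\<in>?I. \<Sum>j\<in>?I. m * (cnj (c i * l i) * (c j * l j) * N i j))"
    unfolding sum.distrib[symmetric]
    by (intro sum.cong HOL.refl) (simp add: split algebra_simps)
  also have "(\<Sum>i\<in>?I. \<Sum>j\<in>?I. m * (cnj (c i * l i) * (c j * l j) * N i j)) =
      m * (\<Sum>i\<in>?I. \<Sum>j\<in>?I. cnj (c i * l i) * (c j * l j) * N i j)"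
    by (simp only: sum_distrib_left)
  also have "(\<Sum>i\<in>?I. \<Sum>j\<in>?I. cnj (c i) * c j * (ip (a' i) (a' j) * N i j)) =
      (\<Sum>i\<in>I. \<Sum>j\<in>I. cnj (c i) * c j * (ip (a' i) (a' j) * N i j))"
  proof -
    have "(\<Sum>j\<in>?I. cnj (c i) * c j * (ip (a' i) (a' j) * N i j)) =
        (\<Sum>j\<in>I. cnj (c i) * c j * (ip (a' i) (a' j) * N i j))" if "i \<in> ?I" for i
      using insert.hyps lk[of i k] that by simp
    then have "(\<Sum>i\<in>?I. \<Sum>j\<in>?I. cnj (c i) * c j * (ip (a' i) (a' j) * N i j)) =
        (\<Sum>i\<in>?I. \<Sum>j\<in>I. cnj (c i) * c j * (ip (a' i) (a' j) * N i j))"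
      by (rule sum.cong[OF HOL.refl])
    then show ?thesis
      using insert.hyps lk[of k] by simp
  qed
  finally have eq: "(\<Sum>i\<in>?I. \<Sum>j\<in>?I. cnj (c i) * c j * (ip (a i) (a j) * N i j)) =
      (\<Sum>i\<in>I. \<Sum>j\<in>I. cnj (c i) * c j * (ip (a' i) (a' j) * N i j)) +
      m * (\<Sum>i\<in>?I. \<Sum>j\<in>?I. cnj (c i * l i) * (c j * l j) * N i j)" .
  have IH: "Im (\<Sum>i\<in>I. \<Sum>j\<in>I. cnj (c i) * c j * (ip (a' i) (a' j) * N i j)) = 0 \<and>
    0 \<le> Re (\<Sum>i\<in>I. \<Sum>j\<in>I. cnj (c i) * c j * (ip (a' i) (a' j) * N i j))"
    by (rule insert.IH) (use insert.prems in \<open>auto simp: a'_def intro: subset_insertI2\<close>)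
  define w where "w = (\<Sum>i\<in>?I. \<Sum>j\<in>?I. cnj (c i * l i) * (c j * l j) * N i j)"
  have w: "Im w = 0" "0 \<le> Re w" using insert.prems(2)[of ?I "\<lambda>i. c i * l i"] by (auto simp: w_def)
  have "Re (m * w) = Re m * Re w" "Im (m * w) = 0"
    using w mre by (metis Im_complex_of_real Re_complex_of_real mult_zero_left mult_zero_right
      diff_zero times_complex.sel add_0)+
  with IH w mre(2) show ?case unfolding eq w_def[symmetric] by simp
qed simp

text \<open>An elementary spectral radius argument. For \<open>y n = (t* t)^(2^n)\<close>
  Cauchy-Schwarz bounds the square of \<open>ip s (y n s)\<close> by \<open>ip s s\<close> times the
  next such value, while \<open>N\<close> bounds these values by a constant times
  \<open>r^(2^n)\<close>, where \<open>r\<close> is \<open>N\<close> at \<open>t* t\<close>;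
  \<open>dyadic_bound\<close> removes the constant.\<close>

lemma left_mult_bound:
  fixes N :: "'a \<Rightarrow> real"
  assumes N: "\<And>x. x \<in> carrier A \<Longrightarrow> 0 \<le> N x"
      "\<And>x y. x \<in> carrier A \<Longrightarrow> y \<in> carrier A \<Longrightarrow> N (x \<otimes> y) \<le> N x * N y"
      "\<And>x. x \<in> carrier A \<Longrightarrow> cmod (\<omega> x) \<le> N x"
    and ts: "t \<in> carrier A" "s \<in> carrier A"
  shows "nrm (t \<otimes> s) \<le> sqrt (N (star A t \<otimes> t)) * nrm s"
proof -
  define y where "y = rec_nat (star A t \<otimes> t) (\<lambda>_ z. z \<otimes> z)"
  have y0: "y 0 = star A t \<otimes> t" and ySuc: "y (Suc n) = y n \<otimes> y n" for n
    by (simp_all add: y_def)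
  have yc [simp]: "y n \<in> carrier A" for n by (induction n) (use ts in \<open>auto simp: y0 ySuc\<close>)
  have ys: "star A (y n) = y n" for n
    by (induction n) (use ts in \<open>auto simp: y0 ySuc star_mult\<close>)
  let ?r = "N (star A t \<otimes> t)"
  have r: "0 \<le> ?r" using N(1) ts by simp
  have Ny: "N (y n) \<le> ?r ^ (2 ^ n)" for n
  proof (induction n)
    case (Suc n)
    have "N (y (Suc n)) \<le> N (y n) * N (y n)" using N(2) by (simp add: ySuc)
    also have "\<dots> \<le> ?r ^ (2 ^ n) * ?r ^ (2 ^ n)" using Suc N(1) r by (intro mult_mono) auto
    finally show ?case by (simp add: power_add[symmetric] mult_2)
  qed (simp add: y0)
  define a where "a n = Re (ip s (y n \<otimes> s))" for n
  define K where "K = N (star A s) * N s"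
  have "a 0 \<le> Re (ip s s) * ?r"
  proof (rule dyadic_bound[of _ _ a K])
    fix n
    have "(a n)\<^sup>2 \<le> (cmod (ip s (y n \<otimes> s)))\<^sup>2"
      unfolding a_def by (rule abs_le_square_iff[THEN iffD1]) (simp add: abs_Re_le_cmod)
    also have "\<dots> \<le> Re (ip s s) * Re (ip (y n \<otimes> s) (y n \<otimes> s))"
      by (rule cauchy_schwarz_sq) (use ts in auto)
    also have "ip (y n \<otimes> s) (y n \<otimes> s) = ip s (y (Suc n) \<otimes> s)"
      using ts by (simp add: ip_def star_mult ys ySuc m_assoc)
    finally show "(a n)\<^sup>2 \<le> Re (ip s s) * a (Suc n)" by (simp add: a_def)
    have "a n \<le> N (star A s \<otimes> (y n \<otimes> s))"
      unfolding a_def ip_def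
      by (rule order_trans[OF complex_Re_le_cmod]) (use ts N(3) in simp)
    also have "\<dots> \<le> N (star A s) * (N (y n) * N s)"
      by (rule order_trans[OF N(2)]) (use ts N in \<open>auto intro!: mult_left_mono\<close>)
    also have "\<dots> \<le> N (star A s) * (?r ^ (2 ^ n) * N s)"
      using Ny[of n] N(1) ts by (intro mult_left_mono mult_right_mono) auto
    finally show "a n \<le> K * ?r ^ (2 ^ n)" by (simp add: K_def mult_ac)
  qed (use ts ip_pos r in auto)
  also have "a 0 = Re (ip (t \<otimes> s) (t \<otimes> s))"
    using ts by (simp add: a_def y0 ip_def star_mult m_assoc)
  finally show ?thesis
    unfolding nrm_def by (simp add: mult.commute real_sqrt_mult[symmetric])
qed

end

subsection \<open>The C*-seminorm of a family of positive functionals\<close>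

text \<open>\<open>S t\<close> is the supremum of the operator norms of left multiplication by
  \<open>t\<close> on the pre-Hilbert spaces of the functionals in \<open>W\<close>. It is finite by
  \<open>left_mult_bound\<close>, and the C*-identity follows as for operators, from \<open>nrm (t
  \<otimes> s)^2 = ip s (star A t \<otimes> t \<otimes> s)\<close> and Cauchy-Schwarz.\<close>

lemma (in star_algebra) gns_seminorm:
  fixes N :: "'a \<Rightarrow> real" and W :: "('a \<Rightarrow> complex) set"
  assumes W: "\<And>\<omega>. \<omega> \<in> W \<Longrightarrow> positive_functional A \<omega>"
    and N: "\<And>x. x \<in> carrier A \<Longrightarrow> 0 \<le> N x"
      "\<And>x y. x \<in> carrier A \<Longrightarrow> y \<in> carrier A \<Longrightarrow> N (x \<otimes> y) \<le> N x * N y"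
      "\<And>\<omega> x. \<omega> \<in> W \<Longrightarrow> x \<in> carrier A \<Longrightarrow> cmod (\<omega> x) \<le> N x"
  defines "S \<equiv> \<lambda>t. Sup (insert 0 {sqrt (Re (\<omega> (star A (t \<otimes> s) \<otimes> (t \<otimes> s)))) | \<omega> s.
     \<omega> \<in> W \<and> s \<in> carrier A \<and> \<omega> (star A s \<otimes> s) = 1})"
  shows "cstar_seminorm A S"
    and "\<And>t \<omega> s. \<lbrakk>t \<in> carrier A; s \<in> carrier A; \<omega> \<in> W; \<omega> (star A s \<otimes> s) = 1\<rbrakk> \<Longrightarrow>
      sqrt (Re (\<omega> (star A (t \<otimes> s) \<otimes> (t \<otimes> s)))) \<le> S t"
    and "\<And>t b. 0 \<le> b \<Longrightarrow> (\<And>\<omega> s. \<lbrakk>s \<in> carrier A; \<omega> \<in> W; \<omega> (star A s \<otimes> s) = 1\<rbrakk> \<Longrightarrow>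
      sqrt (Re (\<omega> (star A (t \<otimes> s) \<otimes> (t \<otimes> s)))) \<le> b) \<Longrightarrow> S t \<le> b"
proof -
  let ?n = "positive_functional.nrm A"
  note pf = W
  have nrm: "?n \<omega> x = sqrt (Re (\<omega> (star A x \<otimes> x)))" if "\<omega> \<in> W" for \<omega> x
    by (simp add: positive_functional.nrm_def[OF W[OF that]] positive_functional.ip_def[OF W[OF that]])
  have bound: "?n \<omega> (t \<otimes> s) \<le> sqrt (N (star A t \<otimes> t)) * ?n \<omega> s"
    if "\<omega> \<in> W" "t \<in> carrier A" "s \<in> carrier A" for \<omega> t s
    by (rule positive_functional.left_mult_bound[OF W[OF that(1)]]) (use N that in auto)
  have one: "?n \<omega> s = 1" if "\<omega> \<in> W" "\<omega> (star A s \<otimes> s) = 1" for \<omega> s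
    using that nrm by simp
  have bdd: "bdd_above (insert 0 {sqrt (Re (\<omega> (star A (t \<otimes> s) \<otimes> (t \<otimes> s)))) | \<omega> s.
     \<omega> \<in> W \<and> s \<in> carrier A \<and> \<omega> (star A s \<otimes> s) = 1})" if "t \<in> carrier A" for t
  proof (rule bdd_aboveI[of _ "sqrt (N (star A t \<otimes> t))"])
    fix x assume "x \<in> insert 0 {sqrt (Re (\<omega> (star A (t \<otimes> s) \<otimes> (t \<otimes> s)))) | \<omega> s.
     \<omega> \<in> W \<and> s \<in> carrier A \<and> \<omega> (star A s \<otimes> s) = 1}"
    then consider "x = 0" | \<omega> s where "\<omega> \<in> W" "s \<in> carrier A" "\<omega> (star A s \<otimes> s) = 1"
      "x = sqrt (Re (\<omega> (star A (t \<otimes> s) \<otimes> (t \<otimes> s))))" by blast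
    then show "x \<le> sqrt (N (star A t \<otimes> t))"
    proof cases
      case 2
      then show ?thesis using bound[of \<omega> t s] that one[of \<omega> s] nrm[of \<omega>] by simp
    qed (use N(1) that in simp)
  qed
  show upper: "sqrt (Re (\<omega> (star A (t \<otimes> s) \<otimes> (t \<otimes> s)))) \<le> S t"
    if "t \<in> carrier A" "s \<in> carrier A" "\<omega> \<in> W" "\<omega> (star A s \<otimes> s) = 1" for t s \<omega>
    unfolding S_def by (rule cSup_upper[OF _ bdd]) (use that in auto)
  show least: "S t \<le> b"
    if "0 \<le> b" "\<And>\<omega> s. \<lbrakk>s \<in> carrier A; \<omega> \<in> W; \<omega> (star A s \<otimes> s) = 1\<rbrakk> \<Longrightarrow>
      sqrt (Re (\<omega> (star A (t \<otimes> s) \<otimes> (t \<otimes> s)))) \<le> b" for t b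
    unfolding S_def by (rule cSup_least) (use that in auto)
  have S0: "0 \<le> S t" if "t \<in> carrier A" for t
    unfolding S_def by (rule cSup_upper[OF _ bdd[OF that]]) simp
  \<comment> \<open>The supremum runs over unit vectors. A vector of positive length is scaled; for
    \<open>s\<close> of length 0 the a priori bound shows that \<open>t \<otimes> s\<close> has
    length 0 too.\<close>
  have op: "?n \<omega> (t \<otimes> s) \<le> S t * ?n \<omega> s"
    if \<omega>: "\<omega> \<in> W" and t: "t \<in> carrier A" and s: "s \<in> carrier A" for \<omega> t s
  proof -
    interpret positive_functional A \<omega> by (rule W[OF \<omega>])
    show ?thesis
    proof (cases "nrm s = 0")
      case True
      then show ?thesis using bound[OF \<omega> t s] by simp
    next
      case False
      then have pos: "0 < nrm s" using nrm_nonneg[OF s] by simp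
      define c where "c = complex_of_real (1 / nrm s)"
      have "nrm (c \<odot> s) = 1" using pos s by (simp add: nrm_smult c_def norm_divide)
      then have "Re (ip (c \<odot> s) (c \<odot> s)) = 1" using nrm_sq[of "c \<odot> s"] s by simp
      then have "\<omega> (star A (c \<odot> s) \<otimes> (c \<odot> s)) = 1"
        using ip_pos(1)[of "c \<odot> s"] s by (simp add: ip_def complex_eq_iff)
      from upper[OF t _ \<omega> this] have "nrm (t \<otimes> (c \<odot> s)) \<le> S t" using s by (simp add: nrm_def ip_def)
      also have "nrm (t \<otimes> (c \<odot> s)) = nrm (t \<otimes> s) / nrm s"
        using s t pos by (simp add: smult_mult_right nrm_smult c_def norm_divide)
      finally show ?thesis using pos by (simp add: field_simps)
    qed
  qed
  have leastn: "S t \<le> b" if "0 \<le> b"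
    "\<And>\<omega> s. \<lbrakk>s \<in> carrier A; \<omega> \<in> W; ?n \<omega> s = 1\<rbrakk> \<Longrightarrow> ?n \<omega> (t \<otimes> s) \<le> b" for t b
  proof (rule least[OF that(1)])
    fix \<omega> s assume *: "s \<in> carrier A" "\<omega> \<in> W" "\<omega> (star A s \<otimes> s) = 1"
    from that(2)[OF *(1,2) one[OF *(2,3)]]
    show "sqrt (Re (\<omega> (star A (t \<otimes> s) \<otimes> (t \<otimes> s)))) \<le> b" by (simp only: nrm[OF *(2)])
  qed
  have smult_le: "S (c \<odot> t) \<le> cmod c * S t" if "t \<in> carrier A" for c t
  proof (rule leastn)
    fix \<omega> s assume *: "s \<in> carrier A" "\<omega> \<in> W" "?n \<omega> s = 1"
    then show "?n \<omega> (c \<odot> t \<otimes> s) \<le> cmod c * S t"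
      using op[of \<omega> t s] that by (simp add: smult_mult_left positive_functional.nrm_smult[OF pf] mult_left_mono)
  qed (use that S0 in simp)
  have mult: "S (x \<otimes> y) \<le> S x * S y" if "x \<in> carrier A" "y \<in> carrier A" for x y
  proof (rule leastn)
    fix \<omega> s assume *: "s \<in> carrier A" "\<omega> \<in> W" "?n \<omega> s = 1"
    have "?n \<omega> (x \<otimes> y \<otimes> s) \<le> S x * ?n \<omega> (y \<otimes> s)"
      using op[of \<omega> x "y \<otimes> s"] that * by (simp add: m_assoc)
    also have "\<dots> \<le> S x * S y"
      using op[of \<omega> y s] that * S0 by (intro mult_left_mono) auto
    finally show "?n \<omega> (x \<otimes> y \<otimes> s) \<le> S x * S y" .
  qed (use that S0 in simp)
  have sq: "(S t)\<^sup>2 \<le> S (star A t \<otimes> t)" if t: "t \<in> carrier A" for t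
  proof -
    have "S t \<le> sqrt (S (star A t \<otimes> t))"
    proof (rule leastn)
      fix \<omega> s assume *: "s \<in> carrier A" "\<omega> \<in> W" "?n \<omega> s = 1"
      interpret positive_functional A \<omega> by (rule W[OF *(2)])
      have "(nrm (t \<otimes> s))\<^sup>2 = Re (ip s (star A t \<otimes> t \<otimes> s))"
        using t * by (simp add: nrm_sq ip_def star_mult m_assoc)
      also have "\<dots> \<le> nrm s * nrm (star A t \<otimes> t \<otimes> s)"
        by (rule order_trans[OF complex_Re_le_cmod cauchy_schwarz]) (use t * in auto)
      also have "\<dots> \<le> S (star A t \<otimes> t)"
        using op[of \<omega> "star A t \<otimes> t" s] t * by simp
      finally show "nrm (t \<otimes> s) \<le> sqrt (S (star A t \<otimes> t))" by (rule real_le_rsqrt)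
    qed (use t S0 in simp)
    then show ?thesis using S0 t by (simp add: real_le_rsqrt sqrt_ge_absD)
  qed
  \<comment> \<open>Cancel \<open>S t\<close> in \<open>(S t)^2 \<le> S (star A t) * S t\<close>, as
    for any C*-seminorm.\<close>
  have star_le: "S t \<le> S (star A t)" if t: "t \<in> carrier A" for t
  proof (cases "S t = 0")
    case False
    have "S t * S t \<le> S (star A t) * S t"
      using order_trans[OF sq[OF t] mult] t by (simp add: power2_eq_square)
    then show ?thesis using False S0[OF t] by simp
  qed (use S0 t in simp)
  show "cstar_seminorm A S"
    unfolding cstar_seminorm_def
  proof (intro conjI ballI allI)
    fix x c assume x: "x \<in> carrier A"
    show "0 \<le> S x" using S0 x by blast
    have "S (star A x) = S x" using star_le[OF x] star_le[of "star A x"] x by simp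
    then show "S (star A x \<otimes> x) = (S x)\<^sup>2"
      using sq[OF x] mult[of "star A x" x] x by (simp add: power2_eq_square)
    show "S (c \<odot> x) = cmod c * S x"
    proof (rule antisym[OF smult_le[OF x]])
      show "cmod c * S x \<le> S (c \<odot> x)"
      proof (cases "c = 0")
        case False
        have "S x = S (inverse c \<odot> (c \<odot> x))" using False x by simp
        also have "\<dots> \<le> cmod (inverse c) * S (c \<odot> x)" by (rule smult_le) (use x in simp)
        finally show ?thesis using False by (simp add: norm_inverse norm_divide field_simps)
      qed (use x S0 in simp)
    qed
  next
    fix x y assume xy: "x \<in> carrier A" "y \<in> carrier A"
    show "S (x \<oplus> y) \<le> S x + S y"
    proof (rule leastn)
      fix \<omega> s assume *: "s \<in> carrier A" "\<omega> \<in> W" "?n \<omega> s = 1"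
      have "?n \<omega> ((x \<oplus> y) \<otimes> s) \<le> ?n \<omega> (x \<otimes> s) + ?n \<omega> (y \<otimes> s)"
        using positive_functional.nrm_add[OF pf[OF *(2)], of "x \<otimes> s" "y \<otimes> s"] xy * by (simp add: l_distr)
      then show "?n \<omega> ((x \<oplus> y) \<otimes> s) \<le> S x + S y"
        using op[of \<omega> x s] op[of \<omega> y s] xy * by simp
    qed (use xy S0 in simp)
    show "S (x \<otimes> y) \<le> S x * S y" by (rule mult) (use xy in auto)
  qed
qed

section \<open>The minimal tensor product\<close>

lemma (in cstar_algebra) state_positive: "cstar_state A \<phi> \<Longrightarrow> positive_functional A \<phi>"
  by unfold_locales (auto simp: cstar_state_def)

locale cstar_pair = A: cstar_algebra A + B: cstar_algebra B
  for A :: "('a, 'm) cstar_algebra_scheme" and B :: "('b, 'n) cstar_algebra_scheme"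
begin

sublocale T: star_monoid "A \<times>\<times> B" "\<lambda>(a, b). (star A a, star B b)"
  rewrites "monoid_star_algebra (A \<times>\<times> B) (\<lambda>(a, b). (star A a, star B b)) \<equiv> formal_tensors A B"
proof -
  interpret monoid "A \<times>\<times> B" by (rule DirProd_monoid) unfold_locales
  show "star_monoid (A \<times>\<times> B) (\<lambda>(a, b). (star A a, star B b))"
    by unfold_locales (auto simp: DirProd_def A.star_mult B.star_mult)
qed (simp add: formal_tensors_def)

abbreviation FT :: "('a \<times> 'b \<Rightarrow> complex) star_algebra" where "FT \<equiv> formal_tensors A B"

lemma tensor_functional_lin: "tensor_functional \<phi> \<psi> = T.lin (\<lambda>(a, b). \<phi> a * \<psi> b)"
  by (auto simp: tensor_functional_def T.lin_def fun_eq_iff intro!: sum.cong)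

text \<open>The value at \<open>star FT t \<otimes> t\<close> is a quadratic form in the
  coefficients of \<open>t\<close>, whose matrix is the entrywise product of the Gram matrices of
  the first and of the second tensor legs.\<close>

lemma tensor_functional_positive:
  assumes "cstar_state A \<phi>" "cstar_state B \<psi>"
  shows "positive_functional FT (tensor_functional \<phi> \<psi>)"
proof -
  interpret f: positive_functional A \<phi> by (rule A.state_positive) fact
  interpret g: positive_functional B \<psi> by (rule B.state_positive) fact
  show ?thesis
  proof
    fix t assume t: "t \<in> carrier FT"
    have fin: "finite (T.supp t)" "T.supp t \<subseteq> carrier (A \<times>\<times> B)" using t by (auto simp: T.T_iff)
    have "tensor_functional \<phi> \<psi> (star FT t \<otimes>\<^bsub>FT\<^esub> t) =
      (\<Sum>z\<in>T.supp t. \<Sum>w\<in>T.supp t. cnj (t z) * t w * (f.ip (fst z) (fst w) * g.ip (snd z) (snd w)))"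
      unfolding tensor_functional_lin T.lin_star_mult[OF t t]
      by (intro sum.cong HOL.refl) (auto simp: f.ip_def g.ip_def split: prod.splits)
    moreover have "Im \<dots> = 0 \<and> 0 \<le> Re \<dots>"
    proof (rule f.schur_product)
      show "fst \<in> T.supp t \<rightarrow> carrier A" using fin by auto
      fix J d assume "J \<subseteq> T.supp t"
      then show "Im (\<Sum>i\<in>J. \<Sum>j\<in>J. cnj (d i) * d j * g.ip (snd i) (snd j)) = 0 \<and>
           0 \<le> Re (\<Sum>i\<in>J. \<Sum>j\<in>J. cnj (d i) * d j * g.ip (snd i) (snd j))"
        using fin by (intro g.gram_positive) (auto intro: finite_subset)
    qed (use fin in simp)
    ultimately show "Im (tensor_functional \<phi> \<psi> (star FT t \<otimes>\<^bsub>FT\<^esub> t)) = 0 \<and>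
        0 \<le> Re (tensor_functional \<phi> \<psi> (star FT t \<otimes>\<^bsub>FT\<^esub> t))" by simp
  qed (simp_all add: tensor_functional_lin T.lin_add T.lin_smult)
qed

abbreviation W :: "(('a \<times> 'b \<Rightarrow> complex) \<Rightarrow> complex) set" where
  "W \<equiv> {tensor_functional \<phi> \<psi> | \<phi> \<psi>. cstar_state A \<phi> \<and> cstar_state B \<psi>}"

lemma spatial_eq: "spatial_seminorm A B t =
   Sup (insert 0 {sqrt (Re (\<omega> (star FT (t \<otimes>\<^bsub>FT\<^esub> s) \<otimes>\<^bsub>FT\<^esub> (t \<otimes>\<^bsub>FT\<^esub> s)))) | \<omega> s.
     \<omega> \<in> W \<and> s \<in> carrier FT \<and> \<omega> (star FT s \<otimes>\<^bsub>FT\<^esub> s) = 1})"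
  unfolding spatial_seminorm_def Let_def by (rule arg_cong[of _ _ Sup]) blast

lemma
  shows spatial_seminorm: "cstar_seminorm FT (spatial_seminorm A B)"
    and spatial_upper: "\<And>t \<phi> \<psi> s. \<lbrakk>t \<in> carrier FT; s \<in> carrier FT; cstar_state A \<phi>; cstar_state B \<psi>;
        tensor_functional \<phi> \<psi> (star FT s \<otimes>\<^bsub>FT\<^esub> s) = 1\<rbrakk> \<Longrightarrow>
      sqrt (Re (tensor_functional \<phi> \<psi> (star FT (t \<otimes>\<^bsub>FT\<^esub> s) \<otimes>\<^bsub>FT\<^esub> (t \<otimes>\<^bsub>FT\<^esub> s)))) \<le> spatial_seminorm A B t"
    and spatial_least: "\<And>t b. 0 \<le> b \<Longrightarrow> (\<And>\<phi> \<psi> s. \<lbrakk>s \<in> carrier FT; cstar_state A \<phi>; cstar_state B \<psi>;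
        tensor_functional \<phi> \<psi> (star FT s \<otimes>\<^bsub>FT\<^esub> s) = 1\<rbrakk> \<Longrightarrow>
      sqrt (Re (tensor_functional \<phi> \<psi> (star FT (t \<otimes>\<^bsub>FT\<^esub> s) \<otimes>\<^bsub>FT\<^esub> (t \<otimes>\<^bsub>FT\<^esub> s)))) \<le> b) \<Longrightarrow>
      spatial_seminorm A B t \<le> b"
proof -
  \<comment> \<open>The weight is the cross norm of elementary tensors. It makes \<open>N\<close>
    submultiplicative and, since states are contractive, an upper bound for every product
    functional; this keeps the spatial seminorm finite.\<close>
  define N where "N = T.norm1 (\<lambda>(a, b). cnorm A a * cnorm B b)"
  have pos: "positive_functional FT \<omega>" if "\<omega> \<in> W" for \<omega>
    using that tensor_functional_positive by auto
  have N0: "0 \<le> N x" if "x \<in> carrier FT" for x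
    unfolding N_def by (rule T.norm1_nonneg[OF that]) (auto simp: DirProd_def)
  have Nm: "N (x \<otimes>\<^bsub>FT\<^esub> y) \<le> N x * N y" if "x \<in> carrier FT" "y \<in> carrier FT" for x y
    unfolding N_def
  proof (rule T.norm1_mult_le[OF that])
    fix z w assume "z \<in> carrier (A \<times>\<times> B)" "w \<in> carrier (A \<times>\<times> B)"
    then obtain a b c d where [simp]: "z = (a, b)" "w = (c, d)" "a \<in> carrier A" "b \<in> carrier B"
      "c \<in> carrier A" "d \<in> carrier B" by (auto simp: DirProd_def)
    have "cnorm A (a \<otimes>\<^bsub>A\<^esub> c) * cnorm B (b \<otimes>\<^bsub>B\<^esub> d) \<le>
        (cnorm A a * cnorm A c) * (cnorm B b * cnorm B d)"
      by (intro mult_mono A.p_mult B.p_mult) auto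
    then show "(case z \<otimes>\<^bsub>A \<times>\<times> B\<^esub> w of (a, b) \<Rightarrow> cnorm A a * cnorm B b) \<le>
        (case z of (a, b) \<Rightarrow> cnorm A a * cnorm B b) * (case w of (a, b) \<Rightarrow> cnorm A a * cnorm B b)"
      by (simp add: mult_ac)
  qed (auto simp: DirProd_def)
  have Nw: "cmod (\<omega> x) \<le> N x" if om: "\<omega> \<in> W" and x: "x \<in> carrier FT" for \<omega> x
  proof -
    obtain \<phi> \<psi> where w: "\<omega> = tensor_functional \<phi> \<psi>" "cstar_state A \<phi>" "cstar_state B \<psi>" using om by blast
    show ?thesis
      unfolding w(1) N_def tensor_functional_lin
      by (rule T.lin_le_norm1[OF x])
         (use w(2,3) in \<open>auto simp: DirProd_def norm_mult cstar_state_def intro!: mult_mono\<close>)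
  qed
  note G = T.T.gns_seminorm[where W = W and N = N, folded spatial_eq]
  show "cstar_seminorm FT (spatial_seminorm A B)"
    by (rule G(1)) (fact pos N0 Nm Nw)+
  show "sqrt (Re (tensor_functional \<phi> \<psi> (star FT (t \<otimes>\<^bsub>FT\<^esub> s) \<otimes>\<^bsub>FT\<^esub> (t \<otimes>\<^bsub>FT\<^esub> s)))) \<le> spatial_seminorm A B t"
    if "t \<in> carrier FT" "s \<in> carrier FT" "cstar_state A \<phi>" "cstar_state B \<psi>"
      "tensor_functional \<phi> \<psi> (star FT s \<otimes>\<^bsub>FT\<^esub> s) = 1" for t \<phi> \<psi> s
    by (rule G(2)) (fact pos N0 Nm Nw that | use that in blast)+
  show "spatial_seminorm A B t \<le> b"
    if "0 \<le> b" "\<And>\<phi> \<psi> s. \<lbrakk>s \<in> carrier FT; cstar_state A \<phi>; cstar_state B \<psi>;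
        tensor_functional \<phi> \<psi> (star FT s \<otimes>\<^bsub>FT\<^esub> s) = 1\<rbrakk> \<Longrightarrow>
      sqrt (Re (tensor_functional \<phi> \<psi> (star FT (t \<otimes>\<^bsub>FT\<^esub> s) \<otimes>\<^bsub>FT\<^esub> (t \<otimes>\<^bsub>FT\<^esub> s)))) \<le> b" for t b
    by (rule G(3)) (fact pos N0 Nm Nw that(1) | use that(2) in blast)+
qed

sublocale S: cstar_seminormed FT "spatial_seminorm A B"
  by (intro cstar_seminormed.intro cstar_seminormed_axioms.intro spatial_seminorm T.star_algebra_T)

lemma min_tensor_C: "min_tensor A B = S.C"
  by (simp add: min_tensor_def)

lemma cstar_min_tensor: "cstar_algebra (min_tensor A B)"
  unfolding min_tensor_C by (rule S.cstar_algebra_C)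

sublocale M: cstar_algebra "min_tensor A B" by (rule cstar_min_tensor)

lemma tensor_cl: "tensor A B a b = S.cl (\<lambda>_. mon (a, b))"
  by (simp add: tensor_def)

lemma tensor_closed [simp]:
  "a \<in> carrier A \<Longrightarrow> b \<in> carrier B \<Longrightarrow> tensor A B a b \<in> carrier (min_tensor A B)"
  by (simp add: tensor_cl min_tensor_C)

text \<open>By linearity the hypothesis passes from elementary outer factors to arbitrary ones, so
  all product functionals vanish at \<open>r (x - y) s\<close>. Taking for \<open>r\<close> the
  adjoint of \<open>(x - y) s\<close> annihilates every term of the supremum defining the
  seminorm.\<close>

lemma cl_const_eqI:
  assumes x: "x \<in> carrier FT" and y: "y \<in> carrier FT"
    and eq: "\<And>\<phi> \<psi> a b c d. \<lbrakk>cstar_state A \<phi>; cstar_state B \<psi>; a \<in> carrier A; b \<in> carrier B;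
        c \<in> carrier A; d \<in> carrier B\<rbrakk> \<Longrightarrow>
      tensor_functional \<phi> \<psi> (mon (a, b) \<otimes>\<^bsub>FT\<^esub> (x \<otimes>\<^bsub>FT\<^esub> mon (c, d))) =
      tensor_functional \<phi> \<psi> (mon (a, b) \<otimes>\<^bsub>FT\<^esub> (y \<otimes>\<^bsub>FT\<^esub> mon (c, d)))"
  shows "S.cl (\<lambda>_. x) = S.cl (\<lambda>_. y)"
proof -
  define t where "t = x \<ominus>\<^bsub>FT\<^esub> y"
  have t: "t \<in> carrier FT" using x y by (simp add: t_def)
  have zero: "tensor_functional \<phi> \<psi> (r \<otimes>\<^bsub>FT\<^esub> (t \<otimes>\<^bsub>FT\<^esub> s)) = 0"
    if st: "cstar_state A \<phi>" "cstar_state B \<psi>" and r: "r \<in> carrier FT" and s: "s \<in> carrier FT" for \<phi> \<psi> r s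
  proof -
    note L = tensor_functional_lin T.lin_add T.lin_smult T.T_lin T.T.l_distr T.T.r_distr
    have 1: "tensor_functional \<phi> \<psi> (mon w \<otimes>\<^bsub>FT\<^esub> (t \<otimes>\<^bsub>FT\<^esub> mon z)) = 0"
      if "w \<in> carrier (A \<times>\<times> B)" "z \<in> carrier (A \<times>\<times> B)" for w z
    proof -
      have [simp]: "mon w \<in> carrier FT" "mon z \<in> carrier FT" using that by (auto intro: T.mon_closed)
      have "tensor_functional \<phi> \<psi> (mon w \<otimes>\<^bsub>FT\<^esub> (x \<otimes>\<^bsub>FT\<^esub> mon z)) =
          tensor_functional \<phi> \<psi> (mon w \<otimes>\<^bsub>FT\<^esub> (y \<otimes>\<^bsub>FT\<^esub> mon z))"
        using eq[OF st] that by (cases w; cases z) (auto simp: DirProd_def)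
      then show ?thesis using x y by (simp add: t_def T.T.minus_eq_smult L)
    qed
    have 2: "tensor_functional \<phi> \<psi> (mon w \<otimes>\<^bsub>FT\<^esub> (t \<otimes>\<^bsub>FT\<^esub> s)) = 0" if "w \<in> carrier (A \<times>\<times> B)" for w
      using s that t
      by (induction s rule: T.T_induct) (use 1 in \<open>auto simp: L\<close>)
    show ?thesis
      using r t s by (induction r rule: T.T_induct) (use 2 in \<open>auto simp: L\<close>)
  qed
  have "spatial_seminorm A B t \<le> 0"
    by (rule spatial_least) (use zero t in auto)
  then have "spatial_seminorm A B t = 0" using S.p_nonneg[OF t] by linarith
  then show ?thesis using x y by (simp add: S.const_eq_iff t_def)
qed

section \<open>Calculus of elementary tensors in the completion\<close>

lemma tensor_mult:
  assumes "a \<in> carrier A" "b \<in> carrier B" "c \<in> carrier A" "d \<in> carrier B"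
  shows "tensor A B a b \<otimes>\<^bsub>min_tensor A B\<^esub> tensor A B c d = tensor A B (a \<otimes>\<^bsub>A\<^esub> c) (b \<otimes>\<^bsub>B\<^esub> d)"
  unfolding tensor_cl min_tensor_C using assms by (simp add: S.C_mult T.mon_mult)

lemma tensor_star:
  assumes "a \<in> carrier A" "b \<in> carrier B"
  shows "star (min_tensor A B) (tensor A B a b) = tensor A B (star A a) (star B b)"
  unfolding tensor_cl min_tensor_C using assms
  by (simp add: S.C_star T.T_star_mon[of "(a, b)", simplified DirProd_def, simplified])

lemma tensor_one: "\<one>\<^bsub>min_tensor A B\<^esub> = tensor A B \<one>\<^bsub>A\<^esub> \<one>\<^bsub>B\<^esub>"
  unfolding tensor_cl min_tensor_C by (simp add: S.C_one T.T_one)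

lemma tensor_add_left:
  assumes "a \<in> carrier A" "a' \<in> carrier A" "b \<in> carrier B"
  shows "tensor A B (a \<oplus>\<^bsub>A\<^esub> a') b = tensor A B a b \<oplus>\<^bsub>min_tensor A B\<^esub> tensor A B a' b"
proof -
  have "S.cl (\<lambda>_. mon (a \<oplus>\<^bsub>A\<^esub> a', b)) = S.cl (\<lambda>_. mon (a, b) \<oplus>\<^bsub>FT\<^esub> mon (a', b))"
    by (rule cl_const_eqI)
       (use assms in \<open>auto simp: tensor_functional_lin T.lin_add T.T_lin T.mon_mult cstar_state_def
         A.l_distr A.r_distr algebra_simps\<close>)
  then show ?thesis unfolding tensor_cl min_tensor_C using assms by (simp add: S.C_add)
qed

lemma tensor_add_right:
  assumes "a \<in> carrier A" "b \<in> carrier B" "b' \<in> carrier B"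
  shows "tensor A B a (b \<oplus>\<^bsub>B\<^esub> b') = tensor A B a b \<oplus>\<^bsub>min_tensor A B\<^esub> tensor A B a b'"
proof -
  have "S.cl (\<lambda>_. mon (a, b \<oplus>\<^bsub>B\<^esub> b')) = S.cl (\<lambda>_. mon (a, b) \<oplus>\<^bsub>FT\<^esub> mon (a, b'))"
    by (rule cl_const_eqI)
       (use assms in \<open>auto simp: tensor_functional_lin T.lin_add T.T_lin T.mon_mult cstar_state_def
         B.l_distr B.r_distr algebra_simps\<close>)
  then show ?thesis unfolding tensor_cl min_tensor_C using assms by (simp add: S.C_add)
qed

lemma tensor_smult_left:
  assumes "a \<in> carrier A" "b \<in> carrier B"
  shows "tensor A B (c \<odot>\<^bsub>A\<^esub> a) b = c \<odot>\<^bsub>min_tensor A B\<^esub> tensor A B a b"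
proof -
  have "S.cl (\<lambda>_. mon (c \<odot>\<^bsub>A\<^esub> a, b)) = S.cl (\<lambda>_. c \<odot>\<^bsub>FT\<^esub> mon (a, b))"
    by (rule cl_const_eqI)
       (use assms in \<open>auto simp: tensor_functional_lin T.lin_smult T.T_lin T.mon_mult cstar_state_def
         A.smult_mult_left A.smult_mult_right\<close>)
  then show ?thesis unfolding tensor_cl min_tensor_C using assms by (simp add: S.C_smult)
qed

lemma tensor_smult_right:
  assumes "a \<in> carrier A" "b \<in> carrier B"
  shows "tensor A B a (c \<odot>\<^bsub>B\<^esub> b) = c \<odot>\<^bsub>min_tensor A B\<^esub> tensor A B a b"
proof -
  have "S.cl (\<lambda>_. mon (a, c \<odot>\<^bsub>B\<^esub> b)) = S.cl (\<lambda>_. c \<odot>\<^bsub>FT\<^esub> mon (a, b))"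
    by (rule cl_const_eqI)
       (use assms in \<open>auto simp: tensor_functional_lin T.lin_smult T.T_lin T.mon_mult cstar_state_def
         B.smult_mult_left B.smult_mult_right\<close>)
  then show ?thesis unfolding tensor_cl min_tensor_C using assms by (simp add: S.C_smult)
qed

lemma tensor_zero_left: "b \<in> carrier B \<Longrightarrow> tensor A B \<zero>\<^bsub>A\<^esub> b = \<zero>\<^bsub>min_tensor A B\<^esub>"
  using tensor_smult_left[of "\<zero>\<^bsub>A\<^esub>" b 0] by simp

lemma tensor_zero_right: "a \<in> carrier A \<Longrightarrow> tensor A B a \<zero>\<^bsub>B\<^esub> = \<zero>\<^bsub>min_tensor A B\<^esub>"
  using tensor_smult_right[of a "\<zero>\<^bsub>B\<^esub>" 0] by simp

lemma tensor_finsum_left: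
  "finite I \<Longrightarrow> f \<in> I \<rightarrow> carrier A \<Longrightarrow> b \<in> carrier B \<Longrightarrow>
   tensor A B (finsum A f I) b = (\<Oplus>\<^bsub>min_tensor A B\<^esub>i\<in>I. tensor A B (f i) b)"
  by (induction I rule: finite_induct) (auto simp: tensor_zero_left tensor_add_left Pi_iff)

lemma tensor_finsum_right:
  "finite I \<Longrightarrow> f \<in> I \<rightarrow> carrier B \<Longrightarrow> a \<in> carrier A \<Longrightarrow>
   tensor A B a (finsum B f I) = (\<Oplus>\<^bsub>min_tensor A B\<^esub>i\<in>I. tensor A B a (f i))"
  by (induction I rule: finite_induct) (auto simp: tensor_zero_right tensor_add_right Pi_iff)

end

lemma state_comp:
  fixes A :: "('a, 'm) cstar_algebra_scheme" and B :: "('b, 'n) cstar_algebra_scheme"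
  assumes "cstar_algebra A" "cstar_algebra B" "h \<in> star_hom A B"
    "\<And>x. x \<in> carrier A \<Longrightarrow> cnorm B (h x) \<le> cnorm A x" "cstar_state B \<phi>"
  shows "cstar_state A (\<lambda>x. \<phi> (h x))"
proof -
  interpret A: cstar_algebra A by fact
  interpret B: cstar_algebra B by fact
  interpret h: star_homomorphism A B h by unfold_locales fact
  have "cmod (\<phi> (h x)) \<le> cnorm A x" if "x \<in> carrier A" for x
    using assms(4)[OF that] assms(5) h.hom_closed[OF that] unfolding cstar_state_def
    by (meson order_trans)
  with assms(5) show ?thesis
    by (simp add: cstar_state_def h.hom_add h.hom_one h.hom_smult h.hom_mult[symmetric] flip: h.hom_star)
       (simp add: h.hom_mult h.hom_star)
qed

text \<open>Surjectivity is needed because the vectors in the spatial seminorm of \<open>B \<otimes> B\<close> have to be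
  images of vectors over \<open>A \<otimes> A\<close>.\<close>

lemma min_tensor_functorial:
  fixes A :: "('a, 'm) cstar_algebra_scheme" and B :: "('b, 'n) cstar_algebra_scheme"
  assumes A: "cstar_algebra A" and B: "cstar_algebra B" and h: "h \<in> star_hom A B"
    and le: "\<And>x. x \<in> carrier A \<Longrightarrow> cnorm B (h x) \<le> cnorm A x" and surj: "h ` carrier A = carrier B"
  shows "\<exists>hh\<in>star_hom (min_tensor A A) (min_tensor B B).
    \<forall>a\<in>carrier A. \<forall>b\<in>carrier A. hh (tensor A A a b) = tensor B B (h a) (h b)"
proof -
  interpret A: cstar_algebra A by fact
  interpret B: cstar_algebra B by fact
  interpret AA: cstar_pair A A by unfold_locales
  interpret BB: cstar_pair B B by unfold_locales
  interpret h: star_homomorphism A B h by unfold_locales fact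
  let ?F = "\<lambda>(a, b). mon (h a, h b) :: 'b \<times> 'b \<Rightarrow> complex"
  define k where "k = AA.T.ext BB.FT ?F"
  have Fc: "?F m \<in> carrier BB.FT" if "m \<in> carrier (A \<times>\<times> A)" for m
    using that by (auto simp: DirProd_def)
  note kx = AA.T.ext_closed[OF BB.T.star_algebra_T Fc] AA.T.ext_mon[OF BB.T.star_algebra_T Fc]
    AA.T.ext_add[OF BB.T.star_algebra_T Fc] AA.T.ext_smult[OF BB.T.star_algebra_T Fc]
    AA.T.ext_zero[of BB.FT ?F]
  have k: "k \<in> star_hom AA.FT BB.FT"
    unfolding k_def
  proof (rule AA.T.ext_star_hom[OF BB.T.star_algebra_T Fc])
    show "?F \<one>\<^bsub>A \<times>\<times> A\<^esub> = \<one>\<^bsub>BB.FT\<^esub>" by (simp add: BB.T.T_one h.hom_one DirProd_def)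
    show "?F (a \<otimes>\<^bsub>A \<times>\<times> A\<^esub> b) = ?F a \<otimes>\<^bsub>BB.FT\<^esub> ?F b"
      if "a \<in> carrier (A \<times>\<times> A)" "b \<in> carrier (A \<times>\<times> A)" for a b
      using that by (auto simp: DirProd_def h.hom_mult BB.T.mon_mult[simplified DirProd_def])
    show "?F ((\<lambda>(a, b). (star A a, star A b)) a) = star BB.FT (?F a)" if "a \<in> carrier (A \<times>\<times> A)" for a
      using that BB.T.T_star_mon by (auto simp: DirProd_def h.hom_star)
  qed
  interpret k: star_homomorphism AA.FT BB.FT k by unfold_locales (rule k)
  have kmon: "k (mon (a, b)) = mon (h a, h b)" if "a \<in> carrier A" "b \<in> carrier A" for a b
    unfolding k_def using that by (subst kx(2)) (auto simp: DirProd_def)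
  have ksurj: "\<exists>s\<in>carrier AA.FT. k s = s'" if "s' \<in> carrier BB.FT" for s'
    using that
  proof (induction s' rule: BB.T.T_induct)
    case zero
    show ?case using k.hom_zero by blast
  next
    case (add f c z)
    then obtain s where s: "s \<in> carrier AA.FT" "k s = f" by blast
    obtain a b where ab: "z = (h a, h b)" "a \<in> carrier A" "b \<in> carrier A"
    proof -
      have "fst z \<in> h ` carrier A" "snd z \<in> h ` carrier A" using add(2) surj by (auto simp: DirProd_def)
      then show ?thesis using that by (metis imageE prod.collapse)
    qed
    have "k (s \<oplus>\<^bsub>AA.FT\<^esub> c \<odot>\<^bsub>AA.FT\<^esub> mon (a, b)) = f \<oplus>\<^bsub>BB.FT\<^esub> c \<odot>\<^bsub>BB.FT\<^esub> mon z"
      using s ab by (simp add: k.hom_add k.hom_smult kmon)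
    then show ?case using s ab by (intro bexI[of _ "s \<oplus>\<^bsub>AA.FT\<^esub> c \<odot>\<^bsub>AA.FT\<^esub> mon (a, b)"]) auto
  qed
  \<comment> \<open>Product functionals over \<open>B\<close> pull back to product functionals over
    \<open>A\<close>, and states to states by \<open>state_comp\<close>. Hence every term of the
    supremum for \<open>k t\<close> also occurs in the one for \<open>t\<close>.\<close>
  have kfun: "tensor_functional \<phi> \<psi> (k t) = tensor_functional (\<lambda>x. \<phi> (h x)) (\<lambda>x. \<psi> (h x)) t"
    if "t \<in> carrier AA.FT" for \<phi> \<psi> t
    using that
    by (induction t rule: AA.T.T_induct)
       (auto simp: k.hom_zero k.hom_add k.hom_smult kmon AA.tensor_functional_lin BB.tensor_functional_lin
        AA.T.lin_add AA.T.lin_smult BB.T.lin_add BB.T.lin_smult)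
  have kle: "spatial_seminorm B B (k t) \<le> spatial_seminorm A A t" if t: "t \<in> carrier AA.FT" for t
  proof (rule BB.spatial_least)
    show "0 \<le> spatial_seminorm A A t" using t by (rule AA.S.p_nonneg)
    fix \<phi> \<psi> s' assume *: "s' \<in> carrier BB.FT" "cstar_state B \<phi>" "cstar_state B \<psi>"
      "tensor_functional \<phi> \<psi> (star BB.FT s' \<otimes>\<^bsub>BB.FT\<^esub> s') = 1"
    obtain s where s: "s \<in> carrier AA.FT" "s' = k s" using ksurj[OF *(1)] by blast
    have 1: "star BB.FT s' \<otimes>\<^bsub>BB.FT\<^esub> s' = k (star AA.FT s \<otimes>\<^bsub>AA.FT\<^esub> s)"
      using s by (simp add: k.hom_mult k.hom_star)
    have 2: "star BB.FT (k t \<otimes>\<^bsub>BB.FT\<^esub> s') \<otimes>\<^bsub>BB.FT\<^esub> (k t \<otimes>\<^bsub>BB.FT\<^esub> s') =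
        k (star AA.FT (t \<otimes>\<^bsub>AA.FT\<^esub> s) \<otimes>\<^bsub>AA.FT\<^esub> (t \<otimes>\<^bsub>AA.FT\<^esub> s))"
      using s t by (simp add: k.hom_mult k.hom_star)
    show "sqrt (Re (tensor_functional \<phi> \<psi> (star BB.FT (k t \<otimes>\<^bsub>BB.FT\<^esub> s') \<otimes>\<^bsub>BB.FT\<^esub> (k t \<otimes>\<^bsub>BB.FT\<^esub> s'))))
        \<le> spatial_seminorm A A t"
      unfolding 2 using s t *(4)[unfolded 1]
      by (subst kfun) (auto simp: kfun intro!: AA.spatial_upper state_comp[OF A B h le] *)
  qed
  define g where "g t = BB.S.cl (\<lambda>_. k t)" for t
  have g: "g \<in> star_hom AA.FT (min_tensor B B)"
    unfolding g_def BB.min_tensor_C by (rule star_hom_comp[OF k BB.S.const_star_hom])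
  have "cnorm (min_tensor B B) (g t) \<le> spatial_seminorm A A t" if "t \<in> carrier AA.FT" for t
    unfolding g_def BB.min_tensor_C using kle[OF that] that by simp
  from AA.S.extend_to_completion[OF BB.cstar_min_tensor g this]
  obtain hh where hh: "hh \<in> star_hom (min_tensor A A) (min_tensor B B)"
    "\<And>a. a \<in> carrier AA.FT \<Longrightarrow> hh (AA.S.cl (\<lambda>_. a)) = g a"
    unfolding AA.min_tensor_C by auto
  show ?thesis
  proof (intro bexI[OF _ hh(1)] ballI)
    fix a b assume "a \<in> carrier A" "b \<in> carrier A"
    then show "hh (tensor A A a b) = tensor B B (h a) (h b)"
      by (simp add: AA.tensor_cl BB.tensor_cl hh(2) g_def kmon)
  qed
qed

section \<open>Transport of compact matrix quantum groups\<close>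

text \<open>The preimage of a closed *-subalgebra that contains the image of \<open>S\<close> is
  closed, since \<open>h\<close> is contractive, and contains \<open>S\<close>; it is therefore
  everything, and surjectivity concludes.\<close>

lemma cstar_generated_image:
  fixes A :: "('a, 'm) cstar_algebra_scheme" and B :: "('b, 'n) cstar_algebra_scheme"
  assumes A: "cstar_algebra A" and B: "cstar_algebra B" and h: "h \<in> star_hom A B"
    and le: "\<And>x. x \<in> carrier A \<Longrightarrow> cnorm B (h x) \<le> cnorm A x" and surj: "h ` carrier A = carrier B"
    and gen: "cstar_generated A S"
  shows "cstar_generated B (h ` S)"
proof -
  interpret A: cstar_algebra A by fact
  interpret B: cstar_algebra B by fact
  interpret h: star_homomorphism A B h by unfold_locales fact
  have S: "S \<subseteq> carrier A" using gen by (simp add: cstar_generated_def)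
  show ?thesis
    unfolding cstar_generated_def
  proof (intro conjI allI impI)
    show "h ` S \<subseteq> carrier B" using S by auto
    fix Q assume Q: "subring Q B \<and> h ` S \<subseteq> Q \<and> (\<forall>x\<in>Q. star B x \<in> Q \<and> (\<forall>c. c \<odot>\<^bsub>B\<^esub> x \<in> Q)) \<and>
      (\<forall>x. \<forall>a\<in>carrier B. range x \<subseteq> Q \<and> (\<lambda>n. cnorm B (x n \<ominus>\<^bsub>B\<^esub> a)) \<longlonglongrightarrow> 0 \<longrightarrow> a \<in> Q)"
    then have sub: "subring Q B" by blast
    define P where "P = {x \<in> carrier A. h x \<in> Q}"
    have "subring P A"
    proof (rule A.subringI)
      show "\<ominus>\<^bsub>A\<^esub> x \<in> P" if "x \<in> P" for x
        using that Q by (simp add: P_def A.uminus_eq_smult h.hom_smult)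
    qed (use subringE[OF sub] in \<open>auto simp: P_def h.hom_one h.hom_mult h.hom_add\<close>)
    moreover have "a \<in> P" if "a \<in> carrier A" "range x \<subseteq> P" "(\<lambda>n. cnorm A (x n \<ominus>\<^bsub>A\<^esub> a)) \<longlonglongrightarrow> 0" for x a
    proof -
      have x: "x n \<in> carrier A" "h (x n) \<in> Q" for n using that(2) by (auto simp: P_def)
      have "(\<lambda>n. cnorm B (h (x n) \<ominus>\<^bsub>B\<^esub> h a)) \<longlonglongrightarrow> 0"
      proof (rule tendsto_0_le[OF that(3)])
        show "cnorm B (h (x n) \<ominus>\<^bsub>B\<^esub> h a) \<le> cnorm A (x n \<ominus>\<^bsub>A\<^esub> a)" for n
          using le[of "x n \<ominus>\<^bsub>A\<^esub> a"] x that(1) by (simp add: h.hom_minus)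
      qed (use x that in simp)
      moreover have "range (\<lambda>n. h (x n)) \<subseteq> Q" using x by auto
      ultimately have "h a \<in> Q" using Q that(1) h.hom_closed by blast
      with that show ?thesis by (simp add: P_def)
    qed
    moreover have "S \<subseteq> P" using S Q by (auto simp: P_def)
    moreover have "star A x \<in> P \<and> (\<forall>c. c \<odot>\<^bsub>A\<^esub> x \<in> P)" if "x \<in> P" for x
      using that Q by (auto simp: P_def h.hom_star h.hom_smult)
    ultimately have "P = carrier A" using gen unfolding cstar_generated_def by blast
    then have "h ` carrier A \<subseteq> Q" unfolding P_def by blast
    then have "carrier B \<subseteq> Q" by (simp only: surj)
    then show "Q = carrier B" using subringE(1)[OF sub] by blast
  qed
qed

lemma matrix_invertible_hom:
  assumes "star_algebra A" "star_algebra B" "h \<in> star_hom A B"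
    and u: "\<And>i j. i \<in> {1..n} \<Longrightarrow> j \<in> {1..n} \<Longrightarrow> u i j \<in> carrier A"
    and inv: "matrix_invertible A n u"
    and w: "\<And>i j. i \<in> {1..n} \<Longrightarrow> j \<in> {1..n} \<Longrightarrow> w i j = h (u i j)"
  shows "matrix_invertible B n w"
proof -
  interpret A: star_algebra A by fact
  interpret B: star_algebra B by fact
  interpret h: star_homomorphism A B h by unfold_locales fact
  obtain v where v: "\<And>i j. i \<in> {1..n} \<Longrightarrow> j \<in> {1..n} \<Longrightarrow> v i j \<in> carrier A"
    "\<And>i j. i \<in> {1..n} \<Longrightarrow> j \<in> {1..n} \<Longrightarrow>
        (\<Oplus>\<^bsub>A\<^esub>k\<in>{1..n}. u i k \<otimes>\<^bsub>A\<^esub> v k j) = (if i = j then \<one>\<^bsub>A\<^esub> else \<zero>\<^bsub>A\<^esub>)"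
    "\<And>i j. i \<in> {1..n} \<Longrightarrow> j \<in> {1..n} \<Longrightarrow>
        (\<Oplus>\<^bsub>A\<^esub>k\<in>{1..n}. v i k \<otimes>\<^bsub>A\<^esub> u k j) = (if i = j then \<one>\<^bsub>A\<^esub> else \<zero>\<^bsub>A\<^esub>)"
    using inv unfolding matrix_invertible_def by blast
  have "(\<Oplus>\<^bsub>B\<^esub>k\<in>{1..n}. w i k \<otimes>\<^bsub>B\<^esub> h (v k j)) = (if i = j then \<one>\<^bsub>B\<^esub> else \<zero>\<^bsub>B\<^esub>) \<and>
      (\<Oplus>\<^bsub>B\<^esub>k\<in>{1..n}. h (v i k) \<otimes>\<^bsub>B\<^esub> w k j) = (if i = j then \<one>\<^bsub>B\<^esub> else \<zero>\<^bsub>B\<^esub>)"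
    if ij: "i \<in> {1..n}" "j \<in> {1..n}" for i j
  proof
    have "(\<Oplus>\<^bsub>B\<^esub>k\<in>{1..n}. w i k \<otimes>\<^bsub>B\<^esub> h (v k j)) = (\<Oplus>\<^bsub>B\<^esub>k\<in>{1..n}. h (u i k \<otimes>\<^bsub>A\<^esub> v k j))"
      by (rule B.finsum_cong') (use ij u v(1) in \<open>auto simp: w h.hom_mult\<close>)
    also have "\<dots> = h (\<Oplus>\<^bsub>A\<^esub>k\<in>{1..n}. u i k \<otimes>\<^bsub>A\<^esub> v k j)"
      by (rule h.hom_finsum[symmetric]) (use ij u v(1) in auto)
    finally show "(\<Oplus>\<^bsub>B\<^esub>k\<in>{1..n}. w i k \<otimes>\<^bsub>B\<^esub> h (v k j)) = (if i = j then \<one>\<^bsub>B\<^esub> else \<zero>\<^bsub>B\<^esub>)"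
      using v(2)[OF ij] by (auto simp: h.hom_one h.hom_zero)
    have "(\<Oplus>\<^bsub>B\<^esub>k\<in>{1..n}. h (v i k) \<otimes>\<^bsub>B\<^esub> w k j) = (\<Oplus>\<^bsub>B\<^esub>k\<in>{1..n}. h (v i k \<otimes>\<^bsub>A\<^esub> u k j))"
      by (rule B.finsum_cong') (use ij u v(1) in \<open>auto simp: w h.hom_mult\<close>)
    also have "\<dots> = h (\<Oplus>\<^bsub>A\<^esub>k\<in>{1..n}. v i k \<otimes>\<^bsub>A\<^esub> u k j)"
      by (rule h.hom_finsum[symmetric]) (use ij u v(1) in auto)
    finally show "(\<Oplus>\<^bsub>B\<^esub>k\<in>{1..n}. h (v i k) \<otimes>\<^bsub>B\<^esub> w k j) = (if i = j then \<one>\<^bsub>B\<^esub> else \<zero>\<^bsub>B\<^esub>)"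
      using v(3)[OF ij] by (auto simp: h.hom_one h.hom_zero)
  qed
  then show ?thesis
    unfolding matrix_invertible_def using v(1) by (intro exI[of _ "\<lambda>i j. h (v i j)"]) auto
qed

text \<open>The new comultiplication is \<open>(h \<otimes> h) \<circ> \<Delta> \<circ> g\<close>.
  The matrix of \<open>H\<close> may have another size than that of \<open>G\<close>, so the
  coproduct formula for its image under \<open>g\<close> is a hypothesis.\<close>

lemma comultiplication_transport:
  assumes A: "cstar_algebra (qalg G)" and B: "cstar_algebra (qalg H)"
    and h: "h \<in> star_hom (qalg G) (qalg H)"
    and le: "\<And>x. x \<in> carrier (qalg G) \<Longrightarrow> cnorm (qalg H) (h x) \<le> cnorm (qalg G) x"
    and surj: "h ` carrier (qalg G) = carrier (qalg H)"
    and g: "g \<in> star_hom (qalg H) (qalg G)"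
    and \<Delta>: "comultiplication G \<Delta>"
    and v: "\<And>i j. i \<in> {1..qdim H} \<Longrightarrow> j \<in> {1..qdim H} \<Longrightarrow> qmat H i j \<in> carrier (qalg H)"
    and hg: "\<And>i j. i \<in> {1..qdim H} \<Longrightarrow> j \<in> {1..qdim H} \<Longrightarrow> h (g (qmat H i j)) = qmat H i j"
    and \<Delta>g: "\<And>i j. i \<in> {1..qdim H} \<Longrightarrow> j \<in> {1..qdim H} \<Longrightarrow> \<Delta> (g (qmat H i j)) =
        (\<Oplus>\<^bsub>min_tensor (qalg G) (qalg G)\<^esub>k\<in>{1..qdim H}.
           tensor (qalg G) (qalg G) (g (qmat H i k)) (g (qmat H k j)))"
  shows "\<exists>hh\<in>star_hom (min_tensor (qalg G) (qalg G)) (min_tensor (qalg H) (qalg H)).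
    (\<forall>a\<in>carrier (qalg G). \<forall>b\<in>carrier (qalg G).
       hh (tensor (qalg G) (qalg G) a b) = tensor (qalg H) (qalg H) (h a) (h b)) \<and>
    comultiplication H (\<lambda>x. hh (\<Delta> (g x)))"
proof -
  let ?A = "qalg G" and ?B = "qalg H"
  interpret A: cstar_algebra ?A by (rule A)
  interpret B: cstar_algebra ?B by (rule B)
  interpret AA: cstar_pair ?A ?A by unfold_locales
  interpret BB: cstar_pair ?B ?B by unfold_locales
  interpret g: star_homomorphism ?B ?A g by unfold_locales (rule g)
  interpret h: star_homomorphism ?A ?B h by unfold_locales (rule h)
  obtain hh where hh: "hh \<in> star_hom (min_tensor ?A ?A) (min_tensor ?B ?B)"
    "\<And>a b. a \<in> carrier ?A \<Longrightarrow> b \<in> carrier ?A \<Longrightarrow> hh (tensor ?A ?A a b) = tensor ?B ?B (h a) (h b)"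
    using min_tensor_functorial[OF A B h le surj] by blast
  interpret hh: star_homomorphism "min_tensor ?A ?A" "min_tensor ?B ?B" hh
    by unfold_locales (rule hh)
  have "(\<lambda>x. hh (\<Delta> (g x))) \<in> star_hom ?B (min_tensor ?B ?B)"
    using star_hom_comp[OF star_hom_comp[OF g] hh(1)] \<Delta> by (auto simp: comultiplication_def)
  moreover have "hh (\<Delta> (g (qmat H i j))) =
      (\<Oplus>\<^bsub>min_tensor ?B ?B\<^esub>k\<in>{1..qdim H}. tensor ?B ?B (qmat H i k) (qmat H k j))"
    if ij: "i \<in> {1..qdim H}" "j \<in> {1..qdim H}" for i j
  proof -
    have "hh (\<Delta> (g (qmat H i j))) =
      (\<Oplus>\<^bsub>min_tensor ?B ?B\<^esub>k\<in>{1..qdim H}. hh (tensor ?A ?A (g (qmat H i k)) (g (qmat H k j))))"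
      unfolding \<Delta>g[OF ij] by (rule hh.hom_finsum) (use v ij in auto)
    also have "\<dots> = (\<Oplus>\<^bsub>min_tensor ?B ?B\<^esub>k\<in>{1..qdim H}. tensor ?B ?B (qmat H i k) (qmat H k j))"
      by (rule BB.M.finsum_cong') (use v ij hg in \<open>auto simp: hh(2)\<close>)
    finally show ?thesis .
  qed
  ultimately have "comultiplication H (\<lambda>x. hh (\<Delta> (g x)))" by (simp add: comultiplication_def)
  with hh show ?thesis by blast
qed

lemma cmqg_mat_closed:
  "compact_matrix_quantum_group G \<Longrightarrow> i \<in> {1..qdim G} \<Longrightarrow> j \<in> {1..qdim G} \<Longrightarrow>
   qmat G i j \<in> carrier (qalg G)"
  unfolding compact_matrix_quantum_group_def cstar_generated_def by blast

text \<open>\<open>H\<close> is only given as a C*-algebra with a matrix; generation, invertibility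
  and comultiplication are carried over from \<open>G\<close> along the isomorphism
  \<open>h\<close>, which matches the two matrices.\<close>

theorem cmqg_transport:
  assumes G: "compact_matrix_quantum_group G" and B: "cstar_algebra (qalg H)"
    and dim: "qdim H = qdim G"
    and h: "h \<in> star_hom (qalg G) (qalg H)"
    and le: "\<And>x. x \<in> carrier (qalg G) \<Longrightarrow> cnorm (qalg H) (h x) \<le> cnorm (qalg G) x"
    and hu: "\<And>i j. i \<in> {1..qdim G} \<Longrightarrow> j \<in> {1..qdim G} \<Longrightarrow> h (qmat G i j) = qmat H i j"
    and g: "g \<in> star_hom (qalg H) (qalg G)"
    and gv: "\<And>i j. i \<in> {1..qdim G} \<Longrightarrow> j \<in> {1..qdim G} \<Longrightarrow> g (qmat H i j) = qmat G i j"
    and gh: "\<And>x. x \<in> carrier (qalg G) \<Longrightarrow> g (h x) = x"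
    and hg: "\<And>x. x \<in> carrier (qalg H) \<Longrightarrow> h (g x) = x"
  shows "qgroup_eq G H"
proof -
  let ?A = "qalg G" and ?B = "qalg H"
  have A: "cstar_algebra ?A" using G by (simp add: compact_matrix_quantum_group_def)
  interpret A: cstar_algebra ?A by (rule A)
  interpret B: cstar_algebra ?B by (rule B)
  interpret g: star_homomorphism ?B ?A g by unfold_locales (rule g)
  interpret h: star_homomorphism ?A ?B h by unfold_locales (rule h)
  have surjg: "g ` carrier ?B = carrier ?A"
    by (rule bij_betw_imp_surj_on[OF bij_betwI[of _ _ _ h]]) (auto simp: gh hg)
  have surj: "h ` carrier ?A = carrier ?B"
    by (rule bij_betw_imp_surj_on[OF bij_betwI[of _ _ _ g]]) (auto simp: gh hg)
  note u = cmqg_mat_closed[OF G]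
  have v: "qmat H i j \<in> carrier ?B" if "i \<in> {1..qdim H}" "j \<in> {1..qdim H}" for i j
    using hu u that dim by (metis h.hom_closed)
  obtain \<Delta> where \<Delta>: "comultiplication G \<Delta>" using G by (auto simp: compact_matrix_quantum_group_def)
  have "\<exists>\<Delta>. comultiplication H \<Delta>"
  proof -
    have "\<Delta> (g (qmat H i j)) =
        (\<Oplus>\<^bsub>min_tensor ?A ?A\<^esub>k\<in>{1..qdim H}. tensor ?A ?A (g (qmat H i k)) (g (qmat H k j)))"
      if ij: "i \<in> {1..qdim H}" "j \<in> {1..qdim H}" for i j
    proof -
      interpret AA: cstar_pair ?A ?A by unfold_locales
      have "\<Delta> (g (qmat H i j)) =
        (\<Oplus>\<^bsub>min_tensor ?A ?A\<^esub>k\<in>{1..qdim G}. tensor ?A ?A (qmat G i k) (qmat G k j))"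
        using \<Delta> ij gv dim by (simp add: comultiplication_def)
      also have "\<dots> = (\<Oplus>\<^bsub>min_tensor ?A ?A\<^esub>k\<in>{1..qdim H}. tensor ?A ?A (g (qmat H i k)) (g (qmat H k j)))"
        unfolding dim by (rule AA.M.finsum_cong') (use u ij gv dim in auto)
      finally show ?thesis .
    qed
    from comultiplication_transport[OF A B h le surj g \<Delta> v hg[OF v] this]
    show ?thesis by blast
  qed
  moreover have "cstar_generated ?B {qmat H i j | i j. i \<in> {1..qdim H} \<and> j \<in> {1..qdim H}}"
  proof -
    have "cstar_generated ?A {qmat G i j | i j. i \<in> {1..qdim G} \<and> j \<in> {1..qdim G}}"
      using G by (simp add: compact_matrix_quantum_group_def)
    from cstar_generated_image[OF A B h le surj this]
    have "cstar_generated ?B (h ` {qmat G i j | i j. i \<in> {1..qdim G} \<and> j \<in> {1..qdim G}})" .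
    also have "h ` {qmat G i j | i j. i \<in> {1..qdim G} \<and> j \<in> {1..qdim G}} =
        {qmat H i j | i j. i \<in> {1..qdim H} \<and> j \<in> {1..qdim H}}"
      unfolding dim using hu by (auto simp: image_iff) metis+
    finally show ?thesis .
  qed
  moreover have "matrix_invertible ?B (qdim H) (qmat H)"
    unfolding dim
    by (rule matrix_invertible_hom[OF A.star_algebra_axioms B.star_algebra_axioms h,
          where u = "qmat G"])
       (use G hu u in \<open>auto simp: compact_matrix_quantum_group_def\<close>)
  moreover have "matrix_invertible ?B (qdim H) (\<lambda>i j. qmat H j i)"
    unfolding dim
    by (rule matrix_invertible_hom[OF A.star_algebra_axioms B.star_algebra_axioms h,
          where u = "\<lambda>i j. qmat G j i"])
       (use G hu u in \<open>auto simp: compact_matrix_quantum_group_def\<close>)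
  ultimately have H: "compact_matrix_quantum_group H"
    using B by (simp add: compact_matrix_quantum_group_def)
  show ?thesis
    unfolding qgroup_eq_def qsubgroup_def
    using G H dim h g surj surjg hu gv
    by (intro conjI bexI[of _ h] bexI[of _ g] ballI) simp_all
qed

lemma qgroup_eq_refl:
  assumes G: "compact_matrix_quantum_group G" shows "qgroup_eq G G"
proof -
  have "(\<lambda>x. x) \<in> star_hom (qalg G) (qalg G)" by (rule star_homI) auto
  with G show ?thesis unfolding qgroup_eq_def qsubgroup_def by (intro conjI bexI[of _ "\<lambda>x. x"]) auto
qed

text \<open>The matrices of \<open>G\<close> and \<open>H\<close> need not correspond, so generation
  and invertibility for \<open>H\<close> are assumed. Only the comultiplication is transported, and
  it is intertwined by construction because \<open>g (h a) = a\<close>.\<close>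

theorem qgroup_isoI:
  assumes G: "compact_matrix_quantum_group G"
    and B: "cstar_algebra (qalg H)"
    and gen: "cstar_generated (qalg H) {qmat H i j | i j. i \<in> {1..qdim H} \<and> j \<in> {1..qdim H}}"
    and inv: "matrix_invertible (qalg H) (qdim H) (qmat H)"
      "matrix_invertible (qalg H) (qdim H) (\<lambda>i j. qmat H j i)"
    and h: "h \<in> star_hom (qalg G) (qalg H)"
    and le: "\<And>x. x \<in> carrier (qalg G) \<Longrightarrow> cnorm (qalg H) (h x) \<le> cnorm (qalg G) x"
    and g: "g \<in> star_hom (qalg H) (qalg G)"
    and gh: "\<And>x. x \<in> carrier (qalg G) \<Longrightarrow> g (h x) = x"
    and hg: "\<And>x. x \<in> carrier (qalg H) \<Longrightarrow> h (g x) = x"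
    and \<Delta>g: "\<And>\<Delta> i j. comultiplication G \<Delta> \<Longrightarrow> i \<in> {1..qdim H} \<Longrightarrow> j \<in> {1..qdim H} \<Longrightarrow>
        \<Delta> (g (qmat H i j)) =
        (\<Oplus>\<^bsub>min_tensor (qalg G) (qalg G)\<^esub>k\<in>{1..qdim H}.
           tensor (qalg G) (qalg G) (g (qmat H i k)) (g (qmat H k j)))"
  shows "qgroup_iso G H"
proof -
  let ?A = "qalg G" and ?B = "qalg H"
  have A: "cstar_algebra ?A" using G by (simp add: compact_matrix_quantum_group_def)
  interpret A: cstar_algebra ?A by (rule A)
  interpret B: cstar_algebra ?B by (rule B)
  interpret g: star_homomorphism ?B ?A g by unfold_locales (rule g)
  interpret h: star_homomorphism ?A ?B h by unfold_locales (rule h)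
  have bij: "bij_betw h (carrier ?A) (carrier ?B)"
    by (rule bij_betwI[of _ _ _ g]) (auto simp: gh hg)
  have surj: "h ` carrier ?A = carrier ?B" using bij by (rule bij_betw_imp_surj_on)
  have v: "qmat H i j \<in> carrier ?B" if "i \<in> {1..qdim H}" "j \<in> {1..qdim H}" for i j
    using gen that unfolding cstar_generated_def by blast
  obtain \<Delta> where \<Delta>: "comultiplication G \<Delta>" using G by (auto simp: compact_matrix_quantum_group_def)
  obtain hh where hh: "hh \<in> star_hom (min_tensor ?A ?A) (min_tensor ?B ?B)"
    "\<forall>a\<in>carrier ?A. \<forall>b\<in>carrier ?A. hh (tensor ?A ?A a b) = tensor ?B ?B (h a) (h b)"
    "comultiplication H (\<lambda>x. hh (\<Delta> (g x)))"
    using comultiplication_transport[OF A B h le surj g \<Delta> v hg[OF v] \<Delta>g[OF \<Delta>]] by blast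
  have "compact_matrix_quantum_group H"
    using B gen inv hh(3) by (auto simp: compact_matrix_quantum_group_def)
  moreover have "\<forall>a\<in>carrier ?A. hh (\<Delta> a) = hh (\<Delta> (g (h a)))" by (simp add: gh)
  ultimately show ?thesis
    unfolding qgroup_iso_def using G h bij hh \<Delta>
    by (intro conjI exI[of _ h] exI[of _ hh] exI[of _ \<Delta>] exI[of _ "\<lambda>x. hh (\<Delta> (g x))"])
qed

text \<open>Vertices are numerals; a literal 1 rewritten to \<open>Suc 0\<close> would no longer
  match the rules for concrete matrix entries.\<close>

declare One_nat_def [simp del]

section \<open>Magic unitaries\<close>

definition magic :: "('a, 'm) star_algebra_scheme \<Rightarrow> nat \<Rightarrow> (nat \<Rightarrow> nat \<Rightarrow> 'a) \<Rightarrow> bool" where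
  "magic A n u \<longleftrightarrow>
     (\<forall>i\<in>{1..n}. \<forall>j\<in>{1..n}. u i j \<in> carrier A \<and> star A (u i j) = u i j) \<and>
     (\<forall>i\<in>{1..n}. \<forall>j\<in>{1..n}. \<forall>k\<in>{1..n}.
        u i j \<otimes>\<^bsub>A\<^esub> u i k = (if j = k then u i j else \<zero>\<^bsub>A\<^esub>) \<and>
        u j i \<otimes>\<^bsub>A\<^esub> u k i = (if j = k then u j i else \<zero>\<^bsub>A\<^esub>)) \<and>
     (\<forall>i\<in>{1..n}. (\<Oplus>\<^bsub>A\<^esub>l\<in>{1..n}. u i l) = \<one>\<^bsub>A\<^esub> \<and> (\<Oplus>\<^bsub>A\<^esub>l\<in>{1..n}. u l i) = \<one>\<^bsub>A\<^esub>)"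

definition intertwines ::
    "('a, 'm) star_algebra_scheme \<Rightarrow> nat \<Rightarrow> (nat \<times> nat) set \<Rightarrow> (nat \<Rightarrow> nat \<Rightarrow> 'a) \<Rightarrow> bool" where
  "intertwines A n E u \<longleftrightarrow> (\<forall>i\<in>{1..n}. \<forall>j\<in>{1..n}.
     (\<Oplus>\<^bsub>A\<^esub>k\<in>{1..n}. adjacency E k j \<odot>\<^bsub>A\<^esub> u i k) = (\<Oplus>\<^bsub>A\<^esub>k\<in>{1..n}. adjacency E i k \<odot>\<^bsub>A\<^esub> u k j))"

definition edges_commute ::
    "('a, 'm) star_algebra_scheme \<Rightarrow> (nat \<times> nat) set \<Rightarrow> (nat \<Rightarrow> nat \<Rightarrow> 'a) \<Rightarrow> bool" where
  "edges_commute A E u \<longleftrightarrow> (\<forall>e\<in>E. \<forall>f\<in>E.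
     u (fst e) (fst f) \<otimes>\<^bsub>A\<^esub> u (snd e) (snd f) = u (snd e) (snd f) \<otimes>\<^bsub>A\<^esub> u (fst e) (fst f))"

abbreviation mat_idx :: "nat \<Rightarrow> (nat \<times> nat) set" where "mat_idx n \<equiv> {1..n} \<times> {1..n}"

lemma satisfies_Un: "satisfies S (R \<union> R') B u \<longleftrightarrow> satisfies S R B u \<and> satisfies S R' B u"
  by (auto simp: satisfies_def)

lemma satisfies_mono: "satisfies S R B u \<Longrightarrow> R' \<subseteq> R \<Longrightarrow> satisfies S R' B u"
  unfolding satisfies_def by blast

section \<open>From relations in the free algebra to equations between matrix entries\<close>

context star_algebra
begin

context
  fixes n :: nat and u :: "nat \<times> nat \<Rightarrow> 'a"
  assumes u: "\<And>x. x \<in> mat_idx n \<Longrightarrow> u x \<in> carrier A"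
begin

interpretation ev: star_homomorphism "mat_free n" A "free_ev A u"
  by (unfold_locales) (rule free_ev_hom, rule u)

private lemma uu: "i \<in> {1..n} \<Longrightarrow> j \<in> {1..n} \<Longrightarrow> u (i, j) \<in> carrier A"
  by (rule u) simp

private lemma fg: "i \<in> {1..n} \<Longrightarrow> j \<in> {1..n} \<Longrightarrow> free_gen (i, j) \<in> carrier (mat_free n)"
  by (rule free_gen_closed) simp

private lemma ev_gen: "i \<in> {1..n} \<Longrightarrow> j \<in> {1..n} \<Longrightarrow> free_ev A u (free_gen (i, j)) = u (i, j)"
  by (rule free_ev_gen) (rule uu)

private lemma ev_sum:
  "f \<in> {1..n} \<rightarrow> carrier (mat_free n) \<Longrightarrow>
   free_ev A u (\<Oplus>\<^bsub>mat_free n\<^esub>k\<in>{1..n}. f k) = (\<Oplus>k\<in>{1..n}. free_ev A u (f k))"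
  by (rule ev.hom_finsum) auto

lemma satisfies_rel_ab:
  "satisfies (mat_idx n) (rel_a n \<union> rel_b n) A u \<longleftrightarrow> magic A n (\<lambda>i j. u (i, j))"
proof -
  have sum: "free_ev A u (\<Oplus>\<^bsub>mat_free n\<^esub>l\<in>{1..n}. free_gen (i, l)) = (\<Oplus>l\<in>{1..n}. u (i, l))"
      "free_ev A u (\<Oplus>\<^bsub>mat_free n\<^esub>l\<in>{1..n}. free_gen (l, i)) = (\<Oplus>l\<in>{1..n}. u (l, i))"
    if "i \<in> {1..n}" for i
    by (subst ev_sum; (rule finsum_cong')?; use that fg uu ev_gen in auto)+
  have "satisfies (mat_idx n) (rel_a n \<union> rel_b n) A u \<longleftrightarrow>
     (\<forall>i\<in>{1..n}. \<forall>j\<in>{1..n}. star A (u (i, j)) = u (i, j)) \<and>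
     (\<forall>i\<in>{1..n}. \<forall>j\<in>{1..n}. \<forall>k\<in>{1..n}. u (i, j) \<otimes> u (i, k) = (if j = k then u (i, j) else \<zero>)) \<and>
     (\<forall>i\<in>{1..n}. \<forall>j\<in>{1..n}. \<forall>k\<in>{1..n}. u (j, i) \<otimes> u (k, i) = (if j = k then u (j, i) else \<zero>)) \<and>
     (\<forall>i\<in>{1..n}. (\<Oplus>l\<in>{1..n}. u (i, l)) = \<one>) \<and> (\<forall>i\<in>{1..n}. (\<Oplus>l\<in>{1..n}. u (l, i)) = \<one>)"
  proof -
    have s: "satisfies (mat_idx n) (rel_a n \<union> rel_b n) A u \<longleftrightarrow>
      (\<forall>r\<in>rel_a n \<union> rel_b n. free_ev A u (fst r) = free_ev A u (snd r))"
      using u by (simp only: satisfies_def split_def) blast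
    have 1: "(\<forall>r\<in>{(f i j, g i j) |i j. i \<in> {1..n} \<and> j \<in> {1..n}}. free_ev A u (fst r) = free_ev A u (snd r)) \<longleftrightarrow>
      (\<forall>i\<in>{1..n}. \<forall>j\<in>{1..n}. free_ev A u (f i j) = free_ev A u (g i j))" for f g by fastforce
    have 2: "(\<forall>r\<in>{(f i j k, g i j k) |i j k. i \<in> {1..n} \<and> j \<in> {1..n} \<and> k \<in> {1..n}}. free_ev A u (fst r) = free_ev A u (snd r)) \<longleftrightarrow>
      (\<forall>i\<in>{1..n}. \<forall>j\<in>{1..n}. \<forall>k\<in>{1..n}. free_ev A u (f i j k) = free_ev A u (g i j k))" for f g by fastforce
    have 3: "(\<forall>r\<in>{(f i, g i) |i. i \<in> {1..n}}. free_ev A u (fst r) = free_ev A u (snd r)) \<longleftrightarrow>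
      (\<forall>i\<in>{1..n}. free_ev A u (f i) = free_ev A u (g i))" for f g by fastforce
    have c: "free_ev A u (free_gen (i, j) \<otimes>\<^bsub>mat_free n\<^esub> free_gen (k, l)) = u (i, j) \<otimes> u (k, l)"
        "free_ev A u (star (mat_free n) (free_gen (i, j))) = star A (u (i, j))"
      if "i \<in> {1..n}" "j \<in> {1..n}" "k \<in> {1..n}" "l \<in> {1..n}" for i j k l
      using that by (simp_all only: ev.hom_mult ev.hom_star fg ev_gen)
    have d: "free_ev A u (if j = k then free_gen (i, l) else \<zero>\<^bsub>mat_free n\<^esub>) = (if j = k then u (i, l) else \<zero>)"
      if "i \<in> {1..n}" "l \<in> {1..n}" for i j k l
      using that by (simp add: ev.hom_zero ev_gen)
    have e: "u x = star A (u x) \<longleftrightarrow> star A (u x) = u x" for x by (rule eq_commute)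
    show ?thesis
      unfolding s
      unfolding rel_a_def rel_b_def Let_def ball_Un 1 2 3
      by (simp add: c d e ev_gen sum ev.hom_one conj_assoc del: atLeastAtMost_iff cong: ball_cong)
  qed
  then show ?thesis unfolding magic_def using uu by blast
qed

lemma satisfies_rel_c:
  "satisfies (mat_idx n) (rel_c n E) A u \<longleftrightarrow> intertwines A n E (\<lambda>i j. u (i, j))"
proof -
  have sum: "free_ev A u (\<Oplus>\<^bsub>mat_free n\<^esub>k\<in>{1..n}. adjacency E k j \<odot>\<^bsub>mat_free n\<^esub> free_gen (i, k)) =
        (\<Oplus>k\<in>{1..n}. adjacency E k j \<odot> u (i, k))"
      "free_ev A u (\<Oplus>\<^bsub>mat_free n\<^esub>k\<in>{1..n}. adjacency E i k \<odot>\<^bsub>mat_free n\<^esub> free_gen (k, j)) =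
        (\<Oplus>k\<in>{1..n}. adjacency E i k \<odot> u (k, j))"
    if "i \<in> {1..n}" "j \<in> {1..n}" for i j
    by (subst ev_sum; (rule finsum_cong')?; use that fg uu ev_gen in \<open>auto simp: ev.hom_smult\<close>)+
  have 1: "(\<forall>r\<in>{(f i j, g i j) |i j. i \<in> {1..n} \<and> j \<in> {1..n}}. free_ev A u (fst r) = free_ev A u (snd r)) \<longleftrightarrow>
      (\<forall>i\<in>{1..n}. \<forall>j\<in>{1..n}. free_ev A u (f i j) = free_ev A u (g i j))" for f g by fastforce
  have "satisfies (mat_idx n) (rel_c n E) A u \<longleftrightarrow>
      (\<forall>r\<in>rel_c n E. free_ev A u (fst r) = free_ev A u (snd r))"
    using u by (simp only: satisfies_def split_def) blast
  also have "\<dots> \<longleftrightarrow> (\<forall>i\<in>{1..n}. \<forall>j\<in>{1..n}.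
     free_ev A u (\<Oplus>\<^bsub>mat_free n\<^esub>k\<in>{1..n}. adjacency E k j \<odot>\<^bsub>mat_free n\<^esub> free_gen (i, k)) =
     free_ev A u (\<Oplus>\<^bsub>mat_free n\<^esub>k\<in>{1..n}. adjacency E i k \<odot>\<^bsub>mat_free n\<^esub> free_gen (k, j)))"
    unfolding rel_c_def Let_def 1 ..
  finally show ?thesis
    unfolding intertwines_def by (simp add: sum del: atLeastAtMost_iff cong: ball_cong)
qed

lemma satisfies_rel_d:
  assumes E: "E \<subseteq> mat_idx n"
  shows "satisfies (mat_idx n) (rel_d n E) A u \<longleftrightarrow> edges_commute A E (\<lambda>i j. u (i, j))"
proof -
  have c: "free_ev A u (free_gen (i, j) \<otimes>\<^bsub>mat_free n\<^esub> free_gen (k, l)) = u (i, j) \<otimes> u (k, l)"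
    if "i \<in> {1..n}" "j \<in> {1..n}" "k \<in> {1..n}" "l \<in> {1..n}" for i j k l
    using that by (simp only: ev.hom_mult fg ev_gen)
  have e: "fst e \<in> {1..n}" "snd e \<in> {1..n}" if "e \<in> E" for e using E that by auto
  have "satisfies (mat_idx n) (rel_d n E) A u \<longleftrightarrow>
      (\<forall>r\<in>rel_d n E. free_ev A u (fst r) = free_ev A u (snd r))"
    using u by (simp only: satisfies_def split_def) blast
  also have "\<dots> \<longleftrightarrow> (\<forall>e\<in>E. \<forall>f\<in>E.
     free_ev A u (free_gen (fst e, fst f) \<otimes>\<^bsub>mat_free n\<^esub> free_gen (snd e, snd f)) =
     free_ev A u (free_gen (snd e, snd f) \<otimes>\<^bsub>mat_free n\<^esub> free_gen (fst e, fst f)))"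
    unfolding rel_d_def Let_def by fastforce
  finally show ?thesis
    unfolding edges_commute_def by (simp add: c e del: atLeastAtMost_iff cong: ball_cong)
qed

end

end

text \<open>By the C*-identity the norm of a projection is its own square.\<close>

lemma (in cstar_algebra) projection_norm:
  assumes "x \<in> carrier A" "star A x = x" "x \<otimes> x = x" shows "cnorm A x \<le> 1"
proof -
  have "cnorm A x = 0 \<or> cnorm A x = 1"
    using p_cstar[OF assms(1)] assms by (simp add: power2_eq_square)
  then show ?thesis by auto
qed

lemma magicD:
  assumes "magic A n u"
  shows magic_closed: "i \<in> {1..n} \<Longrightarrow> j \<in> {1..n} \<Longrightarrow> u i j \<in> carrier A"
    and magic_star: "i \<in> {1..n} \<Longrightarrow> j \<in> {1..n} \<Longrightarrow> star A (u i j) = u i j"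
    and magic_row: "i \<in> {1..n} \<Longrightarrow> j \<in> {1..n} \<Longrightarrow> k \<in> {1..n} \<Longrightarrow>
        u i j \<otimes>\<^bsub>A\<^esub> u i k = (if j = k then u i j else \<zero>\<^bsub>A\<^esub>)"
    and magic_col: "i \<in> {1..n} \<Longrightarrow> j \<in> {1..n} \<Longrightarrow> k \<in> {1..n} \<Longrightarrow>
        u j i \<otimes>\<^bsub>A\<^esub> u k i = (if j = k then u j i else \<zero>\<^bsub>A\<^esub>)"
    and magic_row_sum: "i \<in> {1..n} \<Longrightarrow> (\<Oplus>\<^bsub>A\<^esub>l\<in>{1..n}. u i l) = \<one>\<^bsub>A\<^esub>"
    and magic_col_sum: "i \<in> {1..n} \<Longrightarrow> (\<Oplus>\<^bsub>A\<^esub>l\<in>{1..n}. u l i) = \<one>\<^bsub>A\<^esub>"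
  using assms unfolding magic_def by blast+

context star_algebra
begin

text \<open>Evaluate \<open>u_ia (\<Sum>m. \<epsilon>_im u_mb) u_jb\<close> in two ways. The column
  relation leaves \<open>\<epsilon>_ij u_ia u_jb\<close>; replacing the sum by
  \<open>\<Sum>m. \<epsilon>_mb u_im\<close> and using the row relation leaves
  \<open>\<epsilon>_ab u_ia u_jb\<close>. One coefficient is 1, the other 0.\<close>

lemma non_edge_product:
  assumes m: "magic A n u" and c: "intertwines A n E u"
    and ij: "i \<in> {1..n}" "j \<in> {1..n}" and ab: "a \<in> {1..n}" "b \<in> {1..n}"
    and ne: "(i, j) \<in> E \<longleftrightarrow> (a, b) \<notin> E"
  shows "u i a \<otimes> u j b = \<zero>"
proof -
  note [simp] = magicD(1,2)[OF m]
  have "(\<Oplus>m\<in>{1..n}. adjacency E i m \<odot> u m b) \<otimes> u j b = (\<Oplus>m\<in>{1..n}. (adjacency E i m \<odot> u m b) \<otimes> u j b)"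
    by (rule finsum_ldistr) (use ij ab in auto)
  also have "\<dots> = (adjacency E i j \<odot> u j b) \<otimes> u j b"
    by (rule finsum_delta) (use ij ab in \<open>auto simp: smult_mult_left magic_col[OF m]\<close>)
  also have "\<dots> = adjacency E i j \<odot> u j b" using ij ab by (simp add: smult_mult_left magic_row[OF m])
  finally have 1: "(\<Oplus>m\<in>{1..n}. adjacency E i m \<odot> u m b) \<otimes> u j b = adjacency E i j \<odot> u j b" .
  have "u i a \<otimes> (\<Oplus>m\<in>{1..n}. adjacency E m b \<odot> u i m) = (\<Oplus>m\<in>{1..n}. u i a \<otimes> (adjacency E m b \<odot> u i m))"
    by (rule finsum_rdistr) (use ij ab in auto)
  also have "\<dots> = u i a \<otimes> (adjacency E a b \<odot> u i a)"
    by (rule finsum_delta) (use ij ab in \<open>auto simp: smult_mult_right magic_row[OF m]\<close>)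
  also have "\<dots> = adjacency E a b \<odot> u i a" using ij ab by (simp add: smult_mult_right magic_row[OF m])
  finally have 2: "u i a \<otimes> (\<Oplus>m\<in>{1..n}. adjacency E i m \<odot> u m b) = adjacency E a b \<odot> u i a"
    using c ij ab by (simp add: intertwines_def)
  have "adjacency E i j \<odot> (u i a \<otimes> u j b) = u i a \<otimes> ((\<Oplus>m\<in>{1..n}. adjacency E i m \<odot> u m b) \<otimes> u j b)"
    unfolding 1 using ij ab by (simp add: smult_mult_right)
  also have "\<dots> = (u i a \<otimes> (\<Oplus>m\<in>{1..n}. adjacency E i m \<odot> u m b)) \<otimes> u j b"
    by (rule m_assoc[symmetric]) (use ij ab in auto)
  also have "\<dots> = adjacency E a b \<odot> (u i a \<otimes> u j b)"
    unfolding 2 using ij ab by (simp add: smult_mult_left)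
  finally show ?thesis
    using ne ij ab by (cases "(a, b) \<in> E") (simp_all add: adjacency_def)
qed

end

section \<open>The comultiplication\<close>

context cstar_algebra
begin

definition conv :: "nat \<Rightarrow> (nat \<Rightarrow> nat \<Rightarrow> 'a) \<Rightarrow> nat \<Rightarrow> nat \<Rightarrow> (nat \<Rightarrow> 'a \<times> 'a \<Rightarrow> complex) set" where
  "conv n u i j = (\<Oplus>\<^bsub>min_tensor A A\<^esub>k\<in>{1..n}. tensor A A (u i k) (u k j))"

interpretation D: cstar_pair A A by unfold_locales

context
  fixes n :: nat and u :: "nat \<Rightarrow> nat \<Rightarrow> 'a"
  assumes m: "magic A n u"
begin

private lemma uc [simp]: "i \<in> {1..n} \<Longrightarrow> j \<in> {1..n} \<Longrightarrow> u i j \<in> carrier A"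
  by (rule magicD[OF m])

lemma conv_closed [simp]: "i \<in> {1..n} \<Longrightarrow> j \<in> {1..n} \<Longrightarrow> conv n u i j \<in> carrier (min_tensor A A)"
  unfolding conv_def by (rule D.M.finsum_closed) auto

lemma conv_mult:
  assumes "i \<in> {1..n}" "j \<in> {1..n}" "k \<in> {1..n}" "l \<in> {1..n}"
  shows "conv n u i j \<otimes>\<^bsub>min_tensor A A\<^esub> conv n u k l =
    (\<Oplus>\<^bsub>min_tensor A A\<^esub>a\<in>{1..n}. \<Oplus>\<^bsub>min_tensor A A\<^esub>b\<in>{1..n}. tensor A A (u i a \<otimes> u k b) (u a j \<otimes> u b l))"
proof -
  have "conv n u i j \<otimes>\<^bsub>min_tensor A A\<^esub> conv n u k l =
     (\<Oplus>\<^bsub>min_tensor A A\<^esub>a\<in>{1..n}. tensor A A (u i a) (u a j) \<otimes>\<^bsub>min_tensor A A\<^esub> conv n u k l)"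
    unfolding conv_def[of n u i j] by (rule D.M.finsum_ldistr) (use assms in auto)
  also have "\<dots> = (\<Oplus>\<^bsub>min_tensor A A\<^esub>a\<in>{1..n}. \<Oplus>\<^bsub>min_tensor A A\<^esub>b\<in>{1..n}.
      tensor A A (u i a) (u a j) \<otimes>\<^bsub>min_tensor A A\<^esub> tensor A A (u k b) (u b l))"
    unfolding conv_def[of n u k l]
    by (intro D.M.finsum_cong' HOL.refl D.M.finsum_rdistr) (use assms in \<open>auto intro!: D.M.finsum_closed\<close>)
  also have "\<dots> = (\<Oplus>\<^bsub>min_tensor A A\<^esub>a\<in>{1..n}. \<Oplus>\<^bsub>min_tensor A A\<^esub>b\<in>{1..n}.
      tensor A A (u i a \<otimes> u k b) (u a j \<otimes> u b l))"
    by (intro D.M.finsum_cong' HOL.refl D.tensor_mult) (use assms in \<open>auto intro!: D.M.finsum_closed\<close>)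
  finally show ?thesis .
qed

lemma magic_conv: "magic (min_tensor A A) n (conv n u)"
  unfolding magic_def
proof (intro conjI ballI)
  let ?M = "min_tensor A A"
  fix i j assume ij: "i \<in> {1..n}" "j \<in> {1..n}"
  show "conv n u i j \<in> carrier ?M" using ij by simp
  have "star ?M (conv n u i j) = (\<Oplus>\<^bsub>?M\<^esub>k\<in>{1..n}. star ?M (tensor A A (u i k) (u k j)))"
    unfolding conv_def by (rule D.M.finsum_star) (use ij in auto)
  also have "\<dots> = conv n u i j"
    unfolding conv_def by (rule D.M.finsum_cong') (use ij in \<open>auto simp: D.tensor_star magicD[OF m]\<close>)
  finally show "star ?M (conv n u i j) = conv n u i j" .
  fix k assume k: "k \<in> {1..n}"
  have "conv n u i j \<otimes>\<^bsub>?M\<^esub> conv n u i k =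
      (\<Oplus>\<^bsub>?M\<^esub>a\<in>{1..n}. \<Oplus>\<^bsub>?M\<^esub>b\<in>{1..n}. tensor A A (u i a \<otimes> u i b) (u a j \<otimes> u b k))"
    by (rule conv_mult) (use ij k in auto)
  \<comment> \<open>The row relation in the first leg kills the terms with
    \<open>b \<noteq> a\<close>; on the diagonal the row relation in the second leg compares
    \<open>j\<close> with \<open>k\<close>.\<close>
  also have "\<dots> = (\<Oplus>\<^bsub>?M\<^esub>a\<in>{1..n}. tensor A A (u i a \<otimes> u i a) (u a j \<otimes> u a k))"
    by (intro D.M.finsum_cong' HOL.refl D.M.finsum_delta)
       (use ij k in \<open>auto simp: magic_row[OF m] D.tensor_zero_left\<close>)
  also have "\<dots> = (\<Oplus>\<^bsub>?M\<^esub>a\<in>{1..n}. if j = k then tensor A A (u i a) (u a j) else \<zero>\<^bsub>?M\<^esub>)"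
    by (intro D.M.finsum_cong')
       (use ij k in \<open>auto simp: magic_row[OF m] D.tensor_zero_right\<close>)
  also have "\<dots> = (if j = k then conv n u i j else \<zero>\<^bsub>?M\<^esub>)"
    by (simp add: conv_def D.M.finsum_zero)
  finally show "conv n u i j \<otimes>\<^bsub>?M\<^esub> conv n u i k = (if j = k then conv n u i j else \<zero>\<^bsub>?M\<^esub>)" .
  have "conv n u j i \<otimes>\<^bsub>?M\<^esub> conv n u k i =
      (\<Oplus>\<^bsub>?M\<^esub>a\<in>{1..n}. \<Oplus>\<^bsub>?M\<^esub>b\<in>{1..n}. tensor A A (u j a \<otimes> u k b) (u a i \<otimes> u b i))"
    by (rule conv_mult) (use ij k in auto)
  also have "\<dots> = (\<Oplus>\<^bsub>?M\<^esub>a\<in>{1..n}. tensor A A (u j a \<otimes> u k a) (u a i \<otimes> u a i))"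
    by (intro D.M.finsum_cong' HOL.refl D.M.finsum_delta)
       (use ij k in \<open>auto simp: magic_col[OF m] D.tensor_zero_right\<close>)
  also have "\<dots> = (\<Oplus>\<^bsub>?M\<^esub>a\<in>{1..n}. if j = k then tensor A A (u j a) (u a i) else \<zero>\<^bsub>?M\<^esub>)"
    by (intro D.M.finsum_cong')
       (use ij k in \<open>auto simp: magic_col[OF m] D.tensor_zero_left\<close>)
  also have "\<dots> = (if j = k then conv n u j i else \<zero>\<^bsub>?M\<^esub>)"
    by (simp add: conv_def D.M.finsum_zero)
  finally show "conv n u j i \<otimes>\<^bsub>?M\<^esub> conv n u k i = (if j = k then conv n u j i else \<zero>\<^bsub>?M\<^esub>)" .
next
  let ?M = "min_tensor A A"
  fix i assume i: "i \<in> {1..n}"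
  have "(\<Oplus>\<^bsub>?M\<^esub>l\<in>{1..n}. conv n u i l) = (\<Oplus>\<^bsub>?M\<^esub>k\<in>{1..n}. \<Oplus>\<^bsub>?M\<^esub>l\<in>{1..n}. tensor A A (u i k) (u k l))"
    unfolding conv_def by (rule D.M.finsum_swap) (use i in auto)
  also have "\<dots> = (\<Oplus>\<^bsub>?M\<^esub>k\<in>{1..n}. tensor A A (u i k) \<one>)"
    by (rule D.M.finsum_cong', use i in simp, use i in simp, subst D.tensor_finsum_right[symmetric])
       (use i magic_row_sum[OF m] in auto)
  also have "\<dots> = tensor A A (\<Oplus>k\<in>{1..n}. u i k) \<one>"
    by (rule D.tensor_finsum_left[symmetric]) (use i in auto)
  finally show "(\<Oplus>\<^bsub>?M\<^esub>l\<in>{1..n}. conv n u i l) = \<one>\<^bsub>?M\<^esub>"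
    using i by (simp add: magic_row_sum[OF m] D.tensor_one)
  have "(\<Oplus>\<^bsub>?M\<^esub>l\<in>{1..n}. conv n u l i) = (\<Oplus>\<^bsub>?M\<^esub>k\<in>{1..n}. \<Oplus>\<^bsub>?M\<^esub>l\<in>{1..n}. tensor A A (u l k) (u k i))"
    unfolding conv_def by (rule D.M.finsum_swap) (use i in auto)
  also have "\<dots> = (\<Oplus>\<^bsub>?M\<^esub>k\<in>{1..n}. tensor A A \<one> (u k i))"
    by (rule D.M.finsum_cong', use i in simp, use i in simp, subst D.tensor_finsum_left[symmetric])
       (use i magic_col_sum[OF m] in auto)
  also have "\<dots> = tensor A A \<one> (\<Oplus>k\<in>{1..n}. u k i)"
    by (rule D.tensor_finsum_right[symmetric]) (use i in auto)
  finally show "(\<Oplus>\<^bsub>?M\<^esub>l\<in>{1..n}. conv n u l i) = \<one>\<^bsub>?M\<^esub>"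
    using i by (simp add: magic_col_sum[OF m] D.tensor_one)
qed

text \<open>The adjacency coefficient travels through the tensor sign: the relation for
  \<open>u\<close> is applied to the second leg, bilinearity shifts the coefficient to the first
  leg, and there the relation is applied again.\<close>

lemma intertwines_conv:
  assumes c: "intertwines A n E u" shows "intertwines (min_tensor A A) n E (conv n u)"
  unfolding intertwines_def
proof (intro ballI)
  let ?M = "min_tensor A A"
  fix i j assume ij: "i \<in> {1..n}" "j \<in> {1..n}"
  let ?e = "adjacency E"
  have c': "(\<Oplus>k\<in>{1..n}. ?e k b \<odot> u a k) = (\<Oplus>k\<in>{1..n}. ?e a k \<odot> u k b)"
    if "a \<in> {1..n}" "b \<in> {1..n}" for a b using c that by (simp add: intertwines_def)
  have "(\<Oplus>\<^bsub>?M\<^esub>k\<in>{1..n}. ?e k j \<odot>\<^bsub>?M\<^esub> conv n u i k) =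
      (\<Oplus>\<^bsub>?M\<^esub>k\<in>{1..n}. \<Oplus>\<^bsub>?M\<^esub>m\<in>{1..n}. tensor A A (u i m) (?e k j \<odot> u m k))"
    unfolding conv_def
    by (rule D.M.finsum_cong', use ij in simp, use ij in simp, subst D.M.finsum_smult)
       (use ij in simp, use ij in simp, rule D.M.finsum_cong', use ij in \<open>simp_all add: D.tensor_smult_right\<close>)
  also have "\<dots> = (\<Oplus>\<^bsub>?M\<^esub>m\<in>{1..n}. \<Oplus>\<^bsub>?M\<^esub>k\<in>{1..n}. tensor A A (u i m) (?e k j \<odot> u m k))"
    by (rule D.M.finsum_swap) (use ij in auto)
  also have "\<dots> = (\<Oplus>\<^bsub>?M\<^esub>m\<in>{1..n}. tensor A A (u i m) (\<Oplus>k\<in>{1..n}. ?e m k \<odot> u k j))"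
    by (rule D.M.finsum_cong', use ij in simp, use ij in simp, subst D.tensor_finsum_right[symmetric])
       (use ij c' in auto)
  also have "\<dots> = (\<Oplus>\<^bsub>?M\<^esub>m\<in>{1..n}. \<Oplus>\<^bsub>?M\<^esub>k\<in>{1..n}. tensor A A (u i m) (?e m k \<odot> u k j))"
    by (rule D.M.finsum_cong', use ij in simp, use ij in simp, rule D.tensor_finsum_right)
       (use ij in auto)
  also have "\<dots> = (\<Oplus>\<^bsub>?M\<^esub>m\<in>{1..n}. \<Oplus>\<^bsub>?M\<^esub>k\<in>{1..n}. tensor A A (?e m k \<odot> u i m) (u k j))"
    by (intro D.M.finsum_cong' HOL.refl)
       (use ij in \<open>auto simp: D.tensor_smult_left D.tensor_smult_right\<close>)
  also have "\<dots> = (\<Oplus>\<^bsub>?M\<^esub>k\<in>{1..n}. \<Oplus>\<^bsub>?M\<^esub>m\<in>{1..n}. tensor A A (?e m k \<odot> u i m) (u k j))"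
    by (rule D.M.finsum_swap) (use ij in auto)
  also have "\<dots> = (\<Oplus>\<^bsub>?M\<^esub>k\<in>{1..n}. tensor A A (\<Oplus>m\<in>{1..n}. ?e i m \<odot> u m k) (u k j))"
    by (rule D.M.finsum_cong', use ij in simp, use ij in simp, subst D.tensor_finsum_left[symmetric])
       (use ij c' in auto)
  also have "\<dots> = (\<Oplus>\<^bsub>?M\<^esub>k\<in>{1..n}. \<Oplus>\<^bsub>?M\<^esub>m\<in>{1..n}. tensor A A (?e i m \<odot> u m k) (u k j))"
    by (rule D.M.finsum_cong', use ij in simp, use ij in simp, rule D.tensor_finsum_left)
       (use ij in auto)
  also have "\<dots> = (\<Oplus>\<^bsub>?M\<^esub>m\<in>{1..n}. \<Oplus>\<^bsub>?M\<^esub>k\<in>{1..n}. tensor A A (?e i m \<odot> u m k) (u k j))"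
    by (rule D.M.finsum_swap) (use ij in auto)
  also have "\<dots> = (\<Oplus>\<^bsub>?M\<^esub>m\<in>{1..n}. ?e i m \<odot>\<^bsub>?M\<^esub> conv n u m j)"
    unfolding conv_def
    by (rule D.M.finsum_cong', use ij in simp, use ij in simp, subst D.M.finsum_smult)
       (use ij in simp, use ij in simp, rule D.M.finsum_cong', use ij in \<open>simp_all add: D.tensor_smult_left\<close>)
  finally show "(\<Oplus>\<^bsub>?M\<^esub>k\<in>{1..n}. ?e k j \<odot>\<^bsub>?M\<^esub> conv n u i k) = (\<Oplus>\<^bsub>?M\<^esub>k\<in>{1..n}. ?e i k \<odot>\<^bsub>?M\<^esub> conv n u k j)" .
qed

text \<open>The product is a double sum over middle indices \<open>(a, b)\<close>. If
  \<open>(a, b)\<close> is an edge, the relation for \<open>u\<close> applies in both legs;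
  otherwise the first leg vanishes in either order by \<open>non_edge_product\<close>. This is where
  (d) depends on (c).\<close>

lemma edges_commute_conv:
  assumes c: "intertwines A n E u" and d: "edges_commute A E u" and E: "E \<subseteq> mat_idx n"
  shows "edges_commute (min_tensor A A) E (conv n u)"
  unfolding edges_commute_def
proof (intro ballI)
  let ?M = "min_tensor A A"
  fix e f assume e: "e \<in> E" and f: "f \<in> E"
  obtain i j k l where ef: "e = (i, j)" "f = (k, l)" by (cases e, cases f) auto
  have ij: "i \<in> {1..n}" "j \<in> {1..n}" "k \<in> {1..n}" "l \<in> {1..n}" using e f ef E by auto
  have eq: "tensor A A (u i a \<otimes> u j b) (u a k \<otimes> u b l) = tensor A A (u j b \<otimes> u i a) (u b l \<otimes> u a k)"
    if "a \<in> {1..n}" "b \<in> {1..n}" for a b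
  proof (cases "(a, b) \<in> E")
    case True
    have "u i a \<otimes> u j b = u j b \<otimes> u i a" "u a k \<otimes> u b l = u b l \<otimes> u a k"
      using d e f True unfolding edges_commute_def ef by force+
    then show ?thesis by simp
  next
    case False
    have z: "u i a \<otimes> u j b = \<zero>"
      by (rule non_edge_product[OF m c ij(1,2) that]) (use False e ef in simp)
    have "u j b \<otimes> u i a = star A (u i a \<otimes> u j b)" using ij that by (simp add: star_mult magicD(2)[OF m])
    then show ?thesis using ij that by (simp add: z D.tensor_zero_left)
  qed
  have "conv n u i k \<otimes>\<^bsub>?M\<^esub> conv n u j l =
      (\<Oplus>\<^bsub>?M\<^esub>a\<in>{1..n}. \<Oplus>\<^bsub>?M\<^esub>b\<in>{1..n}. tensor A A (u i a \<otimes> u j b) (u a k \<otimes> u b l))"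
    by (rule conv_mult) (use ij in auto)
  also have "\<dots> = (\<Oplus>\<^bsub>?M\<^esub>a\<in>{1..n}. \<Oplus>\<^bsub>?M\<^esub>b\<in>{1..n}. tensor A A (u j b \<otimes> u i a) (u b l \<otimes> u a k))"
    by (intro D.M.finsum_cong' HOL.refl eq) (use ij in auto)
  also have "\<dots> = (\<Oplus>\<^bsub>?M\<^esub>b\<in>{1..n}. \<Oplus>\<^bsub>?M\<^esub>a\<in>{1..n}. tensor A A (u j b \<otimes> u i a) (u b l \<otimes> u a k))"
    by (rule D.M.finsum_swap) (use ij in auto)
  also have "\<dots> = conv n u j l \<otimes>\<^bsub>?M\<^esub> conv n u i k"
    by (rule conv_mult[symmetric]) (use ij in auto)
  finally show "conv n u (fst e) (fst f) \<otimes>\<^bsub>?M\<^esub> conv n u (snd e) (snd f) =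
      conv n u (snd e) (snd f) \<otimes>\<^bsub>?M\<^esub> conv n u (fst e) (fst f)"
    by (simp add: ef)
qed

text \<open>The inverse is the transpose: distinct entries of a row or column are orthogonal, and
  the remaining squares are the entries themselves, which sum to 1.\<close>

lemma magic_invertible: "matrix_invertible A n u" "matrix_invertible A n (\<lambda>i j. u j i)"
proof -
  have 1: "(\<Oplus>k\<in>{1..n}. u i k \<otimes> u j k) = (if i = j then \<one> else \<zero>)"
    if "i \<in> {1..n}" "j \<in> {1..n}" for i j
  proof -
    have "(\<Oplus>k\<in>{1..n}. u i k \<otimes> u j k) = (\<Oplus>k\<in>{1..n}. if i = j then u i k else \<zero>)"
      by (rule finsum_cong') (use that in \<open>auto simp: magic_col[OF m]\<close>)
    then show ?thesis using that by (simp add: magic_row_sum[OF m] finsum_zero)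
  qed
  have 2: "(\<Oplus>k\<in>{1..n}. u k i \<otimes> u k j) = (if i = j then \<one> else \<zero>)"
    if "i \<in> {1..n}" "j \<in> {1..n}" for i j
  proof -
    have "(\<Oplus>k\<in>{1..n}. u k i \<otimes> u k j) = (\<Oplus>k\<in>{1..n}. if i = j then u k i else \<zero>)"
      by (rule finsum_cong') (use that in \<open>auto simp: magic_row[OF m]\<close>)
    then show ?thesis using that by (simp add: magic_col_sum[OF m] finsum_zero)
  qed
  show "matrix_invertible A n u" "matrix_invertible A n (\<lambda>i j. u j i)"
    unfolding matrix_invertible_def
    by (rule exI[of _ "\<lambda>i j. u j i"], use 1 2 in simp) (rule exI[of _ u], use 1 2 in simp)
qed

end

end

section \<open>Quantum automorphism groups are compact matrix quantum groups\<close>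

lemma rel_carrier:
  shows "rel_a n \<subseteq> carrier (mat_free n) \<times> carrier (mat_free n)"
    and "rel_b n \<subseteq> carrier (mat_free n) \<times> carrier (mat_free n)"
    and "rel_c n E \<subseteq> carrier (mat_free n) \<times> carrier (mat_free n)"
    and "E \<subseteq> mat_idx n \<Longrightarrow> rel_d n E \<subseteq> carrier (mat_free n) \<times> carrier (mat_free n)"
proof -
  note [simp] = free_gen_closed[of "(_, _)" "mat_idx n"]
  show "rel_a n \<subseteq> carrier (mat_free n) \<times> carrier (mat_free n)"
    unfolding rel_a_def Let_def by (auto split: if_splits)
  show "rel_b n \<subseteq> carrier (mat_free n) \<times> carrier (mat_free n)"
    unfolding rel_b_def Let_def by (auto intro!: free.T.finsum_closed)
  show "rel_c n E \<subseteq> carrier (mat_free n) \<times> carrier (mat_free n)"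
    unfolding rel_c_def Let_def by (auto intro!: free.T.finsum_closed)
  show "rel_d n E \<subseteq> carrier (mat_free n) \<times> carrier (mat_free n)" if "E \<subseteq> mat_idx n"
  proof
    fix r assume "r \<in> rel_d n E"
    then obtain e f where ef: "e \<in> E" "f \<in> E" and r: "r =
        (free_gen (fst e, fst f) \<otimes>\<^bsub>mat_free n\<^esub> free_gen (snd e, snd f),
         free_gen (snd e, snd f) \<otimes>\<^bsub>mat_free n\<^esub> free_gen (fst e, fst f))"
      unfolding rel_d_def Let_def by blast
    have "fst e \<in> {1..n}" "snd e \<in> {1..n}" "fst f \<in> {1..n}" "snd f \<in> {1..n}" using that ef by auto
    then show "r \<in> carrier (mat_free n) \<times> carrier (mat_free n)" by (simp add: r)
  qed
qed

lemma satisfiesD: "satisfies S R B u \<Longrightarrow> x \<in> S \<Longrightarrow> u x \<in> carrier B"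
  by (simp add: satisfies_def)

text \<open>The entries of a magic unitary are projections, which bounds the generators by
  1.\<close>

lemma presentation_magic:
  assumes R: "R \<subseteq> carrier (mat_free n) \<times> carrier (mat_free n)" and ab: "rel_a n \<union> rel_b n \<subseteq> R"
  shows "presentation (mat_idx n) R"
proof (rule presentationI[OF R])
  fix B :: "(nat \<Rightarrow> mat_poly) set cstar_algebra" and u x
  assume B: "cstar_algebra B" and sat: "satisfies (mat_idx n) R B u" and x: "x \<in> mat_idx n"
  interpret B: cstar_algebra B by fact
  have "satisfies (mat_idx n) (rel_a n \<union> rel_b n) B u" using sat ab by (rule satisfies_mono)
  then have m: "magic B n (\<lambda>i j. u (i, j))"
    using B.satisfies_rel_ab[of n u] satisfiesD[OF sat] by blast
  show "cnorm B (u x) \<le> 1"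
    using x magicD[OF m] by (cases x) (auto intro!: B.projection_norm)
qed

text \<open>When the relations pass from \<open>u\<close> to \<open>conv n u\<close>, the universal
  property yields a homomorphism sending the generators to their coproducts, and this is the
  comultiplication.\<close>

lemma cmqg_matrix_qgroup:
  assumes R: "R \<subseteq> carrier (mat_free n) \<times> carrier (mat_free n)" and ab: "rel_a n \<union> rel_b n \<subseteq> R"
    and conv: "\<And>u. satisfies (mat_idx n) R (universal_cstar (mat_idx n) R) u \<Longrightarrow>
      satisfies (mat_idx n) R (min_tensor (universal_cstar (mat_idx n) R) (universal_cstar (mat_idx n) R))
        (\<lambda>(i, j). cstar_algebra.conv (universal_cstar (mat_idx n) R) n (\<lambda>i j. u (i, j)) i j)"
  shows "compact_matrix_quantum_group (matrix_qgroup n R)"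
proof -
  interpret P: presentation "mat_idx n" R by (rule presentation_magic[OF R ab])
  interpret D: cstar_pair P.U P.U by unfold_locales
  have sat: "satisfies (mat_idx n) R P.U P.gen" by (rule P.satisfies_gen)
  then have "satisfies (mat_idx n) (rel_a n \<union> rel_b n) P.U P.gen" using ab by (rule satisfies_mono)
  then have m: "magic P.U n (\<lambda>i j. P.gen (i, j))"
    using P.U.satisfies_rel_ab[of n P.gen] satisfiesD[OF sat] by blast
  obtain \<Delta> where \<Delta>: "\<Delta> \<in> star_hom P.U (min_tensor P.U P.U)"
    "\<And>x. x \<in> mat_idx n \<Longrightarrow> \<Delta> (P.gen x) = (\<lambda>(i, j). P.U.conv n (\<lambda>i j. P.gen (i, j)) i j) x"
    using P.universal_property[OF D.cstar_min_tensor conv[OF sat]] by blast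
  have "comultiplication (matrix_qgroup n R) \<Delta>"
    using \<Delta> by (auto simp: comultiplication_def matrix_qgroup_def P.U.conv_def)
  moreover have "P.gen ` mat_idx n = {P.gen (i, j) | i j. i \<in> {1..n} \<and> j \<in> {1..n}}" by (auto; blast)
  ultimately show ?thesis
    using P.cstar_U P.generated P.U.magic_invertible[OF m]
    by (auto simp: compact_matrix_quantum_group_def matrix_qgroup_def)
qed

lemma satisfies_abc:
  assumes "star_algebra B"
  shows "satisfies (mat_idx n) (rel_a n \<union> rel_b n \<union> rel_c n E) B u \<longleftrightarrow>
    magic B n (\<lambda>i j. u (i, j)) \<and> intertwines B n E (\<lambda>i j. u (i, j))"
proof -
  interpret B: star_algebra B by fact
  have "u x \<in> carrier B" if "magic B n (\<lambda>i j. u (i, j))" "x \<in> mat_idx n" for x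
    using magicD(1)[OF that(1)] that(2) by auto
  then show ?thesis
    using B.satisfies_rel_ab[of n u] B.satisfies_rel_c[of n u E]
      satisfiesD[of "mat_idx n" "rel_a n \<union> rel_b n" B u]
    unfolding satisfies_Un by blast
qed

lemma satisfies_abcd:
  assumes "star_algebra B" "E \<subseteq> mat_idx n"
  shows "satisfies (mat_idx n) (rel_a n \<union> rel_b n \<union> rel_c n E \<union> rel_d n E) B u \<longleftrightarrow>
    magic B n (\<lambda>i j. u (i, j)) \<and> intertwines B n E (\<lambda>i j. u (i, j)) \<and> edges_commute B E (\<lambda>i j. u (i, j))"
proof -
  interpret B: star_algebra B by fact
  have "u x \<in> carrier B" if "magic B n (\<lambda>i j. u (i, j))" "x \<in> mat_idx n" for x
    using magicD(1)[OF that(1)] that(2) by auto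
  then show ?thesis
    using satisfies_abc[OF assms(1), of n E u] B.satisfies_rel_d[of n u E] assms(2)
      satisfiesD[of "mat_idx n" "rel_a n \<union> rel_b n \<union> rel_c n E" B u]
    unfolding satisfies_Un by blast
qed

lemma cmqg_G_aut_plus: "compact_matrix_quantum_group (G_aut_plus n E)"
  unfolding G_aut_plus_def
proof (rule cmqg_matrix_qgroup)
  let ?R = "rel_a n \<union> rel_b n \<union> rel_c n E"
  show R: "?R \<subseteq> carrier (mat_free n) \<times> carrier (mat_free n)" using rel_carrier by blast
  interpret P: presentation "mat_idx n" ?R by (rule presentation_magic[OF R]) auto
  interpret D: cstar_pair P.U P.U by unfold_locales
  fix u assume "satisfies (mat_idx n) ?R P.U u"
  then show "satisfies (mat_idx n) ?R (min_tensor P.U P.U) (\<lambda>(i, j). P.U.conv n (\<lambda>i j. u (i, j)) i j)"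
    unfolding satisfies_abc[OF P.U.star_algebra_axioms] satisfies_abc[OF D.M.star_algebra_axioms]
    using P.U.magic_conv P.U.intertwines_conv by simp
qed auto

lemma cmqg_G_aut_star:
  assumes E: "E \<subseteq> mat_idx n" shows "compact_matrix_quantum_group (G_aut_star n E)"
  unfolding G_aut_star_def
proof (rule cmqg_matrix_qgroup)
  let ?R = "rel_a n \<union> rel_b n \<union> rel_c n E \<union> rel_d n E"
  show R: "?R \<subseteq> carrier (mat_free n) \<times> carrier (mat_free n)" using rel_carrier E by blast
  interpret P: presentation "mat_idx n" ?R by (rule presentation_magic[OF R]) auto
  interpret D: cstar_pair P.U P.U by unfold_locales
  fix u assume "satisfies (mat_idx n) ?R P.U u"
  then show "satisfies (mat_idx n) ?R (min_tensor P.U P.U) (\<lambda>(i, j). P.U.conv n (\<lambda>i j. u (i, j)) i j)"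
    unfolding satisfies_abcd[OF P.U.star_algebra_axioms E] satisfies_abcd[OF D.M.star_algebra_axioms E]
    using P.U.magic_conv P.U.intertwines_conv P.U.edges_commute_conv[OF _ _ _ E] by simp
qed auto

section \<open>Functions on a finite set\<close>

lemma function_cstar_simps:
  "carrier (function_cstar K) = extensional K"
  "f \<otimes>\<^bsub>function_cstar K\<^esub> g = (\<lambda>x\<in>K. f x * g x)"
  "f \<oplus>\<^bsub>function_cstar K\<^esub> g = (\<lambda>x\<in>K. f x + g x)"
  "\<one>\<^bsub>function_cstar K\<^esub> = (\<lambda>x\<in>K. 1)"
  "\<zero>\<^bsub>function_cstar K\<^esub> = (\<lambda>x\<in>K. 0)"
  "c \<odot>\<^bsub>function_cstar K\<^esub> f = (\<lambda>x\<in>K. c * f x)"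
  "star (function_cstar K) f = (\<lambda>x\<in>K. cnj (f x))"
  "cnorm (function_cstar K) f = (SUP x\<in>K. cmod (f x))"
  by (simp_all add: function_cstar_def)

lemma star_algebra_function_cstar: "star_algebra (function_cstar K)"
proof -
  have grp: "abelian_group (function_cstar K)"
  proof (rule abelian_groupI)
    show "\<exists>g\<in>carrier (function_cstar K). g \<oplus>\<^bsub>function_cstar K\<^esub> f = \<zero>\<^bsub>function_cstar K\<^esub>"
      if "f \<in> carrier (function_cstar K)" for f
      by (rule bexI[of _ "\<lambda>x\<in>K. - f x"]) (auto simp: function_cstar_simps fun_eq_iff)
  qed (auto simp: function_cstar_simps fun_eq_iff extensional_def add_ac)
  have rng: "ring (function_cstar K)"
  proof (rule ringI[OF grp])
    show "monoid (function_cstar K)"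
      by (rule monoidI) (auto simp: function_cstar_simps fun_eq_iff extensional_def)
  qed (auto simp: function_cstar_simps fun_eq_iff algebra_simps)
  have mod: "module (ring_of_type_algebra :: complex ring) (function_cstar K)"
    by (rule moduleI[OF cring_from_type_algebra grp])
       (auto simp: ring_of_type_algebra_def function_cstar_simps fun_eq_iff extensional_def algebra_simps)
  show ?thesis
    by (intro star_algebra.intro[OF rng] star_algebra_axioms.intro[OF mod])
       (auto simp: function_cstar_simps fun_eq_iff extensional_def)
qed

lemma cstar_algebra_function_cstar:
  assumes K: "finite K" "K \<noteq> {}"
  shows "cstar_algebra (function_cstar K)"
proof -
  let ?F = "function_cstar K"
  interpret F: star_algebra ?F by (rule star_algebra_function_cstar)
  have minus: "f \<ominus>\<^bsub>?F\<^esub> g = (\<lambda>x\<in>K. f x - g x)" if "f \<in> carrier ?F" "g \<in> carrier ?F" for f g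
    using that by (auto simp: F.minus_eq_smult function_cstar_simps fun_eq_iff)
  have le: "cmod (f x) \<le> cnorm ?F f" if "x \<in> K" for f x
    unfolding function_cstar_simps using K that by (intro cSUP_upper) auto
  \<comment> \<open>The norm is the supremum of the evaluation seminorms \<open>|f x|\<close>, so
    the general statement on supremums applies.\<close>
  have "cstar_seminorm ?F (\<lambda>f. SUP p\<in>(\<lambda>x f. cmod (f x)) ` K. p f)"
  proof (rule F.cstar_seminorm_SUP)
    show "cstar_seminorm ?F p" if "p \<in> (\<lambda>x f. cmod (f x)) ` K" for p
      using that
      by (auto simp: cstar_seminorm_def function_cstar_simps norm_mult power2_eq_square norm_triangle_ineq)
    show "bdd_above ((\<lambda>p. p f) ` (\<lambda>x f. cmod (f x)) ` K)" for f :: "'a \<Rightarrow> complex"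
      using K by simp
  qed (use K in simp)
  then have sn: "cstar_seminorm ?F (cnorm ?F)"
    by (simp add: function_cstar_def image_image)
  show ?thesis
  proof (rule cstar_algebra.intro[OF F.star_algebra_axioms], rule cstar_algebra_axioms.intro[OF sn])
    show "f = \<zero>\<^bsub>?F\<^esub>" if "f \<in> carrier ?F" "cnorm ?F f = 0" for f
    proof
      fix x
      show "f x = \<zero>\<^bsub>?F\<^esub> x"
      proof (cases "x \<in> K")
        case True
        with le[OF True, of f] that(2) show ?thesis by (simp add: function_cstar_simps(5))
      next
        case False
        with extensional_arb[of f K x] that(1) show ?thesis by (simp add: function_cstar_simps(1,5))
      qed
    qed
  next
    fix s assume s: "s \<in> cauchy_seqs ?F (cnorm ?F)"
    have sc [simp]: "s n \<in> carrier ?F" for n using s by (auto simp: cauchy_seqs_def)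
    have "\<exists>a. (\<lambda>n. s n x) \<longlonglongrightarrow> a" if x: "x \<in> K" for x
    proof -
      have "Cauchy (\<lambda>n. s n x)"
      proof (rule CauchyI)
        fix e :: real assume "0 < e"
        then obtain N where N: "\<And>m n. m \<ge> N \<Longrightarrow> n \<ge> N \<Longrightarrow> cnorm ?F (s m \<ominus>\<^bsub>?F\<^esub> s n) < e"
          using s unfolding cauchy_seqs_def mem_Collect_eq by meson
        have "norm (s m x - s n x) < e" if "m \<ge> N" "n \<ge> N" for m n
          using le[OF x, of "s m \<ominus>\<^bsub>?F\<^esub> s n"] N[OF that] x by (simp add: minus)
        then show "\<exists>M. \<forall>m\<ge>M. \<forall>n\<ge>M. norm (s m x - s n x) < e" by blast
      qed
      then show ?thesis by (simp add: Cauchy_convergent_iff convergent_def)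
    qed
    then obtain a where a: "\<And>x. x \<in> K \<Longrightarrow> (\<lambda>n. s n x) \<longlonglongrightarrow> a x" by metis
    define b where "b = restrict a K"
    have b: "b \<in> carrier ?F" by (simp add: b_def function_cstar_simps)
    \<comment> \<open>A finite sum dominates the supremum and tends to 0 term by term, so the
      pointwise limits are uniform.\<close>
    have "(\<lambda>n. \<Sum>x\<in>K. cmod (s n x - a x)) \<longlonglongrightarrow> 0"
      using a by (intro tendsto_null_sum tendsto_norm_zero LIM_zero)
    then have "(\<lambda>n. cnorm ?F (s n \<ominus>\<^bsub>?F\<^esub> b)) \<longlonglongrightarrow> 0"
    proof (rule tendsto_0_le)
      fix n
      show "0 \<le> cnorm ?F (s n \<ominus>\<^bsub>?F\<^esub> b)"
      proof -
        obtain x where "x \<in> K" using K by blast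
        then show ?thesis by (rule order_trans[OF norm_ge_zero le])
      qed
      show "cnorm ?F (s n \<ominus>\<^bsub>?F\<^esub> b) \<le> (\<Sum>x\<in>K. cmod (s n x - a x))"
        unfolding minus[OF sc b] function_cstar_simps
        by (rule cSUP_least) (use K in \<open>auto simp: b_def intro: member_le_sum[of _ _ "\<lambda>x. cmod (s n x - a x)"]\<close>)
    qed
    with b show "\<exists>a\<in>carrier ?F. (\<lambda>n. cnorm ?F (s n \<ominus>\<^bsub>?F\<^esub> a)) \<longlonglongrightarrow> 0" by blast
  qed
qed

lemma function_cstar_finsum:
  assumes "finite I" "f \<in> I \<rightarrow> carrier (function_cstar K)"
  shows "finsum (function_cstar K) f I = (\<lambda>x\<in>K. \<Sum>i\<in>I. f i x)"
proof -
  interpret F: star_algebra "function_cstar K" by (rule star_algebra_function_cstar)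
  show ?thesis
    using assms
    by (induction I rule: finite_induct) (auto simp: Pi_iff function_cstar_simps fun_eq_iff)
qed

section \<open>Automorphism groups\<close>

lemma perm_matrix_sum_left:
  fixes \<sigma> :: "nat \<Rightarrow> nat"
  assumes "\<sigma> permutes {1..n}" "a \<in> {1..n}"
  shows "(\<Sum>k\<in>{1..n}. perm_matrix \<sigma> (\<sigma> a) k * f k) = f a"
proof -
  have "(\<Sum>k\<in>{1..n}. perm_matrix \<sigma> (\<sigma> a) k * f k) = (\<Sum>k\<in>{1..n}. if k = a then f k else 0)"
    by (intro sum.cong) (use inj_eq[OF permutes_inj[OF assms(1)]] in \<open>auto simp: perm_matrix_def\<close>)
  then show ?thesis using assms(2) by simp
qed

lemma perm_matrix_sum_right:
  fixes \<sigma> :: "nat \<Rightarrow> nat"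
  assumes "\<sigma> permutes {1..n}" "j \<in> {1..n}"
  shows "(\<Sum>k\<in>{1..n}. f k * perm_matrix \<sigma> k j) = f (\<sigma> j)"
proof -
  have "\<sigma> j \<in> {1..n}" using assms by (simp only: permutes_in_image)
  then show ?thesis by (simp add: perm_matrix_def)
qed

text \<open>With the row index written as \<open>\<sigma> i\<close>, both matrix products have a
  single nonzero term, and the commutation of matrices reads
  \<open>\<epsilon>_ij = \<epsilon>_(\<sigma> i)(\<sigma> j)\<close>.\<close>

lemma aut_group_iff:
  fixes \<sigma> :: "nat \<Rightarrow> nat"
  shows
  "\<sigma> \<in> carrier (aut_group n E) \<longleftrightarrow> \<sigma> permutes {1..n} \<and>
     (\<forall>i\<in>{1..n}. \<forall>j\<in>{1..n}. (i, j) \<in> E \<longleftrightarrow> (\<sigma> i, \<sigma> j) \<in> E)"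
proof -
  have "(\<forall>i\<in>{1..n}. \<forall>j\<in>{1..n}. (\<Sum>k\<in>{1..n}. perm_matrix \<sigma> i k * adjacency E k j) =
       (\<Sum>k\<in>{1..n}. adjacency E i k * perm_matrix \<sigma> k j)) \<longleftrightarrow>
     (\<forall>i\<in>{1..n}. \<forall>j\<in>{1..n}. (i, j) \<in> E \<longleftrightarrow> (\<sigma> i, \<sigma> j) \<in> E)" if p: "\<sigma> permutes {1..n}"
  proof -
    have "(\<forall>i\<in>{1..n}. P i) \<longleftrightarrow> (\<forall>i\<in>{1..n}. P (\<sigma> i))" for P
      using permutes_image[OF p] by (metis (no_types, lifting) image_iff)
    then have "(\<forall>i\<in>{1..n}. \<forall>j\<in>{1..n}. (\<Sum>k\<in>{1..n}. perm_matrix \<sigma> i k * adjacency E k j) =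
       (\<Sum>k\<in>{1..n}. adjacency E i k * perm_matrix \<sigma> k j)) \<longleftrightarrow>
      (\<forall>i\<in>{1..n}. \<forall>j\<in>{1..n}. (\<Sum>k\<in>{1..n}. perm_matrix \<sigma> (\<sigma> i) k * adjacency E k j) =
       (\<Sum>k\<in>{1..n}. adjacency E (\<sigma> i) k * perm_matrix \<sigma> k j))" .
    also have "\<dots> \<longleftrightarrow> (\<forall>i\<in>{1..n}. \<forall>j\<in>{1..n}. adjacency E i j = adjacency E (\<sigma> i) (\<sigma> j))"
      by (intro ball_cong HOL.refl) (simp only: perm_matrix_sum_left[OF p] perm_matrix_sum_right[OF p])
    finally show ?thesis by (simp only: adjacency_def of_bool_eq_iff)
  qed
  then show ?thesis by (auto simp: aut_group_def sym_group_def simp del: atLeastAtMost_iff)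
qed

lemma aut_group_finite: "finite (carrier (aut_group n E))"
  by (rule finite_subset[OF _ finite_permutations[of "{1..n}"]]) (auto simp: aut_group_iff)

lemma aut_group_id: "id \<in> carrier (aut_group n E)"
  by (simp add: aut_group_iff permutes_id)

abbreviation aut_functions :: "nat \<Rightarrow> (nat \<times> nat) set \<Rightarrow> ((nat \<Rightarrow> nat) \<Rightarrow> complex) cstar_algebra" where
  "aut_functions n E \<equiv> function_cstar (carrier (aut_group n E))"

lemma cstar_aut_functions: "cstar_algebra (aut_functions n E)"
  by (intro cstar_algebra_function_cstar aut_group_finite) (use aut_group_id in blast)

definition aut_coord :: "nat \<Rightarrow> (nat \<times> nat) set \<Rightarrow> nat \<Rightarrow> nat \<Rightarrow> (nat \<Rightarrow> nat) \<Rightarrow> complex" where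
  "aut_coord n E i j = (\<lambda>\<sigma>\<in>carrier (aut_group n E). perm_matrix \<sigma> i j)"

lemma aut_coord_closed [simp]: "aut_coord n E i j \<in> carrier (aut_functions n E)"
  by (simp add: aut_coord_def function_cstar_simps)

lemma magic_aut_coord: "magic (aut_functions n E) n (aut_coord n E)"
  unfolding magic_def
proof (intro conjI ballI)
  let ?K = "carrier (aut_group n E)"
  fix i assume i: "i \<in> {1..n}"
  show "(\<Oplus>\<^bsub>aut_functions n E\<^esub>l\<in>{1..n}. aut_coord n E i l) = \<one>\<^bsub>aut_functions n E\<^esub>"
  proof (subst function_cstar_finsum, simp, simp, unfold function_cstar_simps, rule restrict_ext)
    fix \<sigma> assume \<sigma>: "\<sigma> \<in> ?K"
    then have p: "\<sigma> permutes {1..n}" by (simp add: aut_group_iff)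
    then obtain a where a: "a \<in> {1..n}" "i = \<sigma> a" using i permutes_image[OF p] by blast
    show "(\<Sum>l\<in>{1..n}. aut_coord n E i l \<sigma>) = 1"
      using perm_matrix_sum_left[OF p a(1), of "\<lambda>_. 1"] \<sigma> by (simp add: aut_coord_def a(2))
  qed
  show "(\<Oplus>\<^bsub>aut_functions n E\<^esub>l\<in>{1..n}. aut_coord n E l i) = \<one>\<^bsub>aut_functions n E\<^esub>"
  proof (subst function_cstar_finsum, simp, simp, unfold function_cstar_simps, rule restrict_ext)
    fix \<sigma> assume \<sigma>: "\<sigma> \<in> ?K"
    then have p: "\<sigma> permutes {1..n}" by (simp add: aut_group_iff)
    show "(\<Sum>l\<in>{1..n}. aut_coord n E l i \<sigma>) = 1"
      using perm_matrix_sum_right[OF p i, of "\<lambda>_. 1"] \<sigma> by (simp add: aut_coord_def)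
  qed
next
  fix i j k assume ijk: "i \<in> {1..n}" "j \<in> {1..n}" "k \<in> {1..n}"
  have inj: "\<sigma> j = \<sigma> k \<longleftrightarrow> j = k" if "\<sigma> \<in> carrier (aut_group n E)" for \<sigma>
    using that permutes_inj[of \<sigma> "{1..n}"] by (auto simp: aut_group_iff dest: injD)
  show "aut_coord n E i j \<otimes>\<^bsub>aut_functions n E\<^esub> aut_coord n E i k =
      (if j = k then aut_coord n E i j else \<zero>\<^bsub>aut_functions n E\<^esub>)"
    by (cases "j = k") (auto simp: aut_coord_def function_cstar_simps perm_matrix_def fun_eq_iff dest: inj[THEN iffD1, OF _ HOL.sym])
  show "aut_coord n E j i \<otimes>\<^bsub>aut_functions n E\<^esub> aut_coord n E k i =
      (if j = k then aut_coord n E j i else \<zero>\<^bsub>aut_functions n E\<^esub>)"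
    by (auto simp: aut_coord_def function_cstar_simps perm_matrix_def fun_eq_iff)
qed (auto simp: aut_coord_def function_cstar_simps perm_matrix_def fun_eq_iff)

lemma intertwines_aut_coord: "intertwines (aut_functions n E) n E (aut_coord n E)"
  unfolding intertwines_def
proof (intro ballI)
  let ?K = "carrier (aut_group n E)" and ?F = "aut_functions n E"
  interpret F: cstar_algebra ?F by (rule cstar_aut_functions)
  fix i j assume ij: "i \<in> {1..n}" "j \<in> {1..n}"
  have "(\<Sum>k\<in>{1..n}. (adjacency E k j \<odot>\<^bsub>?F\<^esub> aut_coord n E i k) \<sigma>) =
      (\<Sum>k\<in>{1..n}. (adjacency E i k \<odot>\<^bsub>?F\<^esub> aut_coord n E k j) \<sigma>)" if \<sigma>: "\<sigma> \<in> ?K" for \<sigma>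
    using \<sigma> ij unfolding aut_group_def
    by (simp add: function_cstar_simps aut_coord_def aut_group_def mult.commute)
  then show "(\<Oplus>\<^bsub>?F\<^esub>k\<in>{1..n}. adjacency E k j \<odot>\<^bsub>?F\<^esub> aut_coord n E i k) =
      (\<Oplus>\<^bsub>?F\<^esub>k\<in>{1..n}. adjacency E i k \<odot>\<^bsub>?F\<^esub> aut_coord n E k j)"
    by (subst (1 2) function_cstar_finsum) (auto simp: fun_eq_iff)
qed

lemma edges_commute_aut_coord: "edges_commute (aut_functions n E) E' (aut_coord n E)"
  by (auto simp: edges_commute_def function_cstar_simps mult.commute)

section \<open>Commuting magic unitaries\<close>

locale commuting_magic = cstar_algebra A for A :: "('a, 'm) cstar_algebra_scheme" (structure) +
  fixes n :: nat and E :: "(nat \<times> nat) set" and u :: "nat \<Rightarrow> nat \<Rightarrow> 'a"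
  assumes m: "magic A n u" and c: "intertwines A n E u"
    and commute: "\<lbrakk>i \<in> {1..n}; j \<in> {1..n}; k \<in> {1..n}; l \<in> {1..n}\<rbrakk> \<Longrightarrow> u i j \<otimes> u k l = u k l \<otimes> u i j"
begin

abbreviation AK :: "(nat \<Rightarrow> nat) set" where "AK \<equiv> carrier (aut_group n E)"

text \<open>\<open>pr n \<tau>\<close> is the counterpart of the indicator function of
  \<open>\<tau>\<close>. It is defined for arbitrary maps because expanding column sums also
  produces maps that are not injective; their products turn out to be 0.\<close>

primrec pr :: "nat \<Rightarrow> (nat \<Rightarrow> nat) \<Rightarrow> 'a" where
  "pr 0 \<tau> = \<one>"
| "pr (Suc k) \<tau> = pr k \<tau> \<otimes> u (\<tau> (Suc k)) (Suc k)"

lemma uc [simp]: "i \<in> {1..n} \<Longrightarrow> j \<in> {1..n} \<Longrightarrow> u i j \<in> carrier A"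
  by (rule magicD[OF m])

context
  fixes \<tau> :: "nat \<Rightarrow> nat"
  assumes \<tau>: "\<And>i. i \<in> {1..n} \<Longrightarrow> \<tau> i \<in> {1..n}"
begin

lemma \<tau>_Suc: "Suc k \<le> n \<Longrightarrow> \<tau> (Suc k) \<in> {1..n} \<and> Suc k \<in> {1..n}"
  using \<tau>[of "Suc k"] by (simp add: One_nat_def)

lemma pr_closed [simp]: "k \<le> n \<Longrightarrow> pr k \<tau> \<in> carrier A"
  by (induction k) (use \<tau>_Suc in auto)

lemma pr_commute:
  "k \<le> n \<Longrightarrow> a \<in> {1..n} \<Longrightarrow> b \<in> {1..n} \<Longrightarrow> pr k \<tau> \<otimes> u a b = u a b \<otimes> pr k \<tau>"
proof (induction k)
  case (Suc k)
  note [simp del] = atLeastAtMost_iff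
  have t: "\<tau> (Suc k) \<in> {1..n}" "Suc k \<in> {1..n}" using \<tau>_Suc Suc.prems by auto
  have "pr (Suc k) \<tau> \<otimes> u a b = pr k \<tau> \<otimes> (u (\<tau> (Suc k)) (Suc k) \<otimes> u a b)"
    using Suc.prems t by (simp add: m_assoc)
  also have "\<dots> = (pr k \<tau> \<otimes> u a b) \<otimes> u (\<tau> (Suc k)) (Suc k)"
    using Suc.prems t commute[OF t Suc.prems(2,3)] by (simp add: m_assoc)
  also have "\<dots> = u a b \<otimes> pr (Suc k) \<tau>" using Suc t by (simp add: m_assoc)
  finally show ?case .
qed simp

text \<open>By commutativity \<open>u a b\<close> can be moved next to the factor of
  \<open>pr k \<tau>\<close> in the same column \<open>b\<close>, which absorbs or annihilates
  it.\<close>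

lemma pr_mult:
  "k \<le> n \<Longrightarrow> a \<in> {1..n} \<Longrightarrow> b \<in> {1..k} \<Longrightarrow> pr k \<tau> \<otimes> u a b = (if \<tau> b = a then pr k \<tau> else \<zero>)"
proof (induction k)
  case (Suc k)
  note [simp del] = atLeastAtMost_iff
  have t: "\<tau> (Suc k) \<in> {1..n}" "Suc k \<in> {1..n}" using \<tau>_Suc Suc.prems by auto
  have b: "b \<in> {1..n}" using Suc.prems by (auto simp: atLeastAtMost_iff)
  show ?case
  proof (cases "b = Suc k")
    case True
    have "pr (Suc k) \<tau> \<otimes> u a b = pr k \<tau> \<otimes> (u (\<tau> (Suc k)) (Suc k) \<otimes> u a (Suc k))"
      using Suc.prems t True by (simp add: m_assoc)
    then show ?thesis using Suc.prems t True by (simp add: magic_col[OF m])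
  next
    case False
    then have bk: "b \<in> {1..k}" using Suc.prems by (auto simp: atLeastAtMost_iff)
    have "pr (Suc k) \<tau> \<otimes> u a b = pr k \<tau> \<otimes> (u (\<tau> (Suc k)) (Suc k) \<otimes> u a b)"
      using Suc.prems t b by (simp add: m_assoc)
    also have "\<dots> = (pr k \<tau> \<otimes> u a b) \<otimes> u (\<tau> (Suc k)) (Suc k)"
      using Suc.prems t b commute[OF t Suc.prems(2) b] by (simp add: m_assoc)
    also have "\<dots> = (if \<tau> b = a then pr (Suc k) \<tau> else \<zero>)" using Suc t bk by simp
    finally show ?thesis .
  qed
qed simp

lemma pr_star: "k \<le> n \<Longrightarrow> star A (pr k \<tau>) = pr k \<tau>"
proof (induction k)
  case (Suc k)
  have t: "\<tau> (Suc k) \<in> {1..n}" "Suc k \<in> {1..n}" using \<tau>_Suc Suc.prems by auto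
  show ?case
    using Suc t pr_commute[of k "\<tau> (Suc k)" "Suc k"]
    by (simp add: star_mult magicD(2)[OF m] del: atLeastAtMost_iff)
qed simp

lemma pr_eq_0_mult:
  assumes "i \<in> {1..n}" "j \<in> {1..n}" "u (\<tau> i) i \<otimes> u (\<tau> j) j = \<zero>" shows "pr n \<tau> = \<zero>"
proof -
  note [simp del] = atLeastAtMost_iff
  have "pr n \<tau> = (pr n \<tau> \<otimes> u (\<tau> i) i) \<otimes> u (\<tau> j) j" using assms \<tau> by (simp add: pr_mult)
  also have "\<dots> = pr n \<tau> \<otimes> (u (\<tau> i) i \<otimes> u (\<tau> j) j)" using assms(1,2) \<tau> by (simp add: m_assoc)
  finally show ?thesis using assms(3) by simp
qed

text \<open>Two factors of \<open>pr n \<tau>\<close> have product 0. If \<open>\<tau>\<close> is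
  not injective they lie in a common row; otherwise \<open>\<tau>\<close> agrees on the vertices
  with a permutation that breaks an edge or a non-edge, and \<open>non_edge_product\<close>
  applies.\<close>

lemma pr_eq_0:
  assumes \<sigma>: "\<And>\<sigma>. \<sigma> \<in> AK \<Longrightarrow> \<exists>i\<in>{1..n}. \<sigma> i \<noteq> \<tau> i" shows "pr n \<tau> = \<zero>"
proof (cases "inj_on \<tau> {1..n}")
  case False
  then obtain i j where ij: "i \<in> {1..n}" "j \<in> {1..n}" "i \<noteq> j" "\<tau> i = \<tau> j" by (auto simp: inj_on_def)
  show ?thesis
    by (rule pr_eq_0_mult[OF ij(1,2)]) (use ij \<tau> in \<open>simp add: magic_row[OF m]\<close>)
next
  case True
  define \<sigma> where "\<sigma> = (\<lambda>i. if i \<in> {1..n} then \<tau> i else i)"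
  have "\<tau> ` {1..n} = {1..n}" by (rule endo_inj_surj) (use True \<tau> in auto)
  then have "bij_betw \<tau> {1..n} {1..n}" using True by (simp add: bij_betw_def)
  then have "bij_betw \<sigma> {1..n} {1..n}" by (rule bij_betw_cong[THEN iffD1, rotated]) (simp add: \<sigma>_def)
  then have "\<sigma> permutes {1..n}" by (rule bij_imp_permutes) (auto simp: \<sigma>_def)
  moreover have "\<sigma> \<notin> AK" using \<sigma>[of \<sigma>] by (auto simp: \<sigma>_def)
  ultimately obtain i j where ij: "i \<in> {1..n}" "j \<in> {1..n}" "(i, j) \<in> E \<longleftrightarrow> (\<sigma> i, \<sigma> j) \<notin> E"
    unfolding aut_group_iff by blast
  moreover have "\<sigma> i = \<tau> i" "\<sigma> j = \<tau> j" using ij by (simp_all add: \<sigma>_def)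
  ultimately have ij: "i \<in> {1..n}" "j \<in> {1..n}" "(i, j) \<in> E \<longleftrightarrow> (\<tau> i, \<tau> j) \<notin> E" by simp_all
  show ?thesis
    by (rule pr_eq_0_mult[OF ij(1,2)], rule non_edge_product[OF m c]) (use ij \<tau> in auto)
qed

end

lemma K_range: "\<tau> \<in> AK \<Longrightarrow> i \<in> {1..n} \<Longrightarrow> \<tau> i \<in> {1..n}"
  by (simp only: aut_group_iff permutes_in_image)

lemma pr_closed_K [simp]: "\<tau> \<in> AK \<Longrightarrow> pr n \<tau> \<in> carrier A"
  using K_range by (intro pr_closed) auto

lemma pr_pr:
  fixes \<sigma> \<tau> :: "nat \<Rightarrow> nat"
  assumes "\<sigma> \<in> AK" "\<tau> \<in> AK" "k \<le> n"
  shows "pr n \<sigma> \<otimes> pr k \<tau> = (if \<forall>i\<in>{1..k}. \<sigma> i = \<tau> i then pr n \<sigma> else \<zero>)"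
  using assms(3)
proof (induction k)
  case 0
  then show ?case using K_range assms by (simp add: One_nat_def)
next
  case (Suc k)
  have t: "\<tau> (Suc k) \<in> {1..n}" "Suc k \<in> {1..n}"
    using \<tau>_Suc[of \<tau>] K_range assms(2) Suc.prems by auto
  have "pr n \<sigma> \<otimes> pr (Suc k) \<tau> = (pr n \<sigma> \<otimes> pr k \<tau>) \<otimes> u (\<tau> (Suc k)) (Suc k)"
    using t assms K_range Suc.prems by (simp add: m_assoc del: atLeastAtMost_iff)
  also have "\<dots> = (if \<forall>i\<in>{1..k}. \<sigma> i = \<tau> i then pr n \<sigma> \<otimes> u (\<tau> (Suc k)) (Suc k) else \<zero>)"
    using Suc t by (simp del: atLeastAtMost_iff)
  also have "\<dots> = (if \<forall>i\<in>{1..Suc k}. \<sigma> i = \<tau> i then pr n \<sigma> else \<zero>)"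
  proof -
    have "pr n \<sigma> \<otimes> u (\<tau> (Suc k)) (Suc k) = (if \<sigma> (Suc k) = \<tau> (Suc k) then pr n \<sigma> else \<zero>)"
      by (rule pr_mult) (use t K_range[OF assms(1)] in auto)
    moreover have "{1..Suc k} = insert (Suc k) {1..k}" using t(2) by auto
    ultimately show ?thesis by simp
  qed
  finally show ?case .
qed

lemma pr_orthogonal:
  fixes \<sigma> \<tau> :: "nat \<Rightarrow> nat"
  assumes "\<sigma> \<in> AK" "\<tau> \<in> AK" shows "pr n \<sigma> \<otimes> pr n \<tau> = (if \<sigma> = \<tau> then pr n \<sigma> else \<zero>)"
proof -
  have "(\<forall>i\<in>{1..n}. \<sigma> i = \<tau> i) \<longleftrightarrow> \<sigma> = \<tau>"
    using assms unfolding aut_group_iff permutes_def fun_eq_iff by metis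
  then show ?thesis using pr_pr[OF assms] by simp
qed

text \<open>The recursion \<open>x \<otimes> pr k \<tau> = (\<Sum>a. x \<otimes> pr (k + 1) (\<tau>(k + 1 := a)))\<close> avoids expanding a product of sums.\<close>

lemma eq_zero_if_orthogonal:
  assumes x: "x \<in> carrier A" and orth: "\<And>\<sigma>. \<sigma> \<in> AK \<Longrightarrow> x \<otimes> pr n \<sigma> = \<zero>"
  shows "x = \<zero>"
proof -
  have pr_cong: "pr k \<sigma> = pr k \<tau>" if "\<And>i. i \<in> {1..k} \<Longrightarrow> \<sigma> i = \<tau> i" for k \<sigma> \<tau>
    using that by (induction k) (auto simp: One_nat_def)
  have "x \<otimes> pr k \<tau> = \<zero>" if "k \<le> n" "\<And>i. i \<in> {1..n} \<Longrightarrow> \<tau> i \<in> {1..n}" for k \<tau>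
    using that
  proof (induction k arbitrary: \<tau> rule: inc_induct)
    case base
    show ?case
    proof (cases "\<exists>\<sigma>\<in>AK. \<forall>i\<in>{1..n}. \<sigma> i = \<tau> i")
      case True
      then obtain \<sigma> where "\<sigma> \<in> AK" "\<forall>i\<in>{1..n}. \<sigma> i = \<tau> i" by blast
      then show ?thesis using orth[of \<sigma>] pr_cong[of n \<sigma> \<tau>] by simp
    next
      case False
      then have "pr n \<tau> = \<zero>" using base by (intro pr_eq_0) auto
      then show ?thesis using x by simp
    qed
  next
    case (step k)
    have k: "Suc k \<in> {1..n}" using step by (simp add: One_nat_def)
    have pc: "pr k \<tau> \<in> carrier A" using step by (intro pr_closed) auto
    have "x \<otimes> pr k \<tau> = (x \<otimes> pr k \<tau>) \<otimes> (\<Oplus>a\<in>{1..n}. u a (Suc k))"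
      using magic_col_sum[OF m k] x pc by simp
    also have "\<dots> = (\<Oplus>a\<in>{1..n}. (x \<otimes> pr k \<tau>) \<otimes> u a (Suc k))"
      by (rule finsum_rdistr) (use x pc k in auto)
    also have "\<dots> = \<zero>"
    proof (rule finsum_all_zero)
      fix a assume a: "a \<in> {1..n}"
      have "x \<otimes> pr (Suc k) (\<tau>(Suc k := a)) = \<zero>"
        by (rule step.IH) (use step.prems a in auto)
      moreover have "pr k (\<tau>(Suc k := a)) = pr k \<tau>" by (rule pr_cong) auto
      ultimately show "(x \<otimes> pr k \<tau>) \<otimes> u a (Suc k) = \<zero>"
        using x pc a k by (simp add: m_assoc)
    qed
    finally show ?case .
  qed
  \<comment> \<open>For \<open>k = 0\<close> the product is empty, so the claim becomes
    \<open>x \<otimes> \<one> = \<zero>\<close>.\<close>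
  from this[of 0 "\<lambda>i. i"] show ?thesis using x by simp
qed

text \<open>The difference of \<open>\<one>\<close> and the sum is orthogonal to every
  \<open>pr n \<tau>\<close>, hence 0.\<close>

lemma pr_sum: "(\<Oplus>\<sigma>\<in>AK. pr n \<sigma>) = \<one>"
proof -
  have "\<one> \<ominus> (\<Oplus>\<sigma>\<in>AK. pr n \<sigma>) = \<zero>"
  proof (rule eq_zero_if_orthogonal)
    fix \<tau> assume t: "\<tau> \<in> AK"
    have "(\<Oplus>\<sigma>\<in>AK. pr n \<sigma>) \<otimes> pr n \<tau> = (\<Oplus>\<sigma>\<in>AK. pr n \<sigma> \<otimes> pr n \<tau>)"
      by (rule finsum_ldistr) (use t aut_group_finite in auto)
    also have "\<dots> = pr n \<tau> \<otimes> pr n \<tau>"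
      by (rule finsum_delta) (use t aut_group_finite pr_orthogonal in auto)
    finally have "(\<Oplus>\<sigma>\<in>AK. pr n \<sigma>) \<otimes> pr n \<tau> = pr n \<tau>" using pr_orthogonal[OF t t] by simp
    then show "(\<one> \<ominus> (\<Oplus>\<sigma>\<in>AK. pr n \<sigma>)) \<otimes> pr n \<tau> = \<zero>"
      using t by (simp add: minus_distr_left)
  qed auto
  then show ?thesis by (simp add: minus_eq_0_iff)
qed

text \<open>The prospective inverse of the map to functions on the automorphism group: it sends the
  indicator function of \<open>\<sigma>\<close> to \<open>pr n \<sigma>\<close>.\<close>

definition gg :: "((nat \<Rightarrow> nat) \<Rightarrow> complex) \<Rightarrow> 'a" where
  "gg f = (\<Oplus>\<sigma>\<in>AK. f \<sigma> \<odot> pr n \<sigma>)"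

lemma gg_star_hom: "gg \<in> star_hom (aut_functions n E) A"
proof (rule star_homI)
  show "gg f \<in> carrier A" for f unfolding gg_def by (rule finsum_closed) auto
  show "gg \<one>\<^bsub>aut_functions n E\<^esub> = \<one>"
    unfolding gg_def pr_sum[symmetric] by (rule finsum_cong') (auto simp: function_cstar_simps)
  fix f g
  have "gg (f \<oplus>\<^bsub>aut_functions n E\<^esub> g) = (\<Oplus>\<sigma>\<in>AK. f \<sigma> \<odot> pr n \<sigma> \<oplus> g \<sigma> \<odot> pr n \<sigma>)"
    unfolding gg_def by (rule finsum_cong') (auto simp: function_cstar_simps smult_add_left)
  also have "\<dots> = gg f \<oplus> gg g" unfolding gg_def by (rule finsum_addf) auto
  finally show "gg (f \<oplus>\<^bsub>aut_functions n E\<^esub> g) = gg f \<oplus> gg g" .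
  have "gg f \<otimes> gg g = (\<Oplus>\<sigma>\<in>AK. f \<sigma> \<odot> pr n \<sigma> \<otimes> gg g)"
    unfolding gg_def[of f] by (rule finsum_ldistr) (auto simp: aut_group_finite gg_def)
  also have "\<dots> = (\<Oplus>\<sigma>\<in>AK. (f \<sigma> * g \<sigma>) \<odot> pr n \<sigma>)"
  proof (rule finsum_cong')
    fix \<sigma> assume s: "\<sigma> \<in> AK"
    have "f \<sigma> \<odot> pr n \<sigma> \<otimes> gg g = (\<Oplus>\<tau>\<in>AK. f \<sigma> \<odot> pr n \<sigma> \<otimes> (g \<tau> \<odot> pr n \<tau>))"
      unfolding gg_def by (rule finsum_rdistr) (use s in \<open>auto simp: aut_group_finite\<close>)
    also have "\<dots> = f \<sigma> \<odot> pr n \<sigma> \<otimes> (g \<sigma> \<odot> pr n \<sigma>)"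
      by (rule finsum_delta)
         (use s in \<open>auto simp: aut_group_finite smult_mult_left smult_mult_right pr_orthogonal\<close>)
    finally show "f \<sigma> \<odot> pr n \<sigma> \<otimes> gg g = (f \<sigma> * g \<sigma>) \<odot> pr n \<sigma>"
      using s by (simp add: smult_mult_left smult_mult_right pr_orthogonal mult.commute)
  qed auto
  also have "\<dots> = gg (f \<otimes>\<^bsub>aut_functions n E\<^esub> g)"
    unfolding gg_def by (rule finsum_cong') (auto simp: function_cstar_simps)
  finally show "gg (f \<otimes>\<^bsub>aut_functions n E\<^esub> g) = gg f \<otimes> gg g" by simp
  show "gg (c \<odot>\<^bsub>aut_functions n E\<^esub> f) = c \<odot> gg f" for c
  proof -
    have "c \<odot> gg f = (\<Oplus>\<sigma>\<in>AK. c \<odot> (f \<sigma> \<odot> pr n \<sigma>))"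
      unfolding gg_def by (rule finsum_smult) (auto simp: aut_group_finite)
    also have "\<dots> = gg (c \<odot>\<^bsub>aut_functions n E\<^esub> f)"
      unfolding gg_def by (rule finsum_cong') (auto simp: function_cstar_simps)
    finally show ?thesis by simp
  qed
  show "gg (star (aut_functions n E) f) = star A (gg f)"
  proof -
    have ps: "star A (pr n \<rho>) = pr n \<rho>" if "\<rho> \<in> AK" for \<rho>
      by (rule pr_star) (use K_range that in auto)
    have "star A (gg f) = (\<Oplus>\<sigma>\<in>AK. star A (f \<sigma> \<odot> pr n \<sigma>))"
      unfolding gg_def by (rule finsum_star) (auto simp: aut_group_finite)
    also have "\<dots> = gg (star (aut_functions n E) f)"
      unfolding gg_def
      by (rule finsum_cong') (auto simp: function_cstar_simps star_smult ps)
    finally show ?thesis by simp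
  qed
qed

lemma gg_coord: assumes "i \<in> {1..n}" "j \<in> {1..n}" shows "gg (aut_coord n E i j) = u i j"
proof -
  have "gg (aut_coord n E i j) = (\<Oplus>\<sigma>\<in>AK. pr n \<sigma> \<otimes> u i j)"
    unfolding gg_def
  proof (rule finsum_cong')
    fix \<sigma> assume s: "\<sigma> \<in> AK"
    have "pr n \<sigma> \<otimes> u i j = (if \<sigma> j = i then pr n \<sigma> else \<zero>)"
      by (rule pr_mult) (use s K_range assms in auto)
    then show "aut_coord n E i j \<sigma> \<odot> pr n \<sigma> = pr n \<sigma> \<otimes> u i j"
      using s by (simp add: aut_coord_def perm_matrix_def)
  qed (use assms in auto)
  also have "\<dots> = (\<Oplus>\<sigma>\<in>AK. pr n \<sigma>) \<otimes> u i j"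
    by (rule finsum_ldistr[symmetric]) (use assms in \<open>auto simp: aut_group_finite\<close>)
  finally show ?thesis using assms by (simp add: pr_sum)
qed

text \<open>A bound by the sum of the norms of the finitely many \<open>pr n \<sigma>\<close> is
  sufficient, as \<open>hom_eqI\<close> accepts any constant.\<close>

lemma gg_bounded: "\<exists>M. \<forall>f. cnorm A (gg f) \<le> M * cnorm (aut_functions n E) f"
proof (intro exI allI)
  fix f
  have "cnorm A (gg f) \<le> (\<Sum>\<sigma>\<in>AK. cnorm A (f \<sigma> \<odot> pr n \<sigma>))"
    unfolding gg_def by (rule p_finsum) (auto simp: aut_group_finite)
  also have "\<dots> \<le> (\<Sum>\<sigma>\<in>AK. cnorm (aut_functions n E) f * cnorm A (pr n \<sigma>))"
  proof (rule sum_mono)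
    fix \<sigma> assume s: "\<sigma> \<in> AK"
    have "cmod (f \<sigma>) \<le> cnorm (aut_functions n E) f"
      unfolding function_cstar_simps by (rule cSUP_upper) (use s aut_group_finite in auto)
    then show "cnorm A (f \<sigma> \<odot> pr n \<sigma>) \<le> cnorm (aut_functions n E) f * cnorm A (pr n \<sigma>)"
      using s by (simp add: p_smult mult_right_mono)
  qed
  finally show "cnorm A (gg f) \<le> (\<Sum>\<sigma>\<in>AK. cnorm A (pr n \<sigma>)) * cnorm (aut_functions n E) f"
    by (simp add: sum_distrib_left mult.commute)
qed

text \<open>Since \<open>h\<close> is multiplicative and maps entries to coordinates, it sends
  \<open>pr n \<tau>\<close> to the indicator function of \<open>\<tau>\<close>; every function is a
  combination of these.\<close>

lemma hom_gg:
  assumes h: "h \<in> star_hom A (aut_functions n E)"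
    and hu: "\<And>i j. i \<in> {1..n} \<Longrightarrow> j \<in> {1..n} \<Longrightarrow> h (u i j) = aut_coord n E i j"
    and f: "f \<in> carrier (aut_functions n E)"
  shows "h (gg f) = f"
proof -
  let ?F = "aut_functions n E"
  interpret F: cstar_algebra ?F by (rule cstar_aut_functions)
  interpret h: star_homomorphism A ?F h by unfold_locales (rule h)
  have pr: "h (pr k \<tau>) = (\<lambda>\<sigma>\<in>AK. of_bool (\<forall>i\<in>{1..k}. \<sigma> i = \<tau> i))" if "\<tau> \<in> AK" "k \<le> n" for k \<tau>
    using that(2)
  proof (induction k)
    case 0
    then show ?case by (simp add: h.hom_one function_cstar_simps One_nat_def)
  next
    case (Suc k)
    have t: "\<tau> (Suc k) \<in> {1..n}" "Suc k \<in> {1..n}"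
      using \<tau>_Suc[of \<tau>] K_range that(1) Suc.prems by auto
    have "pr k \<tau> \<in> carrier A" using K_range that Suc.prems by (intro pr_closed) auto
    then show ?case
      using Suc t
      by (auto simp: h.hom_mult hu function_cstar_simps aut_coord_def perm_matrix_def fun_eq_iff
          atLeastAtMostSuc_conv One_nat_def simp del: atLeastAtMost_iff)
  qed
  have "h (gg f) = (\<Oplus>\<^bsub>?F\<^esub>\<tau>\<in>AK. h (f \<tau> \<odot> pr n \<tau>))"
    unfolding gg_def by (rule h.hom_finsum) (auto simp: aut_group_finite)
  also have "\<dots> = (\<lambda>\<sigma>\<in>AK. \<Sum>\<tau>\<in>AK. h (f \<tau> \<odot> pr n \<tau>) \<sigma>)"
    by (rule function_cstar_finsum) (auto simp: aut_group_finite)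
  also have "\<dots> = (\<lambda>\<sigma>\<in>AK. \<Sum>\<tau>\<in>AK. if \<tau> = \<sigma> then f \<sigma> else 0)"
  proof (intro restrict_ext sum.cong HOL.refl)
    fix \<sigma> \<tau> assume st: "\<sigma> \<in> AK" "\<tau> \<in> AK"
    then have "(\<forall>i\<in>{1..n}. \<sigma> i = \<tau> i) \<longleftrightarrow> \<tau> = \<sigma>"
      unfolding aut_group_iff permutes_def fun_eq_iff by metis
    then show "h (f \<tau> \<odot> pr n \<tau>) \<sigma> = (if \<tau> = \<sigma> then f \<sigma> else 0)"
      using st by (auto simp: h.hom_smult pr function_cstar_simps)
  qed
  also have "\<dots> = restrict f AK" by (rule restrict_ext) (simp add: aut_group_finite)
  also have "\<dots> = f" using f by (intro extensional_restrict) (simp add: function_cstar_simps)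
  finally show ?thesis .
qed

end

theorem commutative_quantum_group:
  assumes G: "compact_matrix_quantum_group (matrix_qgroup n R)"
    and P: "presentation (mat_idx n) R"
    and m: "magic (universal_cstar (mat_idx n) R) n (\<lambda>i j. universal_gen (mat_idx n) R (i, j))"
    and c: "intertwines (universal_cstar (mat_idx n) R) n E (\<lambda>i j. universal_gen (mat_idx n) R (i, j))"
    and comm: "\<And>i j k l. \<lbrakk>i \<in> {1..n}; j \<in> {1..n}; k \<in> {1..n}; l \<in> {1..n}\<rbrakk> \<Longrightarrow>
      universal_gen (mat_idx n) R (i, j) \<otimes>\<^bsub>universal_cstar (mat_idx n) R\<^esub> universal_gen (mat_idx n) R (k, l) =
      universal_gen (mat_idx n) R (k, l) \<otimes>\<^bsub>universal_cstar (mat_idx n) R\<^esub> universal_gen (mat_idx n) R (i, j)"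
    and sat: "satisfies (mat_idx n) R (aut_functions n E) (\<lambda>(i, j). aut_coord n E i j)"
  shows "qgroup_eq (matrix_qgroup n R) (perm_qgroup n (carrier (aut_group n E)))"
proof -
  interpret P: presentation "mat_idx n" R by (rule P)
  interpret M: commuting_magic P.U n E "\<lambda>i j. P.gen (i, j)"
    by unfold_locales (use m c comm in auto)
  interpret F: cstar_algebra "aut_functions n E" by (rule cstar_aut_functions)
  obtain h where h: "h \<in> star_hom P.U (aut_functions n E)"
    "\<And>i j. i \<in> {1..n} \<Longrightarrow> j \<in> {1..n} \<Longrightarrow> h (P.gen (i, j)) = aut_coord n E i j"
    "\<And>x. x \<in> carrier P.U \<Longrightarrow> cnorm (aut_functions n E) (h x) \<le> cnorm P.U x"
    using P.universal_property[OF F.cstar_algebra_axioms sat] by auto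
  interpret h: star_homomorphism P.U "aut_functions n E" h by unfold_locales (rule h)
  obtain L where L: "\<And>f. cnorm P.U (M.gg f) \<le> L * cnorm (aut_functions n E) f"
    using M.gg_bounded by blast
  have gh: "M.gg (h x) = x" if "x \<in> carrier P.U" for x
  \<comment> \<open>The bound for \<open>gg\<close> is replaced by \<open>max L 0\<close> because
    the comparison below multiplies an inequality by it.\<close>
  proof (rule P.hom_eqI[OF P.cstar_U, of "\<lambda>x. M.gg (h x)" "max L 0" "\<lambda>x. x" 1])
    show "(\<lambda>x. M.gg (h x)) \<in> star_hom P.U P.U" by (rule star_hom_comp[OF h(1) M.gg_star_hom])
    show "(\<lambda>x. x) \<in> star_hom P.U P.U" by (rule star_homI) auto
    fix y assume y: "y \<in> carrier P.U"
    have "L * cnorm (aut_functions n E) (h y) \<le> max L 0 * cnorm P.U y"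
      using y h(3)[OF y] by (intro mult_mono) auto
    with L[of "h y"] show "cnorm P.U (M.gg (h y)) \<le> max L 0 * cnorm P.U y" by linarith
  qed (use that h(2) M.gg_coord in auto)
  show ?thesis
  proof (rule cmqg_transport[OF G, of _ h M.gg])
    show "cstar_algebra (qalg (perm_qgroup n (carrier (aut_group n E))))"
      by (simp add: perm_qgroup_def cstar_aut_functions)
  qed (use h gh M.hom_gg[OF h(1,2)] M.gg_star_hom M.gg_coord in
      \<open>auto simp: matrix_qgroup_def perm_qgroup_def aut_coord_def[symmetric]\<close>)
qed

section \<open>Consequences of the relations for small graphs\<close>

lemma atLeastAtMost_1_4: "{1..4::nat} = {1, 2, 3, 4}" and atLeastAtMost_1_2: "{1..2::nat} = {1, 2}"
  by auto

lemma ball_1_4: "(\<forall>i\<in>{1..4::nat}. P i) \<longleftrightarrow> P 1 \<and> P 2 \<and> P 3 \<and> P 4"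
  and ball_1_2: "(\<forall>i\<in>{1..2::nat}. P i) \<longleftrightarrow> P 1 \<and> P 2"
  unfolding atLeastAtMost_1_4 atLeastAtMost_1_2 by simp_all

lemma graph_compl_involution:
  "simple_graph n E \<Longrightarrow> graph_compl n (graph_compl n E) = E"
  by (auto simp: simple_graph_def graph_compl_def irrefl_def)

lemma simple_graph_compl: "simple_graph n E \<Longrightarrow> simple_graph n (graph_compl n E)"
  by (auto simp: simple_graph_def graph_compl_def irrefl_def sym_def)

lemma simple_\<Gamma>: "i \<in> {1..6} \<Longrightarrow> simple_graph 4 (\<Gamma> i)"
proof -
  assume "i \<in> {1..6}"
  then consider "i = 1" | "i = 2" | "i = 3" | "i = 4" | "i = 5" | "i = 6" by force
  then show ?thesis
    by cases (auto simp: \<Gamma>_def undirected_def simple_graph_def sym_def irrefl_def)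
qed

context star_algebra
begin

lemma finsum_1_4: "f \<in> {1..4} \<rightarrow> carrier A \<Longrightarrow> (\<Oplus>i\<in>{1..4::nat}. f i) = f 1 \<oplus> (f 2 \<oplus> (f 3 \<oplus> f 4))"
  unfolding atLeastAtMost_1_4 by (simp add: Pi_iff)

lemma finsum_1_2: "f \<in> {1..2} \<rightarrow> carrier A \<Longrightarrow> (\<Oplus>i\<in>{1..2::nat}. f i) = f 1 \<oplus> f 2"
  unfolding atLeastAtMost_1_2 by (simp add: Pi_iff)

lemma add_eq_imp_eq_minus:
  "x \<in> carrier A \<Longrightarrow> y \<in> carrier A \<Longrightarrow> x \<oplus> y = z \<Longrightarrow> y = z \<ominus> x"
  by (metis a_comm add.inv_closed minus_eq r_neg1 add.m_assoc)

text \<open>The two adjacency matrices and the identity matrix add up to the all-ones matrix.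
  Multiplying the latter by \<open>u\<close> on either side gives row or column sums, that is
  \<open>\<one>\<close> in every position, so it commutes with \<open>u\<close>.\<close>

lemma intertwines_compl_imp:
  assumes m: "magic A n u" and c: "intertwines A n E u" and E: "irrefl E"
  shows "intertwines A n (graph_compl n E) u"
  unfolding intertwines_def
proof (intro ballI)
  fix i j assume ij: "i \<in> {1..n}" "j \<in> {1..n}"
  note [simp] = magicD(1)[OF m]
  note [simp del] = atLeastAtMost_iff
  have adj: "adjacency (graph_compl n E) k l + (adjacency E k l + of_bool (k = l)) = 1"
    if "k \<in> {1..n}" "l \<in> {1..n}" for k l
    using that E by (auto simp: adjacency_def graph_compl_def irrefl_def)
  have split: "(\<Oplus>k\<in>{1..n}. f k \<odot> x k) \<oplus> ((\<Oplus>k\<in>{1..n}. g k \<odot> x k) \<oplus> (\<Oplus>k\<in>{1..n}. d k \<odot> x k)) =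
      (\<Oplus>k\<in>{1..n}. x k)"
    if "\<And>k. k \<in> {1..n} \<Longrightarrow> x k \<in> carrier A" "\<And>k. k \<in> {1..n} \<Longrightarrow> f k + (g k + d k) = 1" for f g d x
  proof -
    have "(\<Oplus>k\<in>{1..n}. f k \<odot> x k) \<oplus> ((\<Oplus>k\<in>{1..n}. g k \<odot> x k) \<oplus> (\<Oplus>k\<in>{1..n}. d k \<odot> x k)) =
        (\<Oplus>k\<in>{1..n}. f k \<odot> x k \<oplus> (g k \<odot> x k \<oplus> d k \<odot> x k))"
      using that by (simp add: finsum_addf Pi_iff)
    also have "\<dots> = (\<Oplus>k\<in>{1..n}. x k)"
      by (rule finsum_cong') (use that in \<open>auto simp: smult_add_left[symmetric]\<close>)
    finally show ?thesis .
  qed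
  let ?E' = "graph_compl n E"
  have d1: "(\<Oplus>k\<in>{1..n}. of_bool (k = j) \<odot> u i k) = u i j"
    by (subst finsum_delta[of _ j]) (use ij in auto)
  have d2: "(\<Oplus>k\<in>{1..n}. of_bool (i = k) \<odot> u k j) = u i j"
    by (subst finsum_delta[of _ i]) (use ij in auto)
  have L: "(\<Oplus>k\<in>{1..n}. adjacency ?E' k j \<odot> u i k) \<oplus> ((\<Oplus>k\<in>{1..n}. adjacency E k j \<odot> u i k) \<oplus> u i j) = \<one>"
    using split[of "\<lambda>k. u i k" "\<lambda>k. adjacency ?E' k j" "\<lambda>k. adjacency E k j" "\<lambda>k. of_bool (k = j)"]
      adj ij by (simp add: d1 magic_row_sum[OF m])
  have R: "(\<Oplus>k\<in>{1..n}. adjacency ?E' i k \<odot> u k j) \<oplus> ((\<Oplus>k\<in>{1..n}. adjacency E i k \<odot> u k j) \<oplus> u i j) = \<one>"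
    using split[of "\<lambda>k. u k j" "\<lambda>k. adjacency ?E' i k" "\<lambda>k. adjacency E i k" "\<lambda>k. of_bool (i = k)"]
      adj ij by (simp add: d2 magic_col_sum[OF m])
  have "(\<Oplus>k\<in>{1..n}. adjacency E k j \<odot> u i k) = (\<Oplus>k\<in>{1..n}. adjacency E i k \<odot> u k j)"
    using c ij by (simp add: intertwines_def)
  with L R have "(\<Oplus>k\<in>{1..n}. adjacency ?E' k j \<odot> u i k) \<oplus> ((\<Oplus>k\<in>{1..n}. adjacency E i k \<odot> u k j) \<oplus> u i j) =
      (\<Oplus>k\<in>{1..n}. adjacency ?E' i k \<odot> u k j) \<oplus> ((\<Oplus>k\<in>{1..n}. adjacency E i k \<odot> u k j) \<oplus> u i j)" by simp
  then show "(\<Oplus>k\<in>{1..n}. adjacency ?E' k j \<odot> u i k) = (\<Oplus>k\<in>{1..n}. adjacency ?E' i k \<odot> u k j)"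
    by (rule add.r_cancel) (use ij in \<open>auto simp: Pi_iff\<close>)
qed

lemma intertwines_compl:
  assumes m: "magic A n u" and E: "simple_graph n E"
  shows "intertwines A n (graph_compl n E) u \<longleftrightarrow> intertwines A n E u"
  using intertwines_compl_imp[OF m, of E] intertwines_compl_imp[OF m, of "graph_compl n E"]
    simple_graph_compl[OF E] graph_compl_involution[OF E] E
  by (auto simp: simple_graph_def)

lemma smult_eq_imp_zero:
  assumes "x \<in> carrier A" "c \<odot> x = d \<odot> x" "c \<noteq> d" shows "x = \<zero>"
proof -
  have "(c - d) \<odot> x = c \<odot> x \<ominus> d \<odot> x"
    using smult_add_left[OF assms(1), of c "- d"] assms(1) by (simp add: minus_eq_smult)
  then have "(c - d) \<odot> x = \<zero>" using assms by simp
  then have "inverse (c - d) \<odot> ((c - d) \<odot> x) = \<zero>" by simp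
  then show ?thesis using assms by simp
qed

text \<open>Applying \<open>u\<epsilon> = \<epsilon>u\<close> to the all-ones vector shows that
  \<open>\<Sum>l. d_l u_il\<close> equals \<open>d_i\<close> times \<open>\<one>\<close>, where
  \<open>d\<close> denotes degrees. Multiplication by \<open>u_ij\<close> gives
  \<open>d_j u_ij = d_i u_ij\<close>.\<close>

lemma magic_degree:
  assumes m: "magic A n u" and c: "intertwines A n E u" and ij: "i \<in> {1..n}" "j \<in> {1..n}"
    and ne: "(\<Sum>k\<in>{1..n}. adjacency E i k) \<noteq> (\<Sum>k\<in>{1..n}. adjacency E j k)"
  shows "u i j = \<zero>"
proof -
  note [simp] = magicD(1)[OF m]
  note [simp del] = atLeastAtMost_iff
  let ?d = "\<lambda>i. \<Sum>k\<in>{1..n}. adjacency E i k"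
  have "(\<Oplus>l\<in>{1..n}. ?d l \<odot> u i l) = (\<Oplus>l\<in>{1..n}. \<Oplus>k\<in>{1..n}. adjacency E l k \<odot> u i l)"
    by (rule finsum_cong') (use ij in \<open>auto simp: finsum_smult_left Pi_iff\<close>)
  also have "\<dots> = (\<Oplus>k\<in>{1..n}. \<Oplus>l\<in>{1..n}. adjacency E l k \<odot> u i l)"
    by (rule finsum_swap) (use ij in auto)
  also have "\<dots> = (\<Oplus>k\<in>{1..n}. \<Oplus>l\<in>{1..n}. adjacency E i l \<odot> u l k)"
    by (rule finsum_cong') (use ij c in \<open>auto simp: intertwines_def Pi_iff\<close>)
  also have "\<dots> = (\<Oplus>l\<in>{1..n}. \<Oplus>k\<in>{1..n}. adjacency E i l \<odot> u l k)"
    by (rule finsum_swap) (use ij in auto)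
  also have "\<dots> = (\<Oplus>l\<in>{1..n}. adjacency E i l \<odot> \<one>)"
    by (rule finsum_cong') (use ij magic_row_sum[OF m] in \<open>auto simp: finsum_smult[symmetric] Pi_iff\<close>)
  also have "\<dots> = ?d i \<odot> \<one>" by (rule finsum_smult_left) auto
  finally have eq: "(\<Oplus>l\<in>{1..n}. ?d l \<odot> u i l) = ?d i \<odot> \<one>" .
  have "(\<Oplus>l\<in>{1..n}. ?d l \<odot> u i l) \<otimes> u i j = (\<Oplus>l\<in>{1..n}. (?d l \<odot> u i l) \<otimes> u i j)"
    by (rule finsum_ldistr) (use ij in auto)
  also have "\<dots> = (?d j \<odot> u i j) \<otimes> u i j"
    by (rule finsum_delta) (use ij in \<open>auto simp: smult_mult_left magic_row[OF m]\<close>)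
  also have "\<dots> = ?d j \<odot> u i j" using ij by (simp add: smult_mult_left magic_row[OF m])
  finally have "?d i \<odot> u i j = ?d j \<odot> u i j" using ij unfolding eq by (simp add: smult_mult_left)
  then show ?thesis using ne ij by (intro smult_eq_imp_zero[of _ "?d i" "?d j"]) auto
qed

text \<open>Entries in a common row or column are orthogonal or equal. Otherwise
  \<open>(i, k)\<close> and \<open>(j, l)\<close> are pairs of distinct vertices: both are edges,
  both are edges of the complement, or they are of different kind, and then both products
  vanish.\<close>

lemma commute_if_edges_commute:
  assumes m: "magic A n u" and c: "intertwines A n E u" and E: "simple_graph n E"
    and d: "edges_commute A E u" "edges_commute A (graph_compl n E) u"
    and ij: "i \<in> {1..n}" "j \<in> {1..n}" "k \<in> {1..n}" "l \<in> {1..n}"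
  shows "u i j \<otimes> u k l = u k l \<otimes> u i j"
proof (cases "i = k \<or> j = l")
  case True
  then show ?thesis using magic_row[OF m] magic_col[OF m] ij by auto
next
  case False
  have sym: "(a, b) \<in> E \<longleftrightarrow> (b, a) \<in> E" for a b using E by (auto simp: simple_graph_def sym_def)
  consider "(i, k) \<in> E \<longleftrightarrow> (j, l) \<notin> E" | "(i, k) \<in> E" "(j, l) \<in> E" | "(i, k) \<notin> E" "(j, l) \<notin> E" by blast
  then show ?thesis
  proof cases
    case 1
    have "(k, i) \<in> E \<longleftrightarrow> (l, j) \<notin> E" using 1 sym by blast
    then show ?thesis
      using non_edge_product[OF m c ij(1,3,2,4) 1] non_edge_product[OF m c ij(3,1,4,2)] by simp
  next
    case 2
    then show ?thesis using d(1) unfolding edges_commute_def by force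
  next
    case 3
    then have "(i, k) \<in> graph_compl n E" "(j, l) \<in> graph_compl n E"
      using False ij by (auto simp: graph_compl_def)
    then show ?thesis using d(2) unfolding edges_commute_def by force
  qed
qed

lemma edges_commute_if_commute:
  assumes "E \<subseteq> mat_idx n"
    and "\<And>i j k l. \<lbrakk>i \<in> {1..n}; j \<in> {1..n}; k \<in> {1..n}; l \<in> {1..n}\<rbrakk> \<Longrightarrow> u i j \<otimes> u k l = u k l \<otimes> u i j"
  shows "edges_commute A E u"
  unfolding edges_commute_def
proof (intro ballI)
  fix e f assume "e \<in> E" "f \<in> E"
  then have "e \<in> mat_idx n" "f \<in> mat_idx n" using assms(1) by auto
  then show "u (fst e) (fst f) \<otimes> u (snd e) (snd f) = u (snd e) (snd f) \<otimes> u (fst e) (fst f)"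
    by (intro assms(2)) (simp_all only: mem_Times_iff)
qed

section \<open>Magic unitaries of size four\<close>

context
  fixes u :: "nat \<Rightarrow> nat \<Rightarrow> 'a"
  assumes m: "magic A 4 u"
begin

lemma u4_closed:
  "u 1 1 \<in> carrier A" "u 1 2 \<in> carrier A" "u 1 3 \<in> carrier A" "u 1 4 \<in> carrier A"
  "u 2 1 \<in> carrier A" "u 2 2 \<in> carrier A" "u 2 3 \<in> carrier A" "u 2 4 \<in> carrier A"
  "u 3 1 \<in> carrier A" "u 3 2 \<in> carrier A" "u 3 3 \<in> carrier A" "u 3 4 \<in> carrier A"
  "u 4 1 \<in> carrier A" "u 4 2 \<in> carrier A" "u 4 3 \<in> carrier A" "u 4 4 \<in> carrier A"
  by (rule magicD[OF m]; simp)+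

lemma u4_row: assumes "i \<in> {1..4}" shows "u i 1 \<oplus> (u i 2 \<oplus> (u i 3 \<oplus> u i 4)) = \<one>"
  using magic_row_sum[OF m assms] finsum_1_4[of "u i"] magicD(1)[OF m assms] by simp

lemma u4_col: assumes "i \<in> {1..4}" shows "u 1 i \<oplus> (u 2 i \<oplus> (u 3 i \<oplus> u 4 i)) = \<one>"
  using magic_col_sum[OF m assms] finsum_1_4[of "\<lambda>k. u k i"] magicD(1)[OF m _ assms] by simp

lemma u4_intertwines: "intertwines A 4 E u \<Longrightarrow> i \<in> {1..4} \<Longrightarrow> j \<in> {1..4} \<Longrightarrow>
    adjacency E 1 j \<odot> u i 1 \<oplus> (adjacency E 2 j \<odot> u i 2 \<oplus> (adjacency E 3 j \<odot> u i 3 \<oplus> adjacency E 4 j \<odot> u i 4)) =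
    adjacency E i 1 \<odot> u 1 j \<oplus> (adjacency E i 2 \<odot> u 2 j \<oplus> (adjacency E i 3 \<odot> u 3 j \<oplus> adjacency E i 4 \<odot> u 4 j))"
  using magicD(1)[OF m] unfolding intertwines_def by (simp add: finsum_1_4)

lemma u4_degree: "intertwines A 4 E u \<Longrightarrow> i \<in> {1..4} \<Longrightarrow> j \<in> {1..4} \<Longrightarrow>
    adjacency E i 1 + adjacency E i 2 + adjacency E i 3 + adjacency E i 4 \<noteq>
    adjacency E j 1 + adjacency E j 2 + adjacency E j 3 + adjacency E j 4 \<Longrightarrow> u i j = \<zero>"
  by (rule magic_degree[OF m]) (simp_all add: atLeastAtMost_1_4 add.assoc)

end

lemma commute_projection_complement:
  assumes "p \<in> carrier A" "x \<in> {\<zero>, \<one>, p, \<one> \<ominus> p}" "y \<in> {\<zero>, \<one>, p, \<one> \<ominus> p}"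
  shows "x \<otimes> y = y \<otimes> x"
  using assms by (auto simp: minus_distr_left minus_distr_right)

text \<open>The reason why \<open>S_3^+\<close> is classical. In a magic unitary of size three take
  \<open>a\<close> and \<open>b\<close> in different rows and columns, with \<open>a'\<close>,
  \<open>a''\<close> the rest of the row of \<open>a\<close> and \<open>b'\<close>,
  \<open>b''\<close> the rest of the row of \<open>b\<close>. Inserting the row sum of
  \<open>b\<close> between \<open>a\<close> and \<open>a''\<close> gives \<open>a b a'' = 0\<close>;
  inserting that of \<open>a\<close> after \<open>a b\<close> leaves \<open>a b = a b a\<close>,
  which is self-adjoint.\<close>

lemma three_projections_commute:
  assumes [simp]: "a \<in> carrier A" "b \<in> carrier A" "a' \<in> carrier A" "a'' \<in> carrier A" "b' \<in> carrier A" "b'' \<in> carrier A"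
    and sa: "star A a = a" "star A b = b"
    and s1: "a \<oplus> (a' \<oplus> a'') = \<one>" and s2: "b' \<oplus> (b \<oplus> b'') = \<one>"
    and z: "b \<otimes> a' = \<zero>" "a \<otimes> a'' = \<zero>" "a \<otimes> b' = \<zero>" "b'' \<otimes> a'' = \<zero>"
  shows "a \<otimes> b = b \<otimes> a"
proof -
  have "\<zero> = a \<otimes> ((b' \<oplus> (b \<oplus> b'')) \<otimes> a'')" using z(2) by (simp add: s2)
  also have "\<dots> = (a \<otimes> b') \<otimes> a'' \<oplus> (a \<otimes> (b \<otimes> a'') \<oplus> a \<otimes> (b'' \<otimes> a''))"
    by (simp add: l_distr r_distr m_assoc)
  also have "\<dots> = a \<otimes> (b \<otimes> a'')" using z by simp
  finally have z5: "a \<otimes> (b \<otimes> a'') = \<zero>" ..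
  have "a \<otimes> b = a \<otimes> (b \<otimes> (a \<oplus> (a' \<oplus> a'')))" by (simp add: s1)
  also have "\<dots> = a \<otimes> (b \<otimes> a)" by (simp add: r_distr z z5)
  finally have eq: "a \<otimes> b = a \<otimes> (b \<otimes> a)" .
  have "b \<otimes> a = star A (a \<otimes> b)" by (simp add: star_mult sa)
  also have "\<dots> = star A (a \<otimes> (b \<otimes> a))" by (simp only: eq)
  also have "\<dots> = a \<otimes> (b \<otimes> a)" by (simp add: star_mult sa m_assoc)
  finally show ?thesis using eq by simp
qed

section \<open>What the relations say for the individual graphs\<close>

lemma \<Gamma>2_relations:
  assumes m: "magic A 4 u" and c: "intertwines A 4 (\<Gamma> 2) u"
  shows "u 1 3 = \<zero>" "u 1 4 = \<zero>" "u 2 3 = \<zero>" "u 2 4 = \<zero>" "u 3 1 = \<zero>" "u 3 2 = \<zero>" "u 4 1 = \<zero>" "u 4 2 = \<zero>"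
    and "u 2 2 = u 1 1" "u 2 1 = u 1 2" "u 1 2 = \<one> \<ominus> u 1 1"
    and "u 3 4 = \<one> \<ominus> u 3 3" "u 4 3 = \<one> \<ominus> u 3 3" "u 4 4 = u 3 3"
proof -
  note [simp] = u4_closed[OF m]
  note adj = adjacency_def \<Gamma>_def undirected_def
  \<comment> \<open>Vertices 1 and 2 have degree 1, vertices 3 and 4 have degree 0; hence both
    off-diagonal blocks vanish.\<close>
  show z: "u 1 3 = \<zero>" "u 1 4 = \<zero>" "u 2 3 = \<zero>" "u 2 4 = \<zero>" "u 3 1 = \<zero>" "u 3 2 = \<zero>" "u 4 1 = \<zero>" "u 4 2 = \<zero>"
    by (rule u4_degree[OF m c]; simp add: adj)+
  show "u 2 2 = u 1 1" "u 2 1 = u 1 2"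
    using u4_intertwines[OF m c, of 1 2] u4_intertwines[OF m c, of 1 1] by (simp_all add: adj)
  show "u 1 2 = \<one> \<ominus> u 1 1"
    by (rule add_eq_imp_eq_minus) (use u4_row[OF m, of 1] in \<open>simp_all add: z\<close>)
  \<comment> \<open>Between 3 and 4 there is no edge to exploit; this block is determined by its row
    and column sums.\<close>
  show 34: "u 3 4 = \<one> \<ominus> u 3 3"
    by (rule add_eq_imp_eq_minus) (use u4_row[OF m, of 3] in \<open>simp_all add: z\<close>)
  show "u 4 3 = \<one> \<ominus> u 3 3"
    by (rule add_eq_imp_eq_minus) (use u4_col[OF m, of 3] in \<open>simp_all add: z\<close>)
  have "u 4 4 = \<one> \<ominus> u 3 4"
    by (rule add_eq_imp_eq_minus) (use u4_col[OF m, of 4] in \<open>simp_all add: z\<close>)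
  moreover have "u 3 3 = \<one> \<ominus> u 3 4"
    by (rule add_eq_imp_eq_minus) (use u4_row[OF m, of 3] in \<open>simp_all add: z a_comm\<close>)
  ultimately show "u 4 4 = u 3 3" by simp
qed

text \<open>The adjacency matrix is the permutation matrix of the involution exchanging 1 with 2 and
  3 with 4, so commuting with it means that an entry is unchanged when both indices are replaced by
  their neighbours.\<close>

lemma \<Gamma>4_relations:
  assumes m: "magic A 4 u" and c: "intertwines A 4 (\<Gamma> 4) u"
  shows "u 2 1 = u 1 2" "u 2 2 = u 1 1" "u 2 3 = u 1 4" "u 2 4 = u 1 3"
    "u 4 1 = u 3 2" "u 4 2 = u 3 1" "u 4 3 = u 3 4" "u 4 4 = u 3 3"
proof -
  note [simp] = u4_closed[OF m]
  note adj = adjacency_def \<Gamma>_def undirected_def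
  show "u 2 1 = u 1 2" "u 2 2 = u 1 1" "u 2 3 = u 1 4" "u 2 4 = u 1 3"
    using u4_intertwines[OF m c, of 1 1] u4_intertwines[OF m c, of 1 2]
      u4_intertwines[OF m c, of 1 3] u4_intertwines[OF m c, of 1 4] by (simp_all add: adj)
  show "u 4 1 = u 3 2" "u 4 2 = u 3 1" "u 4 3 = u 3 4" "u 4 4 = u 3 3"
    using u4_intertwines[OF m c, of 3 1] u4_intertwines[OF m c, of 3 2]
      u4_intertwines[OF m c, of 3 3] u4_intertwines[OF m c, of 3 4] by (simp_all add: adj)
qed

text \<open>For any two edges the two factors in question are equal elements, here and for
  \<open>\<Gamma> 4\<close> alike.\<close>

lemma \<Gamma>2_edges_commute:
  assumes "magic A 4 u" "intertwines A 4 (\<Gamma> 2) u" shows "edges_commute A (\<Gamma> 2) u"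
  using \<Gamma>2_relations(9,10)[OF assms]
  by (auto simp: edges_commute_def \<Gamma>_def undirected_def)

lemma \<Gamma>4_edges_commute:
  assumes "magic A 4 u" "intertwines A 4 (\<Gamma> 4) u" shows "edges_commute A (\<Gamma> 4) u"
  using \<Gamma>4_relations[OF assms]
  by (auto simp: edges_commute_def \<Gamma>_def undirected_def)

text \<open>The degrees 2, 1, 1, 0 isolate vertices 1 and 4, and a magic unitary on the remaining
  block {2, 3} is determined by a single projection.\<close>

lemma \<Gamma>3_commute:
  assumes m: "magic A 4 u" and c: "intertwines A 4 (\<Gamma> 3) u"
    and ij: "i \<in> {1..4}" "j \<in> {1..4}" "k \<in> {1..4}" "l \<in> {1..4}"
  shows "u i j \<otimes> u k l = u k l \<otimes> u i j"
proof (rule commute_projection_complement)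
  note [simp] = u4_closed[OF m]
  note adj = adjacency_def \<Gamma>_def undirected_def
  have z: "u 1 2 = \<zero>" "u 1 3 = \<zero>" "u 1 4 = \<zero>" "u 2 1 = \<zero>" "u 3 1 = \<zero>" "u 4 1 = \<zero>"
      "u 2 4 = \<zero>" "u 3 4 = \<zero>" "u 4 2 = \<zero>" "u 4 3 = \<zero>"
    by (rule u4_degree[OF m c]; simp add: adj)+
  have 1: "u 1 1 = \<one>" "u 4 4 = \<one>"
    using u4_row[OF m, of 1] u4_row[OF m, of 4] by (simp_all add: z)
  have 23: "u 2 3 = \<one> \<ominus> u 2 2"
    by (rule add_eq_imp_eq_minus) (use u4_row[OF m, of 2] in \<open>simp_all add: z\<close>)
  have 32: "u 3 2 = \<one> \<ominus> u 2 2"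
    by (rule add_eq_imp_eq_minus) (use u4_col[OF m, of 2] in \<open>simp_all add: z\<close>)
  have "u 3 3 = \<one> \<ominus> u 2 3"
    by (rule add_eq_imp_eq_minus) (use u4_col[OF m, of 3] in \<open>simp_all add: z\<close>)
  moreover have "u 2 2 = \<one> \<ominus> u 2 3"
    by (rule add_eq_imp_eq_minus) (use u4_row[OF m, of 2] in \<open>simp_all add: z a_comm\<close>)
  ultimately have 33: "u 3 3 = u 2 2" by simp
  have "\<forall>i\<in>{1..4}. \<forall>j\<in>{1..4}. u i j \<in> {\<zero>, \<one>, u 2 2, \<one> \<ominus> u 2 2}"
    unfolding ball_1_4 using z 1 23 32 33 by simp
  then show "u i j \<in> {\<zero>, \<one>, u 2 2, \<one> \<ominus> u 2 2}" "u k l \<in> {\<zero>, \<one>, u 2 2, \<one> \<ominus> u 2 2}"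
    using ij by blast+
  show "u 2 2 \<in> carrier A" by simp
qed

text \<open>The degrees 2, 2, 1, 1 split \<open>u\<close> into the blocks {1, 2} and {3, 4}, each
  given by one projection; the edge from 1 to 3 identifies \<open>u 3 3\<close> with
  \<open>u 1 1\<close>, so a single projection is left.\<close>

lemma \<Gamma>6_commute:
  assumes m: "magic A 4 u" and c: "intertwines A 4 (\<Gamma> 6) u"
    and ij: "i \<in> {1..4}" "j \<in> {1..4}" "k \<in> {1..4}" "l \<in> {1..4}"
  shows "u i j \<otimes> u k l = u k l \<otimes> u i j"
proof (rule commute_projection_complement)
  note [simp] = u4_closed[OF m]
  note adj = adjacency_def \<Gamma>_def undirected_def
  have z: "u 1 3 = \<zero>" "u 1 4 = \<zero>" "u 2 3 = \<zero>" "u 2 4 = \<zero>" "u 3 1 = \<zero>" "u 3 2 = \<zero>" "u 4 1 = \<zero>" "u 4 2 = \<zero>"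
    by (rule u4_degree[OF m c]; simp add: adj)+
  have 33: "u 3 3 = u 1 1"
    using u4_intertwines[OF m c, of 1 3] by (simp add: adj z)
  have 12: "u 1 2 = \<one> \<ominus> u 1 1"
    by (rule add_eq_imp_eq_minus) (use u4_row[OF m, of 1] in \<open>simp_all add: z\<close>)
  have 21: "u 2 1 = \<one> \<ominus> u 1 1"
    by (rule add_eq_imp_eq_minus) (use u4_col[OF m, of 1] in \<open>simp_all add: z\<close>)
  have 34: "u 3 4 = \<one> \<ominus> u 3 3"
    by (rule add_eq_imp_eq_minus) (use u4_row[OF m, of 3] in \<open>simp_all add: z\<close>)
  have 43: "u 4 3 = \<one> \<ominus> u 3 3"
    by (rule add_eq_imp_eq_minus) (use u4_col[OF m, of 3] in \<open>simp_all add: z\<close>)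
  have "u 2 2 = \<one> \<ominus> u 1 2"
    by (rule add_eq_imp_eq_minus) (use u4_col[OF m, of 2] in \<open>simp_all add: z\<close>)
  moreover have "u 1 1 = \<one> \<ominus> u 1 2"
    by (rule add_eq_imp_eq_minus) (use u4_row[OF m, of 1] in \<open>simp_all add: z a_comm\<close>)
  ultimately have 22: "u 2 2 = u 1 1" by simp
  have "u 4 4 = \<one> \<ominus> u 3 4"
    by (rule add_eq_imp_eq_minus) (use u4_col[OF m, of 4] in \<open>simp_all add: z\<close>)
  moreover have "u 3 3 = \<one> \<ominus> u 3 4"
    by (rule add_eq_imp_eq_minus) (use u4_row[OF m, of 3] in \<open>simp_all add: z a_comm\<close>)
  ultimately have 44: "u 4 4 = u 3 3" by simp
  have "\<forall>i\<in>{1..4}. \<forall>j\<in>{1..4}. u i j \<in> {\<zero>, \<one>, u 1 1, \<one> \<ominus> u 1 1}"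
    unfolding ball_1_4 using z 12 21 22 33 34 43 44 by simp
  then show "u i j \<in> {\<zero>, \<one>, u 1 1, \<one> \<ominus> u 1 1}" "u k l \<in> {\<zero>, \<one>, u 1 1, \<one> \<ominus> u 1 1}"
    using ij by blast+
  show "u 1 1 \<in> carrier A" by simp
qed

text \<open>Vertex 4 is the only one of degree 0, which leaves a magic unitary of size three on the
  triangle; \<open>three_projections_commute\<close> handles entries in different rows and columns
  of it.\<close>

lemma \<Gamma>5_commute:
  assumes m: "magic A 4 u" and c: "intertwines A 4 (\<Gamma> 5) u"
    and ij: "i \<in> {1..4}" "j \<in> {1..4}" "k \<in> {1..4}" "l \<in> {1..4}"
  shows "u i j \<otimes> u k l = u k l \<otimes> u i j"
proof -
  note [simp] = u4_closed[OF m]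
  note adj = adjacency_def \<Gamma>_def undirected_def
  have z: "u 1 4 = \<zero>" "u 2 4 = \<zero>" "u 3 4 = \<zero>" "u 4 1 = \<zero>" "u 4 2 = \<zero>" "u 4 3 = \<zero>"
    by (rule u4_degree[OF m c]; simp add: adj)+
  have 44: "u 4 4 = \<one>" using u4_row[OF m, of 4] by (simp add: z)
  have sum: "u i 1 \<oplus> (u i 2 \<oplus> u i 3) = \<one>" if "i = 1 \<or> i = 2 \<or> i = 3" for i
    using that u4_row[OF m, of i] by (auto simp: z)
  have sum': "u i j \<oplus> (u i k \<oplus> u i l) = \<one>" if "i = 1 \<or> i = 2 \<or> i = 3"
      "distinct [j, k, l]" "j = 1 \<or> j = 2 \<or> j = 3" "k = 1 \<or> k = 2 \<or> k = 3" "l = 1 \<or> l = 2 \<or> l = 3" for i j k l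
  proof -
    have [simp]: "u i 1 \<in> carrier A" "u i 2 \<in> carrier A" "u i 3 \<in> carrier A" using that(1) by auto
    have "j = 1 \<and> k = 2 \<and> l = 3 \<or> j = 1 \<and> k = 3 \<and> l = 2 \<or> j = 2 \<and> k = 1 \<and> l = 3 \<or>
        j = 2 \<and> k = 3 \<and> l = 1 \<or> j = 3 \<and> k = 1 \<and> l = 2 \<or> j = 3 \<and> k = 2 \<and> l = 1"
      using that(2-5) by auto
    then show ?thesis using sum[OF that(1)] by (auto simp: a_ac)
  qed
  have main: "u i j \<otimes> u k l = u k l \<otimes> u i j"
    if i: "i = 1 \<or> i = 2 \<or> i = 3" "k = 1 \<or> k = 2 \<or> k = 3" "i \<noteq> k" and d: "distinct [j, l, e]"
      "j = 1 \<or> j = 2 \<or> j = 3" "l = 1 \<or> l = 2 \<or> l = 3" "e = 1 \<or> e = 2 \<or> e = 3"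
    for i j k l e
  proof -
    have r: "i \<in> {1..4}" "k \<in> {1..4}" "j \<in> {1..4}" "l \<in> {1..4}" "e \<in> {1..4}" using i d by auto
    show ?thesis
      by (rule three_projections_commute[of "u i j" "u k l" "u i l" "u i e" "u k j" "u k e"])
         (use r i d sum'[OF i(1), of j l e] sum'[OF i(2), of j l e] in \<open>simp_all add: magicD[OF m]\<close>)
  qed
  show ?thesis
  proof (cases "i = k \<or> j = l \<or> i = 4 \<or> j = 4 \<or> k = 4 \<or> l = 4")
    case True
    have "u a 4 \<in> {\<zero>, \<one>} \<and> u 4 a \<in> {\<zero>, \<one>}" if "a \<in> {1..4}" for a
      using that 44 z unfolding atLeastAtMost_1_4 by auto
    then have b: "u a 4 = \<zero> \<or> u a 4 = \<one>" "u 4 a = \<zero> \<or> u 4 a = \<one>" if "a \<in> {1..4}" for a using that by auto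
    show ?thesis
    proof (cases "i = k \<or> j = l")
      case True
      then show ?thesis using magic_row[OF m] magic_col[OF m] ij by auto
    next
      case False
      with True have "i = 4 \<or> j = 4 \<or> k = 4 \<or> l = 4" by blast
      then have "(u i j = \<zero> \<or> u i j = \<one>) \<or> (u k l = \<zero> \<or> u k l = \<one>)" using b ij by blast
      moreover have "u i j \<in> carrier A" "u k l \<in> carrier A" using magicD(1)[OF m] ij by blast+
      ultimately show ?thesis by (elim disjE) simp_all
    qed
  next
    case False
    then have r: "i = 1 \<or> i = 2 \<or> i = 3" "k = 1 \<or> k = 2 \<or> k = 3" "i \<noteq> k" "j \<noteq> l"
      "j = 1 \<or> j = 2 \<or> j = 3" "l = 1 \<or> l = 2 \<or> l = 3"
      using ij unfolding atLeastAtMost_1_4 by auto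
    \<comment> \<open>\<open>6 - j - l\<close> is the third element of {1, 2, 3}.\<close>
    show ?thesis
      by (rule main[OF r(1-3), of j l "6 - j - l"]) (use r(4-6) in auto)
  qed
qed

end

section \<open>Equalities of quantum automorphism groups\<close>

text \<open>An equality of objects, stronger than \<open>qgroup_eq\<close>: algebra and generators
  depend on the relations only through the universal seminorm.\<close>

lemma matrix_qgroup_cong:
  assumes "R \<subseteq> carrier (mat_free n) \<times> carrier (mat_free n)"
    and "R' \<subseteq> carrier (mat_free n) \<times> carrier (mat_free n)"
    and "\<And>(B :: (nat \<Rightarrow> mat_poly) set cstar_algebra) u. cstar_algebra B \<Longrightarrow>
      satisfies (mat_idx n) R B u \<longleftrightarrow> satisfies (mat_idx n) R' B u"
  shows "matrix_qgroup n R = matrix_qgroup n R'"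
  using universal_cstar_cong[OF assms]
  by (simp add: matrix_qgroup_def universal_cstar_def universal_gen_def[abs_def])

lemma rels_carrier:
  "rel_a n \<union> rel_b n \<subseteq> carrier (mat_free n) \<times> carrier (mat_free n)"
  "rel_a n \<union> rel_b n \<union> rel_c n E \<subseteq> carrier (mat_free n) \<times> carrier (mat_free n)"
  "E \<subseteq> mat_idx n \<Longrightarrow> rel_a n \<union> rel_b n \<union> rel_c n E \<union> rel_d n E \<subseteq> carrier (mat_free n) \<times> carrier (mat_free n)"
  using rel_carrier by blast+

lemma G_aut_plus_empty: "G_aut_plus n {} = S_plus n"
  unfolding G_aut_plus_def S_plus_def
proof (rule matrix_qgroup_cong[OF rels_carrier(2,1)])
  fix B :: "(nat \<Rightarrow> mat_poly) set cstar_algebra" and u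
  assume "cstar_algebra B"
  then interpret B: cstar_algebra B .
  have "intertwines B n {} (\<lambda>i j. u (i, j))" if m: "magic B n (\<lambda>i j. u (i, j))"
    unfolding intertwines_def by (simp add: adjacency_def magicD(1)[OF m] B.finsum_all_zero del: atLeastAtMost_iff)
  moreover have "satisfies (mat_idx n) (rel_a n \<union> rel_b n) B u \<longleftrightarrow> magic B n (\<lambda>i j. u (i, j))"
    using B.satisfies_rel_ab[of n u] satisfiesD[of "mat_idx n" "rel_a n \<union> rel_b n" B u] magicD(1)[of B n "\<lambda>i j. u (i, j)"]
    by (metis (no_types, lifting) mem_Sigma_iff surj_pair)
  ultimately show "satisfies (mat_idx n) (rel_a n \<union> rel_b n \<union> rel_c n {}) B u \<longleftrightarrow>
      satisfies (mat_idx n) (rel_a n \<union> rel_b n) B u"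
    using satisfies_abc[OF B.star_algebra_axioms, of n "{}" u] by blast
qed

lemma G_aut_plus_compl:
  assumes E: "simple_graph n E" shows "G_aut_plus n (graph_compl n E) = G_aut_plus n E"
  unfolding G_aut_plus_def
proof (rule matrix_qgroup_cong[OF rels_carrier(2) rels_carrier(2)])
  fix B :: "(nat \<Rightarrow> mat_poly) set cstar_algebra" and u
  assume "cstar_algebra B"
  then interpret B: cstar_algebra B .
  show "satisfies (mat_idx n) (rel_a n \<union> rel_b n \<union> rel_c n (graph_compl n E)) B u \<longleftrightarrow>
      satisfies (mat_idx n) (rel_a n \<union> rel_b n \<union> rel_c n E) B u"
    using B.intertwines_compl[OF _ E] unfolding satisfies_abc[OF B.star_algebra_axioms] by blast
qed

lemma G_aut_star_eq_plus:
  assumes E: "E \<subseteq> mat_idx n"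
    and d: "\<And>(B :: (nat \<Rightarrow> mat_poly) set cstar_algebra) u. cstar_algebra B \<Longrightarrow> magic B n u \<Longrightarrow>
      intertwines B n E u \<Longrightarrow> edges_commute B E u"
  shows "G_aut_star n E = G_aut_plus n E"
  unfolding G_aut_plus_def G_aut_star_def
proof (rule matrix_qgroup_cong[OF rels_carrier(3)[OF E] rels_carrier(2)])
  fix B :: "(nat \<Rightarrow> mat_poly) set cstar_algebra" and u
  assume B: "cstar_algebra B"
  then interpret B: cstar_algebra B .
  show "satisfies (mat_idx n) (rel_a n \<union> rel_b n \<union> rel_c n E \<union> rel_d n E) B u \<longleftrightarrow>
      satisfies (mat_idx n) (rel_a n \<union> rel_b n \<union> rel_c n E) B u"
    using d[OF B] unfolding satisfies_abc[OF B.star_algebra_axioms] satisfies_abcd[OF B.star_algebra_axioms E]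
    by blast
qed

lemma G_aut_star_commutative:
  assumes E: "E \<subseteq> mat_idx n"
    and comm: "\<And>(B :: (nat \<Rightarrow> mat_poly) set cstar_algebra) u i j k l. \<lbrakk>cstar_algebra B; magic B n u;
      intertwines B n E u; edges_commute B E u; i \<in> {1..n}; j \<in> {1..n}; k \<in> {1..n}; l \<in> {1..n}\<rbrakk> \<Longrightarrow>
      u i j \<otimes>\<^bsub>B\<^esub> u k l = u k l \<otimes>\<^bsub>B\<^esub> u i j"
  shows "qgroup_eq (G_aut_star n E) (perm_qgroup n (carrier (aut_group n E)))"
proof -
  let ?R = "rel_a n \<union> rel_b n \<union> rel_c n E \<union> rel_d n E"
  interpret P: presentation "mat_idx n" ?R by (rule presentation_magic[OF rels_carrier(3)[OF E]]) auto
  interpret F: cstar_algebra "aut_functions n E" by (rule cstar_aut_functions)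
  have sat: "magic P.U n (\<lambda>i j. P.gen (i, j))" "intertwines P.U n E (\<lambda>i j. P.gen (i, j))"
    "edges_commute P.U E (\<lambda>i j. P.gen (i, j))"
    using P.satisfies_gen unfolding satisfies_abcd[OF P.U.star_algebra_axioms E] by auto
  show ?thesis
    unfolding G_aut_star_def
  proof (rule commutative_quantum_group[OF cmqg_G_aut_star[OF E, unfolded G_aut_star_def]
        P.presentation_axioms sat(1,2)])
    show "satisfies (mat_idx n) ?R (aut_functions n E) (\<lambda>(i, j). aut_coord n E i j)"
      unfolding satisfies_abcd[OF F.star_algebra_axioms E]
      using magic_aut_coord intertwines_aut_coord edges_commute_aut_coord by simp
  qed (rule comm[OF P.cstar_U sat])
qed

text \<open>Commutation of all entries implies (d), so both kinds of quantum automorphism group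
  coincide and the statement for \<open>G_aut_star\<close> applies.\<close>

lemma G_aut_plus_commutative:
  assumes E: "E \<subseteq> mat_idx n"
    and comm: "\<And>(B :: (nat \<Rightarrow> mat_poly) set cstar_algebra) u i j k l. \<lbrakk>cstar_algebra B; magic B n u;
      intertwines B n E u; i \<in> {1..n}; j \<in> {1..n}; k \<in> {1..n}; l \<in> {1..n}\<rbrakk> \<Longrightarrow>
      u i j \<otimes>\<^bsub>B\<^esub> u k l = u k l \<otimes>\<^bsub>B\<^esub> u i j"
  shows "qgroup_eq (G_aut_plus n E) (perm_qgroup n (carrier (aut_group n E)))"
proof -
  have "edges_commute B E u" if "cstar_algebra B" "magic B n u" "intertwines B n E u"
    for B :: "(nat \<Rightarrow> mat_poly) set cstar_algebra" and u
  proof -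
    interpret B: cstar_algebra B by fact
    show ?thesis by (rule B.edges_commute_if_commute[OF E]) (rule comm[OF that])
  qed
  then have "G_aut_star n E = G_aut_plus n E" by (rule G_aut_star_eq_plus[OF E])
  then show ?thesis using G_aut_star_commutative[OF E] comm by metis
qed

section \<open>The dual of the infinite dihedral group\<close>

lemma satisfies_rel_proj:
  assumes "star_algebra B" and u: "\<And>x. u x \<in> carrier B"
  shows "satisfies UNIV rel_proj B u \<longleftrightarrow> (\<forall>x. star B (u x) = u x \<and> u x \<otimes>\<^bsub>B\<^esub> u x = u x)"
proof -
  interpret B: star_algebra B by fact
  interpret ev: star_homomorphism "free_star_algebra UNIV" B "free_ev B u"
    by (unfold_locales) (rule B.free_ev_hom, rule u)
  have "satisfies UNIV rel_proj B u \<longleftrightarrow> (\<forall>r\<in>rel_proj. free_ev B u (fst r) = free_ev B u (snd r))"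
    using u by (simp only: satisfies_def split_def) blast
  also have "\<dots> \<longleftrightarrow> (\<forall>x. free_ev B u (free_gen x) = free_ev B u (star (free_star_algebra UNIV) (free_gen x))) \<and>
      (\<forall>x. free_ev B u (free_gen x \<otimes>\<^bsub>free_star_algebra UNIV\<^esub> free_gen x) = free_ev B u (free_gen x))"
  proof -
    have 1: "(\<forall>r\<in>{(f x, g x) |x. True}. free_ev B u (fst r) = free_ev B u (snd r)) \<longleftrightarrow>
      (\<forall>x. free_ev B u (f x) = free_ev B u (g x))" for f g :: "proj_gen \<Rightarrow> proj_gen word \<Rightarrow> complex" by auto
    show ?thesis unfolding rel_proj_def Let_def ball_Un 1 ..
  qed
  also have "\<dots> \<longleftrightarrow> (\<forall>x. star B (u x) = u x \<and> u x \<otimes>\<^bsub>B\<^esub> u x = u x)"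
    using u by (auto simp: ev.hom_star ev.hom_mult B.free_ev_gen eq_commute[of "u _" "star B _"])
  finally show ?thesis .
qed

lemma rel_proj_carrier:
  "rel_proj \<subseteq> carrier (free_star_algebra UNIV) \<times> carrier (free_star_algebra UNIV)"
  unfolding rel_proj_def Let_def by auto

lemma presentation_rel_proj: "presentation UNIV rel_proj"
proof (rule presentationI[OF rel_proj_carrier])
  fix B :: "(nat \<Rightarrow> proj_gen word \<Rightarrow> complex) set cstar_algebra" and u x
  assume B: "cstar_algebra B" and sat: "satisfies UNIV rel_proj B u"
  interpret B: cstar_algebra B by fact
  have u: "u x \<in> carrier B" for x using sat by (simp add: satisfies_def)
  then show "cnorm B (u x) \<le> 1"
    using sat satisfies_rel_proj[OF B.star_algebra_axioms u] by (intro B.projection_norm) auto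
qed

definition two_projections :: "('a, 'm) star_algebra_scheme \<Rightarrow> 'a \<Rightarrow> 'a \<Rightarrow> nat \<Rightarrow> nat \<Rightarrow> 'a" where
  "two_projections A p q = (\<lambda>i j.
     [[p, \<one>\<^bsub>A\<^esub> \<ominus>\<^bsub>A\<^esub> p, \<zero>\<^bsub>A\<^esub>, \<zero>\<^bsub>A\<^esub>],
      [\<one>\<^bsub>A\<^esub> \<ominus>\<^bsub>A\<^esub> p, p, \<zero>\<^bsub>A\<^esub>, \<zero>\<^bsub>A\<^esub>],
      [\<zero>\<^bsub>A\<^esub>, \<zero>\<^bsub>A\<^esub>, q, \<one>\<^bsub>A\<^esub> \<ominus>\<^bsub>A\<^esub> q],
      [\<zero>\<^bsub>A\<^esub>, \<zero>\<^bsub>A\<^esub>, \<one>\<^bsub>A\<^esub> \<ominus>\<^bsub>A\<^esub> q, q]] ! (i - 1) ! (j - 1))"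

lemma two_projections_simps [simp]:
  "two_projections A p q 1 1 = p" "two_projections A p q 1 2 = \<one>\<^bsub>A\<^esub> \<ominus>\<^bsub>A\<^esub> p"
  "two_projections A p q 1 3 = \<zero>\<^bsub>A\<^esub>" "two_projections A p q 1 4 = \<zero>\<^bsub>A\<^esub>"
  "two_projections A p q 2 1 = \<one>\<^bsub>A\<^esub> \<ominus>\<^bsub>A\<^esub> p" "two_projections A p q 2 2 = p"
  "two_projections A p q 2 3 = \<zero>\<^bsub>A\<^esub>" "two_projections A p q 2 4 = \<zero>\<^bsub>A\<^esub>"
  "two_projections A p q 3 1 = \<zero>\<^bsub>A\<^esub>" "two_projections A p q 3 2 = \<zero>\<^bsub>A\<^esub>"
  "two_projections A p q 3 3 = q" "two_projections A p q 3 4 = \<one>\<^bsub>A\<^esub> \<ominus>\<^bsub>A\<^esub> q"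
  "two_projections A p q 4 1 = \<zero>\<^bsub>A\<^esub>" "two_projections A p q 4 2 = \<zero>\<^bsub>A\<^esub>"
  "two_projections A p q 4 3 = \<one>\<^bsub>A\<^esub> \<ominus>\<^bsub>A\<^esub> q" "two_projections A p q 4 4 = q"
  by (simp_all add: two_projections_def One_nat_def)

context star_algebra
begin

lemma add_minus_cancel:
  assumes "p \<in> carrier A" shows "\<one> \<ominus> p \<oplus> p = \<one>" "p \<oplus> (\<one> \<ominus> p) = \<one>"
proof -
  show "\<one> \<ominus> p \<oplus> p = \<one>" using assms by (simp add: minus_eq l_neg a_assoc)
  then show "p \<oplus> (\<one> \<ominus> p) = \<one>" using assms by (simp add: a_comm)
qed

lemma intertwines_4:
  assumes "\<forall>i\<in>{1..4}. \<forall>j\<in>{1..4}. u i j \<in> carrier A"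
  shows "intertwines A 4 E u \<longleftrightarrow> (\<forall>i\<in>{1..4}. \<forall>j\<in>{1..4}.
    adjacency E 1 j \<odot> u i 1 \<oplus> (adjacency E 2 j \<odot> u i 2 \<oplus> (adjacency E 3 j \<odot> u i 3 \<oplus> adjacency E 4 j \<odot> u i 4)) =
    adjacency E i 1 \<odot> u 1 j \<oplus> (adjacency E i 2 \<odot> u 2 j \<oplus> (adjacency E i 3 \<odot> u 3 j \<oplus> adjacency E i 4 \<odot> u 4 j)))"
  using assms unfolding intertwines_def by (simp add: finsum_1_4)

text \<open>Regroups the difference of two four-term coproducts into two pairs, one for each term of
  the coproduct in \<open>H_2^+\<close>.\<close>

lemma minus_four:
  assumes [simp]: "a \<in> carrier A" "b \<in> carrier A" "a' \<in> carrier A" "b' \<in> carrier A"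
    "c \<in> carrier A" "d \<in> carrier A" "c' \<in> carrier A" "d' \<in> carrier A"
  shows "a \<oplus> (b \<oplus> (a' \<oplus> b')) \<ominus> (c \<oplus> (d \<oplus> (c' \<oplus> d'))) =
    (a \<oplus> b \<ominus> (c \<oplus> d)) \<oplus> (a' \<oplus> b' \<ominus> (c' \<oplus> d'))"
  by (simp add: minus_eq minus_add a_ac)

context
  fixes p q
  assumes [simp]: "p \<in> carrier A" "q \<in> carrier A"
    and sa: "star A p = p" "star A q = q" and idem: "p \<otimes> p = p" "q \<otimes> q = q"
begin

lemma two_projections_closed: "\<forall>i\<in>{1..4}. \<forall>j\<in>{1..4}. two_projections A p q i j \<in> carrier A"
  unfolding ball_1_4 by simp

lemma magic_two_projections: "magic A 4 (two_projections A p q)"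
proof -
  have m: "p \<otimes> (\<one> \<ominus> p) = \<zero>" "(\<one> \<ominus> p) \<otimes> p = \<zero>" "(\<one> \<ominus> p) \<otimes> (\<one> \<ominus> p) = \<one> \<ominus> p"
    "q \<otimes> (\<one> \<ominus> q) = \<zero>" "(\<one> \<ominus> q) \<otimes> q = \<zero>" "(\<one> \<ominus> q) \<otimes> (\<one> \<ominus> q) = \<one> \<ominus> q"
    by (simp_all add: minus_distr_left minus_distr_right idem) (simp_all add: minus_eq)
  have s: "\<forall>i\<in>{1..4}. (\<Oplus>l\<in>{1..4}. two_projections A p q i l) = \<one> \<and> (\<Oplus>l\<in>{1..4}. two_projections A p q l i) = \<one>"
  proof (intro ballI)
    fix i :: nat assume i: "i \<in> {1..4}"
    have "(\<Oplus>l\<in>{1..4}. two_projections A p q i l) = two_projections A p q i 1 \<oplus>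
        (two_projections A p q i 2 \<oplus> (two_projections A p q i 3 \<oplus> two_projections A p q i 4))"
      "(\<Oplus>l\<in>{1..4}. two_projections A p q l i) = two_projections A p q 1 i \<oplus>
        (two_projections A p q 2 i \<oplus> (two_projections A p q 3 i \<oplus> two_projections A p q 4 i))"
      by (rule finsum_1_4; use two_projections_closed i in blast)+
    then show "(\<Oplus>l\<in>{1..4}. two_projections A p q i l) = \<one> \<and> (\<Oplus>l\<in>{1..4}. two_projections A p q l i) = \<one>"
      using i unfolding atLeastAtMost_1_4 by (auto simp: add_minus_cancel)
  qed
  have a: "\<forall>i\<in>{1..4}. \<forall>j\<in>{1..4}. star A (two_projections A p q i j) = two_projections A p q i j"
    unfolding ball_1_4 by (simp add: sa star_minus)
  have r: "\<forall>i\<in>{1..4}. \<forall>j\<in>{1..4}. \<forall>k\<in>{1..4}. two_projections A p q i j \<otimes> two_projections A p q i k =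
      (if j = k then two_projections A p q i j else \<zero>)"
    unfolding ball_1_4 by (simp add: m idem)
  have c: "\<forall>i\<in>{1..4}. \<forall>j\<in>{1..4}. \<forall>k\<in>{1..4}. two_projections A p q j i \<otimes> two_projections A p q k i =
      (if j = k then two_projections A p q j i else \<zero>)"
    unfolding ball_1_4 by (simp add: m idem)
  show ?thesis
    unfolding magic_def using s a r c two_projections_closed by blast
qed

lemma intertwines_two_projections: "intertwines A 4 (\<Gamma> 2) (two_projections A p q)"
  unfolding intertwines_4[OF two_projections_closed] unfolding ball_1_4
  by (simp add: adjacency_def \<Gamma>_def undirected_def)

end

end

theorem G_aut_plus_\<Gamma>2: "qgroup_eq (G_aut_plus 4 (\<Gamma> 2)) Z2_free_Z2_dual"
proof -
  let ?R = "rel_a 4 \<union> rel_b 4 \<union> rel_c 4 (\<Gamma> 2)"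
  interpret P: presentation "mat_idx 4" ?R by (rule presentation_magic[OF rels_carrier(2)]) auto
  interpret D: presentation UNIV rel_proj by (rule presentation_rel_proj)
  let ?p = "D.gen Proj_p" and ?q = "D.gen Proj_q"
  have dual: "Z2_free_Z2_dual = \<lparr>qalg = D.U, qdim = 4, qmat = two_projections D.U ?p ?q\<rparr>"
    by (simp add: Z2_free_Z2_dual_def two_projections_def Let_def)
  have pc [simp]: "D.gen x \<in> carrier D.U" for x by simp
  have pq: "star D.U (D.gen x) = D.gen x" "D.gen x \<otimes>\<^bsub>D.U\<^esub> D.gen x = D.gen x" for x
    using D.satisfies_gen satisfies_rel_proj[OF D.U.star_algebra_axioms pc] by auto
  have m: "magic P.U 4 (\<lambda>i j. P.gen (i, j))" and c: "intertwines P.U 4 (\<Gamma> 2) (\<lambda>i j. P.gen (i, j))"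
    using P.satisfies_gen unfolding satisfies_abc[OF P.U.star_algebra_axioms] by auto
  have "satisfies (mat_idx 4) ?R D.U (\<lambda>(i, j). two_projections D.U ?p ?q i j)"
    unfolding satisfies_abc[OF D.U.star_algebra_axioms]
    using D.U.magic_two_projections[OF pc pc pq(1) pq(1) pq(2) pq(2)]
      D.U.intertwines_two_projections[OF pc pc pq(1) pq(1) pq(2) pq(2)] by simp
  from P.universal_property[OF D.cstar_U this]
  obtain h where h: "h \<in> star_hom P.U D.U"
    "\<And>i j. i \<in> {1..4} \<Longrightarrow> j \<in> {1..4} \<Longrightarrow> h (P.gen (i, j)) = two_projections D.U ?p ?q i j"
    "\<And>x. x \<in> carrier P.U \<Longrightarrow> cnorm D.U (h x) \<le> cnorm P.U x" by auto
  interpret h: star_homomorphism P.U D.U h by unfold_locales (rule h)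
  \<comment> \<open>The diagonal entries \<open>u 1 1\<close> and \<open>u 3 3\<close> are the two
    projections that determine \<open>u\<close> by \<open>\<Gamma>2_relations\<close>.\<close>
  define w where "w x = (case x of Proj_p \<Rightarrow> P.gen (1, 1) | Proj_q \<Rightarrow> P.gen (3, 3))" for x
  have wc: "w x \<in> carrier P.U" for x by (cases x) (simp_all add: w_def)
  have "satisfies UNIV rel_proj P.U w"
    unfolding satisfies_rel_proj[OF P.U.star_algebra_axioms wc]
  proof
    fix x show "star P.U (w x) = w x \<and> w x \<otimes>\<^bsub>P.U\<^esub> w x = w x"
      using magic_star[OF m, of 1 1] magic_star[OF m, of 3 3] magic_row[OF m, of 1 1 1] magic_row[OF m, of 3 3 3]
      by (cases x) (simp_all add: w_def)
  qed
  from D.universal_property[OF P.cstar_U this]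
  obtain g where g: "g \<in> star_hom D.U P.U" "\<And>x. g (D.gen x) = w x"
    "\<And>x. x \<in> carrier D.U \<Longrightarrow> cnorm P.U (g x) \<le> cnorm D.U x" by auto
  interpret g: star_homomorphism D.U P.U g by unfold_locales (rule g)
  have gv: "g (two_projections D.U ?p ?q i j) = P.gen (i, j)" if "i \<in> {1..4}" "j \<in> {1..4}" for i j
  proof -
    have "\<forall>i\<in>{1..4}. \<forall>j\<in>{1..4}. g (two_projections D.U ?p ?q i j) = P.gen (i, j)"
      using P.U.\<Gamma>2_relations[OF m c] unfolding ball_1_4
      by (simp add: g.hom_minus g.hom_one g.hom_zero g(2) w_def)
    with that show ?thesis by blast
  qed
  have hg: "h (g x) = x" if "x \<in> carrier D.U" for x
  proof (rule D.hom_eqI[OF D.cstar_U, of "\<lambda>x. h (g x)" 1 "\<lambda>x. x" 1])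
    show "(\<lambda>x. h (g x)) \<in> star_hom D.U D.U" by (rule star_hom_comp[OF g(1) h(1)])
    show "(\<lambda>x. x) \<in> star_hom D.U D.U" by (rule star_homI) auto
    show "cnorm D.U (h (g y)) \<le> 1 * cnorm D.U y" if "y \<in> carrier D.U" for y
      using g(3)[OF that] h(3)[OF g.hom_closed[OF that]] by simp
    show "h (g (D.gen x)) = D.gen x" for x
      by (cases x) (simp_all add: g(2) w_def h(2))
  qed (use that in auto)
  have gh: "g (h x) = x" if "x \<in> carrier P.U" for x
  proof (rule P.hom_eqI[OF P.cstar_U, of "\<lambda>x. g (h x)" 1 "\<lambda>x. x" 1])
    show "(\<lambda>x. g (h x)) \<in> star_hom P.U P.U" by (rule star_hom_comp[OF h(1) g(1)])
    show "(\<lambda>x. x) \<in> star_hom P.U P.U" by (rule star_homI) auto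
    show "cnorm P.U (g (h y)) \<le> 1 * cnorm P.U y" if "y \<in> carrier P.U" for y
      using h(3)[OF that] g(3)[OF h.hom_closed[OF that]] by simp
    show "g (h (P.gen x)) = P.gen x" if "x \<in> mat_idx 4" for x
      using that by (cases x) (simp add: h(2) gv del: atLeastAtMost_iff)
  qed (use that in auto)
  show ?thesis
  proof (rule cmqg_transport[OF cmqg_G_aut_plus, of _ _ _ h g])
    show "cstar_algebra (qalg Z2_free_Z2_dual)" by (simp add: dual D.cstar_U)
  qed (use h g gv gh hg in \<open>simp_all add: dual G_aut_plus_def matrix_qgroup_def\<close>)
qed

section \<open>The hyperoctahedral quantum group\<close>

definition hyperoctahedral :: "('a, 'm) star_algebra_scheme \<Rightarrow> (nat \<Rightarrow> nat \<Rightarrow> 'a) \<Rightarrow> bool" where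
  "hyperoctahedral A v \<longleftrightarrow>
     (\<forall>i\<in>{1..2}. \<forall>j\<in>{1..2}. v i j \<in> carrier A \<and> star A (v i j) = v i j) \<and>
     (\<forall>i\<in>{1..2}. \<forall>j\<in>{1..2}. \<forall>k\<in>{1..2}. j \<noteq> k \<longrightarrow>
        v i j \<otimes>\<^bsub>A\<^esub> v i k = \<zero>\<^bsub>A\<^esub> \<and> v j i \<otimes>\<^bsub>A\<^esub> v k i = \<zero>\<^bsub>A\<^esub>) \<and>
     (\<forall>i\<in>{1..2}. (\<Oplus>\<^bsub>A\<^esub>k\<in>{1..2}. v i k \<otimes>\<^bsub>A\<^esub> v i k) = \<one>\<^bsub>A\<^esub> \<and> (\<Oplus>\<^bsub>A\<^esub>k\<in>{1..2}. v k i \<otimes>\<^bsub>A\<^esub> v k i) = \<one>\<^bsub>A\<^esub>)"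

lemma (in star_algebra) satisfies_rel_H2:
  assumes u: "\<And>x. x \<in> mat_idx 2 \<Longrightarrow> u x \<in> carrier A"
  shows "satisfies (mat_idx 2) rel_H2 A u \<longleftrightarrow> hyperoctahedral A (\<lambda>i j. u (i, j))"
proof -
  interpret ev: star_homomorphism "mat_free 2" A "free_ev A u"
    by (unfold_locales) (rule free_ev_hom, rule u)
  have uu: "i \<in> {1..2} \<Longrightarrow> j \<in> {1..2} \<Longrightarrow> u (i, j) \<in> carrier A" for i j by (rule u) simp
  have fg: "i \<in> {1..2} \<Longrightarrow> j \<in> {1..2} \<Longrightarrow> free_gen (i, j) \<in> carrier (mat_free 2)" for i j
    by (rule free_gen_closed) simp
  have ev_gen: "i \<in> {1..2} \<Longrightarrow> j \<in> {1..2} \<Longrightarrow> free_ev A u (free_gen (i, j)) = u (i, j)" for i j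
    by (rule free_ev_gen) (rule uu)
  have ev_sum: "free_ev A u (\<Oplus>\<^bsub>mat_free 2\<^esub>k\<in>{1..2}. f k) = (\<Oplus>k\<in>{1..2}. free_ev A u (f k))"
    if "f \<in> {1..2} \<rightarrow> carrier (mat_free 2)" for f :: "nat \<Rightarrow> mat_poly"
    by (rule ev.hom_finsum) (use that in auto)
  have c: "free_ev A u (free_gen (i, j) \<otimes>\<^bsub>mat_free 2\<^esub> free_gen (k, l)) = u (i, j) \<otimes> u (k, l)"
    "free_ev A u (star (mat_free 2) (free_gen (i, j))) = star A (u (i, j))"
    if "i \<in> {1..2}" "j \<in> {1..2}" "k \<in> {1..2}" "l \<in> {1..2}" for i j k l
    using that by (simp_all only: ev.hom_mult ev.hom_star fg ev_gen)
  have sum: "free_ev A u (\<Oplus>\<^bsub>mat_free 2\<^esub>k\<in>{1..2}. free_gen (i, k) \<otimes>\<^bsub>mat_free 2\<^esub> free_gen (i, k)) = (\<Oplus>k\<in>{1..2}. u (i, k) \<otimes> u (i, k))"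
    "free_ev A u (\<Oplus>\<^bsub>mat_free 2\<^esub>k\<in>{1..2}. free_gen (k, i) \<otimes>\<^bsub>mat_free 2\<^esub> free_gen (k, i)) = (\<Oplus>k\<in>{1..2}. u (k, i) \<otimes> u (k, i))"
    if "i \<in> {1..2}" for i
    by (subst ev_sum; (rule finsum_cong')?; use that fg uu c in \<open>auto simp del: atLeastAtMost_iff\<close>)+
  have s: "satisfies (mat_idx 2) rel_H2 A u \<longleftrightarrow>
      (\<forall>r\<in>rel_H2. free_ev A u (fst r) = free_ev A u (snd r))"
    using u by (simp only: satisfies_def split_def) blast
  have 1: "(\<forall>r\<in>{(f i j, g i j) |i j. i \<in> {1..2} \<and> j \<in> {1..2}}. free_ev A u (fst r) = free_ev A u (snd r)) \<longleftrightarrow>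
    (\<forall>i\<in>{1..2}. \<forall>j\<in>{1..2}. free_ev A u (f i j) = free_ev A u (g i j))" for f g :: "nat \<Rightarrow> nat \<Rightarrow> mat_poly" by fastforce
  have 2: "(\<forall>r\<in>{(f i j k, g) |i j k. i \<in> {1..2} \<and> j \<in> {1..2} \<and> k \<in> {1..2} \<and> j \<noteq> k}. free_ev A u (fst r) = free_ev A u (snd r)) \<longleftrightarrow>
    (\<forall>i\<in>{1..2}. \<forall>j\<in>{1..2}. \<forall>k\<in>{1..2}. j \<noteq> k \<longrightarrow> free_ev A u (f i j k) = free_ev A u g)" for f g by fastforce
  have 3: "(\<forall>r\<in>{(f i, g) |i. i \<in> {1..2}}. free_ev A u (fst r) = free_ev A u (snd r)) \<longleftrightarrow>
    (\<forall>i\<in>{1..2}. free_ev A u (f i) = free_ev A u g)" for f g by fastforce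
  have e: "u x = star A (u x) \<longleftrightarrow> star A (u x) = u x" for x by (rule eq_commute)
  have "satisfies (mat_idx 2) rel_H2 A u \<longleftrightarrow>
     (\<forall>i\<in>{1..2}. \<forall>j\<in>{1..2}. star A (u (i, j)) = u (i, j)) \<and>
     (\<forall>i\<in>{1..2}. \<forall>j\<in>{1..2}. \<forall>k\<in>{1..2}. j \<noteq> k \<longrightarrow> u (i, j) \<otimes> u (i, k) = \<zero>) \<and>
     (\<forall>i\<in>{1..2}. \<forall>j\<in>{1..2}. \<forall>k\<in>{1..2}. j \<noteq> k \<longrightarrow> u (j, i) \<otimes> u (k, i) = \<zero>) \<and>
     (\<forall>i\<in>{1..2}. (\<Oplus>k\<in>{1..2}. u (i, k) \<otimes> u (i, k)) = \<one>) \<and> (\<forall>i\<in>{1..2}. (\<Oplus>k\<in>{1..2}. u (k, i) \<otimes> u (k, i)) = \<one>)"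
    unfolding s
    unfolding rel_H2_def Let_def ball_Un 1 2 3
    by (simp add: c e ev_gen sum ev.hom_one ev.hom_zero conj_assoc del: atLeastAtMost_iff cong: ball_cong)
  then show ?thesis unfolding hyperoctahedral_def using uu by blast
qed

section \<open>Elements \<open>a x^2 + b x\<close> with \<open>x^3 = x\<close>, and the two matrices
  attached to the 2-edge graph\<close>

context star_algebra
begin

definition lc :: "'a \<Rightarrow> complex \<Rightarrow> complex \<Rightarrow> 'a" where
  "lc x a b = a \<odot> (x \<otimes> x) \<oplus> b \<odot> x"

lemma lc_closed [simp]: "x \<in> carrier A \<Longrightarrow> lc x a b \<in> carrier A"
  by (simp add: lc_def)

lemma lc_add: "x \<in> carrier A \<Longrightarrow> lc x a b \<oplus> lc x c d = lc x (a + c) (b + d)"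
  by (simp add: lc_def smult_add_left a_ac)

lemma lc_star: "x \<in> carrier A \<Longrightarrow> star A x = x \<Longrightarrow> star A (lc x a b) = lc x (cnj a) (cnj b)"
  by (simp add: lc_def star_add star_smult star_mult)

text \<open>When \<open>x^3 = x\<close>, the element \<open>x^2\<close> acts as a unit on
  \<open>x\<close> and on itself, so the coefficients multiply as in the group algebra of the group
  of order two.\<close>

lemma lc_mult:
  assumes [simp]: "x \<in> carrier A" and cube: "x \<otimes> (x \<otimes> x) = x"
  shows "lc x a b \<otimes> lc x c d = lc x (a * c + b * d) (a * d + b * c)"
proof -
  have "x \<otimes> (x \<otimes> (x \<otimes> x)) = x \<otimes> x" by (simp add: cube)
  then show ?thesis
    by (simp add: lc_def l_distr r_distr smult_mult_left smult_mult_right smult_add_left smult_add_right m_assoc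
        cube a_ac mult.commute)
qed

lemma lc_orthogonal:
  assumes [simp]: "x \<in> carrier A" "y \<in> carrier A" and z: "x \<otimes> y = \<zero>"
  shows "lc x a b \<otimes> lc y c d = \<zero>"
proof -
  have 1: "x \<otimes> (y \<otimes> w) = \<zero>" if "w \<in> carrier A" for w
    using that by (simp add: m_assoc[symmetric] z)
  show ?thesis
    by (simp add: lc_def l_distr r_distr smult_mult_left smult_mult_right m_assoc z 1)
qed

lemma lc_0_0: "x \<in> carrier A \<Longrightarrow> lc x 0 0 = \<zero>" and lc_1_0: "x \<in> carrier A \<Longrightarrow> lc x 1 0 = x \<otimes> x"
  and lc_0_1: "x \<in> carrier A \<Longrightarrow> lc x 0 1 = x"
  by (simp_all add: lc_def)

lemma lc_minus: "x \<in> carrier A \<Longrightarrow> lc x a b \<ominus> lc x c d = lc x (a - c) (b - d)"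
proof -
  assume x: "x \<in> carrier A"
  have "(- 1) \<odot> lc x c d = lc x (- c) (- d)" using x by (simp add: lc_def smult_add_right)
  then show ?thesis using x by (simp add: minus_eq_smult lc_add)
qed

text \<open>\<open>(x^2 + x) / 2\<close> and \<open>(x^2 - x) / 2\<close> are the spectral
  projections of \<open>x\<close> for the eigenvalues 1 and -1. Vertex \<open>i\<close> lies on edge
  \<open>(i + 1) div 2\<close>, and the parity of \<open>i + j\<close> tells whether the edge is
  mapped with or without a flip.\<close>

definition segments :: "(nat \<Rightarrow> nat \<Rightarrow> 'a) \<Rightarrow> nat \<Rightarrow> nat \<Rightarrow> 'a" where
  "segments v i j = lc (v ((i + 1) div 2) ((j + 1) div 2)) (1 / 2) (if even (i + j) then 1 / 2 else - 1 / 2)"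

lemma segments_simps:
  "segments v 1 1 = lc (v 1 1) (1/2) (1/2)" "segments v 1 2 = lc (v 1 1) (1/2) (-1/2)"
  "segments v 1 3 = lc (v 1 2) (1/2) (1/2)" "segments v 1 4 = lc (v 1 2) (1/2) (-1/2)"
  "segments v 2 1 = lc (v 1 1) (1/2) (-1/2)" "segments v 2 2 = lc (v 1 1) (1/2) (1/2)"
  "segments v 2 3 = lc (v 1 2) (1/2) (-1/2)" "segments v 2 4 = lc (v 1 2) (1/2) (1/2)"
  "segments v 3 1 = lc (v 2 1) (1/2) (1/2)" "segments v 3 2 = lc (v 2 1) (1/2) (-1/2)"
  "segments v 3 3 = lc (v 2 2) (1/2) (1/2)" "segments v 3 4 = lc (v 2 2) (1/2) (-1/2)"
  "segments v 4 1 = lc (v 2 1) (1/2) (-1/2)" "segments v 4 2 = lc (v 2 1) (1/2) (1/2)"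
  "segments v 4 3 = lc (v 2 2) (1/2) (-1/2)" "segments v 4 4 = lc (v 2 2) (1/2) (1/2)"
  by (simp_all add: segments_def)

text \<open>The matrix of \<open>u\<close> on the span of \<open>e_1 - e_2\<close> and
  \<open>e_3 - e_4\<close>, the vectors that are odd under exchanging the ends of each edge.\<close>

definition differences :: "(nat \<Rightarrow> nat \<Rightarrow> 'a) \<Rightarrow> nat \<Rightarrow> nat \<Rightarrow> 'a" where
  "differences u a b = u (2 * a - 1) (2 * b - 1) \<ominus> u (2 * a - 1) (2 * b)"

lemma differences_simps:
  "differences u 1 1 = u 1 1 \<ominus> u 1 2" "differences u 1 2 = u 1 3 \<ominus> u 1 4"
  "differences u 2 1 = u 3 1 \<ominus> u 3 2" "differences u 2 2 = u 3 3 \<ominus> u 3 4"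
  by (simp_all add: differences_def One_nat_def)

context
  fixes v :: "nat \<Rightarrow> nat \<Rightarrow> 'a"
  assumes H: "hyperoctahedral A v"
begin

lemma hyper_closed: "v 1 1 \<in> carrier A" "v 1 2 \<in> carrier A" "v 2 1 \<in> carrier A" "v 2 2 \<in> carrier A"
  using H unfolding hyperoctahedral_def ball_1_2 by auto

lemma hyper_star: "star A (v 1 1) = v 1 1" "star A (v 1 2) = v 1 2" "star A (v 2 1) = v 2 1" "star A (v 2 2) = v 2 2"
  using H unfolding hyperoctahedral_def ball_1_2 by auto

lemma hyper_mult:
  "v 1 1 \<otimes> v 1 2 = \<zero>" "v 1 2 \<otimes> v 1 1 = \<zero>" "v 2 1 \<otimes> v 2 2 = \<zero>" "v 2 2 \<otimes> v 2 1 = \<zero>"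
  "v 1 1 \<otimes> v 2 1 = \<zero>" "v 2 1 \<otimes> v 1 1 = \<zero>" "v 1 2 \<otimes> v 2 2 = \<zero>" "v 2 2 \<otimes> v 1 2 = \<zero>"
  using H unfolding hyperoctahedral_def ball_1_2 by auto

lemma hyper_sum:
  "v 1 1 \<otimes> v 1 1 \<oplus> v 1 2 \<otimes> v 1 2 = \<one>" "v 2 1 \<otimes> v 2 1 \<oplus> v 2 2 \<otimes> v 2 2 = \<one>"
  "v 1 1 \<otimes> v 1 1 \<oplus> v 2 1 \<otimes> v 2 1 = \<one>" "v 1 2 \<otimes> v 1 2 \<oplus> v 2 2 \<otimes> v 2 2 = \<one>"
proof -
  note [simp] = hyper_closed
  have s: "\<forall>i\<in>{1..2}. (\<Oplus>k\<in>{1..2}. v i k \<otimes> v i k) = \<one> \<and> (\<Oplus>k\<in>{1..2}. v k i \<otimes> v k i) = \<one>"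
    using H unfolding hyperoctahedral_def by blast
  have "(\<Oplus>k\<in>{1..2}. v i k \<otimes> v i k) = v i 1 \<otimes> v i 1 \<oplus> v i 2 \<otimes> v i 2"
    "(\<Oplus>k\<in>{1..2}. v k i \<otimes> v k i) = v 1 i \<otimes> v 1 i \<oplus> v 2 i \<otimes> v 2 i" if "i = 1 \<or> i = 2" for i
    by (rule finsum_1_2; use that in \<open>auto simp: atLeastAtMost_1_2 simp del: atLeastAtMost_iff\<close>)+
  with s show "v 1 1 \<otimes> v 1 1 \<oplus> v 1 2 \<otimes> v 1 2 = \<one>" "v 2 1 \<otimes> v 2 1 \<oplus> v 2 2 \<otimes> v 2 2 = \<one>"
    "v 1 1 \<otimes> v 1 1 \<oplus> v 2 1 \<otimes> v 2 1 = \<one>" "v 1 2 \<otimes> v 1 2 \<oplus> v 2 2 \<otimes> v 2 2 = \<one>"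
    unfolding ball_1_2 by simp_all
qed

text \<open>Multiply \<open>x^2 + y^2 = 1\<close> by \<open>x\<close> and use
  \<open>x y = 0\<close>.\<close>

lemma hyper_cube:
  "v 1 1 \<otimes> (v 1 1 \<otimes> v 1 1) = v 1 1" "v 1 2 \<otimes> (v 1 2 \<otimes> v 1 2) = v 1 2"
  "v 2 1 \<otimes> (v 2 1 \<otimes> v 2 1) = v 2 1" "v 2 2 \<otimes> (v 2 2 \<otimes> v 2 2) = v 2 2"
proof -
  have gen: "x \<otimes> (x \<otimes> x) = x" if "x \<in> carrier A" "y \<in> carrier A" "x \<otimes> y = \<zero>" "x \<otimes> x \<oplus> y \<otimes> y = \<one>" for x y
  proof -
    have "x = x \<otimes> (x \<otimes> x \<oplus> y \<otimes> y)" using that by simp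
    also have "\<dots> = x \<otimes> (x \<otimes> x) \<oplus> (x \<otimes> y) \<otimes> y"
      using that(1,2) by (simp add: r_distr m_assoc)
    also have "\<dots> = x \<otimes> (x \<otimes> x)" using that(1-3) by simp
    finally show ?thesis by simp
  qed
  show "v 1 1 \<otimes> (v 1 1 \<otimes> v 1 1) = v 1 1"
    by (rule gen[OF hyper_closed(1,2) hyper_mult(1) hyper_sum(1)])
  show "v 1 2 \<otimes> (v 1 2 \<otimes> v 1 2) = v 1 2"
    by (rule gen[OF hyper_closed(2,4) hyper_mult(7) hyper_sum(4)])
  show "v 2 1 \<otimes> (v 2 1 \<otimes> v 2 1) = v 2 1"
    by (rule gen[OF hyper_closed(3,4) hyper_mult(3) hyper_sum(2)])
  show "v 2 2 \<otimes> (v 2 2 \<otimes> v 2 2) = v 2 2"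
    by (rule gen[OF hyper_closed(4,3) hyper_mult(4)]) (use hyper_sum(2) hyper_closed in \<open>simp add: a_comm\<close>)
qed

lemma segments_closed: "\<forall>i\<in>{1..4}. \<forall>j\<in>{1..4}. segments v i j \<in> carrier A"
  unfolding ball_1_4 by (simp add: segments_simps hyper_closed)

lemma magic_segments: "magic A 4 (segments v)"
proof -
  note [simp] = hyper_closed
  \<comment> \<open>Within each pair \<open>(x^2 + x) / 2 + (x^2 - x) / 2 = x^2\<close>, after which
    a row or column sum of squares remains.\<close>
  have four: "a \<oplus> (b \<oplus> (c \<oplus> d)) = (a \<oplus> b) \<oplus> (c \<oplus> d)"
    if "a \<in> carrier A" "b \<in> carrier A" "c \<in> carrier A" "d \<in> carrier A" for a b c d
    using that by (simp add: a_assoc)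
  have s: "\<forall>i\<in>{1..4}. (\<Oplus>l\<in>{1..4}. segments v i l) = \<one> \<and> (\<Oplus>l\<in>{1..4}. segments v l i) = \<one>"
  proof (intro ballI)
    fix i :: nat assume i: "i \<in> {1..4}"
    have "(\<Oplus>l\<in>{1..4}. segments v i l) = (segments v i 1 \<oplus> segments v i 2) \<oplus> (segments v i 3 \<oplus> segments v i 4)"
      "(\<Oplus>l\<in>{1..4}. segments v l i) = (segments v 1 i \<oplus> segments v 2 i) \<oplus> (segments v 3 i \<oplus> segments v 4 i)"
      by (subst finsum_1_4, use segments_closed i in blast, rule four;
          use segments_closed i in \<open>simp\<close>)+
    then show "(\<Oplus>l\<in>{1..4}. segments v i l) = \<one> \<and> (\<Oplus>l\<in>{1..4}. segments v l i) = \<one>"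
      using i unfolding atLeastAtMost_1_4
      by (elim insertE emptyE) (simp_all add: segments_simps lc_add lc_1_0 hyper_sum)
  qed
  have a: "\<forall>i\<in>{1..4}. \<forall>j\<in>{1..4}. star A (segments v i j) = segments v i j"
    unfolding ball_1_4 by (simp add: segments_simps lc_star hyper_star)
  have r: "\<forall>i\<in>{1..4}. \<forall>j\<in>{1..4}. \<forall>k\<in>{1..4}. segments v i j \<otimes> segments v i k =
      (if j = k then segments v i j else \<zero>)"
    unfolding ball_1_4 by (simp add: segments_simps lc_mult hyper_cube lc_orthogonal hyper_mult lc_0_0)
  have c: "\<forall>i\<in>{1..4}. \<forall>j\<in>{1..4}. \<forall>k\<in>{1..4}. segments v j i \<otimes> segments v k i =
      (if j = k then segments v j i else \<zero>)"
    unfolding ball_1_4 by (simp add: segments_simps lc_mult hyper_cube lc_orthogonal hyper_mult lc_0_0)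
  show ?thesis
    unfolding magic_def using s a r c segments_closed by blast
qed

lemma intertwines_segments: "intertwines A 4 (\<Gamma> 4) (segments v)"
  unfolding intertwines_4[OF segments_closed] unfolding ball_1_4
  by (simp add: adjacency_def \<Gamma>_def undirected_def segments_simps hyper_closed)

lemma differences_segments: "\<forall>a\<in>{1..2}. \<forall>b\<in>{1..2}. differences (segments v) a b = v a b"
  unfolding ball_1_2
  by (simp add: differences_simps segments_simps lc_minus hyper_closed lc_0_1)

text \<open>The transpose is the inverse, by orthogonality and the sums of squares.\<close>

lemma hyperoctahedral_invertible: "matrix_invertible A 2 v" "matrix_invertible A 2 (\<lambda>i j. v j i)"
proof -
  note [simp] = hyper_closed
  have "\<forall>i\<in>{1..2}. \<forall>j\<in>{1..2}. (\<Oplus>k\<in>{1..2}. v i k \<otimes> v j k) = (if i = j then \<one> else \<zero>) \<and>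
      (\<Oplus>k\<in>{1..2}. v k i \<otimes> v k j) = (if i = j then \<one> else \<zero>)"
    unfolding ball_1_2 unfolding atLeastAtMost_1_2 by (simp add: hyper_sum hyper_mult)
  moreover have "\<forall>i\<in>{1..2}. \<forall>j\<in>{1..2}. v i j \<in> carrier A" unfolding ball_1_2 by simp
  ultimately have *: "\<And>i j. i \<in> {1..2} \<Longrightarrow> j \<in> {1..2} \<Longrightarrow> (\<Oplus>k\<in>{1..2}. v i k \<otimes> v j k) = (if i = j then \<one> else \<zero>)"
    "\<And>i j. i \<in> {1..2} \<Longrightarrow> j \<in> {1..2} \<Longrightarrow> (\<Oplus>k\<in>{1..2}. v k i \<otimes> v k j) = (if i = j then \<one> else \<zero>)"
    "\<And>i j. i \<in> {1..2} \<Longrightarrow> j \<in> {1..2} \<Longrightarrow> v i j \<in> carrier A" by blast+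
  show "matrix_invertible A 2 v"
    unfolding matrix_invertible_def by (rule exI[of _ "\<lambda>i j. v j i"]) (use * in simp)
  show "matrix_invertible A 2 (\<lambda>i j. v j i)"
    unfolding matrix_invertible_def by (rule exI[of _ v]) (use * in simp)
qed

end

context
  fixes u :: "nat \<Rightarrow> nat \<Rightarrow> 'a"
  assumes m: "magic A 4 u" and c: "intertwines A 4 (\<Gamma> 4) u"
begin

lemma differences_square:
  assumes "p \<in> carrier A" "q \<in> carrier A" "p \<otimes> p = p" "q \<otimes> q = q" "p \<otimes> q = \<zero>" "q \<otimes> p = \<zero>"
  shows "(p \<ominus> q) \<otimes> (p \<ominus> q) = p \<oplus> q"
  using assms by (simp add: minus_distr_left minus_distr_right) (simp add: minus_eq)

lemma hyperoctahedral_differences: "hyperoctahedral A (differences u)"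
proof -
  note [simp] = u4_closed[OF m]
  note rel = \<Gamma>4_relations[OF m c]
  have st: "star A (u i j) = u i j" if "i \<in> {1..4}" "j \<in> {1..4}" for i j
    using magicD(2)[OF m that] .
  have row: "u i j \<otimes> u i k = (if j = k then u i j else \<zero>)" if "i \<in> {1..4}" "j \<in> {1..4}" "k \<in> {1..4}" for i j k
    using magic_row[OF m that] .
  have adj: "(1, 2) \<in> \<Gamma> 4" "(3, 4) \<in> \<Gamma> 4" "(2, 1) \<in> \<Gamma> 4" "(4, 3) \<in> \<Gamma> 4" "(1, 3) \<notin> \<Gamma> 4" "(3, 1) \<notin> \<Gamma> 4"
    "(1, 1) \<notin> \<Gamma> 4" "(2, 2) \<notin> \<Gamma> 4" "(3, 3) \<notin> \<Gamma> 4" "(4, 4) \<notin> \<Gamma> 4"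
    by (simp_all add: \<Gamma>_def undirected_def)
  \<comment> \<open>Here \<open>j\<close> and \<open>k\<close> lie on the same edge. If they are
    equal, the column relation applies; otherwise \<open>(j, k)\<close> is an edge while
    \<open>(1, 3)\<close> is not, and \<open>non_edge_product\<close> applies.\<close>
  have col: "u 1 j \<otimes> u 3 k = \<zero>" "u 3 j \<otimes> u 1 k = \<zero>"
    if "(j, k) \<in> {(1, 1), (1, 2), (2, 1), (2, 2), (3, 3), (3, 4), (4, 3), (4, 4)}" for j k
  proof -
    have jk: "j \<in> {1..4}" "k \<in> {1..4}" using that by auto
    have "u 1 j \<otimes> u 3 k = \<zero> \<and> u 3 j \<otimes> u 1 k = \<zero>"
    proof (cases "j = k")
      case True
      then show ?thesis using magic_col[OF m, of k 1 3] magic_col[OF m, of k 3 1] jk by simp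
    next
      case False
      then have "(j, k) \<in> \<Gamma> 4" using that adj by auto
      then show ?thesis
        using non_edge_product[OF m c, of 1 3 j k] non_edge_product[OF m c, of 3 1 j k] jk adj by simp
    qed
    then show "u 1 j \<otimes> u 3 k = \<zero>" "u 3 j \<otimes> u 1 k = \<zero>" by auto
  qed
  have d: "\<forall>i\<in>{1..2}. \<forall>j\<in>{1..2}. differences u i j \<in> carrier A \<and> star A (differences u i j) = differences u i j"
    unfolding ball_1_2 by (simp add: differences_simps star_minus st)
  have z: "\<forall>i\<in>{1..2}. \<forall>j\<in>{1..2}. \<forall>k\<in>{1..2}. j \<noteq> k \<longrightarrow>
        differences u i j \<otimes> differences u i k = \<zero> \<and> differences u j i \<otimes> differences u k i = \<zero>"
    unfolding ball_1_2
    by (simp add: differences_simps minus_distr_left minus_distr_right row col)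
  have sq: "differences u 1 1 \<otimes> differences u 1 1 = u 1 1 \<oplus> u 1 2"
    "differences u 1 2 \<otimes> differences u 1 2 = u 1 3 \<oplus> u 1 4"
    "differences u 2 1 \<otimes> differences u 2 1 = u 3 1 \<oplus> u 3 2"
    "differences u 2 2 \<otimes> differences u 2 2 = u 3 3 \<oplus> u 3 4"
    unfolding differences_simps by (rule differences_square; simp add: row)+
  have s1: "u 1 1 \<oplus> u 1 2 \<oplus> (u 1 3 \<oplus> u 1 4) = \<one>" "u 3 1 \<oplus> u 3 2 \<oplus> (u 3 3 \<oplus> u 3 4) = \<one>"
    using u4_row[OF m, of 1] u4_row[OF m, of 3] by (simp_all add: a_assoc)
  have s2: "u 1 1 \<oplus> u 1 2 \<oplus> (u 3 1 \<oplus> u 3 2) = \<one>" "u 1 3 \<oplus> u 1 4 \<oplus> (u 3 3 \<oplus> u 3 4) = \<one>"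
    using u4_col[OF m, of 1] u4_col[OF m, of 3] by (simp_all add: a_assoc rel)
  have s: "\<forall>i\<in>{1..2}. (\<Oplus>k\<in>{1..2}. differences u i k \<otimes> differences u i k) = \<one> \<and>
      (\<Oplus>k\<in>{1..2}. differences u k i \<otimes> differences u k i) = \<one>"
  proof (intro ballI)
    fix i :: nat assume i: "i \<in> {1..2}"
    have "(\<Oplus>k\<in>{1..2}. differences u i k \<otimes> differences u i k) =
        differences u i 1 \<otimes> differences u i 1 \<oplus> differences u i 2 \<otimes> differences u i 2"
      "(\<Oplus>k\<in>{1..2}. differences u k i \<otimes> differences u k i) =
        differences u 1 i \<otimes> differences u 1 i \<oplus> differences u 2 i \<otimes> differences u 2 i"
      by (rule finsum_1_2; use d i in blast)+
    then show "(\<Oplus>k\<in>{1..2}. differences u i k \<otimes> differences u i k) = \<one> \<and>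
      (\<Oplus>k\<in>{1..2}. differences u k i \<otimes> differences u k i) = \<one>"
      using i unfolding atLeastAtMost_1_2 by (elim insertE emptyE) (simp_all add: sq s1 s2)
  qed
  show ?thesis unfolding hyperoctahedral_def using d z s by blast
qed

lemma segments_differences: "\<forall>i\<in>{1..4}. \<forall>j\<in>{1..4}. segments (differences u) i j = u i j"
proof -
  note [simp] = u4_closed[OF m]
  have row: "u i j \<otimes> u i k = (if j = k then u i j else \<zero>)" if "i \<in> {1..4}" "j \<in> {1..4}" "k \<in> {1..4}" for i j k
    using magic_row[OF m that] .
  \<comment> \<open>For orthogonal projections \<open>x = p - q\<close> has square
    \<open>p + q\<close>, so \<open>p\<close> and \<open>q\<close> are the spectral projections used
    by \<open>segments\<close>.\<close>
  have lc: "lc (p \<ominus> q) (1/2) (1/2) = p" "lc (p \<ominus> q) (1/2) (- 1/2) = q"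
    if [simp]: "p \<in> carrier A" "q \<in> carrier A" and o: "p \<otimes> p = p" "q \<otimes> q = q" "p \<otimes> q = \<zero>" "q \<otimes> p = \<zero>" for p q
  proof -
    have half: "(1/2) \<odot> x \<oplus> (1/2) \<odot> x = x" if "x \<in> carrier A" for x
      using that by (simp add: smult_add_left[symmetric])
    have null: "(1/2) \<odot> x \<oplus> (- (1/2)) \<odot> x = \<zero>" "(- (1/2)) \<odot> x \<oplus> (1/2) \<odot> x = \<zero>" if "x \<in> carrier A" for x
      using that by (simp_all add: smult_add_left[symmetric])
    have "lc (p \<ominus> q) (1/2) (1/2) = ((1/2) \<odot> p \<oplus> (1/2) \<odot> p) \<oplus> ((1/2) \<odot> q \<oplus> (- (1/2)) \<odot> q)"
      unfolding lc_def differences_square[OF that] by (simp add: minus_eq_smult smult_add_right a_ac)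
    then show "lc (p \<ominus> q) (1/2) (1/2) = p" by (simp add: half null)
    have "lc (p \<ominus> q) (1/2) (- 1/2) = ((1/2) \<odot> p \<oplus> (- (1/2)) \<odot> p) \<oplus> ((1/2) \<odot> q \<oplus> (1/2) \<odot> q)"
      unfolding lc_def differences_square[OF that] by (simp add: minus_eq_smult smult_add_right a_ac)
    then show "lc (p \<ominus> q) (1/2) (- 1/2) = q" by (simp add: half null)
  qed
  show ?thesis
    unfolding ball_1_4 segments_simps differences_simps
    using \<Gamma>4_relations[OF m c] by (simp add: lc[simplified] row)
qed

end

end

lemma (in cstar_pair) tensor_minus_minus:
  assumes [simp]: "a \<in> carrier A" "a' \<in> carrier A" "b \<in> carrier B" "b' \<in> carrier B"
  shows "tensor A B (a \<ominus>\<^bsub>A\<^esub> a') (b \<ominus>\<^bsub>B\<^esub> b') =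
    (tensor A B a b \<oplus>\<^bsub>min_tensor A B\<^esub> tensor A B a' b') \<ominus>\<^bsub>min_tensor A B\<^esub>
    (tensor A B a b' \<oplus>\<^bsub>min_tensor A B\<^esub> tensor A B a' b)"
  by (simp add: A.minus_eq_smult B.minus_eq_smult M.minus_eq_smult tensor_add_left tensor_add_right
      tensor_smult_left tensor_smult_right M.smult_add_right M.a_ac)

lemma satisfies_rel_H2_iff:
  assumes "star_algebra B"
  shows "satisfies (mat_idx 2) rel_H2 B u \<longleftrightarrow> hyperoctahedral B (\<lambda>i j. u (i, j))"
proof -
  interpret B: star_algebra B by fact
  have "u x \<in> carrier B" if "hyperoctahedral B (\<lambda>i j. u (i, j))" "x \<in> mat_idx 2" for x
    using that unfolding hyperoctahedral_def by (cases x) blast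
  then show ?thesis
    using B.satisfies_rel_H2[of u] satisfiesD[of "mat_idx 2" rel_H2 B u] by blast
qed

lemma rel_H2_carrier: "rel_H2 \<subseteq> carrier (mat_free 2) \<times> carrier (mat_free 2)"
proof -
  note [simp] = free_gen_closed[of "(_, _)" "mat_idx 2"]
  show ?thesis unfolding rel_H2_def Let_def by (auto intro!: free.T.finsum_closed)
qed

lemma presentation_rel_H2: "presentation (mat_idx 2) rel_H2"
proof (rule presentationI[OF rel_H2_carrier])
  fix B :: "(nat \<Rightarrow> mat_poly) set cstar_algebra" and u x
  assume B: "cstar_algebra B" and sat: "satisfies (mat_idx 2) rel_H2 B u" and x: "x \<in> mat_idx 2"
  interpret B: cstar_algebra B by fact
  have H: "hyperoctahedral B (\<lambda>i j. u (i, j))" using sat satisfies_rel_H2_iff[OF B.star_algebra_axioms] by blast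
  \<comment> \<open>From \<open>y^3 = y\<close> the square of \<open>y\<close> is a projection, and
    its norm is the square of that of \<open>y\<close>.\<close>
  have le: "cnorm B y \<le> 1" if y: "y \<in> carrier B" "star B y = y" "y \<otimes>\<^bsub>B\<^esub> (y \<otimes>\<^bsub>B\<^esub> y) = y" for y
  proof -
    have "cnorm B (y \<otimes>\<^bsub>B\<^esub> y) \<le> 1"
      by (rule B.projection_norm) (use y in \<open>simp_all add: B.star_mult B.m_assoc\<close>)
    then have "(cnorm B y)\<^sup>2 \<le> 1" using B.p_cstar[OF y(1)] y(2) by simp
    then show ?thesis using power2_le_imp_le[of "cnorm B y" 1] by simp
  qed
  have "\<forall>i\<in>{1..2}. \<forall>j\<in>{1..2}. cnorm B (u (i, j)) \<le> 1"
    unfolding ball_1_2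
    using B.hyper_closed[OF H] B.hyper_star[OF H] B.hyper_cube[OF H] by (intro conjI le)
  then show "cnorm B (u x) \<le> 1" using x by (cases x) blast
qed

theorem G_aut_plus_\<Gamma>4: "qgroup_iso (G_aut_plus 4 (\<Gamma> 4)) H2_plus"
proof -
  let ?R = "rel_a 4 \<union> rel_b 4 \<union> rel_c 4 (\<Gamma> 4)"
  interpret P: presentation "mat_idx 4" ?R by (rule presentation_magic[OF rels_carrier(2)]) auto
  interpret H: presentation "mat_idx 2" rel_H2 by (rule presentation_rel_H2)
  let ?u = "\<lambda>i j. P.gen (i, j)" and ?v = "\<lambda>i j. H.gen (i, j)"
  have m: "magic P.U 4 ?u" and c: "intertwines P.U 4 (\<Gamma> 4) ?u"
    using P.satisfies_gen unfolding satisfies_abc[OF P.U.star_algebra_axioms] by auto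
  have v: "hyperoctahedral H.U ?v"
    using H.satisfies_gen satisfies_rel_H2_iff[OF H.U.star_algebra_axioms] by blast
  have "satisfies (mat_idx 4) ?R H.U (\<lambda>(i, j). H.U.segments ?v i j)"
    unfolding satisfies_abc[OF H.U.star_algebra_axioms]
    using H.U.magic_segments[OF v] H.U.intertwines_segments[OF v] by simp
  from P.universal_property[OF H.cstar_U this]
  obtain h where h: "h \<in> star_hom P.U H.U"
    "\<And>i j. i \<in> {1..4} \<Longrightarrow> j \<in> {1..4} \<Longrightarrow> h (P.gen (i, j)) = H.U.segments ?v i j"
    "\<And>x. x \<in> carrier P.U \<Longrightarrow> cnorm H.U (h x) \<le> cnorm P.U x" by auto
  interpret h: star_homomorphism P.U H.U h by unfold_locales (rule h)
  have "satisfies (mat_idx 2) rel_H2 P.U (\<lambda>(i, j). P.U.differences ?u i j)"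
    unfolding satisfies_rel_H2_iff[OF P.U.star_algebra_axioms]
    using P.U.hyperoctahedral_differences[OF m c] by simp
  from H.universal_property[OF P.cstar_U this]
  obtain g where g: "g \<in> star_hom H.U P.U"
    "\<And>i j. i \<in> {1..2} \<Longrightarrow> j \<in> {1..2} \<Longrightarrow> g (H.gen (i, j)) = P.U.differences ?u i j"
    "\<And>x. x \<in> carrier H.U \<Longrightarrow> cnorm P.U (g x) \<le> cnorm H.U x" by auto
  interpret g: star_homomorphism H.U P.U g by unfold_locales (rule g)
  have idx4: "1 \<in> {1..4::nat}" "2 \<in> {1..4::nat}" "3 \<in> {1..4::nat}" "4 \<in> {1..4::nat}"
    and idx2: "1 \<in> {1..2::nat}" "2 \<in> {1..2::nat}" by simp_all
  have hg: "h (g x) = x" if "x \<in> carrier H.U" for x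
  proof (rule H.hom_eqI[OF H.cstar_U, of "\<lambda>x. h (g x)" 1 "\<lambda>x. x" 1])
    show "(\<lambda>x. h (g x)) \<in> star_hom H.U H.U" by (rule star_hom_comp[OF g(1) h(1)])
    show "(\<lambda>x. x) \<in> star_hom H.U H.U" by (rule star_homI) auto
    show "cnorm H.U (h (g y)) \<le> 1 * cnorm H.U y" if "y \<in> carrier H.U" for y
      using g(3)[OF that] h(3)[OF g.hom_closed[OF that]] by simp
    show "h (g (H.gen x)) = H.gen x" if x: "x \<in> mat_idx 2" for x
    proof -
      have "\<forall>i\<in>{1..2}. \<forall>j\<in>{1..2}. h (P.U.differences ?u i j) = H.U.differences (H.U.segments ?v) i j"
        unfolding ball_1_2 P.U.differences_simps H.U.differences_simps
        using P.U.u4_closed[OF m] by (simp add: h.hom_minus h(2))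
      then show ?thesis using x g(2) H.U.differences_segments[OF v] by (cases x) auto
    qed
  qed (use that in auto)
  have gh: "g (h x) = x" if "x \<in> carrier P.U" for x
  proof (rule P.hom_eqI[OF P.cstar_U, of "\<lambda>x. g (h x)" 1 "\<lambda>x. x" 1])
    show "(\<lambda>x. g (h x)) \<in> star_hom P.U P.U" by (rule star_hom_comp[OF h(1) g(1)])
    show "(\<lambda>x. x) \<in> star_hom P.U P.U" by (rule star_homI) auto
    show "cnorm P.U (g (h y)) \<le> 1 * cnorm P.U y" if "y \<in> carrier P.U" for y
      using h(3)[OF that] g(3)[OF h.hom_closed[OF that]] by simp
    show "g (h (P.gen x)) = P.gen x" if x: "x \<in> mat_idx 4" for x
    proof -
      \<comment> \<open>The entries of \<open>segments\<close> are polynomials in the generators, so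
        applying \<open>g\<close> to them means evaluating the same polynomials at
        \<open>differences\<close>.\<close>
      have lc: "g (H.U.lc y a b) = P.U.lc (g y) a b" if "y \<in> carrier H.U" for y a b
        using that by (simp add: H.U.lc_def P.U.lc_def g.hom_add g.hom_smult g.hom_mult)
      have "\<forall>i\<in>{1..4}. \<forall>j\<in>{1..4}. g (H.U.segments ?v i j) = P.U.segments (P.U.differences ?u) i j"
        unfolding ball_1_4 H.U.segments_simps P.U.segments_simps
        using H.U.hyper_closed[OF v] g(2)[OF idx2(1) idx2(1)] g(2)[OF idx2] g(2)[OF idx2(2,1)] g(2)[OF idx2(2) idx2(2)]
        by (simp add: lc)
      then show ?thesis using x h(2) P.U.segments_differences[OF m c] by (cases x) auto
    qed
  qed (use that in auto)
  have cop: "\<Delta> (g (H.gen (i, j))) =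
        (\<Oplus>\<^bsub>min_tensor P.U P.U\<^esub>k\<in>{1..2}. tensor P.U P.U (g (H.gen (i, k))) (g (H.gen (k, j))))"
    if \<Delta>: "comultiplication (G_aut_plus 4 (\<Gamma> 4)) \<Delta>" and ij: "i \<in> {1..2}" "j \<in> {1..2}" for \<Delta> i j
  proof -
    interpret T: cstar_pair P.U P.U by unfold_locales
    have "\<Delta> \<in> star_hom P.U (min_tensor P.U P.U)"
      using \<Delta> by (simp add: comultiplication_def G_aut_plus_def matrix_qgroup_def)
    then interpret \<Delta>: star_homomorphism P.U "min_tensor P.U P.U" \<Delta> by unfold_locales
    note [simp] = P.U.u4_closed[OF m]
    have \<Delta>u: "\<Delta> (P.gen (r, s)) = tensor P.U P.U (P.gen (r, 1)) (P.gen (1, s)) \<oplus>\<^bsub>min_tensor P.U P.U\<^esub>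
       (tensor P.U P.U (P.gen (r, 2)) (P.gen (2, s)) \<oplus>\<^bsub>min_tensor P.U P.U\<^esub>
       (tensor P.U P.U (P.gen (r, 3)) (P.gen (3, s)) \<oplus>\<^bsub>min_tensor P.U P.U\<^esub>
        tensor P.U P.U (P.gen (r, 4)) (P.gen (4, s))))" if "r \<in> {1..4}" "s \<in> {1..4}" for r s
    proof -
      have "\<Delta> (P.gen (r, s)) = (\<Oplus>\<^bsub>min_tensor P.U P.U\<^esub>k\<in>{1..4}. tensor P.U P.U (P.gen (r, k)) (P.gen (k, s)))"
        using \<Delta> that by (simp add: comultiplication_def G_aut_plus_def matrix_qgroup_def)
      also have "\<dots> = tensor P.U P.U (P.gen (r, 1)) (P.gen (1, s)) \<oplus>\<^bsub>min_tensor P.U P.U\<^esub>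
       (tensor P.U P.U (P.gen (r, 2)) (P.gen (2, s)) \<oplus>\<^bsub>min_tensor P.U P.U\<^esub>
       (tensor P.U P.U (P.gen (r, 3)) (P.gen (3, s)) \<oplus>\<^bsub>min_tensor P.U P.U\<^esub>
        tensor P.U P.U (P.gen (r, 4)) (P.gen (4, s))))"
        by (rule T.M.finsum_1_4) (use magicD(1)[OF m] that in auto)
      finally show ?thesis .
    qed
    \<comment> \<open>In the coproduct of a difference the terms with middle index 2 and 4 are
      rewritten by exchanging both indices with their neighbours; each pair of middle indices then
      factors as a tensor product of two differences.\<close>
    have eq: "\<forall>i\<in>{1..2}. \<forall>j\<in>{1..2}. \<Delta> (P.U.differences ?u i j) =
        tensor P.U P.U (P.U.differences ?u i 1) (P.U.differences ?u 1 j) \<oplus>\<^bsub>min_tensor P.U P.U\<^esub>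
        tensor P.U P.U (P.U.differences ?u i 2) (P.U.differences ?u 2 j)"
      unfolding ball_1_2 P.U.differences_simps
      by (simp add: \<Delta>.hom_minus \<Delta>u T.tensor_minus_minus P.U.\<Gamma>4_relations[OF m c] T.M.minus_four)
    have "(\<Oplus>\<^bsub>min_tensor P.U P.U\<^esub>k\<in>{1..2}. tensor P.U P.U (g (H.gen (i, k))) (g (H.gen (k, j)))) =
        tensor P.U P.U (g (H.gen (i, 1))) (g (H.gen (1, j))) \<oplus>\<^bsub>min_tensor P.U P.U\<^esub>
        tensor P.U P.U (g (H.gen (i, 2))) (g (H.gen (2, j)))"
      by (rule T.M.finsum_1_2) (use ij in auto)
    then show ?thesis using eq ij by (simp add: g(2))
  qed
  show ?thesis
  proof (rule qgroup_isoI[OF cmqg_G_aut_plus, where h = h and g = g])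
    show "cstar_algebra (qalg H2_plus)" by (simp add: H2_plus_def matrix_qgroup_def H.cstar_U)
    have "H.gen ` mat_idx 2 = {H.gen (i, j) | i j. i \<in> {1..2} \<and> j \<in> {1..2}}" by (auto; blast)
    then show "cstar_generated (qalg H2_plus) {qmat H2_plus i j | i j. i \<in> {1..qdim H2_plus} \<and> j \<in> {1..qdim H2_plus}}"
      using H.generated by (simp add: H2_plus_def matrix_qgroup_def)
    show "matrix_invertible (qalg H2_plus) (qdim H2_plus) (qmat H2_plus)"
      "matrix_invertible (qalg H2_plus) (qdim H2_plus) (\<lambda>i j. qmat H2_plus j i)"
      using H.U.hyperoctahedral_invertible[OF v] by (simp_all add: H2_plus_def matrix_qgroup_def)
    show "\<Delta> (g (qmat H2_plus i j)) =
        (\<Oplus>\<^bsub>min_tensor (qalg (G_aut_plus 4 (\<Gamma> 4))) (qalg (G_aut_plus 4 (\<Gamma> 4)))\<^esub>k\<in>{1..qdim H2_plus}.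
           tensor (qalg (G_aut_plus 4 (\<Gamma> 4))) (qalg (G_aut_plus 4 (\<Gamma> 4))) (g (qmat H2_plus i k)) (g (qmat H2_plus k j)))"
      if "comultiplication (G_aut_plus 4 (\<Gamma> 4)) \<Delta>" "i \<in> {1..qdim H2_plus}" "j \<in> {1..qdim H2_plus}" for \<Delta> i j
      using cop[of \<Delta> i j] that by (simp add: H2_plus_def matrix_qgroup_def G_aut_plus_def)
  qed (use h g gh hg in \<open>simp_all add: H2_plus_def G_aut_plus_def matrix_qgroup_def\<close>)
qed

section \<open>Permutations and graphs on four points\<close>

text \<open>Coding permutations by their four values turns composition and comparison into
  computation on tuples; outside {1, 2, 3, 4} the function must be the identity to satisfy
  \<open>permutes\<close>.\<close>

definition perm_of :: "nat \<times> nat \<times> nat \<times> nat \<Rightarrow> nat \<Rightarrow> nat" where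
  "perm_of = (\<lambda>(a, b, c, d) i. if i = 1 then a else if i = 2 then b else if i = 3 then c
     else if i = 4 then d else i)"

lemma perm_of_simps [simp]:
  "perm_of (a, b, c, d) 1 = a" "perm_of (a, b, c, d) 2 = b"
  "perm_of (a, b, c, d) 3 = c" "perm_of (a, b, c, d) 4 = d"
  by (simp_all add: perm_of_def)

lemma perm_of_outside: "i \<notin> {1..4} \<Longrightarrow> perm_of ps i = i"
  by (cases ps) (auto simp: perm_of_def)

lemma perm_of_inject: "perm_of ps = perm_of qs \<longleftrightarrow> ps = qs"
  by (cases ps; cases qs) (metis perm_of_simps)

lemma perm_of_comp:
  "perm_of p \<circ> perm_of (a, b, c, d) = perm_of (perm_of p a, perm_of p b, perm_of p c, perm_of p d)"
proof
  fix i :: nat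
  consider "i = 1" | "i = 2" | "i = 3" | "i = 4" | "i \<notin> {1..4}" by force
  then show "(perm_of p \<circ> perm_of (a, b, c, d)) i = perm_of (perm_of p a, perm_of p b, perm_of p c, perm_of p d) i"
    by cases (simp_all add: perm_of_outside del: atLeastAtMost_iff)
qed

definition perms4 :: "(nat \<times> nat \<times> nat \<times> nat) list" where
  "perms4 = (let l = [1, 2, 3, 4] in filter (\<lambda>(a, b, c, d). distinct [a, b, c, d])
     (List.product l (List.product l (List.product l l))))"

text \<open>As a code equation this lets later evaluations start from the 24 explicit
  tuples.\<close>

lemma perms4_eq [code]:
  "perms4 = [(1, 2, 3, 4), (1, 2, 4, 3), (1, 3, 2, 4), (1, 3, 4, 2), (1, 4, 2, 3), (1, 4, 3, 2),
    (2, 1, 3, 4), (2, 1, 4, 3), (2, 3, 1, 4), (2, 3, 4, 1), (2, 4, 1, 3), (2, 4, 3, 1),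
    (3, 1, 2, 4), (3, 1, 4, 2), (3, 2, 1, 4), (3, 2, 4, 1), (3, 4, 1, 2), (3, 4, 2, 1),
    (4, 1, 2, 3), (4, 1, 3, 2), (4, 2, 1, 3), (4, 2, 3, 1), (4, 3, 1, 2), (4, 3, 2, 1)]"
  by code_simp

lemma perms4_iff: "(a, b, c, d) \<in> set perms4 \<longleftrightarrow> distinct [a, b, c, d] \<and>
    a \<in> {1, 2, 3, 4} \<and> b \<in> {1, 2, 3, 4} \<and> c \<in> {1, 2, 3, 4} \<and> d \<in> {1, 2, 3, 4}"
proof -
  have "(a, b, c, d) \<in> set (filter (\<lambda>(a, b, c, d). distinct [a, b, c, d])
      (List.product l (List.product l (List.product l l)))) \<longleftrightarrow> distinct [a, b, c, d] \<and>
      a \<in> set l \<and> b \<in> set l \<and> c \<in> set l \<and> d \<in> set l" for l :: "nat list"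
    by (simp del: distinct.simps) blast
  from this[of "[1, 2, 3, 4]"] show ?thesis
    unfolding perms4_def Let_def by (simp only: list.set)
qed

lemma permutes_4_iff:
  fixes \<sigma> :: "nat \<Rightarrow> nat"
  shows "\<sigma> permutes {1..4} \<longleftrightarrow> (\<exists>ps\<in>set perms4. \<sigma> = perm_of ps)"
proof
  assume p: "\<sigma> permutes {1..4}"
  have inj: "\<sigma> i = \<sigma> j \<longleftrightarrow> i = j" for i j using permutes_inj[OF p] by (auto dest: injD)
  have "\<sigma> i \<in> {1, 2, 3, 4}" if "i \<in> {1, 2, 3, 4}" for i
    using permutes_in_image[OF p, of i] that by (simp only: atLeastAtMost_1_4)
  then have "\<sigma> 1 \<in> {1, 2, 3, 4}" "\<sigma> 2 \<in> {1, 2, 3, 4}" "\<sigma> 3 \<in> {1, 2, 3, 4}" "\<sigma> 4 \<in> {1, 2, 3, 4}"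
    by blast+
  moreover have "distinct [\<sigma> 1, \<sigma> 2, \<sigma> 3, \<sigma> 4]" by (simp add: inj)
  ultimately have "(\<sigma> 1, \<sigma> 2, \<sigma> 3, \<sigma> 4) \<in> set perms4" unfolding perms4_iff by blast
  moreover have "\<sigma> = perm_of (\<sigma> 1, \<sigma> 2, \<sigma> 3, \<sigma> 4)"
  proof
    fix i
    show "\<sigma> i = perm_of (\<sigma> 1, \<sigma> 2, \<sigma> 3, \<sigma> 4) i"
      using permutes_not_in[OF p, of i] unfolding atLeastAtMost_1_4 by (auto simp: perm_of_def)
  qed
  ultimately show "\<exists>ps\<in>set perms4. \<sigma> = perm_of ps" by blast
next
  assume "\<exists>ps\<in>set perms4. \<sigma> = perm_of ps"
  then obtain a b c d where abcd: "(a, b, c, d) \<in> set perms4" and \<sigma>: "\<sigma> = perm_of (a, b, c, d)" by auto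
  have inj: "inj_on \<sigma> {1..4}"
    using abcd unfolding perms4_iff \<sigma> atLeastAtMost_1_4 inj_on_def by simp
  have "\<sigma> ` {1..4} \<subseteq> {1..4}" using abcd unfolding perms4_iff \<sigma> atLeastAtMost_1_4 by simp
  then have "\<sigma> ` {1..4} = {1..4}" by (intro endo_inj_surj inj) simp_all
  then show "\<sigma> permutes {1..4}"
    using inj by (intro bij_imp_permutes) (simp_all add: bij_betw_def \<sigma> perm_of_outside)
qed

definition adjacent :: "(nat \<times> nat) list \<Rightarrow> nat \<Rightarrow> nat \<Rightarrow> bool" where
  "adjacent es x y \<longleftrightarrow> (x, y) \<in> set es \<or> (y, x) \<in> set es"

text \<open>The upper triangle of the adjacency matrix after relabelling, in the same order of pairs
  as \<open>edge_list\<close>.\<close>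

definition pattern :: "nat \<times> nat \<times> nat \<times> nat \<Rightarrow> (nat \<times> nat) list \<Rightarrow> bool list" where
  "pattern = (\<lambda>(a, b, c, d) es. [adjacent es a b, adjacent es a c, adjacent es a d,
     adjacent es b c, adjacent es b d, adjacent es c d])"

definition edge_list :: "(nat \<times> nat) set \<Rightarrow> bool list" where
  "edge_list E = [(1, 2) \<in> E, (1, 3) \<in> E, (1, 4) \<in> E, (2, 3) \<in> E, (2, 4) \<in> E, (3, 4) \<in> E]"

lemma adjacent_iff: "(x, y) \<in> undirected (set es) \<longleftrightarrow> adjacent es x y"
  by (auto simp: undirected_def adjacent_def)

text \<open>A symmetric loopless relation on four points is determined by its six pairs with
  \<open>i < j\<close>; the condition on \<open>es\<close> excludes loops on the other side.\<close>

lemma pattern_iff: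
  assumes E: "simple_graph 4 E" and es: "\<forall>(x, y)\<in>set es. x \<noteq> y"
  shows "(\<forall>i\<in>{1..4}. \<forall>j\<in>{1..4}. (i, j) \<in> E \<longleftrightarrow> (perm_of ps i, perm_of ps j) \<in> undirected (set es))
    \<longleftrightarrow> edge_list E = pattern ps es"
proof -
  have s: "(2, 1) \<in> E \<longleftrightarrow> (1, 2) \<in> E" "(3, 1) \<in> E \<longleftrightarrow> (1, 3) \<in> E" "(4, 1) \<in> E \<longleftrightarrow> (1, 4) \<in> E"
    "(3, 2) \<in> E \<longleftrightarrow> (2, 3) \<in> E" "(4, 2) \<in> E \<longleftrightarrow> (2, 4) \<in> E" "(4, 3) \<in> E \<longleftrightarrow> (3, 4) \<in> E" "(i, i) \<notin> E" for i
    using E by (auto simp: simple_graph_def sym_def irrefl_def)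
  have a: "adjacent es x y \<longleftrightarrow> adjacent es y x" "\<not> adjacent es x x" for x y
    using es by (auto simp: adjacent_def)
  obtain p q r t where ps: "ps = (p, q, r, t)" by (cases ps)
  show ?thesis
    unfolding ball_1_4 adjacent_iff ps edge_list_def pattern_def
    by (simp add: s a(2) a(1)[of q p] a(1)[of r p] a(1)[of t p] a(1)[of r q] a(1)[of t q] a(1)[of t r])
      blast
qed

definition graph_lists :: "(nat \<times> nat) list list" where
  "graph_lists = [[], [(1, 2)], [(1, 2), (1, 3)], [(1, 2), (3, 4)], [(1, 2), (1, 3), (2, 3)],
     [(1, 2), (1, 3), (2, 4)]]"

lemma \<Gamma>_lists:
  "\<Gamma> 1 = undirected (set [])" "\<Gamma> 2 = undirected (set [(1, 2)])" "\<Gamma> 3 = undirected (set [(1, 2), (1, 3)])"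
  "\<Gamma> 4 = undirected (set [(1, 2), (3, 4)])" "\<Gamma> 5 = undirected (set [(1, 2), (1, 3), (2, 3)])"
  "\<Gamma> 6 = undirected (set [(1, 2), (1, 3), (2, 4)])"
  by (simp_all add: \<Gamma>_def)

text \<open>Exhaustive search: for each of the 64 labelled graphs, a listed graph and a relabelling
  match it or its complement.\<close>

lemma graph_lists_check:
  "list_all (\<lambda>bs. list_ex (\<lambda>es. list_ex (\<lambda>ps. let w = pattern ps es in bs = w \<or> map Not bs = w) perms4)
     graph_lists) (List.n_lists 6 [False, True])"
  by code_simp

theorem graphs_on_four_vertices:
  assumes E: "simple_graph 4 E"
  shows "\<exists>i\<in>{1..6}. graph_iso 4 E (\<Gamma> i) \<or> graph_iso 4 (graph_compl 4 E) (\<Gamma> i)"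
proof -
  have "edge_list E \<in> set (List.n_lists 6 [False, True])"
    by (auto simp: set_n_lists edge_list_def)
  then obtain es ps where es: "es \<in> set graph_lists" and ps: "ps \<in> set perms4"
    and w: "edge_list E = pattern ps es \<or> map Not (edge_list E) = pattern ps es"
    using graph_lists_check unfolding list_all_iff list_ex_iff Let_def by blast
  have ne: "\<forall>(x, y)\<in>set es. x \<noteq> y" using es unfolding graph_lists_def by auto
  \<comment> \<open>Complementation negates each of the six bits, so the second alternative of the
    search concerns the complement.\<close>
  have "map Not (edge_list E) = edge_list (graph_compl 4 E)"
    by (simp add: edge_list_def graph_compl_def)
  with w have "graph_iso 4 E (undirected (set es)) \<or> graph_iso 4 (graph_compl 4 E) (undirected (set es))"
    unfolding graph_iso_def
    using pattern_iff[OF E ne, of ps] pattern_iff[OF simple_graph_compl[OF E] ne, of ps] ps permutes_4_iff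
    by metis
  moreover have "\<exists>i\<in>{1..6}. \<Gamma> i = undirected (set es)"
  proof -
    have idx: "1 \<in> {1..6::nat}" "2 \<in> {1..6::nat}" "3 \<in> {1..6::nat}" "4 \<in> {1..6::nat}" "5 \<in> {1..6::nat}" "6 \<in> {1..6::nat}"
      by simp_all
    have "es = [] \<or> es = [(1, 2)] \<or> es = [(1, 2), (1, 3)] \<or> es = [(1, 2), (3, 4)] \<or>
        es = [(1, 2), (1, 3), (2, 3)] \<or> es = [(1, 2), (1, 3), (2, 4)]"
      using es by (simp add: graph_lists_def)
    then show ?thesis by (elim disjE; simp only:; metis \<Gamma>_lists idx)
  qed
  ultimately show ?thesis by metis
qed

section \<open>The automorphism groups\<close>

lemma mult_aut_group [simp]: "\<sigma> \<otimes>\<^bsub>aut_group n E\<^esub> \<tau> = \<sigma> \<circ> \<tau>" for \<sigma> \<tau> :: "nat \<Rightarrow> nat"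
  by (simp add: aut_group_def sym_group_def)

lemma aut_group_eqI: "carrier (aut_group n E) = carrier (aut_group n E') \<Longrightarrow> aut_group n E = aut_group n E'"
  by (simp add: aut_group_def)

lemma aut_group_compl:
  assumes E: "simple_graph n E" shows "aut_group n (graph_compl n E) = aut_group n E"
proof (rule aut_group_eqI, rule Set.set_eqI)
  fix \<sigma> :: "nat \<Rightarrow> nat"
  have "(\<forall>i\<in>{1..n}. \<forall>j\<in>{1..n}. (i, j) \<in> graph_compl n E \<longleftrightarrow> (\<sigma> i, \<sigma> j) \<in> graph_compl n E) \<longleftrightarrow>
      (\<forall>i\<in>{1..n}. \<forall>j\<in>{1..n}. (i, j) \<in> E \<longleftrightarrow> (\<sigma> i, \<sigma> j) \<in> E)" if p: "\<sigma> permutes {1..n}"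
  proof (intro ball_cong HOL.refl)
    fix i j assume ij: "i \<in> {1..n}" "j \<in> {1..n}"
    have "\<sigma> i \<in> {1..n}" "\<sigma> j \<in> {1..n}" using ij by (simp_all only: permutes_in_image[OF p])
    moreover have "\<sigma> i = \<sigma> j \<longleftrightarrow> i = j" using permutes_inj[OF p] by (auto dest: injD)
    moreover have "(k, k) \<notin> E" for k using E by (auto simp: simple_graph_def irrefl_def)
    ultimately show "((i, j) \<in> graph_compl n E \<longleftrightarrow> (\<sigma> i, \<sigma> j) \<in> graph_compl n E) \<longleftrightarrow> ((i, j) \<in> E \<longleftrightarrow> (\<sigma> i, \<sigma> j) \<in> E)"
      using ij unfolding graph_compl_def by (cases "i = j") auto
  qed
  then show "\<sigma> \<in> carrier (aut_group n (graph_compl n E)) \<longleftrightarrow> \<sigma> \<in> carrier (aut_group n E)"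
    unfolding aut_group_iff by blast
qed

lemma aut_group_empty: "aut_group n {} = sym_group n"
proof -
  have "carrier (aut_group n {}) = carrier (sym_group n)"
    by (auto simp: aut_group_iff sym_group_def)
  then show ?thesis by (simp add: aut_group_def sym_group_def)
qed

text \<open>An equality and not just an isomorphism: permutations of {1, 2, 3} are functions that
  fix all other numbers, in particular the isolated vertex 4.\<close>

lemma aut_group_\<Gamma>5: "aut_group 4 (\<Gamma> 5) = sym_group 3"
proof -
  have V: "{1..3::nat} = {1, 2, 3}" by auto
  have edge: "(i, j) \<in> \<Gamma> 5 \<longleftrightarrow> i \<in> {1..3} \<and> j \<in> {1..3} \<and> i \<noteq> j" for i j
    unfolding V by (auto simp: \<Gamma>_def undirected_def)
  have "carrier (aut_group 4 (\<Gamma> 5)) = carrier (sym_group 3)"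
  proof (rule Set.set_eqI)
    fix \<sigma> :: "nat \<Rightarrow> nat"
    show "\<sigma> \<in> carrier (aut_group 4 (\<Gamma> 5)) \<longleftrightarrow> \<sigma> \<in> carrier (sym_group 3)"
    proof
      assume "\<sigma> \<in> carrier (sym_group 3)"
      then have p: "\<sigma> permutes {1..3}" by (simp add: sym_group_def)
      have "\<sigma> i \<in> {1..3} \<longleftrightarrow> i \<in> {1..3}" for i by (rule permutes_in_image[OF p])
      moreover have "\<sigma> i = \<sigma> j \<longleftrightarrow> i = j" for i j using permutes_inj[OF p] by (auto dest: injD)
      moreover have "\<sigma> permutes {1..4}" by (rule permutes_subset[OF p]) auto
      ultimately show "\<sigma> \<in> carrier (aut_group 4 (\<Gamma> 5))" unfolding aut_group_iff edge by simp
    next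
      assume "\<sigma> \<in> carrier (aut_group 4 (\<Gamma> 5))"
      then have p: "\<sigma> permutes {1..4}"
        and e: "\<And>i j. i \<in> {1..4} \<Longrightarrow> j \<in> {1..4} \<Longrightarrow> (i, j) \<in> \<Gamma> 5 \<longleftrightarrow> (\<sigma> i, \<sigma> j) \<in> \<Gamma> 5"
        unfolding aut_group_iff by blast+
      \<comment> \<open>If 4 were sent into the triangle, its image would have a neighbour there,
        and the preimage of that neighbour would be adjacent to the isolated vertex 4.\<close>
      have "\<sigma> 4 = 4"
      proof (rule ccontr)
        assume n4: "\<sigma> 4 \<noteq> 4"
        have "\<sigma> 4 \<in> {1..4}" by (simp only: permutes_in_image[OF p]) simp
        with n4 have s4: "\<sigma> 4 \<in> {1..3}" by auto
        obtain y where y: "y \<in> {1..3}" "y \<noteq> \<sigma> 4" by (cases "\<sigma> 4 = 1") (auto intro: that[of 1] that[of 2])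
        have "y \<in> \<sigma> ` {1..4}" using y(1) unfolding permutes_image[OF p] by auto
        then obtain z where z: "z \<in> {1..4}" "y = \<sigma> z" by blast
        have "(\<sigma> 4, \<sigma> z) \<in> \<Gamma> 5" using s4 y z unfolding edge by auto
        then have "(4, z) \<in> \<Gamma> 5" using e[of 4 z] z by simp
        then show False unfolding edge by simp
      qed
      then have "\<sigma> permutes {1..3}"
        by (intro permutes_superset[OF p]) (auto simp: atLeastAtMost_1_4 V)
      then show "\<sigma> \<in> carrier (sym_group 3)" by (simp add: sym_group_def)
    qed
  qed
  then show ?thesis by (simp add: aut_group_def sym_group_def)
qed

definition aut_list :: "(nat \<times> nat) list \<Rightarrow> (nat \<times> nat \<times> nat \<times> nat) list" where
  "aut_list es = filter (\<lambda>ps. pattern (1, 2, 3, 4) es = pattern ps es) perms4"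

lemma carrier_aut_list:
  assumes es: "\<forall>(x, y)\<in>set es. x \<noteq> y" and E: "simple_graph 4 (undirected (set es))"
  shows "carrier (aut_group 4 (undirected (set es))) = perm_of ` set (aut_list es)"
proof -
  have "edge_list (undirected (set es)) = pattern (1, 2, 3, 4) es"
    by (simp add: edge_list_def pattern_def adjacent_iff)
  then have key: "(\<forall>i\<in>{1..4}. \<forall>j\<in>{1..4}. (i, j) \<in> undirected (set es) \<longleftrightarrow>
      (perm_of ps i, perm_of ps j) \<in> undirected (set es)) \<longleftrightarrow> pattern (1, 2, 3, 4) es = pattern ps es" for ps
    using pattern_iff[OF E es, of ps] by simp
  show ?thesis
  proof (rule Set.set_eqI)
    fix \<sigma> :: "nat \<Rightarrow> nat"
    have "\<sigma> \<in> perm_of ` set (aut_list es) \<longleftrightarrow>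
        (\<exists>ps\<in>set perms4. \<sigma> = perm_of ps \<and> pattern (1, 2, 3, 4) es = pattern ps es)"
      unfolding aut_list_def by (simp only: image_iff set_filter mem_Collect_eq Bex_def) blast
    then show "\<sigma> \<in> carrier (aut_group 4 (undirected (set es))) \<longleftrightarrow> \<sigma> \<in> perm_of ` set (aut_list es)"
      unfolding aut_group_iff permutes_4_iff key[symmetric] by metis
  qed
qed

lemma aut_list_values:
  "aut_list [(1, 2)] = [(1, 2, 3, 4), (1, 2, 4, 3), (2, 1, 3, 4), (2, 1, 4, 3)]"
  "aut_list [(1, 2), (1, 3)] = [(1, 2, 3, 4), (1, 3, 2, 4)]"
  "aut_list [(1, 2), (3, 4)] = [(1, 2, 3, 4), (1, 2, 4, 3), (2, 1, 3, 4), (2, 1, 4, 3),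
     (3, 4, 1, 2), (3, 4, 2, 1), (4, 3, 1, 2), (4, 3, 2, 1)]"
  "aut_list [(1, 2), (1, 3), (2, 4)] = [(1, 2, 3, 4), (2, 1, 4, 3)]"
  by code_simp+

lemma carrier_aut_\<Gamma>:
  "carrier (aut_group 4 (\<Gamma> 2)) = {perm_of (1, 2, 3, 4), perm_of (1, 2, 4, 3), perm_of (2, 1, 3, 4), perm_of (2, 1, 4, 3)}"
  "carrier (aut_group 4 (\<Gamma> 3)) = {perm_of (1, 2, 3, 4), perm_of (1, 3, 2, 4)}"
  "carrier (aut_group 4 (\<Gamma> 4)) = {perm_of (1, 2, 3, 4), perm_of (1, 2, 4, 3), perm_of (2, 1, 3, 4),
     perm_of (2, 1, 4, 3), perm_of (3, 4, 1, 2), perm_of (3, 4, 2, 1), perm_of (4, 3, 1, 2), perm_of (4, 3, 2, 1)}"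
  "carrier (aut_group 4 (\<Gamma> 6)) = {perm_of (1, 2, 3, 4), perm_of (2, 1, 4, 3)}"
  using carrier_aut_list[of "[(1, 2)]"] carrier_aut_list[of "[(1, 2), (1, 3)]"]
    carrier_aut_list[of "[(1, 2), (3, 4)]"] carrier_aut_list[of "[(1, 2), (1, 3), (2, 4)]"]
    simple_\<Gamma>[of 2] simple_\<Gamma>[of 3] simple_\<Gamma>[of 4] simple_\<Gamma>[of 6]
  unfolding \<Gamma>_lists aut_list_values by simp_all

text \<open>\<open>k\<close> is a vertex moved by the involution; whether \<open>k\<close> is fixed
  separates the two elements.\<close>

lemma aut_group_iso_Z2:
  fixes k :: nat
  assumes K: "carrier (aut_group n E) = {\<rho>, \<tau>}" and k: "\<rho> k = k" "\<tau> k \<noteq> k"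
    and m: "\<rho> \<circ> \<rho> = \<rho>" "\<rho> \<circ> \<tau> = \<tau>" "\<tau> \<circ> \<rho> = \<tau>" "\<tau> \<circ> \<tau> = \<rho>"
  shows "aut_group n E \<cong> Z2"
proof -
  let ?h = "\<lambda>f :: nat \<Rightarrow> nat. if f k = k then 0 else 1 :: int"
  have "?h \<in> iso (aut_group n E) Z2"
  proof (rule isoI)
    show "?h \<in> hom (aut_group n E) Z2"
      by (rule homI) (use k m in \<open>auto simp: K carrier_integer_mod_group\<close>)
    have "{0..<int 2} = {0, 1}" by auto
    then show "bij_betw ?h (carrier (aut_group n E)) (carrier Z2)"
      using k unfolding bij_betw_def inj_on_def by (auto simp: K carrier_integer_mod_group)
  qed
  then show ?thesis by (rule is_isoI)
qed

lemma aut_group_\<Gamma>3: "aut_group 4 (\<Gamma> 3) \<cong> Z2"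
  by (rule aut_group_iso_Z2[OF carrier_aut_\<Gamma>(2), of 2]) (simp_all add: perm_of_comp)

lemma aut_group_\<Gamma>6: "aut_group 4 (\<Gamma> 6) \<cong> Z2"
  by (rule aut_group_iso_Z2[OF carrier_aut_\<Gamma>(4), of 1]) (simp_all add: perm_of_comp)

lemma aut_group_\<Gamma>2: "aut_group 4 (\<Gamma> 2) \<cong> Z2 \<times>\<times> Z2"
proof -
  \<comment> \<open>The two components record whether the ends of the edge {1, 2}, and the isolated
    vertices 3 and 4, are exchanged.\<close>
  let ?h = "\<lambda>f :: nat \<Rightarrow> nat. (if f 1 = 1 then 0 else 1 :: int, if f 3 = 3 then 0 else 1 :: int)"
  have V: "{0..<int 2} = {0, 1}" by auto
  have "?h \<in> iso (aut_group 4 (\<Gamma> 2)) (Z2 \<times>\<times> Z2)"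
  proof (rule isoI)
    show "?h \<in> hom (aut_group 4 (\<Gamma> 2)) (Z2 \<times>\<times> Z2)"
      by (rule homI) (auto simp: carrier_aut_\<Gamma>(1) carrier_integer_mod_group)
    show "bij_betw ?h (carrier (aut_group 4 (\<Gamma> 2))) (carrier (Z2 \<times>\<times> Z2))"
      unfolding bij_betw_def inj_on_def
      by (auto simp: carrier_aut_\<Gamma>(1) carrier_integer_mod_group V)
  qed
  then show ?thesis by (rule is_isoI)
qed

subsection \<open>The dihedral group of order 8\<close>

abbreviation D4_relators :: "dihedral_gen word set" where
  "D4_relators \<equiv> {[(Dih_x, False), (Dih_x, False)], [(Dih_y, False), (Dih_y, False)],
     [(Dih_x, False), (Dih_y, False), (Dih_x, False), (Dih_y, False),
      (Dih_x, False), (Dih_y, False), (Dih_x, False), (Dih_y, False)]}"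

abbreviation D4_eq :: "dihedral_gen word \<Rightarrow> dihedral_gen word \<Rightarrow> bool" (infix \<open>\<approx>\<close> 50) where
  "v \<approx> w \<equiv> presentation_eq D4_relators v w"

text \<open>The first involution flips the edge {1, 2}, the second exchanges the two edges; their
  product is a 4-cycle, which matches the third relator.\<close>

primrec dih_perm :: "dihedral_gen \<Rightarrow> nat \<Rightarrow> nat" where
  "dih_perm Dih_x = perm_of (2, 1, 3, 4)"
| "dih_perm Dih_y = perm_of (3, 4, 1, 2)"

text \<open>The exponent of a letter is ignored because both generators are sent to
  involutions.\<close>

definition word_perm :: "dihedral_gen word \<Rightarrow> nat \<Rightarrow> nat" where
  "word_perm w = foldr (\<lambda>(g, b) f. dih_perm g \<circ> f) w id"

lemma word_perm_append: "word_perm (v @ w) = word_perm v \<circ> word_perm w"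
  by (induction v) (auto simp: word_perm_def fun_eq_iff)

lemma perm_of_id: "perm_of (1, 2, 3, 4) = id"
  by (auto simp: perm_of_def fun_eq_iff)

lemma dih_perm_involution: "dih_perm g \<circ> dih_perm g = id"
  by (cases g) (simp_all add: perm_of_comp perm_of_id)

lemma word_perm_eq: "v \<approx> w \<Longrightarrow> word_perm v = word_perm w"
proof (induction rule: presentation_eq.induct)
  case (cancel v x b w)
  have "word_perm [(x, b), (x, \<not> b)] = id" by (simp add: word_perm_def dih_perm_involution)
  then show ?case by (simp only: word_perm_append) simp
next
  case (relator r v w)
  then have "word_perm r = id"
    by (auto simp: word_perm_def perm_of_comp perm_of_id simp flip: perm_of_id)
  then show ?case by (simp only: word_perm_append) simp
qed simp_all

lemma D4_eq_append: "v \<approx> w \<Longrightarrow> a @ v @ b \<approx> a @ w @ b"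
proof (induction rule: presentation_eq.induct)
  case (cancel v x c w)
  show ?case using presentation_eq.cancel[of D4_relators "a @ v" x c "w @ b"] by simp
next
  case (relator r v w)
  then show ?case using presentation_eq.relator[of r D4_relators "a @ v" "w @ b"] by simp
qed (auto intro: presentation_eq.intros)

abbreviation (input) dx :: "dihedral_gen \<times> bool" where "dx \<equiv> (Dih_x, False)"
abbreviation (input) dy :: "dihedral_gen \<times> bool" where "dy \<equiv> (Dih_y, False)"

text \<open>The alternating words of length at most 4, where \<open>xyxy\<close> also represents
  \<open>yxyx\<close>.\<close>

definition normal_forms :: "dihedral_gen word list" where
  "normal_forms = [[], [dx], [dy], [dx, dy], [dy, dx], [dx, dy, dx], [dy, dx, dy], [dx, dy, dx, dy]]"

lemma D4_square: "[(g, False), (g, False)] @ w \<approx> w"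
  using presentation_eq.relator[of "[(g, False), (g, False)]" D4_relators "[]" w] by (cases g) auto

lemma D4_cons: "v \<approx> w \<Longrightarrow> l # v \<approx> l # w"
  using D4_eq_append[of v w "[l]" "[]"] by simp

text \<open>Insert the square of the generator after the inverse letter: removing it as a relator
  leaves the inverse, cancelling the first pair leaves the generator.\<close>

lemma D4_inverse: "(g, True) # w \<approx> (g, False) # w"
proof -
  have "(g, True) # [(g, False), (g, False)] @ w \<approx> (g, True) # w"
    by (rule D4_cons) (rule D4_square)
  moreover have "(g, True) # [(g, False), (g, False)] @ w \<approx> (g, False) # w"
    using presentation_eq.cancel[of D4_relators "[]" g True "(g, False) # w"] by simp
  ultimately show ?thesis by (meson presentation_eq.sym presentation_eq.trans)
qed

text \<open>Append the relator \<open>(xy)^4\<close> to \<open>yxyx\<close> and remove the squares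
  that arise at the junction, one after the other, until \<open>xyxy\<close> is left.\<close>

lemma D4_braid: "[dy, dx, dy, dx] \<approx> [dx, dy, dx, dy]"
proof -
  note tr = presentation_eq.trans[of D4_relators]
  have "[dy, dx, dy, dx] @ [dx, dy, dx, dy, dx, dy, dx, dy] \<approx> [dy, dx, dy, dx]"
    using presentation_eq.relator[of "[dx, dy, dx, dy, dx, dy, dx, dy]" D4_relators "[dy, dx, dy, dx]" "[]"] by simp
  moreover have "[dy, dx, dy, dx, dx, dy, dx, dy, dx, dy, dx, dy] \<approx> [dy, dx, dy, dy, dx, dy, dx, dy, dx, dy]"
    using D4_square[of Dih_x "[dy, dx, dy, dx, dy, dx, dy]"] by (simp add: D4_cons)
  moreover have "[dy, dx, dy, dy, dx, dy, dx, dy, dx, dy] \<approx> [dy, dx, dx, dy, dx, dy, dx, dy]"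
    using D4_square[of Dih_y "[dx, dy, dx, dy, dx, dy]"] by (simp add: D4_cons)
  moreover have "[dy, dx, dx, dy, dx, dy, dx, dy] \<approx> [dy, dy, dx, dy, dx, dy]"
    using D4_square[of Dih_x "[dy, dx, dy, dx, dy]"] by (simp add: D4_cons)
  moreover have "[dy, dy, dx, dy, dx, dy] \<approx> [dx, dy, dx, dy]"
    using D4_square[of Dih_y "[dx, dy, dx, dy]"] by simp
  ultimately show ?thesis by (simp, meson presentation_eq.sym presentation_eq.trans)
qed

lemma normal_form_cons:
  assumes "w \<in> set normal_forms" shows "\<exists>v\<in>set normal_forms. (g, False) # w \<approx> v"
proof -
  note r = presentation_eq.refl
  have sq: "(g, False) # (g, False) # w \<approx> w" for g w using D4_square by simp
  \<comment> \<open>The one product that leaves the list of alternating words of length 4: rewriting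
    \<open>xyxy\<close> as \<open>yxyx\<close> exposes a square.\<close>
  have y4: "[dy, dx, dy, dx, dy] \<approx> [dx, dy, dx]"
  proof -
    have "dy # [dx, dy, dx, dy] \<approx> dy # [dy, dx, dy, dx]"
      by (rule D4_cons, rule presentation_eq.sym, rule D4_braid)
    then show ?thesis using sq[of Dih_y "[dx, dy, dx]"] by (meson presentation_eq.trans)
  qed
  show ?thesis
    using assms
    by (cases g) (auto simp: normal_forms_def intro: r sq D4_braid y4)
qed

lemma ex_normal_form: "\<exists>v\<in>set normal_forms. w \<approx> v"
proof (induction w)
  case Nil
  show ?case by (auto simp: normal_forms_def intro: presentation_eq.refl)
next
  case (Cons l w)
  obtain g b where l: "l = (g, b)" by (cases l)
  obtain v where v: "v \<in> set normal_forms" "w \<approx> v" using Cons by blast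
  have "l # w \<approx> (g, False) # v"
    using D4_inverse[of g w] D4_cons[OF v(2), of "(g, False)"] unfolding l
    by (cases b) (auto intro: presentation_eq.trans)
  with normal_form_cons[OF v(1), of g] show ?case by (meson presentation_eq.trans)
qed

lemma normal_form_perms:
  "map word_perm normal_forms = map perm_of [(1, 2, 3, 4), (2, 1, 3, 4), (3, 4, 1, 2), (3, 4, 2, 1),
     (4, 3, 1, 2), (4, 3, 2, 1), (1, 2, 4, 3), (2, 1, 4, 3)]"
  by (simp add: normal_forms_def word_perm_def perm_of_comp perm_of_id)

text \<open>Every word reduces to one of eight normal forms, whose permutations are pairwise
  distinct; hence the representation by permutations is faithful.\<close>

lemma D4_eq_iff: "v \<approx> w \<longleftrightarrow> word_perm v = word_perm w"
proof
  assume eq: "word_perm v = word_perm w"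
  obtain v' w' where n: "v' \<in> set normal_forms" "v \<approx> v'" "w' \<in> set normal_forms" "w \<approx> w'"
    using ex_normal_form by metis
  have "distinct (map word_perm normal_forms)"
    unfolding normal_form_perms by (simp add: perm_of_inject)
  moreover have "word_perm v' = word_perm w'" using eq n word_perm_eq by metis
  ultimately have "v' = w'" using n unfolding distinct_map by (metis inj_onD)
  with n show "v \<approx> w" by (meson presentation_eq.sym presentation_eq.trans)
qed (rule word_perm_eq)

lemma range_word_perm: "range word_perm = carrier (aut_group 4 (\<Gamma> 4))"
proof -
  have "range word_perm = word_perm ` set normal_forms"
    using ex_normal_form word_perm_eq by (auto simp: image_iff) metis
  also have "\<dots> = set (map word_perm normal_forms)" by simp
  also have "\<dots> = carrier (aut_group 4 (\<Gamma> 4))"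
    unfolding normal_form_perms carrier_aut_\<Gamma> by auto
  finally show ?thesis .
qed

lemma aut_group_\<Gamma>4: "aut_group 4 (\<Gamma> 4) \<cong> D4"
proof -
  have D4: "D4 = presented_group D4_relators" by (simp add: D4_def Let_def)
  \<comment> \<open>The classes of the presented group are the fibres of \<open>word_perm\<close>,
    so a permutation corresponds to its fibre.\<close>
  let ?h = "\<lambda>f. {w. word_perm w = f}"
  have cls: "{(v, w). v \<approx> w} `` {u} = ?h (word_perm u)" for u
    by (auto simp: D4_eq_iff)
  have carrier: "carrier D4 = ?h ` range word_perm"
    unfolding D4 presented_group_def quotient_def by (auto simp: cls[simplified])
  have "?h \<in> iso (aut_group 4 (\<Gamma> 4)) D4"
  proof (rule isoI)
    show "?h \<in> hom (aut_group 4 (\<Gamma> 4)) D4"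
    proof (rule homI)
      fix f g assume fg: "f \<in> carrier (aut_group 4 (\<Gamma> 4))" "g \<in> carrier (aut_group 4 (\<Gamma> 4))"
      then obtain u v where uv: "f = word_perm u" "g = word_perm v" unfolding range_word_perm[symmetric] by blast
      show "?h f \<in> carrier D4" using uv by (auto simp: carrier)
      show "?h (f \<otimes>\<^bsub>aut_group 4 (\<Gamma> 4)\<^esub> g) = ?h f \<otimes>\<^bsub>D4\<^esub> ?h g"
        unfolding D4 presented_group_def using uv by (auto simp: D4_eq_iff word_perm_append)
    qed
    show "bij_betw ?h (carrier (aut_group 4 (\<Gamma> 4))) (carrier D4)"
      unfolding carrier range_word_perm[symmetric] bij_betw_def inj_on_def by blast
  qed
  then show ?thesis by (rule is_isoI)
qed

section \<open>The classification\<close>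

lemma \<Gamma>_subset: "i \<in> {1..6} \<Longrightarrow> \<Gamma> i \<subseteq> mat_idx 4" "i \<in> {1..6} \<Longrightarrow> \<Gamma>c i \<subseteq> mat_idx 4"
  using simple_\<Gamma>[of i] simple_graph_compl[OF simple_\<Gamma>[of i]] by (auto simp: simple_graph_def)

lemma eq_on_mat_idx_4:
  assumes "A \<subseteq> mat_idx 4" "B \<subseteq> mat_idx 4" "\<forall>i\<in>{1..4}. \<forall>j\<in>{1..4}. (i, j) \<in> A \<longleftrightarrow> (i, j) \<in> B"
  shows "A = B"
  using assms by (intro equalityI subsetI; case_tac x) blast+

lemma \<Gamma>c_values:
  "\<Gamma>c 1 = {(i, j). i \<in> {1..4} \<and> j \<in> {1..4} \<and> i \<noteq> j}"
  "\<Gamma>c 2 = undirected {(1, 3), (1, 4), (2, 3), (2, 4), (3, 4)}"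
  "\<Gamma>c 3 = undirected {(2, 3), (2, 4), (3, 4), (1, 4)}"
  "\<Gamma>c 4 = undirected {(1, 3), (3, 2), (2, 4), (4, 1)}"
  "\<Gamma>c 5 = undirected {(4, 1), (4, 2), (4, 3)}"
proof -
  have "\<Gamma>c i \<subseteq> mat_idx 4" for i by (auto simp: graph_compl_def)
  note eqI = eq_on_mat_idx_4[OF this]
  note defs = ball_1_4 graph_compl_def \<Gamma>_def undirected_def
  show "\<Gamma>c 1 = {(i, j). i \<in> {1..4} \<and> j \<in> {1..4} \<and> i \<noteq> j}"
    by (rule eqI) (auto simp: graph_compl_def \<Gamma>_def undirected_def)
  show "\<Gamma>c 2 = undirected {(1, 3), (1, 4), (2, 3), (2, 4), (3, 4)}"
    by (rule eqI, force simp: undirected_def, simp add: defs)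
  show "\<Gamma>c 3 = undirected {(2, 3), (2, 4), (3, 4), (1, 4)}"
    by (rule eqI, force simp: undirected_def, simp add: defs)
  show "\<Gamma>c 4 = undirected {(1, 3), (3, 2), (2, 4), (4, 1)}"
    by (rule eqI, force simp: undirected_def, simp add: defs)
  show "\<Gamma>c 5 = undirected {(4, 1), (4, 2), (4, 3)}"
    by (rule eqI, force simp: undirected_def, simp add: defs)
qed

lemma \<Gamma>c6_iso: "graph_iso 4 (\<Gamma>c 6) (\<Gamma> 6)"
proof -
  \<comment> \<open>The complement is the path 1 - 4 - 3 - 2; this permutation sends it to 4 - 2 - 1
    - 3, which is \<open>\<Gamma> 6\<close> traversed from vertex 4.\<close>
  have "edge_list (\<Gamma>c 6) = pattern (4, 3, 1, 2) [(1, 2), (1, 3), (2, 4)]"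
    by (simp add: edge_list_def pattern_def adjacent_def graph_compl_def \<Gamma>_def undirected_def)
  then have "\<forall>i\<in>{1..4}. \<forall>j\<in>{1..4}. (i, j) \<in> \<Gamma>c 6 \<longleftrightarrow> (perm_of (4, 3, 1, 2) i, perm_of (4, 3, 1, 2) j) \<in> \<Gamma> 6"
    unfolding \<Gamma>_lists(6) by (subst pattern_iff) (use simple_graph_compl[OF simple_\<Gamma>[of 6]] in \<open>simp_all add: \<Gamma>_lists(6)\<close>)
  moreover have "perm_of (4, 3, 1, 2) permutes {1..4}"
    unfolding permutes_4_iff by (rule bexI[of _ "(4, 3, 1, 2)"]) (simp_all add: perms4_iff)
  ultimately show ?thesis unfolding graph_iso_def by blast
qed

text \<open>For the complement, relation (d) supplies the commutation of the entries on the edges of the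
  complement, and the commutation on the edges of \<open>\<Gamma> i\<close> follows from the other relations.\<close>

lemma G_aut_star_compl_commutative:
  assumes i: "i \<in> {1..6}"
    and d: "\<And>(B :: (nat \<Rightarrow> mat_poly) set cstar_algebra) u. \<lbrakk>cstar_algebra B; magic B 4 u;
      intertwines B 4 (\<Gamma> i) u\<rbrakk> \<Longrightarrow> edges_commute B (\<Gamma> i) u"
    and iso: "aut_group 4 (\<Gamma> i) \<cong> K"
  shows "equals_aut_group (G_aut_star 4 (\<Gamma>c i)) 4 (\<Gamma>c i) K"
  unfolding equals_aut_group_def
proof
  note s = simple_\<Gamma>[OF i]
  show "aut_group 4 (\<Gamma>c i) \<cong> K" using iso aut_group_compl[OF s] by simp
  show "qgroup_eq (G_aut_star 4 (\<Gamma>c i)) (perm_qgroup 4 (carrier (aut_group 4 (\<Gamma>c i))))"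
  proof (rule G_aut_star_commutative[OF \<Gamma>_subset(2)[OF i]])
    fix B :: "(nat \<Rightarrow> mat_poly) set cstar_algebra" and u and j k l p :: nat
    assume B: "cstar_algebra B" and m: "magic B 4 u" and c: "intertwines B 4 (\<Gamma>c i) u"
      and dc: "edges_commute B (\<Gamma>c i) u" and idx: "j \<in> {1..4}" "k \<in> {1..4}" "l \<in> {1..4}" "p \<in> {1..4}"
    interpret B: cstar_algebra B by fact
    have c': "intertwines B 4 (\<Gamma> i) u" using c B.intertwines_compl[OF m s] by simp
    show "u j k \<otimes>\<^bsub>B\<^esub> u l p = u l p \<otimes>\<^bsub>B\<^esub> u j k"
      by (rule B.commute_if_edges_commute[OF m c' s d[OF B m c'] dc idx])
  qed
qed

text \<open>If (a), (b) and (c) for \<open>\<Gamma> i\<close> already force commutation, then so do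
  they for the complement, whose magic intertwiners and automorphisms are the same.\<close>

lemma G_aut_commutative:
  assumes i: "i \<in> {1..6}"
    and comm: "\<And>(B :: (nat \<Rightarrow> mat_poly) set cstar_algebra) u j k l p. \<lbrakk>cstar_algebra B; magic B 4 u;
      intertwines B 4 (\<Gamma> i) u; j \<in> {1..4}; k \<in> {1..4}; l \<in> {1..4}; p \<in> {1..4}\<rbrakk> \<Longrightarrow>
      u j k \<otimes>\<^bsub>B\<^esub> u l p = u l p \<otimes>\<^bsub>B\<^esub> u j k"
    and iso: "aut_group 4 (\<Gamma> i) \<cong> K"
  shows "equals_aut_group (G_aut_star 4 (\<Gamma>c i)) 4 (\<Gamma>c i) K"
    and "equals_aut_group (G_aut_star 4 (\<Gamma> i)) 4 (\<Gamma> i) K"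
    and "equals_aut_group (G_aut_plus 4 (\<Gamma> i)) 4 (\<Gamma> i) K"
proof -
  have d: "edges_commute B (\<Gamma> i) u" if "cstar_algebra B" "magic B 4 u" "intertwines B 4 (\<Gamma> i) u"
    for B :: "(nat \<Rightarrow> mat_poly) set cstar_algebra" and u
  proof -
    interpret B: cstar_algebra B by fact
    show ?thesis by (rule B.edges_commute_if_commute[OF \<Gamma>_subset(1)[OF i]]) (rule comm[OF that])
  qed
  show "equals_aut_group (G_aut_star 4 (\<Gamma>c i)) 4 (\<Gamma>c i) K"
    by (rule G_aut_star_compl_commutative[OF i d iso])
  have "qgroup_eq (G_aut_plus 4 (\<Gamma> i)) (perm_qgroup 4 (carrier (aut_group 4 (\<Gamma> i))))"
    by (rule G_aut_plus_commutative[OF \<Gamma>_subset(1)[OF i]]) (rule comm)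
  moreover have "G_aut_star 4 (\<Gamma> i) = G_aut_plus 4 (\<Gamma> i)"
    by (rule G_aut_star_eq_plus[OF \<Gamma>_subset(1)[OF i] d])
  ultimately show "equals_aut_group (G_aut_star 4 (\<Gamma> i)) 4 (\<Gamma> i) K"
    "equals_aut_group (G_aut_plus 4 (\<Gamma> i)) 4 (\<Gamma> i) K"
    using iso by (simp_all add: equals_aut_group_def)
qed

lemma \<Gamma>1_edges_commute: "edges_commute B (\<Gamma> 1) u"
  by (simp add: edges_commute_def \<Gamma>_lists(1) undirected_def)

lemma G_aut_star_eq_plus_\<Gamma>:
  "G_aut_star 4 (\<Gamma> 1) = G_aut_plus 4 (\<Gamma> 1)"
  "G_aut_star 4 (\<Gamma> 2) = G_aut_plus 4 (\<Gamma> 2)"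
  "G_aut_star 4 (\<Gamma> 4) = G_aut_plus 4 (\<Gamma> 4)"
proof -
  have sa: "star_algebra B" if "cstar_algebra B" for B :: "(nat \<Rightarrow> mat_poly) set cstar_algebra"
    using that by (rule cstar_algebra.axioms)
  show "G_aut_star 4 (\<Gamma> 1) = G_aut_plus 4 (\<Gamma> 1)"
    by (rule G_aut_star_eq_plus[OF \<Gamma>_subset(1)]) (simp_all add: \<Gamma>1_edges_commute)
  show "G_aut_star 4 (\<Gamma> 2) = G_aut_plus 4 (\<Gamma> 2)"
    by (rule G_aut_star_eq_plus[OF \<Gamma>_subset(1)], simp, rule star_algebra.\<Gamma>2_edges_commute[OF sa])
  show "G_aut_star 4 (\<Gamma> 4) = G_aut_plus 4 (\<Gamma> 4)"
    by (rule G_aut_star_eq_plus[OF \<Gamma>_subset(1)], simp, rule star_algebra.\<Gamma>4_edges_commute[OF sa])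
qed

lemma G_aut_plus_\<Gamma>1: "G_aut_plus 4 (\<Gamma> 1) = S_plus 4"
  using G_aut_plus_empty[of 4] by (simp add: \<Gamma>_lists(1) undirected_def)

theorem theorem3p8:
  shows
    "(\<forall>E. simple_graph 4 E \<longrightarrow>
        (\<exists>i\<in>{1..6}. graph_iso 4 E (\<Gamma> i) \<or> graph_iso 4 (graph_compl 4 E) (\<Gamma> i))) \<and>

     \<Gamma>c 1 = {(i, j). i \<in> {1..4} \<and> j \<in> {1..4} \<and> i \<noteq> j} \<and>
     aut_group 4 (\<Gamma> 1) \<cong> sym_group 4 \<and>
     equals_aut_group (G_aut_star 4 (\<Gamma>c 1)) 4 (\<Gamma>c 1) (sym_group 4) \<and>
     qgroup_eq (G_aut_star 4 (\<Gamma> 1)) (S_plus 4) \<and>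
     qgroup_eq (G_aut_plus 4 (\<Gamma> 1)) (S_plus 4) \<and>

     \<Gamma>c 2 = undirected {(1, 3), (1, 4), (2, 3), (2, 4), (3, 4)} \<and>
     aut_group 4 (\<Gamma> 2) \<cong> Z2 \<times>\<times> Z2 \<and>
     equals_aut_group (G_aut_star 4 (\<Gamma>c 2)) 4 (\<Gamma>c 2) (Z2 \<times>\<times> Z2) \<and>
     qgroup_eq (G_aut_star 4 (\<Gamma> 2)) Z2_free_Z2_dual \<and>
     qgroup_eq (G_aut_plus 4 (\<Gamma> 2)) Z2_free_Z2_dual \<and>

     \<Gamma>c 3 = undirected {(2, 3), (2, 4), (3, 4), (1, 4)} \<and>
     aut_group 4 (\<Gamma> 3) \<cong> Z2 \<and>
     equals_aut_group (G_aut_star 4 (\<Gamma>c 3)) 4 (\<Gamma>c 3) Z2 \<and>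
     equals_aut_group (G_aut_star 4 (\<Gamma> 3)) 4 (\<Gamma> 3) Z2 \<and>
     equals_aut_group (G_aut_plus 4 (\<Gamma> 3)) 4 (\<Gamma> 3) Z2 \<and>

     \<Gamma>c 4 = undirected {(1, 3), (3, 2), (2, 4), (4, 1)} \<and>
     aut_group 4 (\<Gamma> 4) \<cong> D4 \<and>
     equals_aut_group (G_aut_star 4 (\<Gamma>c 4)) 4 (\<Gamma>c 4) D4 \<and>
     qgroup_iso (G_aut_star 4 (\<Gamma> 4)) H2_plus \<and>
     qgroup_iso (G_aut_plus 4 (\<Gamma> 4)) H2_plus \<and>

     \<Gamma>c 5 = undirected {(4, 1), (4, 2), (4, 3)} \<and>
     aut_group 4 (\<Gamma> 5) \<cong> sym_group 3 \<and>
     equals_aut_group (G_aut_star 4 (\<Gamma>c 5)) 4 (\<Gamma>c 5) (sym_group 3) \<and>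
     equals_aut_group (G_aut_star 4 (\<Gamma> 5)) 4 (\<Gamma> 5) (sym_group 3) \<and>
     equals_aut_group (G_aut_plus 4 (\<Gamma> 5)) 4 (\<Gamma> 5) (sym_group 3) \<and>

     graph_iso 4 (\<Gamma>c 6) (\<Gamma> 6) \<and>
     aut_group 4 (\<Gamma> 6) \<cong> Z2 \<and>
     equals_aut_group (G_aut_star 4 (\<Gamma>c 6)) 4 (\<Gamma>c 6) Z2 \<and>
     equals_aut_group (G_aut_star 4 (\<Gamma> 6)) 4 (\<Gamma> 6) Z2 \<and>
     equals_aut_group (G_aut_plus 4 (\<Gamma> 6)) 4 (\<Gamma> 6) Z2 \<and>

     (\<forall>i\<in>{1..6}. aut_group 4 (\<Gamma>c i) = aut_group 4 (\<Gamma> i) \<and>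
        qgroup_eq (G_aut_plus 4 (\<Gamma>c i)) (G_aut_plus 4 (\<Gamma> i)))"
proof -
  have idx: "1 \<in> {1..6::nat}" "2 \<in> {1..6::nat}" "3 \<in> {1..6::nat}" "4 \<in> {1..6::nat}" "5 \<in> {1..6::nat}" "6 \<in> {1..6::nat}"
    by simp_all
  have sa: "star_algebra B" if "cstar_algebra B" for B :: "(nat \<Rightarrow> mat_poly) set cstar_algebra"
    using that by (rule cstar_algebra.axioms)
  have iso1: "aut_group 4 (\<Gamma> 1) \<cong> sym_group 4"
    using aut_group_empty[of 4] by (simp add: \<Gamma>_lists(1) undirected_def)
  have iso5: "aut_group 4 (\<Gamma> 5) \<cong> sym_group 3" by (simp add: aut_group_\<Gamma>5)
  have g1: "equals_aut_group (G_aut_star 4 (\<Gamma>c 1)) 4 (\<Gamma>c 1) (sym_group 4)"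
    by (rule G_aut_star_compl_commutative[OF idx(1) _ iso1]) (rule \<Gamma>1_edges_commute)
  have g2: "equals_aut_group (G_aut_star 4 (\<Gamma>c 2)) 4 (\<Gamma>c 2) (Z2 \<times>\<times> Z2)"
    by (rule G_aut_star_compl_commutative[OF idx(2) _ aut_group_\<Gamma>2])
       (rule star_algebra.\<Gamma>2_edges_commute[OF sa])
  have g4: "equals_aut_group (G_aut_star 4 (\<Gamma>c 4)) 4 (\<Gamma>c 4) D4"
    by (rule G_aut_star_compl_commutative[OF idx(4) _ aut_group_\<Gamma>4])
       (rule star_algebra.\<Gamma>4_edges_commute[OF sa])
  have g3: "equals_aut_group (G_aut_star 4 (\<Gamma>c 3)) 4 (\<Gamma>c 3) Z2"
    "equals_aut_group (G_aut_star 4 (\<Gamma> 3)) 4 (\<Gamma> 3) Z2"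
    "equals_aut_group (G_aut_plus 4 (\<Gamma> 3)) 4 (\<Gamma> 3) Z2"
    by (rule G_aut_commutative[OF idx(3) _ aut_group_\<Gamma>3], (rule star_algebra.\<Gamma>3_commute[OF sa]; assumption))+
  have g5: "equals_aut_group (G_aut_star 4 (\<Gamma>c 5)) 4 (\<Gamma>c 5) (sym_group 3)"
    "equals_aut_group (G_aut_star 4 (\<Gamma> 5)) 4 (\<Gamma> 5) (sym_group 3)"
    "equals_aut_group (G_aut_plus 4 (\<Gamma> 5)) 4 (\<Gamma> 5) (sym_group 3)"
    by (rule G_aut_commutative[OF idx(5) _ iso5], (rule star_algebra.\<Gamma>5_commute[OF sa]; assumption))+
  have g6: "equals_aut_group (G_aut_star 4 (\<Gamma>c 6)) 4 (\<Gamma>c 6) Z2"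
    "equals_aut_group (G_aut_star 4 (\<Gamma> 6)) 4 (\<Gamma> 6) Z2"
    "equals_aut_group (G_aut_plus 4 (\<Gamma> 6)) 4 (\<Gamma> 6) Z2"
    by (rule G_aut_commutative[OF idx(6) _ aut_group_\<Gamma>6], (rule star_algebra.\<Gamma>6_commute[OF sa]; assumption))+
  \<comment> \<open>The presentations for the empty graph and for \<open>S_plus 4\<close> give the
    same object, so only reflexivity remains; it includes the fact that \<open>S_plus 4\<close> is a
    quantum group.\<close>
  have S: "qgroup_eq (S_plus 4) (S_plus 4)"
    using qgroup_eq_refl[OF cmqg_G_aut_plus[of 4 "\<Gamma> 1"]] by (simp add: G_aut_plus_\<Gamma>1)
  have compl: "\<forall>i\<in>{1..6}. aut_group 4 (\<Gamma>c i) = aut_group 4 (\<Gamma> i) \<and>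
      qgroup_eq (G_aut_plus 4 (\<Gamma>c i)) (G_aut_plus 4 (\<Gamma> i))"
  proof (intro ballI conjI)
    fix i :: nat assume i: "i \<in> {1..6}"
    show "aut_group 4 (\<Gamma>c i) = aut_group 4 (\<Gamma> i)" by (rule aut_group_compl[OF simple_\<Gamma>[OF i]])
    show "qgroup_eq (G_aut_plus 4 (\<Gamma>c i)) (G_aut_plus 4 (\<Gamma> i))"
      unfolding G_aut_plus_compl[OF simple_\<Gamma>[OF i]] by (rule qgroup_eq_refl[OF cmqg_G_aut_plus])
  qed
  show ?thesis
    \<comment> \<open>For graphs 1, 2 and 4 the objects \<open>G_aut_star\<close> and
      \<open>G_aut_plus\<close> are equal, so each pair of claims becomes one.\<close>
    unfolding G_aut_star_eq_plus_\<Gamma> G_aut_plus_\<Gamma>1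
    by (intro conjI allI impI graphs_on_four_vertices \<Gamma>c_values \<Gamma>c6_iso iso1 g1 S aut_group_\<Gamma>2 g2
        G_aut_plus_\<Gamma>2 aut_group_\<Gamma>3 g3 aut_group_\<Gamma>4 g4 G_aut_plus_\<Gamma>4 iso5 g5 aut_group_\<Gamma>6 g6
        compl)
qed

end
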